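(* Let $X=\{X_t\}_{t\ge0}$ be the solution of $$\mathrm{d}X_t=\sum_{j=1}^m\big\{(\beta_j-\alpha_jX_t)\,\mathrm{d}t+\sigma_j\,\mathrm{d}W_t\big\}I_{\{\theta_{j-1}\le X_t<\theta_j\}},\qquad X_0=x,$$ where $W$ is a standard one-dimensional Brownian motion, $\alpha_j,\beta_j\in\mathbb{R}$ with $\alpha_1>0,\alpha_m>0$, $\sigma_j>0$, $x\in\mathbb{R}$, and $-\infty=\theta_0<\theta_1<\cdots<\theta_m=\infty$ are known thresholds. Suppose $X$ is observed at $t_k=kh$, $k=0,\dots,n$, with $h=h_n$ such that $h\to0$ and $nh\to\infty$ as $n\to\infty$. Write $I_i(y)=I_{\{\theta_{i-1}\le y<\theta_i\}}$, and $L_{i,n}^{0}=\sum_{k=0}^{n-1}I_i(X_{t_k})$, $Q_{i,n}=\sum_{k=0}^{n-1}(X_{t_{k+1}}-X_{t_k})I_i(X_{t_k})$, $D_{i,n}=\sum_{k=0}^{n-1}X_{t_k}^2I_i(X_{t_k})$, $J_{i,n}=\sum_{k=0}^{n-1}X_{t_k}I_i(X_{t_k})$, $H_{i,n}=\sum_{k=0}^{n-1}X_{t_k}I_i(X_{t_k})(X_{t_{k+1}}-X_{t_k})$, and $$\hat\alpha_{i,n}=\frac{Q_{i,n}J_{i,n}-L^0_{i,n}H_{i,n}}{L^0_{i,n}D_{i,n}h-J_{i,n}^2h},\qquad \hat\beta_{i,n}=\frac{Q_{i,n}D_{i,n}-H_{i,n}J_{i,n}}{L^0_{i,n}D_{i,n}h-J_{i,n}^2h}.$$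 Let $L_{i,n}=\sum_{k=0}^{n-1}I_i(X_{t_k})h$ and $$\hat\sigma_{i,n}=\sqrt{\frac{\sum_{k=0}^{n-1}\Big(X_{t_{k+1}}-X_{t_k}-\sum_{j=1}^m(\hat\beta_{j,n}-\hat\alpha_{j,n}X_{t_k})I_j(X_{t_k})h\Big)^2I_i(X_{t_k})}{L_{i,n}}}.$$ Then for each $i=1,\dots,m$, $\hat\sigma_{i,n}^2\to\sigma_i^2$ in probability as $n\to\infty$. *)

theory Defs
  imports "HOL-Probability.Probability"
begin

definition brownian_motion ::
  "'a measure \<Rightarrow> (real \<Rightarrow> 'a measure) \<Rightarrow> (real \<Rightarrow> 'a \<Rightarrow> real) \<Rightarrow> bool" where
  "brownian_motion M F W \<longleftrightarrow>
     prob_space M \<and> filtration (space M) F \<and> (\<forall>t. sets (F t) \<subseteq> sets M) \<and>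
     (\<forall>t\<ge>0. W t \<in> borel_measurable (F t)) \<and>
     (\<forall>\<omega>\<in>space M. W 0 \<omega> = 0 \<and> continuous_on {0..} (\<lambda>t. W t \<omega>)) \<and>
     (\<forall>s t. 0 \<le> s \<and> s < t \<longrightarrow>
        distributed M lborel (\<lambda>\<omega>. W t \<omega> - W s \<omega>)
          (\<lambda>y. ennreal (normal_density 0 (sqrt (t - s)) y)) \<and>
        (\<forall>A\<in>sets (F s). \<forall>B\<in>sets borel.
           measure M (A \<inter> {\<omega>\<in>space M. W t \<omega> - W s \<omega> \<in> B})
             = measure M A * measure M {\<omega>\<in>space M. W t \<omega> - W s \<omega> \<in> B}))"

definition simple_adapted ::
  "(real \<Rightarrow> 'a measure) \<Rightarrow> real list \<Rightarrow> ('a \<Rightarrow> real) list \<Rightarrow> bool" where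
  "simple_adapted F ss xis \<longleftrightarrow>
     length ss = Suc (length xis) \<and> ss ! 0 = 0 \<and> sorted_wrt (<) ss \<and>
     (\<forall>k<length xis. xis ! k \<in> borel_measurable (F (ss ! k)) \<and>
        (\<exists>C. \<forall>\<omega>. \<bar>(xis ! k) \<omega>\<bar> \<le> C))"

definition simple_value :: "real list \<Rightarrow> ('a \<Rightarrow> real) list \<Rightarrow> real \<Rightarrow> 'a \<Rightarrow> real" where
  "simple_value ss xis s \<omega> =
     (\<Sum>k<length xis. (if ss ! k < s \<and> s \<le> ss ! Suc k then (xis ! k) \<omega> else 0))"

definition simple_integral ::
  "(real \<Rightarrow> 'a \<Rightarrow> real) \<Rightarrow> real list \<Rightarrow> ('a \<Rightarrow> real) list \<Rightarrow> real \<Rightarrow> 'a \<Rightarrow> real" where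
  "simple_integral W ss xis t \<omega> =
     (\<Sum>k<length xis. (xis ! k) \<omega> *
        (W (min t (ss ! Suc k)) \<omega> - W (min t (ss ! k)) \<omega>))"

definition ito_integral_at ::
  "'a measure \<Rightarrow> (real \<Rightarrow> 'a measure) \<Rightarrow> (real \<Rightarrow> 'a \<Rightarrow> real) \<Rightarrow> (real \<Rightarrow> 'a \<Rightarrow> real)
     \<Rightarrow> real \<Rightarrow> ('a \<Rightarrow> real) \<Rightarrow> bool" where
  "ito_integral_at M F W H t Y \<longleftrightarrow>
     Y \<in> borel_measurable M \<and>
     (\<exists>ss xis. (\<forall>n. simple_adapted F (ss n) (xis n)) \<and>
        ((\<lambda>n. \<integral>\<^sup>+\<omega>. (\<integral>\<^sup>+s\<in>{0..t}. ennreal ((H s \<omega> - simple_value (ss n) (xis n) s \<omega>)\<^sup>2) \<partial>lborel) \<partial>M)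
           \<longlonglongrightarrow> 0) \<and>
        ((\<lambda>n. \<integral>\<^sup>+\<omega>. ennreal ((Y \<omega> - simple_integral W (ss n) (xis n) t \<omega>)\<^sup>2) \<partial>M)
           \<longlonglongrightarrow> 0))"

text \<open>Thresholds: theta 0 = -infinity < theta 1 < ... < theta m = +infinity (extended reals).\<close>
definition ind :: "(nat \<Rightarrow> ereal) \<Rightarrow> nat \<Rightarrow> real \<Rightarrow> real" where
  "ind \<theta> i y = (if \<theta> (i - 1) \<le> ereal y \<and> ereal y < \<theta> i then 1 else 0)"

definition drift_coef ::
  "nat \<Rightarrow> (nat \<Rightarrow> ereal) \<Rightarrow> (nat \<Rightarrow> real) \<Rightarrow> (nat \<Rightarrow> real) \<Rightarrow> real \<Rightarrow> real" where
  "drift_coef m \<theta> \<alpha> \<beta> y = (\<Sum>j=1..m. (\<beta> j - \<alpha> j * y) * ind \<theta> j y)"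

definition diff_coef :: "nat \<Rightarrow> (nat \<Rightarrow> ereal) \<Rightarrow> (nat \<Rightarrow> real) \<Rightarrow> real \<Rightarrow> real" where
  "diff_coef m \<theta> \<sigma> y = (\<Sum>j=1..m. \<sigma> j * ind \<theta> j y)"

definition threshold_sde_solution ::
  "'a measure \<Rightarrow> (real \<Rightarrow> 'a measure) \<Rightarrow> (real \<Rightarrow> 'a \<Rightarrow> real) \<Rightarrow> nat \<Rightarrow> (nat \<Rightarrow> ereal)
    \<Rightarrow> (nat \<Rightarrow> real) \<Rightarrow> (nat \<Rightarrow> real) \<Rightarrow> (nat \<Rightarrow> real) \<Rightarrow> real \<Rightarrow> (real \<Rightarrow> 'a \<Rightarrow> real) \<Rightarrow> bool" where
  "threshold_sde_solution M F W m \<theta> \<alpha> \<beta> \<sigma> x X \<longleftrightarrow>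
     (\<forall>t\<ge>0. X t \<in> borel_measurable (F t)) \<and>
     (\<forall>\<omega>\<in>space M. continuous_on {0..} (\<lambda>t. X t \<omega>)) \<and>
     (\<forall>t\<ge>0. \<exists>Y. ito_integral_at M F W (\<lambda>s \<omega>. diff_coef m \<theta> \<sigma> (X s \<omega>)) t Y \<and>
        (AE \<omega> in M. X t \<omega> = x + (LBINT s=0..t. drift_coef m \<theta> \<alpha> \<beta> (X s \<omega>)) + Y \<omega>))"

section \<open>Estimators from the observations obs k = X_(t_k), t_k = k h\<close>

definition L0n :: "(nat \<Rightarrow> ereal) \<Rightarrow> nat \<Rightarrow> nat \<Rightarrow> (nat \<Rightarrow> real) \<Rightarrow> real" where
  "L0n \<theta> i n obs = (\<Sum>k<n. ind \<theta> i (obs k))"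
definition Qn :: "(nat \<Rightarrow> ereal) \<Rightarrow> nat \<Rightarrow> nat \<Rightarrow> (nat \<Rightarrow> real) \<Rightarrow> real" where
  "Qn \<theta> i n obs = (\<Sum>k<n. (obs (Suc k) - obs k) * ind \<theta> i (obs k))"
definition Dn :: "(nat \<Rightarrow> ereal) \<Rightarrow> nat \<Rightarrow> nat \<Rightarrow> (nat \<Rightarrow> real) \<Rightarrow> real" where
  "Dn \<theta> i n obs = (\<Sum>k<n. (obs k)\<^sup>2 * ind \<theta> i (obs k))"
definition Jn :: "(nat \<Rightarrow> ereal) \<Rightarrow> nat \<Rightarrow> nat \<Rightarrow> (nat \<Rightarrow> real) \<Rightarrow> real" where
  "Jn \<theta> i n obs = (\<Sum>k<n. obs k * ind \<theta> i (obs k))"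
definition Hn :: "(nat \<Rightarrow> ereal) \<Rightarrow> nat \<Rightarrow> nat \<Rightarrow> (nat \<Rightarrow> real) \<Rightarrow> real" where
  "Hn \<theta> i n obs = (\<Sum>k<n. obs k * ind \<theta> i (obs k) * (obs (Suc k) - obs k))"

definition alpha_hat :: "(nat \<Rightarrow> ereal) \<Rightarrow> nat \<Rightarrow> nat \<Rightarrow> real \<Rightarrow> (nat \<Rightarrow> real) \<Rightarrow> real" where
  "alpha_hat \<theta> i n h obs =
     (Qn \<theta> i n obs * Jn \<theta> i n obs - L0n \<theta> i n obs * Hn \<theta> i n obs) /
     (L0n \<theta> i n obs * Dn \<theta> i n obs * h - (Jn \<theta> i n obs)\<^sup>2 * h)"

definition beta_hat :: "(nat \<Rightarrow> ereal) \<Rightarrow> nat \<Rightarrow> nat \<Rightarrow> real \<Rightarrow> (nat \<Rightarrow> real) \<Rightarrow> real" where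
  "beta_hat \<theta> i n h obs =
     (Qn \<theta> i n obs * Dn \<theta> i n obs - Hn \<theta> i n obs * Jn \<theta> i n obs) /
     (L0n \<theta> i n obs * Dn \<theta> i n obs * h - (Jn \<theta> i n obs)\<^sup>2 * h)"

definition Ln :: "(nat \<Rightarrow> ereal) \<Rightarrow> nat \<Rightarrow> nat \<Rightarrow> real \<Rightarrow> (nat \<Rightarrow> real) \<Rightarrow> real" where
  "Ln \<theta> i n h obs = (\<Sum>k<n. ind \<theta> i (obs k) * h)"

definition sigma_hat ::
  "nat \<Rightarrow> (nat \<Rightarrow> ereal) \<Rightarrow> nat \<Rightarrow> nat \<Rightarrow> real \<Rightarrow> (nat \<Rightarrow> real) \<Rightarrow> real" where
  "sigma_hat m \<theta> i n h obs =
     sqrt ((\<Sum>k<n. (obs (Suc k) - obs k -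
              (\<Sum>j=1..m. (beta_hat \<theta> j n h obs - alpha_hat \<theta> j n h obs * obs k)
                          * ind \<theta> j (obs k) * h))\<^sup>2 * ind \<theta> i (obs k))
           / Ln \<theta> i n h obs)"

end

theory Submission
  imports Defs
begin

text \<open>The numerator of the estimator of \<open>\<sigma>\<^sub>i\<^sup>2\<close> is a residual sum of squares: the squared increments starting in regime
  \<open>i\<close> minus \<open>P = \<Sum> (u + v X\<^sub>k)\<^sup>2\<close>, the squared length of their projection on \<open>1, X\<^sub>k\<close>. Up to an \<open>L\<^sup>1\<close> error of order \<open>o(nh)\<close> the squared
  increments add up to \<open>\<sigma>\<^sub>i\<^sup>2 L\<^sub>i\<close>, because the path leaves regime \<open>i\<close> within a time step only when it starts near a
  threshold. The normal equations bound \<open>P\<close> by the drift increments and by the squared martingale sums divided by \<open>n\<close>,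
  provided the regression is nondegenerate. So everything rests on occupation times, which are controlled without ergodic
  theory: a discrete Ito formula is applied to \<open>sqrt (\<delta>\<^sup>2 + (y - \<theta>)\<^sup>2)\<close>, showing that visits near a threshold are rare,
  and to a Lyapunov function \<open>z\<^sup>2 / 2 - a exp (- l z\<^sup>2 / 2)\<close> with \<open>z = y - \<rho>\<close>, whose generator is at most \<open>-1\<close> away from
  \<open>\<rho>\<close>, showing that every interval is visited a positive fraction of the time. Uniform second moments of the chain come
  from the dissipativity of the outer regimes \<open>1\<close> and \<open>m\<close>.\<close>

section \<open>Square-integrable functions\<close>

text \<open>Three obstacles shape the development. First, \<open>ito_integral_at\<close> provides
  for each single time its own approximating sequence and determines the integral only almost
  everywhere; orthogonality, isometry and fourth moments of increments must be recovered from that.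
  Fourth moments require integrands bounded uniformly along the sequence, hence the truncation at
  the bound \<open>K\<close> of the diffusion coefficient. Second, the coefficients jump at the
  thresholds, so derivatives are taken of test functions only, and the jumps of the drift are paid
  for by a bounded term. Third, h is an arbitrary null sequence with nh tending to infinity, so
  every estimate is uniform in n and in 0 < h <= \<open>h0\<close>: a single step produces errors of
  order h^(3/2), a martingale sum over the horizon nh is of order sqrt(nh), and both are small
  against occupation times of order nh. The drift estimators enter only through their normal
  equations, which survive a vanishing determinant because division by zero returns 0.\<close>

definition L2 :: "'a measure \<Rightarrow> ('a \<Rightarrow> real) \<Rightarrow> bool" where
  "L2 N f \<longleftrightarrow> f \<in> borel_measurable N \<and> integrable N (\<lambda>x. (f x)\<^sup>2)"

lemma L2_measurable: "L2 N f \<Longrightarrow> f \<in> borel_measurable N"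
  and L2_integrable_square: "L2 N f \<Longrightarrow> integrable N (\<lambda>x. (f x)\<^sup>2)"
  by (auto simp: L2_def)

lemma two_abs_mult_le: "2 * \<bar>a * b\<bar> \<le> a\<^sup>2 + b\<^sup>2" for a b :: real
proof -
  have "0 \<le> (\<bar>a\<bar> - \<bar>b\<bar>)\<^sup>2" by simp
  then show ?thesis by (simp add: power2_diff abs_mult)
qed

lemma abs_mult_le_squares: "\<bar>a * b\<bar> \<le> a\<^sup>2 + b\<^sup>2" for a b :: real
  by (rule order_trans[OF _ two_abs_mult_le]) simp

lemma square_add_le: "(a + b)\<^sup>2 \<le> 2 * a\<^sup>2 + 2 * b\<^sup>2" for a b :: real
  using two_abs_mult_le[of a b] by (simp add: power2_sum algebra_simps abs_le_iff)

lemma L2_mult_integrable: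
  assumes "L2 N f" "L2 N g" shows "integrable N (\<lambda>x. f x * g x)"
proof (rule Bochner_Integration.integrable_bound)
  show "integrable N (\<lambda>x. (f x)\<^sup>2 + (g x)\<^sup>2)"
    using assms by (auto simp: L2_def)
  show "(\<lambda>x. f x * g x) \<in> borel_measurable N"
    using assms by (auto simp: L2_def)
  show "AE x in N. norm (f x * g x) \<le> norm ((f x)\<^sup>2 + (g x)\<^sup>2)"
    using abs_mult_le_squares by (intro AE_I2) simp
qed

lemma L2_bound:
  assumes "L2 N g" "f \<in> borel_measurable N" "\<And>x. x \<in> space N \<Longrightarrow> \<bar>f x\<bar> \<le> \<bar>g x\<bar>"
  shows "L2 N f"
  unfolding L2_def
proof
  show "integrable N (\<lambda>x. (f x)\<^sup>2)"
    by (rule Bochner_Integration.integrable_bound[OF L2_integrable_square[OF assms(1)]])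
       (use assms in \<open>auto intro!: AE_I2 simp: abs_le_square_iff\<close>)
qed fact

lemma L2_add:
  assumes "L2 N f" "L2 N g" shows "L2 N (\<lambda>x. f x + g x)"
proof -
  have "integrable N (\<lambda>x. (f x)\<^sup>2 + 2 * (f x * g x) + (g x)\<^sup>2)"
    using assms L2_mult_integrable[OF assms] by (auto simp: L2_def)
  then show ?thesis using assms by (auto simp: L2_def power2_sum algebra_simps)
qed

lemma L2_cmult: "L2 N f \<Longrightarrow> L2 N (\<lambda>x. c * f x)"
  by (auto simp: L2_def power_mult_distrib)

lemma L2_diff: "L2 N f \<Longrightarrow> L2 N g \<Longrightarrow> L2 N (\<lambda>x. f x - g x)"
  using L2_add[of N f "\<lambda>x. -1 * g x"] L2_cmult[of N g "-1"] by simp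

lemma L2_zero: "L2 N (\<lambda>x. 0)"
  by (simp add: L2_def)

lemma L2_sum: "(\<And>i. i \<in> I \<Longrightarrow> L2 N (f i)) \<Longrightarrow> L2 N (\<lambda>x. \<Sum>i\<in>I. f i x)"
  by (induction I rule: infinite_finite_induct) (auto simp: L2_zero intro!: L2_add)

lemma L2_abs: "L2 N f \<Longrightarrow> L2 N (\<lambda>x. \<bar>f x\<bar>)"
  by (auto simp: L2_def)

lemma L2_mult_bounded:
  assumes "L2 N f" "g \<in> borel_measurable N" "\<And>x. x \<in> space N \<Longrightarrow> \<bar>g x\<bar> \<le> C"
  shows "L2 N (\<lambda>x. g x * f x)"
proof (rule L2_bound[of N "\<lambda>x. C * f x"])
  show "L2 N (\<lambda>x. C * f x)" using assms by (intro L2_cmult)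
  show "(\<lambda>x. g x * f x) \<in> borel_measurable N" using assms by (auto simp: L2_def)
  fix x assume "x \<in> space N"
  then show "\<bar>g x * f x\<bar> \<le> \<bar>C * f x\<bar>"
    using assms(3)[of x] by (auto simp: abs_mult intro!: mult_right_mono)
qed

lemma (in finite_measure) L2_const: "L2 M (\<lambda>x. c)"
  by (auto simp: L2_def)

lemma (in finite_measure) L2_integrable: "L2 M f \<Longrightarrow> integrable M f"
  using L2_mult_integrable[OF _ L2_const[of 1], of f] by simp

text \<open>Serves to pass the isometry from step processes to the limit. With d = f - g, the
  difference of squares is at most d^2 + 2 |d| |g|, and the cross term is split as d^2/\<eta> +
  \<eta> g^2. The second part is made small first by the choice of \<eta>; the first part then tends
  to 0.\<close>

lemma L2_tendsto_square:
  assumes fn: "\<And>n. L2 N (f n)" and f: "L2 N g"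
    and lim: "(\<lambda>n. \<integral>x. (f n x - g x)\<^sup>2 \<partial>N) \<longlonglongrightarrow> 0"
  shows "(\<lambda>n. \<integral>x. (f n x)\<^sup>2 \<partial>N) \<longlonglongrightarrow> (\<integral>x. (g x)\<^sup>2 \<partial>N)"
proof (rule LIMSEQ_I)
  fix \<epsilon> :: real assume e: "0 < \<epsilon>"
  define G where "G = (\<integral>x. (g x)\<^sup>2 \<partial>N)"
  have G0: "0 \<le> G" by (simp add: G_def)
  define \<eta> where "\<eta> = \<epsilon> / (2 * (G + 1))"
  have eta: "0 < \<eta>" using e G0 by (simp add: \<eta>_def)
  have etaG: "\<eta> * G < \<epsilon> / 2 + 0"
    using e G0 by (simp add: \<eta>_def field_simps)
  define K where "K = 1 + 1 / \<eta>"
  have K: "0 < K" using eta by (simp add: K_def add_pos_pos)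
  obtain n0 where n0: "\<And>n. n \<ge> n0 \<Longrightarrow> (\<integral>x. (f n x - g x)\<^sup>2 \<partial>N) < \<epsilon> / (2 * K)"
    using LIMSEQ_D[OF lim, of "\<epsilon> / (2 * K)"] e K by auto
  have "\<bar>(\<integral>x. (f n x)\<^sup>2 \<partial>N) - G\<bar> < \<epsilon>" if n: "n \<ge> n0" for n
  proof -
    have i1: "integrable N (\<lambda>x. (f n x - g x)\<^sup>2)" using L2_diff[OF fn f] by (simp add: L2_def)
    have i2: "integrable N (\<lambda>x. (f n x)\<^sup>2)" "integrable N (\<lambda>x. (g x)\<^sup>2)"
      using fn f by (auto simp: L2_def)
    have "\<bar>(\<integral>x. (f n x)\<^sup>2 \<partial>N) - G\<bar> = \<bar>\<integral>x. (f n x)\<^sup>2 - (g x)\<^sup>2 \<partial>N\<bar>"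
      using i2 by (simp add: G_def)
    also have "\<dots> \<le> (\<integral>x. \<bar>(f n x)\<^sup>2 - (g x)\<^sup>2\<bar> \<partial>N)" by (rule integral_abs_bound)
    also have "\<dots> \<le> (\<integral>x. K * (f n x - g x)\<^sup>2 + \<eta> * (g x)\<^sup>2 \<partial>N)"
    proof (rule integral_mono)
      fix x
      define d where "d = f n x - g x"
      have "0 \<le> (\<bar>d\<bar> / sqrt \<eta> - sqrt \<eta> * \<bar>g x\<bar>)\<^sup>2" by simp
      also have "\<dots> = d\<^sup>2 / \<eta> + \<eta> * (g x)\<^sup>2 - 2 * \<bar>d\<bar> * \<bar>g x\<bar>"
        using eta by (simp add: power2_diff power_mult_distrib power_divide)
      finally have "2 * \<bar>d\<bar> * \<bar>g x\<bar> \<le> d\<^sup>2 / \<eta> + \<eta> * (g x)\<^sup>2" by simp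
      moreover have "(f n x)\<^sup>2 - (g x)\<^sup>2 = d\<^sup>2 + 2 * d * g x"
        by (simp add: d_def power2_eq_square algebra_simps)
      then have "\<bar>(f n x)\<^sup>2 - (g x)\<^sup>2\<bar> \<le> d\<^sup>2 + 2 * \<bar>d\<bar> * \<bar>g x\<bar>"
        using abs_triangle_ineq[of "d\<^sup>2" "2 * d * g x"] by (simp add: abs_mult)
      ultimately show "\<bar>(f n x)\<^sup>2 - (g x)\<^sup>2\<bar> \<le> K * (f n x - g x)\<^sup>2 + \<eta> * (g x)\<^sup>2"
        by (simp add: K_def d_def[symmetric] algebra_simps)
    qed (use i1 i2 in auto)
    also have "\<dots> = K * (\<integral>x. (f n x - g x)\<^sup>2 \<partial>N) + \<eta> * G"
      using i1 i2 by (simp add: G_def)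
    also have "\<dots> < K * (\<epsilon> / (2 * K)) + \<epsilon> / 2"
      using n0[OF n] K etaG by (intro add_strict_mono mult_strict_left_mono) auto
    also have "\<dots> = \<epsilon>" using K by simp
    finally show ?thesis .
  qed
  then show "\<exists>no. \<forall>n\<ge>no. norm ((\<integral>x. (f n x)\<^sup>2 \<partial>N) - (\<integral>x. (g x)\<^sup>2 \<partial>N)) < \<epsilon>"
    by (auto simp: G_def)
qed

text \<open>Young's inequality d <= d^2/\<eta> + \<eta>, integrated over a space of finite mass. The
  L1 limit later gives first moments over events and an almost everywhere convergent
  subsequence.\<close>

lemma (in finite_measure) L2_tendsto_L1:
  assumes fn: "\<And>n. L2 M (f n)" and f: "L2 M g"
    and lim: "(\<lambda>n. \<integral>x. (f n x - g x)\<^sup>2 \<partial>M) \<longlonglongrightarrow> 0"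
  shows "(\<lambda>n. \<integral>x. \<bar>f n x - g x\<bar> \<partial>M) \<longlonglongrightarrow> 0"
proof (rule LIMSEQ_I)
  fix \<epsilon> :: real assume e: "0 < \<epsilon>"
  define m where "m = measure M (space M)"
  have m: "0 \<le> m" by (simp add: m_def)
  define \<eta> where "\<eta> = \<epsilon> / (2 * (m + 1))"
  have eta: "0 < \<eta>" using e m by (simp add: \<eta>_def)
  obtain n0 where n0: "\<And>n. n \<ge> n0 \<Longrightarrow> (\<integral>x. (f n x - g x)\<^sup>2 \<partial>M) < \<epsilon> * \<eta> / 2"
    using LIMSEQ_D[OF lim, of "\<epsilon> * \<eta> / 2"] e eta by auto
  have "(\<integral>x. \<bar>f n x - g x\<bar> \<partial>M) < \<epsilon>" if n: "n \<ge> n0" for n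
  proof -
    have i1: "integrable M (\<lambda>x. (f n x - g x)\<^sup>2)" using L2_diff[OF fn f] by (simp add: L2_def)
    have "(\<integral>x. \<bar>f n x - g x\<bar> \<partial>M) \<le> (\<integral>x. (f n x - g x)\<^sup>2 / \<eta> + \<eta> \<partial>M)"
    proof (rule integral_mono)
      show "integrable M (\<lambda>x. \<bar>f n x - g x\<bar>)"
        by (rule L2_integrable[OF L2_abs[OF L2_diff[OF fn f]]])
      fix x
      define d where "d = \<bar>f n x - g x\<bar>"
      have d: "d \<ge> 0" by (simp add: d_def)
      have "d * \<eta> \<le> d\<^sup>2 + \<eta>\<^sup>2"
        using abs_mult_le_squares[of d \<eta>] d eta by (simp add: abs_mult)
      then have "d \<le> d\<^sup>2 / \<eta> + \<eta>" using eta by (simp add: field_simps power2_eq_square)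
      then show "\<bar>f n x - g x\<bar> \<le> (f n x - g x)\<^sup>2 / \<eta> + \<eta>" by (simp add: d_def)
    qed (use i1 in auto)
    also have "\<dots> = (\<integral>x. (f n x - g x)\<^sup>2 \<partial>M) / \<eta> + \<eta> * m"
      using i1 by (simp add: m_def)
    also have "\<dots> < \<epsilon> / 2 + \<epsilon> / 2"
    proof (rule add_strict_mono)
      show "(\<integral>x. (f n x - g x)\<^sup>2 \<partial>M) / \<eta> < \<epsilon> / 2" using n0[OF n] eta by (simp add: field_simps)
      show "\<eta> * m < \<epsilon> / 2" using e m by (simp add: \<eta>_def field_simps)
    qed
    finally show ?thesis by simp
  qed
  then show "\<exists>no. \<forall>n\<ge>no. norm ((\<integral>x. \<bar>f n x - g x\<bar> \<partial>M) - 0) < \<epsilon>" by auto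
qed

text \<open>Rounding time down to the dyadic grid by \<open>q n\<close> leaves countably many time
  values, so each approximant is jointly measurable; continuity of the paths makes the approximants
  converge pointwise.\<close>

lemma measurable_continuous_process:
  fixes Y :: "real \<Rightarrow> 'a \<Rightarrow> real"
  assumes meas: "\<And>s. Y s \<in> borel_measurable N"
    and cont: "\<And>\<omega>. \<omega> \<in> space N \<Longrightarrow> continuous_on UNIV (\<lambda>s. Y s \<omega>)"
  shows "(\<lambda>(\<omega>, s). Y s \<omega>) \<in> borel_measurable (N \<Otimes>\<^sub>M borel)"
proof -
  define q where "q n s = real_of_int \<lfloor>s * 2 ^ n\<rfloor> / 2 ^ n" for n :: nat and s :: real
  show ?thesis
  proof (rule borel_measurable_LIMSEQ_real)
  fix z :: "'a \<times> real" assume z: "z \<in> space (N \<Otimes>\<^sub>M borel)"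
  obtain \<omega> s where zs: "z = (\<omega>, s)" by (cases z)
  have "(\<lambda>n. q n s) \<longlonglongrightarrow> s"
  proof (rule tendsto_sandwich)
    show "\<forall>\<^sub>F n in sequentially. s - (1/2) ^ n \<le> q n s"
    proof (intro always_eventually allI)
      fix n
      have "s * 2 ^ n \<le> of_int \<lfloor>s * 2 ^ n\<rfloor> + 1" by linarith
      then have "s * 2 ^ n / 2 ^ n \<le> (of_int \<lfloor>s * 2 ^ n\<rfloor> + 1) / 2 ^ n"
        by (intro divide_right_mono) auto
      then show "s - (1/2) ^ n \<le> q n s" by (simp add: q_def add_divide_distrib power_divide)
    qed
    show "\<forall>\<^sub>F n in sequentially. q n s \<le> s"
      by (intro always_eventually allI) (simp add: q_def field_simps)
    have "(\<lambda>n. s - (1/2::real) ^ n) \<longlonglongrightarrow> s - 0"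
      by (intro tendsto_intros LIMSEQ_realpow_zero) auto
    then show "(\<lambda>n. s - (1/2::real) ^ n) \<longlonglongrightarrow> s" by simp
  qed auto
  moreover have "isCont (\<lambda>s. Y s \<omega>) s"
    using cont[of \<omega>] z by (simp add: zs space_pair_measure continuous_on_eq_continuous_at)
  ultimately show "(\<lambda>n. Y (q n (snd z)) (fst z)) \<longlonglongrightarrow> (case z of (\<omega>, s) \<Rightarrow> Y s \<omega>)"
    unfolding zs prod.case fst_conv snd_conv by (rule isCont_tendsto_compose[rotated])
next
  fix n :: nat
  have 1: "(\<lambda>z. Y (real_of_int i / 2 ^ n) (fst z)) \<in> borel_measurable (N \<Otimes>\<^sub>M borel)" for i
    by (rule measurable_compose[OF measurable_fst meas])
  have 2: "(\<lambda>z. \<lfloor>snd z * (2::real) ^ n\<rfloor>) \<in> measurable (N \<Otimes>\<^sub>M borel) (count_space UNIV)"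
    by measurable
  show "(\<lambda>z. Y (q n (snd z)) (fst z)) \<in> borel_measurable (N \<Otimes>\<^sub>M borel)"
    unfolding q_def by (rule measurable_compose_countable[OF 1 2])
  qed
qed

section \<open>Martingale differences\<close>

locale filtered_prob_space = prob_space M for M :: "'a measure" +
  fixes F :: "real \<Rightarrow> 'a measure"
  assumes filt: "filtration (space M) F" and sets_F_subset: "sets (F t) \<subseteq> sets M"
begin

lemma space_F [simp]: "space (F t) = space M"
  using filtration.space_F[OF filt] by simp

lemma sets_F_mono: "s \<le> t \<Longrightarrow> sets (F s) \<subseteq> sets (F t)"
  using filtration.sets_F_mono[OF filt] by blast

lemma subalgebra_F: "subalgebra M (F t)"
  using sets_F_subset by (simp add: subalgebra_def)

lemma measurable_F_M: "f \<in> measurable (F t) N \<Longrightarrow> f \<in> measurable M N"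
  by (rule measurable_from_subalg[OF subalgebra_F])

lemma measurable_F_mono: "f \<in> measurable (F s) N \<Longrightarrow> s \<le> t \<Longrightarrow> f \<in> measurable (F t) N"
  using sets_F_mono[of s t] by (auto simp: measurable_def)

lemma sigma_finite_subalgebra_F: "sigma_finite_subalgebra M (F t)"
  by (intro finite_measure_subalgebra_is_sigma_finite finite_measure_subalgebra.intro
      finite_measure_subalgebra_axioms.intro subalgebra_F) unfold_locales

text \<open>Testing against indicators says that the conditional expectation of \<open>D\<close>
  given \<open>F s\<close> is 0. Pulling out \<zeta> transfers this to every weight known at time s
  whose product with \<open>D\<close> is integrable, bounded or not.\<close>

lemma orthogonal_of_indicator:
  fixes D :: "'a \<Rightarrow> real"
  assumes D: "integrable M D" and zero: "\<And>A. A \<in> sets (F s) \<Longrightarrow> (\<integral>\<omega>. indicator A \<omega> * D \<omega> \<partial>M) = 0"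
    and \<zeta>: "\<zeta> \<in> borel_measurable (F s)" "integrable M (\<lambda>\<omega>. \<zeta> \<omega> * D \<omega>)"
  shows "(\<integral>\<omega>. \<zeta> \<omega> * D \<omega> \<partial>M) = 0"
proof -
  interpret sigma_finite_subalgebra M "F s" by (rule sigma_finite_subalgebra_F)
  have "AE \<omega> in M. real_cond_exp M (F s) D \<omega> = 0"
    by (rule real_cond_exp_charact) (use D zero in \<open>auto simp: set_lebesgue_integral_def\<close>)
  then have "(\<integral>\<omega>. \<zeta> \<omega> * real_cond_exp M (F s) D \<omega> \<partial>M) = (\<integral>\<omega>. 0 \<partial>M)"
    using measurable_F_M[OF \<zeta>(1)] by (intro integral_cong_AE) auto
  with real_cond_exp_intg(2)[OF \<zeta>(2) \<zeta>(1)] D show ?thesis by simp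
qed

text \<open>Companion of \<open>orthogonal_of_indicator\<close> for second moments. With values in
  \<open>ennreal\<close> the weight may be unbounded, and finiteness of the integrals becomes a
  conclusion, drawn in \<open>weighted_noise\<close>.\<close>

lemma nn_integral_weight_eq_of_indicator:
  fixes D E :: "'a \<Rightarrow> ennreal"
  assumes [measurable]: "D \<in> borel_measurable M" "E \<in> borel_measurable M"
    and eq: "\<And>A. A \<in> sets (F s) \<Longrightarrow> (\<integral>\<^sup>+\<omega>. D \<omega> * indicator A \<omega> \<partial>M) = (\<integral>\<^sup>+\<omega>. E \<omega> * indicator A \<omega> \<partial>M)"
    and \<zeta>: "\<zeta> \<in> borel_measurable (F s)"
  shows "(\<integral>\<^sup>+\<omega>. \<zeta> \<omega> * D \<omega> \<partial>M) = (\<integral>\<^sup>+\<omega>. \<zeta> \<omega> * E \<omega> \<partial>M)"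
proof -
  interpret sigma_finite_subalgebra M "F s" by (rule sigma_finite_subalgebra_F)
  have "AE \<omega> in M. nn_cond_exp M (F s) D \<omega> = nn_cond_exp M (F s) E \<omega>"
  proof (rule nn_cond_exp_charact)
    fix A assume A: "A \<in> sets (F s)"
    have "(\<integral>\<^sup>+\<omega>. indicator A \<omega> * nn_cond_exp M (F s) D \<omega> \<partial>M) = (\<integral>\<^sup>+\<omega>. indicator A \<omega> * D \<omega> \<partial>M)"
      using A by (intro nn_cond_exp_intg) auto
    then show "(\<integral>\<^sup>+ x\<in>A. E x \<partial>M) = (\<integral>\<^sup>+ x\<in>A. nn_cond_exp M (F s) D x \<partial>M)"
      using eq[OF A] by (simp add: mult.commute)
  qed auto
  then have "(\<integral>\<^sup>+\<omega>. \<zeta> \<omega> * nn_cond_exp M (F s) D \<omega> \<partial>M) = (\<integral>\<^sup>+\<omega>. \<zeta> \<omega> * nn_cond_exp M (F s) E \<omega> \<partial>M)"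
    by (intro nn_integral_cong_AE) auto
  with \<zeta> show ?thesis by (simp add: nn_cond_exp_intg)
qed

text \<open>The partial sum up to n is known at time \<open>t n\<close>, while \<open>d n\<close> is
  orthogonal to what is known then, so every cross term of the square vanishes. It is applied on the
  observation grid, to weighted noise and to compensated squares.\<close>

lemma martingale_difference_sum_square:
  fixes t :: "nat \<Rightarrow> real" and d :: "nat \<Rightarrow> 'a \<Rightarrow> real"
  assumes t: "mono t" and d: "\<And>k. k < n \<Longrightarrow> L2 M (d k)"
    and meas: "\<And>k. k < n \<Longrightarrow> d k \<in> borel_measurable (F (t (Suc k)))"
    and zero: "\<And>k A. k < n \<Longrightarrow> A \<in> sets (F (t k)) \<Longrightarrow> (\<integral>\<omega>. indicator A \<omega> * d k \<omega> \<partial>M) = 0"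
  shows "(\<integral>\<omega>. (\<Sum>k<n. d k \<omega>)\<^sup>2 \<partial>M) = (\<Sum>k<n. \<integral>\<omega>. (d k \<omega>)\<^sup>2 \<partial>M)"
  using d meas zero
proof (induction n)
  case (Suc n)
  let ?s = "\<lambda>\<omega>. \<Sum>k<n. d k \<omega>"
  have L2s: "L2 M ?s" and L2n: "L2 M (d n)" using Suc.prems by (auto intro!: L2_sum)
  have i: "integrable M (\<lambda>\<omega>. (?s \<omega>)\<^sup>2)" "integrable M (\<lambda>\<omega>. (d n \<omega>)\<^sup>2)" "integrable M (\<lambda>\<omega>. ?s \<omega> * d n \<omega>)"
    using L2s L2n L2_mult_integrable[OF L2s L2n] by (auto simp: L2_def)
  have "?s \<in> borel_measurable (F (t n))"
  proof (rule borel_measurable_sum)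
    fix k assume "k \<in> {..<n}"
    then show "d k \<in> borel_measurable (F (t n))"
      using Suc.prems(2)[of k] monoD[OF t, of "Suc k" n] by (auto intro: measurable_F_mono)
  qed
  then have "(\<integral>\<omega>. ?s \<omega> * d n \<omega> \<partial>M) = 0"
    using Suc.prems(3)[of n] by (intro orthogonal_of_indicator[OF L2_integrable[OF L2n] _ _ i(3)]) simp_all
  moreover have "(\<Sum>k<Suc n. d k \<omega>)\<^sup>2 = (?s \<omega>)\<^sup>2 + 2 * (?s \<omega> * d n \<omega>) + (d n \<omega>)\<^sup>2" for \<omega>
    by (simp add: power2_sum algebra_simps)
  moreover have "(\<integral>\<omega>. (?s \<omega>)\<^sup>2 \<partial>M) = (\<Sum>k<n. \<integral>\<omega>. (d k \<omega>)\<^sup>2 \<partial>M)"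
    by (rule Suc.IH) (use Suc.prems in \<open>auto simp: less_Suc_eq\<close>)
  ultimately show ?case using i by simp
qed simp

end

lemma integral_sum_sum:
  fixes f :: "'i \<Rightarrow> 'j \<Rightarrow> 'a \<Rightarrow> real"
  assumes "\<And>i j. i \<in> I \<Longrightarrow> j \<in> J \<Longrightarrow> integrable N (f i j)"
  shows "(\<integral>x. (\<Sum>i\<in>I. \<Sum>j\<in>J. f i j x) \<partial>N) = (\<Sum>i\<in>I. \<Sum>j\<in>J. \<integral>x. f i j x \<partial>N)"
  using assms by (simp add: Bochner_Integration.integral_sum Bochner_Integration.integrable_sum)

section \<open>Time intervals as finite measure spaces\<close>

text \<open>Left-open like the intervals of \<open>simple_value\<close>, so adjacent intervals
  neither overlap nor leave a gap. Since it is finite, its product with \<open>M\<close> is finite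
  too, and bounded processes are square integrable there.\<close>

definition time_measure :: "real \<Rightarrow> real \<Rightarrow> real measure" where
  "time_measure s t = restrict_space lborel {s<..t}"

lemma space_time_measure: "space (time_measure s t) = {s<..t}"
  by (simp add: time_measure_def space_restrict_space)

lemma measure_time_measure:
  assumes "A \<in> sets borel" "A \<subseteq> {s<..t}"
  shows "measure (time_measure s t) A = measure lborel A"
  unfolding time_measure_def using assms by (intro measure_restrict_space) auto

lemma sets_time_measure: "A \<in> sets borel \<Longrightarrow> A \<subseteq> {s<..t} \<Longrightarrow> A \<in> sets (time_measure s t)"
  unfolding time_measure_def by (subst sets_restrict_space_iff) auto

lemma measurable_time_measure: "f \<in> measurable borel N \<Longrightarrow> f \<in> measurable (time_measure s t) N"
  unfolding time_measure_def by (rule measurable_restrict_space1) simp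

lemma finite_measure_time: "finite_measure (time_measure s t)"
proof (rule finite_measureI)
  have "emeasure lborel {s<..t} < \<infinity>"
    by (rule emeasure_bounded_finite, rule bounded_subset[OF bounded_closed_interval[of s t]]) auto
  then show "emeasure (time_measure s t) (space (time_measure s t)) \<noteq> \<infinity>"
    by (simp add: time_measure_def emeasure_restrict_space space_restrict_space)
qed

context prob_space
begin

abbreviation space_time :: "real \<Rightarrow> real \<Rightarrow> ('a \<times> real) measure" where
  "space_time s t \<equiv> M \<Otimes>\<^sub>M time_measure s t"

lemma pair_sigma_finite_time: "pair_sigma_finite M (time_measure s t)"
proof -
  interpret T: finite_measure "time_measure s t" by (rule finite_measure_time)
  show ?thesis by unfold_locales
qed

lemma finite_measure_space_time: "finite_measure (space_time s t)"
proof -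
  interpret T: finite_measure "time_measure s t" by (rule finite_measure_time)
  show ?thesis
    by (rule finite_measureI)
       (simp add: space_pair_measure T.emeasure_pair_measure_Times ennreal_mult_eq_top_iff)
qed

lemma L2_bounded_space_time:
  assumes "f \<in> borel_measurable (space_time s t)" "\<And>z. z \<in> space (space_time s t) \<Longrightarrow> \<bar>f z\<bar> \<le> C"
  shows "L2 (space_time s t) f"
proof -
  interpret finite_measure "space_time s t" by (rule finite_measure_space_time)
  show ?thesis by (rule L2_bound[OF L2_const[of C]]) (use assms in force)+
qed

end

section \<open>Stochastic integrals of step processes\<close>

locale brownian = filtered_prob_space +
  fixes W :: "real \<Rightarrow> 'a \<Rightarrow> real"
  assumes bm: "brownian_motion M F W"
begin

section \<open>Moments and independence of Brownian increments\<close>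

abbreviation incr :: "real \<Rightarrow> real \<Rightarrow> 'a \<Rightarrow> real" where
  "incr s t \<omega> \<equiv> W t \<omega> - W s \<omega>"

lemma W_measurable_F: "0 \<le> t \<Longrightarrow> W t \<in> borel_measurable (F t)"
  using bm by (simp add: brownian_motion_def)

lemma incr_measurable_F:
  assumes "0 \<le> s" "s \<le> t" shows "incr s t \<in> borel_measurable (F t)"
  by (rule borel_measurable_diff[OF W_measurable_F measurable_F_mono[OF W_measurable_F]]) (use assms in auto)

lemma incr_measurable: "0 \<le> s \<Longrightarrow> s \<le> t \<Longrightarrow> incr s t \<in> borel_measurable M"
  by (rule measurable_F_M[OF incr_measurable_F])

lemma incr_distributed:
  "0 \<le> s \<Longrightarrow> s < t \<Longrightarrow> distributed M lborel (incr s t) (\<lambda>y. ennreal (normal_density 0 (sqrt (t - s)) y))"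
  using bm by (simp add: brownian_motion_def)

text \<open>The moments of a centred normal variable of variance t - s. The case s = t is separate
  because \<open>brownian_motion\<close> supplies a density only for s < t.\<close>

lemma incr_moment:
  assumes st: "0 \<le> s" "s \<le> t"
  shows "integrable M (\<lambda>\<omega>. incr s t \<omega> ^ k)"
    and "(\<integral>\<omega>. incr s t \<omega> ^ 1 \<partial>M) = 0"
    and "(\<integral>\<omega>. incr s t \<omega> ^ 2 \<partial>M) = t - s"
    and "(\<integral>\<omega>. incr s t \<omega> ^ 3 \<partial>M) = 0"
    and "(\<integral>\<omega>. incr s t \<omega> ^ 4 \<partial>M) = 3 * (t - s)\<^sup>2"
proof -
  have *: "integrable M (\<lambda>\<omega>. incr s t \<omega> ^ k) \<and>
     (\<integral>\<omega>. incr s t \<omega> ^ 1 \<partial>M) = 0 \<and> (\<integral>\<omega>. incr s t \<omega> ^ 2 \<partial>M) = t - s \<and>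
     (\<integral>\<omega>. incr s t \<omega> ^ 3 \<partial>M) = 0 \<and> (\<integral>\<omega>. incr s t \<omega> ^ 4 \<partial>M) = 3 * (t - s)\<^sup>2"
  proof (cases "s = t")
    case False
    define v where "v = sqrt (t - s)"
    have v: "0 < v" "v\<^sup>2 = t - s" using False st by (auto simp: v_def)
    have D: "distributed M lborel (incr s t) (\<lambda>y. ennreal (normal_density 0 v y))"
      using incr_distributed[of s t] False st by (simp add: v_def)
    have int: "(\<integral>\<omega>. incr s t \<omega> ^ j \<partial>M) = (\<integral>x. normal_density 0 v x * x ^ j \<partial>lborel)" for j
      by (rule distributed_integral[OF D, symmetric]) (use v in auto)
    have "integrable M (\<lambda>\<omega>. incr s t \<omega> ^ k)"
      using distributed_integrable[OF D, of "\<lambda>x. x ^ k"] integrable_normal_moment[OF v(1), of 0 k] v by simp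
    moreover have "(\<integral>\<omega>. incr s t \<omega> ^ 1 \<partial>M) = 0"
      using integral_normal_moment_odd[OF v(1), of 0 0] by (simp only: int) simp
    moreover have "(\<integral>\<omega>. incr s t \<omega> ^ 2 \<partial>M) = t - s"
      using integral_normal_moment_even[OF v(1), of 0 1] v by (simp only: int) simp
    moreover have "(\<integral>\<omega>. incr s t \<omega> ^ 3 \<partial>M) = 0"
      using integral_normal_moment_odd[OF v(1), of 0 1] by (simp only: int) (simp add: numeral_3_eq_3)
    moreover have "(\<integral>\<omega>. incr s t \<omega> ^ 4 \<partial>M) = 3 * (t - s)\<^sup>2"
      using integral_normal_moment_even[OF v(1), of 0 2] v
      by (simp only: int) (simp add: fact_numeral power2_eq_square)
    ultimately show ?thesis by blast
  qed simp
  show "integrable M (\<lambda>\<omega>. incr s t \<omega> ^ k)"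
    and "(\<integral>\<omega>. incr s t \<omega> ^ 1 \<partial>M) = 0"
    and "(\<integral>\<omega>. incr s t \<omega> ^ 2 \<partial>M) = t - s"
    and "(\<integral>\<omega>. incr s t \<omega> ^ 3 \<partial>M) = 0"
    and "(\<integral>\<omega>. incr s t \<omega> ^ 4 \<partial>M) = 3 * (t - s)\<^sup>2"
    using * by blast+
qed

text \<open>\<open>brownian_motion\<close> gives the product rule for events of \<open>F s\<close>
  and events of the increment. Preimages under one function form an intersection-stable family, so
  the rule extends to the generated sigma-algebras.\<close>

lemma incr_indep:
  assumes st: "0 \<le> s" "s < t" and \<zeta>: "\<zeta> \<in> borel_measurable (F s)"
  shows "indep_var borel \<zeta> borel (incr s t)"
  unfolding indep_var_eq
proof (intro conjI indep_set_sigma_sets)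
  show m: "\<zeta> \<in> borel_measurable M" "incr s t \<in> borel_measurable M"
    using st \<zeta> by (auto intro: measurable_F_M incr_measurable)
  let ?A = "{\<zeta> -` B \<inter> space M |B. B \<in> sets borel}"
  let ?B = "{incr s t -` B \<inter> space M |B. B \<in> sets borel}"
  have stable: "Int_stable {f -` B \<inter> space M |B. B \<in> sets borel}" for f :: "'a \<Rightarrow> real"
  proof (rule Int_stableI)
    fix a b assume "a \<in> {f -` B \<inter> space M |B. B \<in> sets borel}" "b \<in> {f -` B \<inter> space M |B. B \<in> sets borel}"
    then obtain A B where "A \<in> sets borel" "B \<in> sets borel" "a = f -` A \<inter> space M" "b = f -` B \<inter> space M"
      by blast
    then show "a \<inter> b \<in> {f -` B \<inter> space M |B. B \<in> sets borel}"
      by (auto intro!: exI[of _ "A \<inter> B"])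
  qed
  show "Int_stable ?A" "Int_stable ?B" by (rule stable)+
  show "indep_set ?A ?B"
  proof (rule indep_setI)
    show "?A \<subseteq> events" "?B \<subseteq> events" using measurable_sets[OF m(1)] measurable_sets[OF m(2)] by auto
    fix a b assume "a \<in> ?A" "b \<in> ?B"
    then obtain A B where ab: "A \<in> sets borel" "B \<in> sets borel" "a = \<zeta> -` A \<inter> space M" "b = incr s t -` B \<inter> space M"
      by blast
    have a: "a \<in> sets (F s)" using measurable_sets[OF \<zeta> ab(1)] by (simp add: ab(3))
    have "\<forall>A\<in>sets (F s). \<forall>B\<in>sets borel.
           measure M (A \<inter> {\<omega>\<in>space M. W t \<omega> - W s \<omega> \<in> B})
             = measure M A * measure M {\<omega>\<in>space M. W t \<omega> - W s \<omega> \<in> B}"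
      using bm st by (simp add: brownian_motion_def)
    moreover have "b = {\<omega>\<in>space M. W t \<omega> - W s \<omega> \<in> B}" by (auto simp: ab)
    ultimately show "prob (a \<inter> b) = prob a * prob b" using a ab(2) by blast
  qed
qed

text \<open>Stated for every power k, to cover all terms that appear when the fourth power of a sum
  is expanded in \<open>step_integral_moments\<close>.\<close>

lemma expectation_mult_incr_power:
  assumes st: "0 \<le> s" "s \<le> t" and \<zeta>: "\<zeta> \<in> borel_measurable (F s)" "integrable M \<zeta>"
  shows "integrable M (\<lambda>\<omega>. \<zeta> \<omega> * incr s t \<omega> ^ k)"
    and "(\<integral>\<omega>. \<zeta> \<omega> * incr s t \<omega> ^ k \<partial>M) = (\<integral>\<omega>. \<zeta> \<omega> \<partial>M) * (\<integral>\<omega>. incr s t \<omega> ^ k \<partial>M)"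
proof -
  have "integrable M (\<lambda>\<omega>. \<zeta> \<omega> * incr s t \<omega> ^ k) \<and>
    (\<integral>\<omega>. \<zeta> \<omega> * incr s t \<omega> ^ k \<partial>M) = (\<integral>\<omega>. \<zeta> \<omega> \<partial>M) * (\<integral>\<omega>. incr s t \<omega> ^ k \<partial>M)"
  proof (cases "s = t")
    case False
    then have "indep_var borel \<zeta> borel (incr s t)" using st \<zeta> by (intro incr_indep) auto
    then have "indep_var borel (id \<circ> \<zeta>) borel ((\<lambda>x. x ^ k) \<circ> incr s t)"
      by (rule indep_var_compose) auto
    then have i: "indep_var borel \<zeta> borel (\<lambda>\<omega>. incr s t \<omega> ^ k)" by (simp add: comp_def)
    show ?thesis
      using indep_var_integrable[OF i \<zeta>(2) incr_moment(1)[OF st]]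
        indep_var_lebesgue_integral[OF i \<zeta>(2) incr_moment(1)[OF st]] by blast
  qed (use \<zeta> in \<open>auto simp: power_0_left prob_space\<close>)
  then show "integrable M (\<lambda>\<omega>. \<zeta> \<omega> * incr s t \<omega> ^ k)"
    and "(\<integral>\<omega>. \<zeta> \<omega> * incr s t \<omega> ^ k \<partial>M) = (\<integral>\<omega>. \<zeta> \<omega> \<partial>M) * (\<integral>\<omega>. incr s t \<omega> ^ k \<partial>M)"
    by blast+
qed

lemma L2_incr: "0 \<le> s \<Longrightarrow> s \<le> t \<Longrightarrow> L2 M (incr s t)"
  using incr_moment(1)[of s t 2] incr_measurable[of s t] by (simp add: L2_def)

lemma L2_bounded_mult_incr:
  assumes "0 \<le> s" "s \<le> t" "\<xi> \<in> borel_measurable (F r)" "\<And>\<omega>. \<bar>\<xi> \<omega>\<bar> \<le> C"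
  shows "L2 M (\<lambda>\<omega>. \<xi> \<omega> * incr s t \<omega>)"
  by (rule L2_mult_bounded[OF L2_incr]) (use assms in \<open>auto intro: measurable_F_M\<close>)

text \<open>The intervals may overlap, because integrands on unrelated time grids are compared
  later. Both are cut at c and at the earlier right endpoint; of the resulting products only the
  square over the common piece has nonzero mean, and it contributes the length of that
  piece.\<close>

lemma expectation_incr_incr_le:
  assumes ab: "0 \<le> a" "a \<le> b" and cd: "c \<le> d" and ac: "a \<le> c"
    and \<xi>: "\<xi> \<in> borel_measurable (F a)" "\<And>\<omega>. \<bar>\<xi> \<omega>\<bar> \<le> C"
    and \<eta>: "\<eta> \<in> borel_measurable (F c)" "\<And>\<omega>. \<bar>\<eta> \<omega>\<bar> \<le> C'"
  shows "(\<integral>\<omega>. (\<xi> \<omega> * incr a b \<omega>) * (\<eta> \<omega> * incr c d \<omega>) \<partial>M)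
     = (\<integral>\<omega>. \<xi> \<omega> * \<eta> \<omega> \<partial>M) * measure lborel ({a<..b} \<inter> {c<..d})"
proof -
  have c0: "0 \<le> c" using ab ac by simp
  have \<xi>c: "\<xi> \<in> borel_measurable (F c)" using \<xi>(1) ac by (rule measurable_F_mono)
  have \<xi>\<eta>b: "\<bar>\<xi> \<omega> * \<eta> \<omega>\<bar> \<le> C * C'" for \<omega>
    using \<xi>(2)[of \<omega>] \<eta>(2)[of \<omega>] by (simp add: abs_mult mult_mono')
  have \<xi>\<eta>: "(\<lambda>\<omega>. \<xi> \<omega> * \<eta> \<omega>) \<in> borel_measurable (F c)" using \<xi>c \<eta>(1) by simp
  have \<xi>\<eta>i: "integrable M (\<lambda>\<omega>. \<xi> \<omega> * \<eta> \<omega>)"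
    by (rule integrable_const_bound[of _ "C * C'"]) (use \<xi>\<eta>b measurable_F_M[OF \<xi>\<eta>] in auto)
  \<comment> \<open>An increment lying in the future of all other factors is independent of them and
    centred, so the mean of the product is 0.\<close>
  have past: "(\<integral>\<omega>. \<xi> \<omega> * \<eta> \<omega> * incr r e \<omega> * incr e' f \<omega> \<partial>M) = 0"
    if "0 \<le> r" "r \<le> e" "e \<le> e'" "e' \<le> f" "c \<le> e'" for r e e' f
  proof -
    have m: "(\<lambda>\<omega>. \<xi> \<omega> * \<eta> \<omega> * incr r e \<omega>) \<in> borel_measurable (F e')"
      by (intro borel_measurable_times[of "\<lambda>\<omega>. \<xi> \<omega> * \<eta> \<omega>"]
          measurable_F_mono[OF \<xi>\<eta>] measurable_F_mono[OF incr_measurable_F]) (use that in auto)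
    have i: "integrable M (\<lambda>\<omega>. \<xi> \<omega> * \<eta> \<omega> * incr r e \<omega>)"
      using L2_bounded_mult_incr[OF _ _ \<xi>\<eta> \<xi>\<eta>b, of r e] that by (intro L2_integrable) auto
    show ?thesis
      using expectation_mult_incr_power(2)[OF _ _ m i, of f 1] incr_moment(2)[of e' f] that by simp
  qed
  have past_i: "integrable M (\<lambda>\<omega>. \<xi> \<omega> * \<eta> \<omega> * incr r e \<omega> * incr e' f \<omega>)"
    if "0 \<le> r" "r \<le> e" "0 \<le> e'" "e' \<le> f" for r e e' f
    by (rule L2_mult_integrable[OF L2_bounded_mult_incr[OF _ _ \<xi>\<eta> \<xi>\<eta>b] L2_incr]) (use that in auto)
  show ?thesis
  proof (cases "b \<le> c")
    case True
    then have "{a<..b} \<inter> {c<..d} = {}" by auto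
    moreover have eq: "(\<xi> \<omega> * incr a b \<omega>) * (\<eta> \<omega> * incr c d \<omega>) = \<xi> \<omega> * \<eta> \<omega> * incr a b \<omega> * incr c d \<omega>" for \<omega>
      by (simp only: mult.assoc mult.left_commute)
    ultimately show ?thesis unfolding eq using past[of a b c d] True ab cd by simp
  next
    case False
    define e where "e = min b d"
    define f where "f = max b d"
    have e: "c \<le> e" "e \<le> f" using False cd by (auto simp: e_def f_def)
    \<comment> \<open>The product is symmetric in b and d, so the earlier and the later of them may
      be named e and f.\<close>
    have ef: "incr c b \<omega> * incr c d \<omega> = incr c e \<omega> * incr c f \<omega>" for \<omega>
      by (auto simp: e_def f_def min_def max_def)
    have "(\<xi> \<omega> * incr a b \<omega>) * (\<eta> \<omega> * incr c d \<omega>) =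
      \<xi> \<omega> * \<eta> \<omega> * incr a c \<omega> * incr c d \<omega> + \<xi> \<omega> * \<eta> \<omega> * incr c e \<omega> ^ 2
        + \<xi> \<omega> * \<eta> \<omega> * incr c e \<omega> * incr e f \<omega>" for \<omega>
    proof -
      have "(\<xi> \<omega> * incr a b \<omega>) * (\<eta> \<omega> * incr c d \<omega>) =
        \<xi> \<omega> * \<eta> \<omega> * incr a c \<omega> * incr c d \<omega> + \<xi> \<omega> * \<eta> \<omega> * (incr c b \<omega> * incr c d \<omega>)"
        by (simp add: algebra_simps)
      then show ?thesis unfolding ef by (simp add: algebra_simps power2_eq_square)
    qed
    then have "(\<integral>\<omega>. (\<xi> \<omega> * incr a b \<omega>) * (\<eta> \<omega> * incr c d \<omega>) \<partial>M) =
      (\<integral>\<omega>. \<xi> \<omega> * \<eta> \<omega> * incr a c \<omega> * incr c d \<omega> \<partial>M) + (\<integral>\<omega>. \<xi> \<omega> * \<eta> \<omega> * incr c e \<omega> ^ 2 \<partial>M)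
      + (\<integral>\<omega>. \<xi> \<omega> * \<eta> \<omega> * incr c e \<omega> * incr e f \<omega> \<partial>M)"
      using past_i[of a c c d] past_i[of c e e f] expectation_mult_incr_power(1)[OF _ _ \<xi>\<eta> \<xi>\<eta>i, of e 2]
        ab ac cd c0 e by simp
    also have "\<dots> = (\<integral>\<omega>. \<xi> \<omega> * \<eta> \<omega> \<partial>M) * (e - c)"
      using past[of a c c d] past[of c e e f] expectation_mult_incr_power(2)[OF _ _ \<xi>\<eta> \<xi>\<eta>i, of e 2]
        incr_moment(3)[of c e] ab ac cd c0 e by simp
    also have "e - c = measure lborel ({a<..b} \<inter> {c<..d})"
    proof -
      have "{a<..b} \<inter> {c<..d} = {c<..e}" using ac by (auto simp: e_def)
      then show ?thesis using e by simp
    qed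
    finally show ?thesis .
  qed
qed

lemma expectation_incr_incr:
  assumes "0 \<le> a" "a \<le> b" "0 \<le> c" "c \<le> d"
    and \<xi>: "\<xi> \<in> borel_measurable (F a)" "\<And>\<omega>. \<bar>\<xi> \<omega>\<bar> \<le> C"
    and \<eta>: "\<eta> \<in> borel_measurable (F c)" "\<And>\<omega>. \<bar>\<eta> \<omega>\<bar> \<le> C'"
  shows "(\<integral>\<omega>. (\<xi> \<omega> * incr a b \<omega>) * (\<eta> \<omega> * incr c d \<omega>) \<partial>M)
     = (\<integral>\<omega>. \<xi> \<omega> * \<eta> \<omega> \<partial>M) * measure lborel ({a<..b} \<inter> {c<..d})"
proof (cases "a \<le> c")
  case True
  show ?thesis by (rule expectation_incr_incr_le[OF assms(1,2,4) True \<xi> \<eta>])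
next
  case False
  then have "c \<le> a" by simp
  then have "(\<integral>\<omega>. (\<eta> \<omega> * incr c d \<omega>) * (\<xi> \<omega> * incr a b \<omega>) \<partial>M)
     = (\<integral>\<omega>. \<eta> \<omega> * \<xi> \<omega> \<partial>M) * measure lborel ({c<..d} \<inter> {a<..b})"
    by (rule expectation_incr_incr_le[OF assms(3,4,2) _ \<eta> \<xi>])
  then show ?thesis
    unfolding mult.commute[of "\<eta> _ * incr c d _"] mult.commute[of "\<eta> _" "\<xi> _"] Int_commute[of "{c<..d}"] .
qed

text \<open>The intervals are indexed by any finite set and may overlap, so the difference of two
  step processes on different grids is again of this form, by putting their intervals side by
  side.\<close>

definition step_value :: "nat set \<Rightarrow> (nat \<Rightarrow> real) \<Rightarrow> (nat \<Rightarrow> real) \<Rightarrow> (nat \<Rightarrow> 'a \<Rightarrow> real) \<Rightarrow> 'a \<times> real \<Rightarrow> real" where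
  "step_value I a b \<xi> z = (\<Sum>i\<in>I. \<xi> i (fst z) * indicator {a i<..b i} (snd z))"

definition step_integral :: "nat set \<Rightarrow> (nat \<Rightarrow> real) \<Rightarrow> (nat \<Rightarrow> real) \<Rightarrow> (nat \<Rightarrow> 'a \<Rightarrow> real) \<Rightarrow> 'a \<Rightarrow> real" where
  "step_integral I a b \<xi> \<omega> = (\<Sum>i\<in>I. \<xi> i \<omega> * incr (a i) (b i) \<omega>)"

definition step_process :: "real \<Rightarrow> real \<Rightarrow> nat set \<Rightarrow> (nat \<Rightarrow> real) \<Rightarrow> (nat \<Rightarrow> real) \<Rightarrow> (nat \<Rightarrow> 'a \<Rightarrow> real) \<Rightarrow> bool" where
  "step_process s t I a b \<xi> \<longleftrightarrow> 0 \<le> s \<and> finite I \<and>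
     (\<forall>i\<in>I. s \<le> a i \<and> a i \<le> b i \<and> b i \<le> t \<and> \<xi> i \<in> borel_measurable (F (a i)) \<and> (\<exists>C. \<forall>\<omega>. \<bar>\<xi> i \<omega>\<bar> \<le> C))"

lemma L2_step_integral:
  assumes "step_process s t I a b \<xi>" shows "L2 M (step_integral I a b \<xi>)"
  unfolding step_integral_def
proof (rule L2_sum)
  fix i assume "i \<in> I"
  with assms obtain C where "0 \<le> a i" "a i \<le> b i" "\<xi> i \<in> borel_measurable (F (a i))" "\<forall>\<omega>. \<bar>\<xi> i \<omega>\<bar> \<le> C"
    unfolding step_process_def by force
  then show "L2 M (\<lambda>\<omega>. \<xi> i \<omega> * incr (a i) (b i) \<omega>)" by (intro L2_bounded_mult_incr) auto
qed

lemma L2_step_value: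
  assumes "step_process s t I a b \<xi>" shows "L2 (space_time s t) (step_value I a b \<xi>)"
  unfolding step_value_def
proof (rule L2_sum)
  fix i assume "i \<in> I"
  with assms obtain C where \<xi>: "\<xi> i \<in> borel_measurable (F (a i))" "\<forall>\<omega>. \<bar>\<xi> i \<omega>\<bar> \<le> C"
    unfolding step_process_def by force
  have m1: "(\<lambda>z. \<xi> i (fst z)) \<in> borel_measurable (space_time s t)"
    by (rule measurable_compose[OF measurable_fst measurable_F_M[OF \<xi>(1)]])
  have "(indicator {a i<..b i} :: real \<Rightarrow> real) \<in> borel_measurable borel" by simp
  from measurable_compose[OF measurable_snd measurable_time_measure[OF this]]
  have m2: "(\<lambda>z. indicator {a i<..b i} (snd z) :: real) \<in> borel_measurable (space_time s t)" .
  show "L2 (space_time s t) (\<lambda>z. \<xi> i (fst z) * indicator {a i<..b i} (snd z))"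
    by (rule L2_bounded_space_time[of _ _ _ C])
       (use m1 m2 \<xi>(2) abs_ge_zero[of "\<xi> i _", THEN order_trans] in \<open>auto simp: indicator_def\<close>)
qed

text \<open>Squaring gives a double sum on either side. By \<open>expectation_incr_incr\<close> on
  the left and integration over time on the right, both have as (i, j) term the mean of
  \<open>\<xi> i * \<xi> j\<close> times the length of the overlap of the two intervals.\<close>

theorem step_isometry:
  assumes sp: "step_process s t I a b \<xi>"
  shows "(\<integral>\<omega>. (step_integral I a b \<xi> \<omega>)\<^sup>2 \<partial>M) = (\<integral>z. (step_value I a b \<xi> z)\<^sup>2 \<partial>space_time s t)"
proof -
  interpret P: pair_sigma_finite M "time_measure s t" by (rule pair_sigma_finite_time)
  interpret T: finite_measure "time_measure s t" by (rule finite_measure_time)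
  have fin: "finite I" and ab: "\<And>i. i \<in> I \<Longrightarrow> 0 \<le> a i \<and> s \<le> a i \<and> a i \<le> b i \<and> b i \<le> t"
    and \<xi>m: "\<And>i. i \<in> I \<Longrightarrow> \<xi> i \<in> borel_measurable (F (a i))"
    using sp by (auto simp: step_process_def)
  have "\<forall>i\<in>I. \<exists>C. \<forall>\<omega>. \<bar>\<xi> i \<omega>\<bar> \<le> C" using sp by (auto simp: step_process_def)
  then obtain C where C: "\<And>i \<omega>. i \<in> I \<Longrightarrow> \<bar>\<xi> i \<omega>\<bar> \<le> C i" by metis
  define K where "K i j = {a i<..b i} \<inter> {a j<..b j}" for i j
  have \<xi>\<xi>: "integrable M (\<lambda>\<omega>. \<xi> i \<omega> * \<xi> j \<omega>)" if "i \<in> I" "j \<in> I" for i j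
    by (rule integrable_const_bound[of _ "C i * C j"])
       (use that C measurable_F_M[OF \<xi>m] in \<open>auto simp: abs_mult intro!: mult_mono'\<close>)
  have II: "integrable M (\<lambda>\<omega>. (\<xi> i \<omega> * incr (a i) (b i) \<omega>) * (\<xi> j \<omega> * incr (a j) (b j) \<omega>))"
    if "i \<in> I" "j \<in> I" for i j
    using that ab \<xi>m C by (intro L2_mult_integrable L2_bounded_mult_incr) auto
  have "(\<integral>\<omega>. (step_integral I a b \<xi> \<omega>)\<^sup>2 \<partial>M) =
    (\<integral>\<omega>. (\<Sum>i\<in>I. \<Sum>j\<in>I. (\<xi> i \<omega> * incr (a i) (b i) \<omega>) * (\<xi> j \<omega> * incr (a j) (b j) \<omega>)) \<partial>M)"
    by (simp add: step_integral_def power2_eq_square sum_product)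
  also have "\<dots> = (\<Sum>i\<in>I. \<Sum>j\<in>I. \<integral>\<omega>. (\<xi> i \<omega> * incr (a i) (b i) \<omega>) * (\<xi> j \<omega> * incr (a j) (b j) \<omega>) \<partial>M)"
    by (rule integral_sum_sum[OF II])
  also have "\<dots> = (\<Sum>i\<in>I. \<Sum>j\<in>I. (\<integral>\<omega>. \<xi> i \<omega> * \<xi> j \<omega> \<partial>M) * measure lborel (K i j))"
    unfolding K_def using ab \<xi>m C by (intro sum.cong refl expectation_incr_incr) auto
  also have "\<dots> = (\<integral>\<omega>. (\<Sum>i\<in>I. \<Sum>j\<in>I. \<xi> i \<omega> * \<xi> j \<omega> * measure lborel (K i j)) \<partial>M)"
    using \<xi>\<xi> by (subst integral_sum_sum) auto
  also have "\<dots> = (\<integral>\<omega>. (\<integral>u. (step_value I a b \<xi> (\<omega>, u))\<^sup>2 \<partial>time_measure s t) \<partial>M)"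
  proof (rule Bochner_Integration.integral_cong[OF refl])
    fix \<omega>
    have sub: "K i j \<subseteq> {s<..t}" if "i \<in> I" "j \<in> I" for i j using ab[OF that(1)] by (auto simp: K_def)
    have Kb: "K i j \<in> sets borel" for i j by (simp add: K_def)
    have "(step_value I a b \<xi> (\<omega>, u))\<^sup>2 = (\<Sum>i\<in>I. \<Sum>j\<in>I. \<xi> i \<omega> * \<xi> j \<omega> * indicator (K i j) u)" for u
      unfolding step_value_def power2_eq_square sum_product
      by (intro sum.cong refl) (auto simp: K_def indicator_def)
    moreover have "(\<integral>u. (\<Sum>i\<in>I. \<Sum>j\<in>I. \<xi> i \<omega> * \<xi> j \<omega> * indicator (K i j) u) \<partial>time_measure s t)
      = (\<Sum>i\<in>I. \<Sum>j\<in>I. \<integral>u. \<xi> i \<omega> * \<xi> j \<omega> * indicator (K i j) u \<partial>time_measure s t)"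
      using sub Kb T.emeasure_finite
      by (intro integral_sum_sum integrable_mult_right integrable_real_indicator sets_time_measure)
         (auto simp: less_top[symmetric])
    moreover have "\<dots> = (\<Sum>i\<in>I. \<Sum>j\<in>I. \<xi> i \<omega> * \<xi> j \<omega> * measure lborel (K i j))"
    proof (intro sum.cong refl)
      fix i j assume "i \<in> I" "j \<in> I"
      from sub[OF this] Kb[of i j]
      show "(\<integral>u. \<xi> i \<omega> * \<xi> j \<omega> * indicator (K i j) u \<partial>time_measure s t) = \<xi> i \<omega> * \<xi> j \<omega> * measure lborel (K i j)"
        by (simp add: space_time_measure measure_time_measure Int_absorb2)
    qed
    ultimately show "(\<Sum>i\<in>I. \<Sum>j\<in>I. \<xi> i \<omega> * \<xi> j \<omega> * measure lborel (K i j)) =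
      (\<integral>u. (step_value I a b \<xi> (\<omega>, u))\<^sup>2 \<partial>time_measure s t)" by simp
  qed
  also have "\<dots> = (\<integral>z. (step_value I a b \<xi> z)\<^sup>2 \<partial>space_time s t)"
    by (rule P.integral_fst'[OF L2_integrable_square[OF L2_step_value[OF sp]]])
  finally show ?thesis .
qed

text \<open>Induction on the number of intervals. In the expansion of the fourth power of
  \<open>A + \<xi> * Z\<close> the terms with an odd power of \<open>Z\<close> have mean 0; the
  others add up to at most 3 K^4 (\<tau>^2 + 2 \<tau> \<delta> + \<delta>^2), a perfect square, so
  the Gaussian constant 3 survives the step. Integrability and adaptedness are carried along because
  the next step uses them.\<close>

lemma step_integral_moments:
  fixes p :: "nat \<Rightarrow> real" and \<xi> :: "nat \<Rightarrow> 'a \<Rightarrow> real"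
  assumes p: "mono p" "0 \<le> p 0"
    and \<xi>: "\<And>k. k < n \<Longrightarrow> \<xi> k \<in> borel_measurable (F (p k))" "\<And>k \<omega>. k < n \<Longrightarrow> \<bar>\<xi> k \<omega>\<bar> \<le> K"
  defines "A \<equiv> \<lambda>n. step_integral {..<n} p (\<lambda>k. p (Suc k)) \<xi>"
  shows "integrable M (\<lambda>\<omega>. A n \<omega> ^ 4) \<and> A n \<in> borel_measurable (F (p n)) \<and>
     (\<integral>\<omega>. A n \<omega> ^ 2 \<partial>M) \<le> K\<^sup>2 * (p n - p 0) \<and> (\<integral>\<omega>. A n \<omega> ^ 4 \<partial>M) \<le> 3 * K ^ 4 * (p n - p 0)\<^sup>2"
  using \<xi>
proof (induction n)
  case 0
  show ?case by (simp add: A_def step_integral_def)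
next
  case (Suc n)
  define Z where "Z \<omega> = incr (p n) (p (Suc n)) \<omega>" for \<omega>
  define \<delta> where "\<delta> = p (Suc n) - p n"
  define \<tau> where "\<tau> = p n - p 0"
  have IH: "integrable M (\<lambda>\<omega>. A n \<omega> ^ 4)" "A n \<in> borel_measurable (F (p n))"
     "(\<integral>\<omega>. A n \<omega> ^ 2 \<partial>M) \<le> K\<^sup>2 * \<tau>" "(\<integral>\<omega>. A n \<omega> ^ 4 \<partial>M) \<le> 3 * K ^ 4 * \<tau>\<^sup>2"
    using Suc.IH Suc.prems by (simp_all add: \<tau>_def)
  have pn: "0 \<le> p n" "p n \<le> p (Suc n)" using monoD[OF p(1), of 0 n] monoD[OF p(1), of n "Suc n"] p(2) by auto
  have \<tau>: "0 \<le> \<tau>" "0 \<le> \<delta>" using monoD[OF p(1), of 0 n] pn by (auto simp: \<tau>_def \<delta>_def)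
  have \<xi>n: "\<xi> n \<in> borel_measurable (F (p n))" "\<And>\<omega>. \<bar>\<xi> n \<omega>\<bar> \<le> K" using Suc.prems by auto
  have K: "0 \<le> K" using \<xi>n(2)[of undefined] by linarith
  have \<xi>K: "\<bar>\<xi> n \<omega>\<bar> ^ j \<le> K ^ j" for \<omega> j using \<xi>n(2)[of \<omega>] by (intro power_mono) auto
  have AS: "A (Suc n) \<omega> = A n \<omega> + \<xi> n \<omega> * Z \<omega>" for \<omega>
    by (simp add: A_def step_integral_def Z_def)
  have low: "integrable M (\<lambda>\<omega>. A n \<omega> ^ j)" if "j \<le> 4" for j
  proof (rule Bochner_Integration.integrable_bound[where f="\<lambda>\<omega>. 1 + A n \<omega> ^ 4"])
    show "integrable M (\<lambda>\<omega>. 1 + A n \<omega> ^ 4)" using IH(1) by auto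
    show "(\<lambda>\<omega>. A n \<omega> ^ j) \<in> borel_measurable M" using measurable_F_M[OF IH(2)] by simp
    have "\<bar>x\<bar> ^ j \<le> 1 + x ^ 4" for x :: real
    proof (cases "\<bar>x\<bar> \<le> 1")
      case True
      then have "\<bar>x\<bar> ^ j \<le> 1" by (simp add: power_le_one)
      then show ?thesis by (simp add: add_increasing2)
    next
      case False
      then have "\<bar>x\<bar> ^ j \<le> \<bar>x\<bar> ^ 4" using that by (intro power_increasing) auto
      then show ?thesis by simp
    qed
    then show "AE \<omega> in M. norm (A n \<omega> ^ j) \<le> norm (1 + A n \<omega> ^ 4)"
      by (auto simp: power_abs abs_of_nonneg add_nonneg_nonneg)
  qed
  have wm: "(\<lambda>\<omega>. A n \<omega> ^ i * \<xi> n \<omega> ^ j) \<in> borel_measurable (F (p n))" for i j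
    using IH(2) \<xi>n(1) by auto
  have wi: "integrable M (\<lambda>\<omega>. A n \<omega> ^ i * \<xi> n \<omega> ^ j)" if "i \<le> 4" for i j
  proof (rule Bochner_Integration.integrable_bound[where f="\<lambda>\<omega>. K ^ j * A n \<omega> ^ i"])
    show "integrable M (\<lambda>\<omega>. K ^ j * A n \<omega> ^ i)" using low[OF that] by auto
    show "AE \<omega> in M. norm (A n \<omega> ^ i * \<xi> n \<omega> ^ j) \<le> norm (K ^ j * A n \<omega> ^ i)"
      using \<xi>K K by (auto simp: abs_mult power_abs mult.commute[of "K ^ j"] intro!: mult_left_mono)
  qed (rule measurable_F_M[OF wm])
  note W = expectation_mult_incr_power[OF pn wm wi, folded Z_def]
  note Zm = incr_moment[OF pn, folded Z_def \<delta>_def]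
  have i2: "integrable M (\<lambda>\<omega>. A n \<omega> ^ 2)" using low[of 2] by simp
  \<comment> \<open>Zeroth powers are written out so that every summand is a power of
    \<open>A\<close>, times a power of \<xi>, times a power of \<open>Z\<close>, the shape to which
    the instances of \<open>W\<close> apply.\<close>
  have e2: "A (Suc n) \<omega> ^ 2 = A n \<omega> ^ 2 * \<xi> n \<omega> ^ 0 * Z \<omega> ^ 0 + 2 * (A n \<omega> ^ 1 * \<xi> n \<omega> ^ 1 * Z \<omega> ^ 1) + A n \<omega> ^ 0 * \<xi> n \<omega> ^ 2 * Z \<omega> ^ 2" for \<omega>
    by (simp add: AS power2_eq_square algebra_simps)
  have e4: "A (Suc n) \<omega> ^ 4 = A n \<omega> ^ 4 * \<xi> n \<omega> ^ 0 * Z \<omega> ^ 0 + 4 * (A n \<omega> ^ 3 * \<xi> n \<omega> ^ 1 * Z \<omega> ^ 1)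
     + 6 * (A n \<omega> ^ 2 * \<xi> n \<omega> ^ 2 * Z \<omega> ^ 2) + 4 * (A n \<omega> ^ 1 * \<xi> n \<omega> ^ 3 * Z \<omega> ^ 3) + A n \<omega> ^ 0 * \<xi> n \<omega> ^ 4 * Z \<omega> ^ 4" for \<omega>
    by (simp add: AS power4_eq_xxxx power3_eq_cube power2_eq_square algebra_simps)
  have \<xi>2: "(\<integral>\<omega>. A n \<omega> ^ 2 * \<xi> n \<omega> ^ 2 \<partial>M) \<le> K\<^sup>2 * (K\<^sup>2 * \<tau>)"
  proof -
    have "(\<integral>\<omega>. A n \<omega> ^ 2 * \<xi> n \<omega> ^ 2 \<partial>M) \<le> (\<integral>\<omega>. K\<^sup>2 * A n \<omega> ^ 2 \<partial>M)"
      using wi[of 2 2] i2 \<xi>K[of _ 2] by (intro integral_mono) (auto simp: mult.commute[of "K\<^sup>2"] intro!: mult_left_mono)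
    also have "\<dots> \<le> K\<^sup>2 * (K\<^sup>2 * \<tau>)" using mult_left_mono[OF IH(3), of "K\<^sup>2"] i2 by simp
    finally show ?thesis .
  qed
  have \<xi>j: "(\<integral>\<omega>. A n \<omega> ^ 0 * \<xi> n \<omega> ^ j \<partial>M) \<le> K ^ j" for j
  proof -
    have "(\<integral>\<omega>. A n \<omega> ^ 0 * \<xi> n \<omega> ^ j \<partial>M) \<le> (\<integral>\<omega>. K ^ j \<partial>M)"
      using wi[of 0 j] \<xi>K[of _ j] abs_ge_self[of "\<xi> n _ ^ j"]
      by (intro integral_mono) (auto simp: power_abs[symmetric] intro: order_trans)
    then show ?thesis by (simp add: prob_space)
  qed
  have "(\<integral>\<omega>. A (Suc n) \<omega> ^ 2 \<partial>M) = (\<integral>\<omega>. A n \<omega> ^ 2 \<partial>M) + (\<integral>\<omega>. A n \<omega> ^ 0 * \<xi> n \<omega> ^ 2 \<partial>M) * \<delta>"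
    using W[of 2 0 0] W[of 1 1 1] W[of 0 2 2] Zm by (simp add: e2 prob_space)
  also have "\<dots> \<le> K\<^sup>2 * \<tau> + K ^ 2 * \<delta>"
    using IH(3) \<tau> by (intro add_mono mult_right_mono \<xi>j) auto
  finally have m2: "(\<integral>\<omega>. A (Suc n) \<omega> ^ 2 \<partial>M) \<le> K\<^sup>2 * (p (Suc n) - p 0)"
    by (simp add: \<tau>_def \<delta>_def algebra_simps)
  have "(\<integral>\<omega>. A (Suc n) \<omega> ^ 4 \<partial>M) = (\<integral>\<omega>. A n \<omega> ^ 4 \<partial>M) + 6 * ((\<integral>\<omega>. A n \<omega> ^ 2 * \<xi> n \<omega> ^ 2 \<partial>M) * \<delta>)
      + (\<integral>\<omega>. A n \<omega> ^ 0 * \<xi> n \<omega> ^ 4 \<partial>M) * (3 * \<delta>\<^sup>2)"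
    using W[of 4 0 0] W[of 3 1 1] W[of 2 2 2] W[of 1 3 3] W[of 0 4 4] Zm by (simp add: e4 prob_space)
  also have "\<dots> \<le> 3 * K ^ 4 * \<tau>\<^sup>2 + 6 * (K\<^sup>2 * (K\<^sup>2 * \<tau>) * \<delta>) + K ^ 4 * (3 * \<delta>\<^sup>2)"
    using IH(4) \<tau> by (intro add_mono mult_right_mono mult_left_mono \<xi>j \<xi>2) auto
  also have "\<dots> = 3 * K ^ 4 * (\<tau> + \<delta>)\<^sup>2"
    by (simp add: power4_eq_xxxx power2_eq_square algebra_simps)
  finally have m4: "(\<integral>\<omega>. A (Suc n) \<omega> ^ 4 \<partial>M) \<le> 3 * K ^ 4 * (p (Suc n) - p 0)\<^sup>2"
    by (simp add: \<tau>_def \<delta>_def)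
  have "integrable M (\<lambda>\<omega>. A (Suc n) \<omega> ^ 4)"
    unfolding e4 using W(1)[of 4 0 0] W(1)[of 3 1 1] W(1)[of 2 2 2] W(1)[of 1 3 3] W(1)[of 0 4 4]
    by (intro Bochner_Integration.integrable_add integrable_mult_right) auto
  moreover have "A (Suc n) \<in> borel_measurable (F (p (Suc n)))"
    unfolding AS[abs_def] Z_def
    by (rule borel_measurable_add[OF measurable_F_mono[OF IH(2) pn(2)]
          borel_measurable_times[OF measurable_F_mono[OF \<xi>n(1) pn(2)] incr_measurable_F[OF pn]]])
  ultimately show ?case using m2 m4 by blast
qed

end

section \<open>The Ito integral of a bounded process\<close>

context brownian
begin

text \<open>Even indices carry the first process and odd indices the negative of the second: a
  disjoint union of index sets inside the naturals.\<close>

lemma step_process_diff: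
  assumes "step_process s t I a b \<xi>" "step_process s t J c d \<eta>"
  obtains L e f \<zeta> where "step_process s t L e f \<zeta>"
    "\<And>\<omega>. step_integral L e f \<zeta> \<omega> = step_integral I a b \<xi> \<omega> - step_integral J c d \<eta> \<omega>"
    "\<And>z. step_value L e f \<zeta> z = step_value I a b \<xi> z - step_value J c d \<eta> z"
proof
  define ev where "ev (i::nat) = 2 * i" for i
  define od where "od (i::nat) = 2 * i + 1" for i
  define L where "L = ev ` I \<union> od ` J"
  define e where "e k = (if even k then a (k div 2) else c (k div 2))" for k
  define f where "f k = (if even k then b (k div 2) else d (k div 2))" for k
  define \<zeta> where "\<zeta> k \<omega> = (if even k then \<xi> (k div 2) \<omega> else - \<eta> (k div 2) \<omega>)" for k \<omega>
  have fin: "finite I" "finite J" using assms by (auto simp: step_process_def)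
  have split: "sum g L = (\<Sum>i\<in>I. g (ev i)) + (\<Sum>j\<in>J. g (od j))" for g :: "nat \<Rightarrow> real"
  proof -
    have "ev ` I \<inter> od ` J = {}" by (auto simp: ev_def od_def) presburger
    then have "sum g L = sum g (ev ` I) + sum g (od ` J)"
      unfolding L_def using fin by (intro sum.union_disjoint) auto
    then show ?thesis by (simp add: sum.reindex inj_on_def ev_def od_def)
  qed
  have at [simp]: "e (ev i) = a i" "f (ev i) = b i" "\<zeta> (ev i) = \<xi> i"
    "e (od i) = c i" "f (od i) = d i" "\<zeta> (od i) = (\<lambda>\<omega>. - \<eta> i \<omega>)" for i
    by (auto simp: e_def f_def \<zeta>_def ev_def od_def)
  show "step_process s t L e f \<zeta>"
    unfolding step_process_def
  proof (intro conjI ballI)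
    show "0 \<le> s" "finite L" using assms fin by (auto simp: step_process_def L_def)
    fix k assume "k \<in> L"
    then consider i where "i \<in> I" "k = ev i" | j where "j \<in> J" "k = od j" by (auto simp: L_def)
    then have "s \<le> e k \<and> e k \<le> f k \<and> f k \<le> t \<and> \<zeta> k \<in> borel_measurable (F (e k)) \<and> (\<exists>C. \<forall>\<omega>. \<bar>\<zeta> k \<omega>\<bar> \<le> C)"
      by cases (use assms in \<open>auto simp: step_process_def\<close>)
    then show "s \<le> e k" "e k \<le> f k" "f k \<le> t" "\<zeta> k \<in> borel_measurable (F (e k))" "\<exists>C. \<forall>\<omega>. \<bar>\<zeta> k \<omega>\<bar> \<le> C"
      by blast+
  qed
  show "step_integral L e f \<zeta> \<omega> = step_integral I a b \<xi> \<omega> - step_integral J c d \<eta> \<omega>" for \<omega>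
    by (simp add: step_integral_def split sum_negf)
  show "step_value L e f \<zeta> z = step_value I a b \<xi> z - step_value J c d \<eta> z" for z
    by (simp add: step_value_def split sum_negf)
qed

lemma step_isometry_diff:
  assumes "step_process s t I a b \<xi>" "step_process s t J c d \<eta>"
  shows "(\<integral>\<omega>. (step_integral I a b \<xi> \<omega> - step_integral J c d \<eta> \<omega>)\<^sup>2 \<partial>M)
     = (\<integral>z. (step_value I a b \<xi> z - step_value J c d \<eta> z)\<^sup>2 \<partial>space_time s t)"
proof (rule step_process_diff[OF assms])
  fix L e f \<zeta>
  assume sp: "step_process s t L e f \<zeta>"
    and "\<And>\<omega>. step_integral L e f \<zeta> \<omega> = step_integral I a b \<xi> \<omega> - step_integral J c d \<eta> \<omega>"
    and "\<And>z. step_value L e f \<zeta> z = step_value I a b \<xi> z - step_value J c d \<eta> z"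
  then show ?thesis using step_isometry[OF sp] by simp
qed

text \<open>A simple integrand restricted to \<open>{s<..t}\<close>: grid points are clamped to \<open>[s, t]\<close> and made constant beyond the end of the
  list, and coefficients that only become measurable after \<open>t\<close> are set to \<open>0\<close>, since their intervals are then empty.\<close>

definition pt :: "real \<Rightarrow> real \<Rightarrow> real list \<Rightarrow> nat \<Rightarrow> real" where
  "pt s t ss k = max s (min t (ss ! min k (length ss - 1)))"

definition cf :: "(real \<Rightarrow> real) \<Rightarrow> real \<Rightarrow> real list \<Rightarrow> ('a \<Rightarrow> real) list \<Rightarrow> nat \<Rightarrow> 'a \<Rightarrow> real" where
  "cf c t ss xis k \<omega> = (if ss ! k < t then c ((xis ! k) \<omega>) else 0)"

text \<open>\<open>c\<close> acts on the coefficients: the identity reproduces the given simple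
  integrand, truncation makes it bounded uniformly along an approximating sequence.\<close>

abbreviation SI :: "(real \<Rightarrow> real) \<Rightarrow> real \<Rightarrow> real \<Rightarrow> real list \<Rightarrow> ('a \<Rightarrow> real) list \<Rightarrow> 'a \<Rightarrow> real" where
  "SI c s t ss xis \<equiv> step_integral {..<length xis} (pt s t ss) (\<lambda>k. pt s t ss (Suc k)) (cf c t ss xis)"

abbreviation SV :: "(real \<Rightarrow> real) \<Rightarrow> real \<Rightarrow> real \<Rightarrow> real list \<Rightarrow> ('a \<Rightarrow> real) list \<Rightarrow> 'a \<times> real \<Rightarrow> real" where
  "SV c s t ss xis \<equiv> step_value {..<length xis} (pt s t ss) (\<lambda>k. pt s t ss (Suc k)) (cf c t ss xis)"

lemma simple_adapted_nth:
  assumes "simple_adapted F ss xis"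
  shows "length ss = Suc (length xis)" "ss ! 0 = 0"
    and "i < j \<Longrightarrow> j \<le> length xis \<Longrightarrow> ss ! i < ss ! j"
    and "i \<le> length xis \<Longrightarrow> 0 \<le> ss ! i"
proof -
  show l: "length ss = Suc (length xis)" "ss ! 0 = 0" using assms by (auto simp: simple_adapted_def)
  show lt: "ss ! i < ss ! j" if "i < j" "j \<le> length xis" for i j
    using assms that by (intro sorted_wrt_nth_less[of "(<)"]) (auto simp: simple_adapted_def)
  show "0 \<le> ss ! i" if "i \<le> length xis" using lt[of 0 i] that l by (cases i) auto
qed

lemma pt_mono: assumes "simple_adapted F ss xis" shows "mono (pt s t ss)"
proof (rule monoI)
  fix i j :: nat assume "i \<le> j"
  define i' j' where "i' = min i (length xis)" and "j' = min j (length xis)"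
  have "i' \<le> j'" "j' \<le> length xis" using \<open>i \<le> j\<close> by (auto simp: i'_def j'_def)
  then have "ss ! i' \<le> ss ! j'"
    using simple_adapted_nth(3)[OF assms, of i' j'] by (cases "i' = j'") auto
  then show "pt s t ss i \<le> pt s t ss j"
    using simple_adapted_nth(1)[OF assms] unfolding pt_def i'_def j'_def by auto
qed

lemma pt_range: "s \<le> t \<Longrightarrow> s \<le> pt s t ss k \<and> pt s t ss k \<le> t"
  by (auto simp: pt_def)

lemma pt_nth: "simple_adapted F ss xis \<Longrightarrow> k \<le> length xis \<Longrightarrow> pt s t ss k = max s (min t (ss ! k))"
  by (simp add: pt_def simple_adapted_nth(1))

lemma cf_measurable:
  assumes sa: "simple_adapted F ss xis" and k: "k < length xis" and c: "c \<in> borel_measurable borel"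
  shows "cf c t ss xis k \<in> borel_measurable (F (pt s t ss k))"
proof (cases "ss ! k < t")
  case True
  have "xis ! k \<in> borel_measurable (F (ss ! k))" using sa k by (simp add: simple_adapted_def)
  then have "xis ! k \<in> borel_measurable (F (pt s t ss k))"
    by (rule measurable_F_mono) (use True pt_nth[OF sa, of k s t] k in auto)
  then have "(\<lambda>\<omega>. c ((xis ! k) \<omega>)) \<in> borel_measurable (F (pt s t ss k))"
    using c by (rule measurable_compose)
  then show ?thesis using True by (simp add: cf_def[abs_def])
qed (simp add: cf_def[abs_def])

lemma simple_step_process:
  assumes sa: "simple_adapted F ss xis" and st: "0 \<le> s" "s \<le> t"
    and c: "c \<in> borel_measurable borel" "\<And>x. \<bar>c x\<bar> \<le> \<bar>x\<bar>"
  shows "step_process s t {..<length xis} (pt s t ss) (\<lambda>k. pt s t ss (Suc k)) (cf c t ss xis)"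
  unfolding step_process_def
proof (intro conjI ballI)
  fix k assume "k \<in> {..<length xis}"
  then have k: "k < length xis" by simp
  show "cf c t ss xis k \<in> borel_measurable (F (pt s t ss k))" by (rule cf_measurable[OF sa k c(1)])
  obtain C where C: "\<And>\<omega>. \<bar>(xis ! k) \<omega>\<bar> \<le> C" using sa k by (auto simp: simple_adapted_def)
  have "\<bar>cf c t ss xis k \<omega>\<bar> \<le> C" for \<omega>
    using C[of \<omega>] c(2)[of "(xis ! k) \<omega>"] by (auto simp: cf_def)
  then show "\<exists>C. \<forall>\<omega>. \<bar>cf c t ss xis k \<omega>\<bar> \<le> C" by blast
  show "pt s t ss k \<le> pt s t ss (Suc k)" by (rule monoD[OF pt_mono[OF sa]]) simp
qed (use st pt_range[OF st(2)] in auto)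

text \<open>A time u lies in at most one interval of the grid, so at most one summand is nonzero and
  \<open>c\<close> passes through the sum; \<open>c 0 = 0\<close> handles times that no interval
  contains.\<close>

lemma SV_eq:
  assumes sa: "simple_adapted F ss xis" and u: "s < u" "u \<le> t" and c0: "c 0 = 0"
  shows "SV c s t ss xis (\<omega>, u) = c (simple_value ss xis u \<omega>)"
proof -
  define P where "P k \<longleftrightarrow> ss ! k < u \<and> u \<le> ss ! Suc k" for k
  have "SV c s t ss xis (\<omega>, u) = (\<Sum>k<length xis. if P k then c ((xis ! k) \<omega>) else 0)"
    unfolding step_value_def
  proof (rule sum.cong[OF refl])
    fix k assume "k \<in> {..<length xis}"
    then have "pt s t ss k = max s (min t (ss ! k))" "pt s t ss (Suc k) = max s (min t (ss ! Suc k))"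
      using pt_nth[OF sa] by auto
    then show "cf c t ss xis k (fst (\<omega>, u)) * indicator {pt s t ss k<..pt s t ss (Suc k)} (snd (\<omega>, u))
      = (if P k then c ((xis ! k) \<omega>) else 0)"
      using u by (auto simp: cf_def P_def indicator_def)
  qed
  also have "\<dots> = c (\<Sum>k<length xis. if P k then (xis ! k) \<omega> else 0)"
  proof (cases "\<exists>j<length xis. P j")
    case True
    then obtain j where j: "j < length xis" "P j" by blast
    have uniq: "k = j" if "k < length xis" "P k" for k
    proof (rule ccontr)
      assume "k \<noteq> j"
      then consider "Suc k \<le> j" | "Suc j \<le> k" by linarith
      then show False
      proof cases
        case 1
        then have "ss ! Suc k \<le> ss ! j"
          using simple_adapted_nth(3)[OF sa, of "Suc k" j] j by (cases "Suc k = j") auto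
        with j that show False by (auto simp: P_def)
      next
        case 2
        then have "ss ! Suc j \<le> ss ! k"
          using simple_adapted_nth(3)[OF sa, of "Suc j" k] that by (cases "Suc j = k") auto
        with j that show False by (auto simp: P_def)
      qed
    qed
    have "(\<Sum>k<length xis. if P k then g k else 0) = g j" for g :: "nat \<Rightarrow> real"
    proof -
      have "(\<Sum>k<length xis. if P k then g k else 0) = (\<Sum>k<length xis. if k = j then g k else 0)"
      proof (rule sum.cong[OF refl])
        fix k assume "k \<in> {..<length xis}"
        then show "(if P k then g k else 0) = (if k = j then g k else 0)"
          using uniq[of k] j(2) by (cases "P k") auto
      qed
      then show ?thesis using j by simp
    qed
    then show ?thesis by simp
  next
    case False
    then show ?thesis using c0 by (simp add: sum.neutral)
  qed
  finally show ?thesis by (simp add: simple_value_def P_def)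
qed

text \<open>An interval starting at t or later has coefficient 0 in \<open>cf\<close>, while
  \<open>simple_integral\<close> clamps both of its endpoints to t; either way it contributes
  nothing.\<close>

lemma SI_id:
  assumes sa: "simple_adapted F ss xis" and t: "0 \<le> t"
  shows "SI (\<lambda>x. x) 0 t ss xis \<omega> = simple_integral W ss xis t \<omega>"
  unfolding step_integral_def simple_integral_def
proof (rule sum.cong[OF refl])
  fix k assume k: "k \<in> {..<length xis}"
  then have "0 \<le> ss ! k" "ss ! k < ss ! Suc k" using simple_adapted_nth[OF sa] by auto
  moreover have "pt 0 t ss k = max 0 (min t (ss ! k))" "pt 0 t ss (Suc k) = max 0 (min t (ss ! Suc k))"
    using pt_nth[OF sa] k by auto
  ultimately show "cf (\<lambda>x. x) t ss xis k \<omega> * incr (pt 0 t ss k) (pt 0 t ss (Suc k)) \<omega>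
    = (xis ! k) \<omega> * (W (min t (ss ! Suc k)) \<omega> - W (min t (ss ! k)) \<omega>)"
    using t by (auto simp: cf_def)
qed

text \<open>Lets one sequence approximate increments of the integral as well. The check
  distinguishes where the interval of index k lies relative to s and t; an interval straddling s is
  cut there, and its coefficient is the same in all three terms.\<close>

lemma SI_add:
  assumes sa: "simple_adapted F ss xis" and st: "0 \<le> s" "s \<le> t"
  shows "SI c 0 t ss xis \<omega> = SI c 0 s ss xis \<omega> + SI c s t ss xis \<omega>"
  unfolding step_integral_def sum.distrib[symmetric]
proof (rule sum.cong[OF refl])
  fix k assume k: "k \<in> {..<length xis}"
  then have k': "0 \<le> ss ! k" "ss ! k < ss ! Suc k" using simple_adapted_nth[OF sa] by auto
  have p: "pt r v ss k = max r (min v (ss ! k))" "pt r v ss (Suc k) = max r (min v (ss ! Suc k))" for r v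
    using pt_nth[OF sa] k by auto
  consider "t \<le> ss ! k" | "s \<le> ss ! k" "ss ! k < t" | "ss ! k < s" "ss ! Suc k \<le> s" | "ss ! k < s" "s < ss ! Suc k"
    using k' by linarith
  then show "cf c t ss xis k \<omega> * incr (pt 0 t ss k) (pt 0 t ss (Suc k)) \<omega> =
    cf c s ss xis k \<omega> * incr (pt 0 s ss k) (pt 0 s ss (Suc k)) \<omega> +
    cf c t ss xis k \<omega> * incr (pt s t ss k) (pt s t ss (Suc k)) \<omega>"
    by cases (use st k' in \<open>auto simp: p cf_def algebra_simps\<close>)
qed

end

section \<open>Limits of step integrals for a bounded integrand\<close>

locale ito_integrable = brownian +
  fixes H Y :: "real \<Rightarrow> 'a \<Rightarrow> real" and K :: real
  assumes H_measurable: "\<And>s t. 0 \<le> s \<Longrightarrow> (\<lambda>z. H (snd z) (fst z)) \<in> borel_measurable (M \<Otimes>\<^sub>M time_measure s t)"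
    and H_bound: "\<And>u \<omega>. \<bar>H u \<omega>\<bar> \<le> K"
    and ito: "\<And>t. 0 \<le> t \<Longrightarrow> ito_integral_at M F W H t (Y t)"
begin

text \<open>Clamping to [-K, K] moves every number closer to each value of \<open>H\<close>, so
  truncated approximations converge at least as well, and they obey the fourth moment bound of
  \<open>step_integral_moments\<close> with one and the same constant.\<close>

definition trunc :: "real \<Rightarrow> real" where
  "trunc x = max (- K) (min K x)"

lemma K_nonneg: "0 \<le> K"
  using H_bound[of undefined undefined] by linarith

lemma trunc: "trunc \<in> borel_measurable borel" "\<bar>trunc x\<bar> \<le> \<bar>x\<bar>" "\<bar>trunc x\<bar> \<le> K" "trunc 0 = 0"
  "\<bar>y\<bar> \<le> K \<Longrightarrow> \<bar>trunc x - y\<bar> \<le> \<bar>x - y\<bar>"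
  using K_nonneg unfolding trunc_def[abs_def] by auto

abbreviation Hz :: "'a \<times> real \<Rightarrow> real" where
  "Hz z \<equiv> H (snd z) (fst z)"

lemma L2_Hz: "0 \<le> s \<Longrightarrow> L2 (space_time s t) Hz"
  using H_measurable H_bound by (intro L2_bounded_space_time) auto

definition approximates :: "real \<Rightarrow> (nat \<Rightarrow> real list) \<Rightarrow> (nat \<Rightarrow> ('a \<Rightarrow> real) list) \<Rightarrow> bool" where
  "approximates t ss xis \<longleftrightarrow> (\<forall>n. simple_adapted F (ss n) (xis n)) \<and>
     ((\<lambda>n. \<integral>\<^sup>+\<omega>. (\<integral>\<^sup>+u\<in>{0..t}. ennreal ((H u \<omega> - simple_value (ss n) (xis n) u \<omega>)\<^sup>2) \<partial>lborel) \<partial>M)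
           \<longlonglongrightarrow> 0) \<and>
     ((\<lambda>n. \<integral>\<^sup>+\<omega>. ennreal ((Y t \<omega> - simple_integral W (ss n) (xis n) t \<omega>)\<^sup>2) \<partial>M) \<longlonglongrightarrow> 0)"

lemma approximates_exists: "0 \<le> t \<Longrightarrow> \<exists>ss xis. approximates t ss xis"
  using ito[of t] unfolding ito_integral_at_def approximates_def by blast

lemma Y_measurable: "0 \<le> t \<Longrightarrow> Y t \<in> borel_measurable M"
  using ito[of t] unfolding ito_integral_at_def by blast

text \<open>The sequence chosen for time t approximates \<open>H\<close> on every subinterval of
  [0, t], since shrinking the domain and applying a map such as \<open>trunc\<close> only decrease
  the error.\<close>

lemma SV_tendsto:
  assumes ap: "approximates t ss xis" and st: "0 \<le> s" "s \<le> r" "r \<le> t"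
    and c: "c \<in> borel_measurable borel" "\<And>x. \<bar>c x\<bar> \<le> \<bar>x\<bar>" "\<And>x y. \<bar>y\<bar> \<le> K \<Longrightarrow> \<bar>c x - y\<bar> \<le> \<bar>x - y\<bar>"
  shows "(\<lambda>n. \<integral>z. (SV c s r (ss n) (xis n) z - Hz z)\<^sup>2 \<partial>space_time s r) \<longlonglongrightarrow> 0"
proof -
  interpret T: finite_measure "time_measure s r" by (rule finite_measure_time)
  have sa: "simple_adapted F (ss n) (xis n)" for n using ap by (simp add: approximates_def)
  have c0: "c 0 = 0" using c(2)[of 0] by simp
  let ?e = "\<lambda>n. \<integral>\<^sup>+\<omega>. (\<integral>\<^sup>+u\<in>{0..t}. ennreal ((H u \<omega> - simple_value (ss n) (xis n) u \<omega>)\<^sup>2) \<partial>lborel) \<partial>M"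
  let ?d = "\<lambda>n z. SV c s r (ss n) (xis n) z - Hz z"
  have L2d: "L2 (space_time s r) (?d n)" for n
    by (intro L2_diff L2_Hz L2_step_value[OF simple_step_process[OF sa st(1,2) c(1,2)]] st)
  have le: "ennreal (\<integral>z. (?d n z)\<^sup>2 \<partial>space_time s r) \<le> ?e n" for n
  proof -
    have "ennreal (\<integral>z. (?d n z)\<^sup>2 \<partial>space_time s r) = (\<integral>\<^sup>+z. ennreal ((?d n z)\<^sup>2) \<partial>space_time s r)"
      using L2d[of n] by (intro nn_integral_eq_integral[symmetric]) (auto simp: L2_def)
    also have "\<dots> = (\<integral>\<^sup>+\<omega>. (\<integral>\<^sup>+u. ennreal ((?d n (\<omega>, u))\<^sup>2) \<partial>time_measure s r) \<partial>M)"
      using L2_measurable[OF L2d[of n]]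
      by (intro T.nn_integral_fst[symmetric] measurable_compose[OF borel_measurable_power measurable_ennreal])
    also have "\<dots> \<le> ?e n"
    proof (rule nn_integral_mono)
      fix \<omega>
      have "(\<integral>\<^sup>+u. ennreal ((?d n (\<omega>, u))\<^sup>2) \<partial>time_measure s r)
        = (\<integral>\<^sup>+u. ennreal ((?d n (\<omega>, u))\<^sup>2) * indicator {s<..r} u \<partial>lborel)"
        unfolding time_measure_def by (rule nn_integral_restrict_space) simp
      also have "\<dots> \<le> (\<integral>\<^sup>+u\<in>{0..t}. ennreal ((H u \<omega> - simple_value (ss n) (xis n) u \<omega>)\<^sup>2) \<partial>lborel)"
      proof (rule nn_integral_mono)
        fix u
        show "ennreal ((?d n (\<omega>, u))\<^sup>2) * indicator {s<..r} u
          \<le> ennreal ((H u \<omega> - simple_value (ss n) (xis n) u \<omega>)\<^sup>2) * indicator {0..t} u"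
        proof (cases "s < u \<and> u \<le> r")
          case True
          have "\<bar>c (simple_value (ss n) (xis n) u \<omega>) - H u \<omega>\<bar> \<le> \<bar>simple_value (ss n) (xis n) u \<omega> - H u \<omega>\<bar>"
            by (rule c(3)[OF H_bound])
          moreover have "SV c s r (ss n) (xis n) (\<omega>, u) = c (simple_value (ss n) (xis n) u \<omega>)"
            by (rule SV_eq[where c=c]) (use sa True c0 in auto)
          ultimately have "(?d n (\<omega>, u))\<^sup>2 \<le> (H u \<omega> - simple_value (ss n) (xis n) u \<omega>)\<^sup>2"
            by (simp add: abs_le_square_iff power2_commute[of "H u \<omega>"])
          then show ?thesis using True st by (simp add: ennreal_leI)
        qed auto
      qed
      finally show "(\<integral>\<^sup>+u. ennreal ((?d n (\<omega>, u))\<^sup>2) \<partial>time_measure s r)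
        \<le> (\<integral>\<^sup>+u\<in>{0..t}. ennreal ((H u \<omega> - simple_value (ss n) (xis n) u \<omega>)\<^sup>2) \<partial>lborel)" .
    qed
    finally show ?thesis .
  qed
  have e0: "?e \<longlonglongrightarrow> 0" using ap by (simp add: approximates_def)
  have "(\<lambda>n. ennreal (\<integral>z. (?d n z)\<^sup>2 \<partial>space_time s r)) \<longlonglongrightarrow> 0"
    by (rule tendsto_sandwich[OF _ _ tendsto_const e0]) (use le in \<open>auto intro!: always_eventually\<close>)
  then show ?thesis by (subst (asm) ennreal_tendsto_0_iff) auto
qed

lemma tendsto_L2_trans:
  assumes fg: "(\<lambda>n. \<integral>x. (f n x - g n x)\<^sup>2 \<partial>N) \<longlonglongrightarrow> 0" and gh: "(\<lambda>n. \<integral>x. (g n x - h n x)\<^sup>2 \<partial>N) \<longlonglongrightarrow> 0"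
    and L: "\<And>n. L2 N (f n)" "\<And>n. L2 N (g n)" "\<And>n. L2 N (h n)"
  shows "(\<lambda>n. \<integral>x. (f n x - h n x)\<^sup>2 \<partial>N) \<longlonglongrightarrow> 0"
proof (rule tendsto_sandwich[OF _ _ tendsto_const])
  show "(\<lambda>n. 2 * (\<integral>x. (f n x - g n x)\<^sup>2 \<partial>N) + 2 * (\<integral>x. (g n x - h n x)\<^sup>2 \<partial>N)) \<longlonglongrightarrow> 0"
    using tendsto_add[OF tendsto_mult_left[OF fg, of 2] tendsto_mult_left[OF gh, of 2]] by simp
  show "\<forall>\<^sub>F n in sequentially. (\<integral>x. (f n x - h n x)\<^sup>2 \<partial>N)
    \<le> 2 * (\<integral>x. (f n x - g n x)\<^sup>2 \<partial>N) + 2 * (\<integral>x. (g n x - h n x)\<^sup>2 \<partial>N)"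
  proof (intro always_eventually allI)
    fix n
    have i: "integrable N (\<lambda>x. (f n x - g n x)\<^sup>2)" "integrable N (\<lambda>x. (g n x - h n x)\<^sup>2)" "integrable N (\<lambda>x. (f n x - h n x)\<^sup>2)"
      using L by (auto intro!: L2_integrable_square L2_diff)
    have "(\<integral>x. (f n x - h n x)\<^sup>2 \<partial>N) \<le> (\<integral>x. 2 * (f n x - g n x)\<^sup>2 + 2 * (g n x - h n x)\<^sup>2 \<partial>N)"
    proof (rule integral_mono)
      fix x
      show "(f n x - h n x)\<^sup>2 \<le> 2 * (f n x - g n x)\<^sup>2 + 2 * (g n x - h n x)\<^sup>2"
        using square_add_le[of "f n x - g n x" "g n x - h n x"] by simp
    qed (use i in auto)
    then show "(\<integral>x. (f n x - h n x)\<^sup>2 \<partial>N) \<le> 2 * (\<integral>x. (f n x - g n x)\<^sup>2 \<partial>N) + 2 * (\<integral>x. (g n x - h n x)\<^sup>2 \<partial>N)"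
      using i by simp
  qed
qed auto

text \<open>\<open>ito_integral_at\<close> supplies unrelated sequences for different times. On a
  common interval both step values approach \<open>H\<close>, so by the isometry for differences the
  step integrals approach each other.\<close>

lemma SI_tendsto_same:
  assumes ap: "approximates t ss xis" and ap': "approximates t' ss' xis'"
    and st: "0 \<le> s" "s \<le> r" "r \<le> t" "r \<le> t'"
    and c: "c \<in> borel_measurable borel" "\<And>x. \<bar>c x\<bar> \<le> \<bar>x\<bar>" "\<And>x y. \<bar>y\<bar> \<le> K \<Longrightarrow> \<bar>c x - y\<bar> \<le> \<bar>x - y\<bar>"
    and d: "d \<in> borel_measurable borel" "\<And>x. \<bar>d x\<bar> \<le> \<bar>x\<bar>" "\<And>x y. \<bar>y\<bar> \<le> K \<Longrightarrow> \<bar>d x - y\<bar> \<le> \<bar>x - y\<bar>"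
  shows "(\<lambda>n. \<integral>\<omega>. (SI c s r (ss n) (xis n) \<omega> - SI d s r (ss' n) (xis' n) \<omega>)\<^sup>2 \<partial>M) \<longlonglongrightarrow> 0"
proof -
  have sa: "simple_adapted F (ss n) (xis n)" "simple_adapted F (ss' n) (xis' n)" for n
    using ap ap' by (auto simp: approximates_def)
  note sp = simple_step_process[OF sa(1) st(1,2) c(1,2)] simple_step_process[OF sa(2) st(1,2) d(1,2)]
  have "(\<lambda>n. \<integral>z. (SV c s r (ss n) (xis n) z - SV d s r (ss' n) (xis' n) z)\<^sup>2 \<partial>space_time s r) \<longlonglongrightarrow> 0"
  proof (rule tendsto_L2_trans[where g="\<lambda>n. Hz"])
    show "(\<lambda>n. \<integral>z. (SV c s r (ss n) (xis n) z - Hz z)\<^sup>2 \<partial>space_time s r) \<longlonglongrightarrow> 0"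
      by (rule SV_tendsto[OF ap st(1-3) c])
    show "(\<lambda>n. \<integral>z. (Hz z - SV d s r (ss' n) (xis' n) z)\<^sup>2 \<partial>space_time s r) \<longlonglongrightarrow> 0"
      unfolding power2_commute[of "Hz _"] by (rule SV_tendsto[OF ap' st(1,2,4) d])
  qed (intro L2_step_value[OF sp(1)] L2_step_value[OF sp(2)] L2_Hz st)+
  then show ?thesis unfolding step_isometry_diff[OF sp(1) sp(2)] .
qed

text \<open>Square integrability of \<open>Y t\<close> comes from a single index at which the
  approximation error is below 1: there \<open>Y t\<close> is the difference of two square
  integrable variables.\<close>

lemma L2_Y:
  assumes t: "0 \<le> t" shows "L2 M (Y t)"
    and "approximates t ss xis \<Longrightarrow> (\<lambda>n. \<integral>\<omega>. (SI (\<lambda>x. x) 0 t (ss n) (xis n) \<omega> - Y t \<omega>)\<^sup>2 \<partial>M) \<longlonglongrightarrow> 0"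
proof -
  have L2SI: "L2 M (SI (\<lambda>x. x) 0 t (ss n) (xis n))" if ap: "approximates t ss xis" for ss xis n
    by (rule L2_step_integral[OF simple_step_process])
      (use t ap in \<open>auto simp: approximates_def\<close>)
  have lim: "(\<lambda>n. \<integral>\<^sup>+\<omega>. ennreal ((SI (\<lambda>x. x) 0 t (ss n) (xis n) \<omega> - Y t \<omega>)\<^sup>2) \<partial>M) \<longlonglongrightarrow> 0"
    if ap: "approximates t ss xis" for ss xis
    using ap t by (simp add: approximates_def SI_id power2_commute)
  show L2Y: "L2 M (Y t)"
  proof -
    obtain ss xis where ap: "approximates t ss xis" using approximates_exists[OF t] by blast
    have "\<forall>\<^sub>F n in sequentially. (\<integral>\<^sup>+\<omega>. ennreal ((SI (\<lambda>x. x) 0 t (ss n) (xis n) \<omega> - Y t \<omega>)\<^sup>2) \<partial>M) < 1"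
      using order_tendstoD(2)[OF lim[OF ap], of 1] by simp
    then obtain n where n: "(\<integral>\<^sup>+\<omega>. ennreal ((SI (\<lambda>x. x) 0 t (ss n) (xis n) \<omega> - Y t \<omega>)\<^sup>2) \<partial>M) < 1"
      by (auto simp: eventually_sequentially)
    let ?d = "\<lambda>\<omega>. SI (\<lambda>x. x) 0 t (ss n) (xis n) \<omega> - Y t \<omega>"
    have m: "?d \<in> borel_measurable M"
      using L2_measurable[OF L2SI[OF ap]] Y_measurable[OF t] by (intro borel_measurable_diff)
    have "integrable M (\<lambda>\<omega>. (?d \<omega>)\<^sup>2)"
      by (rule integrableI_bounded) (use m n in \<open>auto intro: less_trans[of _ 1]\<close>)
    then have "L2 M ?d" using m by (simp add: L2_def)
    from L2_diff[OF L2SI[OF ap, of n] this] show ?thesis by simp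
  qed
  assume ap: "approximates t ss xis"
  have "(\<integral>\<^sup>+\<omega>. ennreal ((SI (\<lambda>x. x) 0 t (ss n) (xis n) \<omega> - Y t \<omega>)\<^sup>2) \<partial>M) =
    ennreal (\<integral>\<omega>. (SI (\<lambda>x. x) 0 t (ss n) (xis n) \<omega> - Y t \<omega>)\<^sup>2 \<partial>M)" for n
    using L2_integrable_square[OF L2_diff[OF L2SI[OF ap] L2Y]] by (intro nn_integral_eq_integral) auto
  with lim[OF ap] show "(\<lambda>n. \<integral>\<omega>. (SI (\<lambda>x. x) 0 t (ss n) (xis n) \<omega> - Y t \<omega>)\<^sup>2 \<partial>M) \<longlonglongrightarrow> 0"
    by (simp add: ennreal_tendsto_0_iff)
qed

text \<open>Exchanges the truncated sequence chosen for t against the untruncated one chosen for s,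
  whose limit at time s is known.\<close>

lemma SI_tendsto_Y:
  assumes ap: "approximates t ss xis" and st: "0 \<le> s" "s \<le> t"
  shows "(\<lambda>n. \<integral>\<omega>. (SI trunc 0 s (ss n) (xis n) \<omega> - Y s \<omega>)\<^sup>2 \<partial>M) \<longlonglongrightarrow> 0"
proof -
  obtain ss' xis' where ap': "approximates s ss' xis'" using approximates_exists[OF st(1)] by blast
  have sa: "simple_adapted F (ss n) (xis n)" "simple_adapted F (ss' n) (xis' n)" for n
    using ap ap' by (auto simp: approximates_def)
  show ?thesis
  proof (rule tendsto_L2_trans)
    show "(\<lambda>n. \<integral>\<omega>. (SI trunc 0 s (ss n) (xis n) \<omega> - SI (\<lambda>x. x) 0 s (ss' n) (xis' n) \<omega>)\<^sup>2 \<partial>M) \<longlonglongrightarrow> 0"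
      by (rule SI_tendsto_same[OF ap ap']) (use st trunc in auto)
    show "(\<lambda>n. \<integral>\<omega>. (SI (\<lambda>x. x) 0 s (ss' n) (xis' n) \<omega> - Y s \<omega>)\<^sup>2 \<partial>M) \<longlonglongrightarrow> 0"
      by (rule L2_Y(2)[OF st(1) ap'])
    show "L2 M (SI trunc 0 s (ss n) (xis n))" "L2 M (SI (\<lambda>x. x) 0 s (ss' n) (xis' n))" for n
      by (rule L2_step_integral[OF simple_step_process], use sa st trunc in auto)+
  qed (rule L2_Y(1)[OF st(1)])
qed

lemma SI_tendsto:
  assumes ap: "approximates t ss xis" and st: "0 \<le> s" "s \<le> t"
  shows "(\<lambda>n. \<integral>\<omega>. (SI trunc s t (ss n) (xis n) \<omega> - (Y t \<omega> - Y s \<omega>))\<^sup>2 \<partial>M) \<longlonglongrightarrow> 0"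
proof -
  have t: "0 \<le> t" using st by simp
  have sa: "simple_adapted F (ss n) (xis n)" for n
    using ap by (auto simp: approximates_def)
  have L: "L2 M (SI trunc a b (ss n) (xis n))" if "0 \<le> a" "a \<le> b" for a b n
    by (rule L2_step_integral[OF simple_step_process[OF sa that trunc(1,2)]])
  have eq: "SI trunc s t (ss n) (xis n) \<omega> - (Y t \<omega> - Y s \<omega>) =
    (SI trunc 0 t (ss n) (xis n) \<omega> - Y t \<omega>) - (SI trunc 0 s (ss n) (xis n) \<omega> - Y s \<omega>)" for n \<omega>
    by (simp add: SI_add[OF sa st, where c=trunc])
  have "(\<lambda>n. \<integral>\<omega>. ((SI trunc 0 t (ss n) (xis n) \<omega> - Y t \<omega>) - (SI trunc 0 s (ss n) (xis n) \<omega> - Y s \<omega>))\<^sup>2 \<partial>M) \<longlonglongrightarrow> 0"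
  proof (rule tendsto_L2_trans[where g="\<lambda>n \<omega>. 0"])
    show "(\<lambda>n. \<integral>\<omega>. ((SI trunc 0 t (ss n) (xis n) \<omega> - Y t \<omega>) - 0)\<^sup>2 \<partial>M) \<longlonglongrightarrow> 0"
      using SI_tendsto_Y[OF ap t order_refl] by simp
    show "(\<lambda>n. \<integral>\<omega>. (0 - (SI trunc 0 s (ss n) (xis n) \<omega> - Y s \<omega>))\<^sup>2 \<partial>M) \<longlonglongrightarrow> 0"
      using SI_tendsto_Y[OF ap st] by (simp only: diff_0 power2_minus)
  qed (intro L2_diff L2_zero L L2_Y(1) st t order_refl)+
  then show ?thesis unfolding eq .
qed

text \<open>Every clamped interval starts at s or later, so a factor known at time s can be absorbed
  into the coefficients. This yields identities restricted to events of \<open>F s\<close>, which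
  play the role of conditional ones.\<close>

lemma simple_prefix_SI:
  assumes sa: "simple_adapted F ss xis" and st: "0 \<le> s" "s \<le> t" and A: "A \<in> sets (F s)"
  shows "step_process s t {..<length xis} (pt s t ss) (\<lambda>k. pt s t ss (Suc k)) (\<lambda>k \<omega>. indicator A \<omega> * cf trunc t ss xis k \<omega>)"
  unfolding step_process_def
proof (intro conjI ballI)
  note sp = simple_step_process[OF sa st trunc(1,2)]
  show "0 \<le> s" "finite {..<length xis}" using st by auto
  fix k assume k: "k \<in> {..<length xis}"
  with sp show "s \<le> pt s t ss k" "pt s t ss k \<le> pt s t ss (Suc k)" "pt s t ss (Suc k) \<le> t"
    by (auto simp: step_process_def)
  have "A \<in> sets (F (pt s t ss k))" using A pt_range[OF st(2), of ss k] sets_F_mono by blast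
  then show "(\<lambda>\<omega>. indicator A \<omega> * cf trunc t ss xis k \<omega>) \<in> borel_measurable (F (pt s t ss k))"
    using cf_measurable[OF sa _ trunc(1), of k t s] k by (intro borel_measurable_times) auto
  have "\<bar>indicator A \<omega> * cf trunc t ss xis k \<omega>\<bar> \<le> K" for \<omega>
    using trunc(3) K_nonneg by (auto simp: cf_def indicator_def)
  then show "\<exists>C. \<forall>\<omega>. \<bar>indicator A \<omega> * cf trunc t ss xis k \<omega>\<bar> \<le> C" by blast
qed

text \<open>Each property holds for the truncated step integrals and passes to the limit: the mean
  by L1 convergence, the isometry by convergence of squares, the fourth moment by Fatou's lemma
  along an almost everywhere convergent subsequence.\<close>

theorem ito_increment:
  assumes st: "0 \<le> s" "s \<le> t"
  shows "A \<in> sets (F s) \<Longrightarrow> (\<integral>\<omega>. indicator A \<omega> * (Y t \<omega> - Y s \<omega>) \<partial>M) = 0"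
    and "A \<in> sets (F s) \<Longrightarrow> (\<integral>\<omega>. indicator A \<omega> * (Y t \<omega> - Y s \<omega>)\<^sup>2 \<partial>M) =
      (\<integral>z. indicator A (fst z) * (H (snd z) (fst z))\<^sup>2 \<partial>space_time s t)"
    and "integrable M (\<lambda>\<omega>. (Y t \<omega> - Y s \<omega>) ^ 4)"
    and "(\<integral>\<omega>. (Y t \<omega> - Y s \<omega>) ^ 4 \<partial>M) \<le> 3 * K ^ 4 * (t - s)\<^sup>2"
proof -
  have t: "0 \<le> t" using st by simp
  obtain ss xis where ap: "approximates t ss xis" using approximates_exists[OF t] by blast
  have sa: "simple_adapted F (ss n) (xis n)" for n
    using ap by (auto simp: approximates_def)
  define Z where "Z \<omega> = Y t \<omega> - Y s \<omega>" for \<omega>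
  define I where "I n = SI trunc s t (ss n) (xis n)" for n
  have L2Z: "L2 M Z" unfolding Z_def[abs_def] by (intro L2_diff L2_Y st t)
  have L2I: "L2 M (I n)" for n
    unfolding I_def by (rule L2_step_integral[OF simple_step_process[OF sa st trunc(1,2)]])
  have lim: "(\<lambda>n. \<integral>\<omega>. (I n \<omega> - Z \<omega>)\<^sup>2 \<partial>M) \<longlonglongrightarrow> 0"
    unfolding I_def Z_def by (rule SI_tendsto[OF ap st])
  note lim1 = L2_tendsto_L1[OF L2I L2Z lim]
  {
    fix A assume A: "A \<in> sets (F s)"
    have AM: "A \<in> sets M" using A sets_F_subset by blast
    have I0: "(\<integral>\<omega>. indicator A \<omega> * I n \<omega> \<partial>M) = 0" for n
    proof -
      note sp = simple_prefix_SI[OF sa st A, of n]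
      let ?p = "pt s t (ss n)"
      have "indicator A \<omega> * I n \<omega> = (\<Sum>k<length (xis n). (indicator A \<omega> * cf trunc t (ss n) (xis n) k \<omega>) * incr (?p k) (?p (Suc k)) \<omega> ^ 1)" for \<omega>
        by (simp add: I_def step_integral_def sum_distrib_left mult.assoc)
      moreover have "integrable M (\<lambda>\<omega>. (indicator A \<omega> * cf trunc t (ss n) (xis n) k \<omega>) * incr (?p k) (?p (Suc k)) \<omega> ^ 1) \<and>
         (\<integral>\<omega>. (indicator A \<omega> * cf trunc t (ss n) (xis n) k \<omega>) * incr (?p k) (?p (Suc k)) \<omega> ^ 1 \<partial>M) = 0" if "k < length (xis n)" for k
      proof -
        have p0: "0 \<le> ?p k" using pt_range[OF st(2), of "ss n" k] st(1) by linarith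
        have p1: "?p k \<le> ?p (Suc k)" by (rule monoD[OF pt_mono[OF sa]]) simp
        note pk = p0 p1
        have m: "(\<lambda>\<omega>. indicator A \<omega> * cf trunc t (ss n) (xis n) k \<omega>) \<in> borel_measurable (F (?p k))"
          using sp that by (simp add: step_process_def)
        have i: "integrable M (\<lambda>\<omega>. indicator A \<omega> * cf trunc t (ss n) (xis n) k \<omega>)"
        proof (rule integrable_const_bound[of _ K])
          show "AE \<omega> in M. norm (indicator A \<omega> * cf trunc t (ss n) (xis n) k \<omega>) \<le> K"
            using trunc(3) K_nonneg by (intro AE_I2) (auto simp: cf_def indicator_def)
        qed (rule measurable_F_M[OF m])
        show ?thesis
          using expectation_mult_incr_power[OF pk m i, of 1] incr_moment(2)[OF pk] by simp
      qed
      ultimately show ?thesis by (simp add: Bochner_Integration.integral_sum)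
    qed
    have "(\<integral>\<omega>. indicator A \<omega> * Z \<omega> \<partial>M) = 0"
    proof (rule LIMSEQ_unique)
      show "(\<lambda>n. \<integral>\<omega>. indicator A \<omega> * I n \<omega> \<partial>M) \<longlonglongrightarrow> 0" by (simp add: I0)
      have "(\<lambda>n. (\<integral>\<omega>. indicator A \<omega> * I n \<omega> \<partial>M) - (\<integral>\<omega>. indicator A \<omega> * Z \<omega> \<partial>M)) \<longlonglongrightarrow> 0"
      proof (rule Lim_null_comparison[OF always_eventually[OF allI] lim1])
        fix n
        have i: "integrable M (\<lambda>\<omega>. indicator A \<omega> * I n \<omega>)" "integrable M (\<lambda>\<omega>. indicator A \<omega> * Z \<omega>)"
          using L2_integrable[OF L2I[of n]] L2_integrable[OF L2Z] integrable_real_mult_indicator[OF AM] by (auto simp: mult.commute)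
        have iD: "integrable M (\<lambda>\<omega>. \<bar>I n \<omega> - Z \<omega>\<bar>)" by (intro L2_integrable L2_abs L2_diff L2I L2Z)
        have "norm ((\<integral>\<omega>. indicator A \<omega> * I n \<omega> \<partial>M) - (\<integral>\<omega>. indicator A \<omega> * Z \<omega> \<partial>M))
          = \<bar>\<integral>\<omega>. indicator A \<omega> * I n \<omega> - indicator A \<omega> * Z \<omega> \<partial>M\<bar>" using i by simp
        also have "\<dots> \<le> (\<integral>\<omega>. \<bar>indicator A \<omega> * I n \<omega> - indicator A \<omega> * Z \<omega>\<bar> \<partial>M)" by (rule integral_abs_bound)
        also have "\<dots> \<le> (\<integral>\<omega>. \<bar>I n \<omega> - Z \<omega>\<bar> \<partial>M)"
          using i iD by (intro integral_mono) (auto simp: indicator_def)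
        finally show "norm ((\<integral>\<omega>. indicator A \<omega> * I n \<omega> \<partial>M) - (\<integral>\<omega>. indicator A \<omega> * Z \<omega> \<partial>M)) \<le> (\<integral>\<omega>. \<bar>I n \<omega> - Z \<omega>\<bar> \<partial>M)" .
      qed
      then show "(\<lambda>n. \<integral>\<omega>. indicator A \<omega> * I n \<omega> \<partial>M) \<longlonglongrightarrow> (\<integral>\<omega>. indicator A \<omega> * Z \<omega> \<partial>M)"
        by (rule LIM_zero_cancel)
    qed
    then show "(\<integral>\<omega>. indicator A \<omega> * (Y t \<omega> - Y s \<omega>) \<partial>M) = 0" by (simp add: Z_def)
    let ?N = "space_time s t"
    let ?V = "\<lambda>n. SV trunc s t (ss n) (xis n)"
    have iA: "(\<lambda>z. indicator A (fst z) :: real) \<in> borel_measurable ?N"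
      using AM by measurable
    \<comment> \<open>A weight bounded by 1 preserves L2 convergence. It is used with the indicator
      of A, once on \<open>M\<close> and once on the product with time.\<close>
    have contract: "(\<lambda>n. \<integral>x. (g x * f n x - g x * h x)\<^sup>2 \<partial>N) \<longlonglongrightarrow> 0"
      if l: "(\<lambda>n. \<integral>x. (f n x - h x)\<^sup>2 \<partial>N) \<longlonglongrightarrow> 0" and L: "\<And>n. L2 N (f n)" "L2 N h"
        and g: "g \<in> borel_measurable N" "\<And>x. \<bar>g x\<bar> \<le> 1"
      for N :: "'b measure" and f h and g :: "'b \<Rightarrow> real"
    proof (rule tendsto_sandwich[OF _ _ tendsto_const l])
      show "\<forall>\<^sub>F n in sequentially. (\<integral>x. (g x * f n x - g x * h x)\<^sup>2 \<partial>N) \<le> (\<integral>x. (f n x - h x)\<^sup>2 \<partial>N)"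
      proof (intro always_eventually allI integral_mono)
        fix n
        show "integrable N (\<lambda>x. (f n x - h x)\<^sup>2)" by (intro L2_integrable_square L2_diff L)
        show "integrable N (\<lambda>x. (g x * f n x - g x * h x)\<^sup>2)"
          by (intro L2_integrable_square L2_diff L2_mult_bounded[where C=1] L g)
        fix x
        have "(g x)\<^sup>2 \<le> 1" using g(2)[of x] by (simp add: abs_square_le_1)
        then have "(g x)\<^sup>2 * (f n x - h x)\<^sup>2 \<le> 1 * (f n x - h x)\<^sup>2" by (rule mult_right_mono) simp
        then show "(g x * f n x - g x * h x)\<^sup>2 \<le> (f n x - h x)\<^sup>2"
          by (simp add: right_diff_distrib[symmetric] power_mult_distrib)
      qed
    qed auto
    have "(\<integral>\<omega>. (indicator A \<omega> * Z \<omega>)\<^sup>2 \<partial>M) = (\<integral>z. (indicator A (fst z) * Hz z)\<^sup>2 \<partial>?N)"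
    proof (rule LIMSEQ_unique)
      show "(\<lambda>n. \<integral>\<omega>. (indicator A \<omega> * I n \<omega>)\<^sup>2 \<partial>M) \<longlonglongrightarrow> (\<integral>\<omega>. (indicator A \<omega> * Z \<omega>)\<^sup>2 \<partial>M)"
        by (intro L2_tendsto_square contract L2_mult_bounded[where C=1] L2I L2Z lim) (use AM in \<open>auto simp: indicator_def\<close>)
      have "(\<integral>\<omega>. (indicator A \<omega> * I n \<omega>)\<^sup>2 \<partial>M) = (\<integral>z. (indicator A (fst z) * ?V n z)\<^sup>2 \<partial>?N)" for n
        using step_isometry[OF simple_prefix_SI[OF sa st A, of n]]
        by (simp only: I_def step_integral_def step_value_def sum_distrib_left mult.assoc)
      moreover have "(\<lambda>n. \<integral>z. (indicator A (fst z) * ?V n z)\<^sup>2 \<partial>?N) \<longlonglongrightarrow> (\<integral>z. (indicator A (fst z) * Hz z)\<^sup>2 \<partial>?N)"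
        by (intro L2_tendsto_square contract L2_mult_bounded[where C=1] L2_Hz SV_tendsto[OF ap st order_refl trunc(1,2,5)]
            L2_step_value[OF simple_step_process[OF sa st trunc(1,2)]] iA st) (auto simp: indicator_def)
      ultimately show "(\<lambda>n. \<integral>\<omega>. (indicator A \<omega> * I n \<omega>)\<^sup>2 \<partial>M) \<longlonglongrightarrow> (\<integral>z. (indicator A (fst z) * Hz z)\<^sup>2 \<partial>?N)"
        by simp
    qed
    moreover have "(indicator A \<omega> * y)\<^sup>2 = indicator A \<omega> * y\<^sup>2" for \<omega> and y :: real by (simp add: indicator_def)
    ultimately show "(\<integral>\<omega>. indicator A \<omega> * (Y t \<omega> - Y s \<omega>)\<^sup>2 \<partial>M) =
      (\<integral>z. indicator A (fst z) * (H (snd z) (fst z))\<^sup>2 \<partial>space_time s t)" by (simp add: Z_def)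
  }
  \<comment> \<open>Fatou's lemma asks for a pointwise limit, which L1 convergence provides along a
    subsequence.\<close>
  obtain r where r: "strict_mono r" "AE \<omega> in M. (\<lambda>n. I (r n) \<omega> - Z \<omega>) \<longlonglongrightarrow> 0"
    using tendsto_L1_AE_subseq[of M "\<lambda>n \<omega>. I n \<omega> - Z \<omega>"] lim1 L2_integrable[OF L2_diff[OF L2I L2Z]] by auto
  have I4: "integrable M (\<lambda>\<omega>. I n \<omega> ^ 4)" "(\<integral>\<omega>. I n \<omega> ^ 4 \<partial>M) \<le> 3 * K ^ 4 * (t - s)\<^sup>2" for n
  proof -
    let ?p = "pt s t (ss n)"
    have p: "s \<le> ?p k \<and> ?p k \<le> t" for k using pt_range[OF st(2)] .
    have cfK: "\<bar>cf trunc t (ss n) (xis n) k \<omega>\<bar> \<le> K" for k \<omega>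
      using trunc(3) K_nonneg by (auto simp: cf_def)
    have *: "integrable M (\<lambda>\<omega>. I n \<omega> ^ 4) \<and> I n \<in> borel_measurable (F (?p (length (xis n)))) \<and>
      (\<integral>\<omega>. I n \<omega> ^ 2 \<partial>M) \<le> K\<^sup>2 * (?p (length (xis n)) - ?p 0) \<and>
      (\<integral>\<omega>. I n \<omega> ^ 4 \<partial>M) \<le> 3 * K ^ 4 * (?p (length (xis n)) - ?p 0)\<^sup>2"
      unfolding I_def
      by (rule step_integral_moments) (use p[of 0] st pt_mono[OF sa] cf_measurable[OF sa _ trunc(1)] cfK in auto)
    then show "integrable M (\<lambda>\<omega>. I n \<omega> ^ 4)" by blast
    have "0 \<le> ?p (length (xis n)) - ?p 0" "?p (length (xis n)) - ?p 0 \<le> t - s"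
      using p[of 0] p[of "length (xis n)"] monoD[OF pt_mono[OF sa], of 0 "length (xis n)"] by (auto simp: algebra_simps)
    then have "3 * K ^ 4 * (?p (length (xis n)) - ?p 0)\<^sup>2 \<le> 3 * K ^ 4 * (t - s)\<^sup>2"
      by (intro mult_left_mono power_mono) auto
    with * show "(\<integral>\<omega>. I n \<omega> ^ 4 \<partial>M) \<le> 3 * K ^ 4 * (t - s)\<^sup>2" by linarith
  qed
  have Zm: "Z \<in> borel_measurable M" by (rule L2_measurable[OF L2Z])
  have Im: "I n \<in> borel_measurable M" for n by (rule L2_measurable[OF L2I])
  have bound: "(\<integral>\<^sup>+\<omega>. ennreal (Z \<omega> ^ 4) \<partial>M) \<le> ennreal (3 * K ^ 4 * (t - s)\<^sup>2)"
  proof -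
    have "(\<integral>\<^sup>+\<omega>. ennreal (Z \<omega> ^ 4) \<partial>M) = (\<integral>\<^sup>+\<omega>. liminf (\<lambda>n. ennreal (I (r n) \<omega> ^ 4)) \<partial>M)"
    proof (rule nn_integral_cong_AE)
      show "AE \<omega> in M. ennreal (Z \<omega> ^ 4) = liminf (\<lambda>n. ennreal (I (r n) \<omega> ^ 4))"
        using r(2)
      proof eventually_elim
        case (elim \<omega>)
        from LIM_zero_cancel[OF this] have "(\<lambda>n. ennreal (I (r n) \<omega> ^ 4)) \<longlonglongrightarrow> ennreal (Z \<omega> ^ 4)"
          by (intro tendsto_ennrealI tendsto_power)
        then show ?case by (intro lim_imp_Liminf[symmetric]) auto
      qed
    qed
    also have "\<dots> \<le> liminf (\<lambda>n. \<integral>\<^sup>+\<omega>. ennreal (I (r n) \<omega> ^ 4) \<partial>M)"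
      using Im by (intro nn_integral_liminf) auto
    also have "\<dots> \<le> ennreal (3 * K ^ 4 * (t - s)\<^sup>2)"
    proof -
      have "(\<integral>\<^sup>+\<omega>. ennreal (I (r n) \<omega> ^ 4) \<partial>M) \<le> ennreal (3 * K ^ 4 * (t - s)\<^sup>2)" for n
        using I4[of "r n"] by (subst nn_integral_eq_integral) (auto intro: ennreal_leI)
      then show ?thesis by (intro Liminf_le) auto
    qed
    finally show ?thesis .
  qed
  have iZ: "integrable M (\<lambda>\<omega>. Z \<omega> ^ 4)"
    by (rule integrableI_bounded) (use Zm bound in \<open>auto intro: le_less_trans\<close>)
  then show "integrable M (\<lambda>\<omega>. (Y t \<omega> - Y s \<omega>) ^ 4)" by (simp add: Z_def)
  have "ennreal (\<integral>\<omega>. Z \<omega> ^ 4 \<partial>M) \<le> ennreal (3 * K ^ 4 * (t - s)\<^sup>2)"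
    using bound iZ by (subst (asm) nn_integral_eq_integral) auto
  then show "(\<integral>\<omega>. (Y t \<omega> - Y s \<omega>) ^ 4 \<partial>M) \<le> 3 * K ^ 4 * (t - s)\<^sup>2"
    using K_nonneg by (subst (asm) ennreal_le_iff) (auto simp: Z_def)
qed

end

section \<open>Moment estimates over short time intervals\<close>

interpretation time: finite_measure "time_measure s t" for s t
  by (rule finite_measure_time)

lemma measure_space_time_measure: "s \<le> t \<Longrightarrow> measure (time_measure s t) (space (time_measure s t)) = t - s"
  by (simp add: space_time_measure measure_time_measure)

text \<open>Moves a variable upper limit into the integrand. The measure is then fixed, as required
  both for joint measurability in the upper limit and for bounds uniform in it.\<close>

lemma time_integral_prefix:
  fixes f :: "real \<Rightarrow> real"
  assumes "u \<le> t"
  shows "(\<integral>v. f v \<partial>time_measure s u) = (\<integral>v. indicator {..u} v * f v \<partial>time_measure s t)"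
proof -
  have "(\<integral>v. f v \<partial>time_measure s u) = (\<integral>v. indicator {s<..u} v *\<^sub>R f v \<partial>lborel)"
    unfolding time_measure_def by (rule integral_restrict_space) simp
  also have "\<dots> = (\<integral>v. indicator {s<..t} v *\<^sub>R (indicator {..u} v * f v) \<partial>lborel)"
    using assms by (intro Bochner_Integration.integral_cong) (auto simp: indicator_def)
  also have "\<dots> = (\<integral>v. indicator {..u} v * f v \<partial>time_measure s t)"
    unfolding time_measure_def by (rule integral_restrict_space[symmetric]) simp
  finally show ?thesis .
qed

text \<open>Cauchy-Schwarz, obtained from the nonnegative variance of f about its time average
  \<open>m\<close>.\<close>

lemma time_integral_square_le:
  fixes f :: "real \<Rightarrow> real"
  assumes st: "s < t" and f: "L2 (time_measure s t) f"
  shows "(\<integral>u. f u \<partial>time_measure s t)\<^sup>2 \<le> (t - s) * (\<integral>u. (f u)\<^sup>2 \<partial>time_measure s t)"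
proof -
  define m where "m = (\<integral>u. f u \<partial>time_measure s t) / (t - s)"
  have m: "(\<integral>u. f u \<partial>time_measure s t) = m * (t - s)" using st by (simp add: m_def)
  have i: "integrable (time_measure s t) f" "integrable (time_measure s t) (\<lambda>u. (f u)\<^sup>2)"
    using f by (auto intro: time.L2_integrable simp: L2_def)
  have "0 \<le> (\<integral>u. (f u - m)\<^sup>2 \<partial>time_measure s t)" by simp
  also have "\<dots> = (\<integral>u. (f u)\<^sup>2 - 2 * m * f u + m\<^sup>2 \<partial>time_measure s t)"
    by (simp add: power2_diff algebra_simps)
  also have "\<dots> = (\<integral>u. (f u)\<^sup>2 \<partial>time_measure s t) - 2 * m * (m * (t - s)) + m\<^sup>2 * (t - s)"
    using i st by (simp add: m measure_space_time_measure)
  finally have "(t - s) * (m\<^sup>2 * (t - s)) \<le> (t - s) * (\<integral>u. (f u)\<^sup>2 \<partial>time_measure s t)"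
    using st by (intro mult_left_mono) (auto simp: power2_eq_square algebra_simps)
  then show ?thesis by (simp add: m power_mult_distrib) (simp add: power2_eq_square ac_simps)
qed

section \<open>Drift, noise and oscillation of an adapted path\<close>

locale adapted_path = filtered_prob_space +
  fixes X :: "real \<Rightarrow> 'a \<Rightarrow> real" and b sg :: "real \<Rightarrow> real" and c0 c1 K :: real
  assumes X_adapted: "\<And>t. 0 \<le> t \<Longrightarrow> X t \<in> borel_measurable (F t)"
    and X_continuous: "\<And>\<omega>. \<omega> \<in> space M \<Longrightarrow> continuous_on {0..} (\<lambda>t. X t \<omega>)"
    and b_borel: "b \<in> borel_measurable borel" and sg_borel: "sg \<in> borel_measurable borel"
    and b_growth: "\<And>y. \<bar>b y\<bar> \<le> c0 + c1 * \<bar>y\<bar>" and c0: "0 \<le> c0" and c1: "0 < c1"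
    and sg_bound: "\<And>y. \<bar>sg y\<bar> \<le> K"
begin

lemma X_measurable: "0 \<le> t \<Longrightarrow> X t \<in> borel_measurable M"
  by (rule measurable_F_M[OF X_adapted])

lemma X_jointly_measurable:
  fixes \<phi> :: "real \<Rightarrow> real"
  assumes st: "0 \<le> s" "0 \<le> t" and \<phi>: "\<phi> \<in> borel_measurable borel"
  shows "(\<lambda>z. \<phi> (X (snd z) (fst z))) \<in> borel_measurable (F t \<Otimes>\<^sub>M time_measure s t)"
proof -
  \<comment> \<open>Clamping the time to [0, t] makes the path continuous on the whole line and each
    of its values known at time t, without changing it on {s<..t}.\<close>
  define Y where "Y u \<omega> = X (min t (max 0 u)) \<omega>" for u \<omega>
  have "(\<lambda>(\<omega>, u). Y u \<omega>) \<in> borel_measurable (F t \<Otimes>\<^sub>M borel)"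
  proof (rule measurable_continuous_process)
    show "Y u \<in> borel_measurable (F t)" for u
      unfolding Y_def[abs_def] by (rule measurable_F_mono[OF X_adapted]) (use st in auto)
    show "continuous_on UNIV (\<lambda>u. Y u \<omega>)" if "\<omega> \<in> space (F t)" for \<omega>
      unfolding Y_def
      by (rule continuous_on_compose2[OF X_continuous]) (use that st in \<open>auto intro!: continuous_intros\<close>)
  qed
  moreover have "(\<lambda>z. (fst z, snd z)) \<in> measurable (F t \<Otimes>\<^sub>M time_measure s t) (F t \<Otimes>\<^sub>M borel)"
    by (intro measurable_Pair measurable_fst measurable_compose[OF measurable_snd measurable_time_measure]) simp
  ultimately have "(\<lambda>z. Y (snd z) (fst z)) \<in> borel_measurable (F t \<Otimes>\<^sub>M time_measure s t)"
    by (auto dest: measurable_compose)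
  then have "(\<lambda>z. \<phi> (Y (snd z) (fst z))) \<in> borel_measurable (F t \<Otimes>\<^sub>M time_measure s t)"
    using \<phi> by (rule measurable_compose)
  then show ?thesis
    by (rule measurable_cong[THEN iffD1, rotated])
      (use st in \<open>auto simp: Y_def space_pair_measure space_time_measure min_def max_def\<close>)
qed

lemma pair_time_F_M:
  assumes "f \<in> borel_measurable (F r \<Otimes>\<^sub>M time_measure s t)"
  shows "f \<in> borel_measurable (space_time s t)"
proof -
  have "(\<lambda>x. x) \<in> measurable M (F r)" by (rule measurable_F_M[of _ r]) simp
  then have "(\<lambda>z. (fst z, snd z)) \<in> measurable (space_time s t) (F r \<Otimes>\<^sub>M time_measure s t)"
    by (intro measurable_Pair measurable_snd measurable_compose[OF measurable_fst])
  from measurable_compose[OF this assms] show ?thesis by simp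
qed

lemma path_section_measurable:
  fixes \<phi> :: "real \<Rightarrow> real"
  assumes st: "0 \<le> s" "s \<le> t" and \<phi>: "\<phi> \<in> borel_measurable borel" and \<omega>: "\<omega> \<in> space M"
  shows "(\<lambda>u. \<phi> (X u \<omega>)) \<in> borel_measurable (time_measure s t)"
  using measurable_Pair2[OF X_jointly_measurable[OF st(1) _ \<phi>], of t \<omega>] st \<omega> by simp

lemma path_bounded:
  assumes "\<omega> \<in> space M" "0 \<le> s"
  obtains C where "\<And>u. s \<le> u \<Longrightarrow> u \<le> t \<Longrightarrow> \<bar>X u \<omega>\<bar> \<le> C"
proof -
  have "continuous_on {s..t} (\<lambda>u. X u \<omega>)"
    using X_continuous[OF assms(1)] by (rule continuous_on_subset) (use assms in auto)
  then have "compact ((\<lambda>u. X u \<omega>) ` {s..t})" by (intro compact_continuous_image) auto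
  then have "bounded ((\<lambda>u. X u \<omega>) ` {s..t})" by (rule compact_imp_bounded)
  then obtain a where "\<forall>y\<in>(\<lambda>u. X u \<omega>) ` {s..t}. norm y \<le> a" unfolding bounded_iff by blast
  then show ?thesis using that[of a] by simp
qed

lemma path_integrable:
  fixes \<phi> :: "real \<Rightarrow> real"
  assumes st: "0 \<le> s" "s \<le> t" and \<phi>: "\<phi> \<in> borel_measurable borel" and \<omega>: "\<omega> \<in> space M"
    and gr: "\<And>y. \<bar>\<phi> y\<bar> \<le> a + d * \<bar>y\<bar>" and d: "0 \<le> d"
  shows "integrable (time_measure s t) (\<lambda>u. \<phi> (X u \<omega>))"
proof -
  obtain C where C: "\<And>u. s \<le> u \<Longrightarrow> u \<le> t \<Longrightarrow> \<bar>X u \<omega>\<bar> \<le> C" using path_bounded[OF \<omega> st(1)] by blast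
  show ?thesis
  proof (rule time.integrable_const_bound[of _ "a + d * C"])
    show "AE u in time_measure s t. norm (\<phi> (X u \<omega>)) \<le> a + d * C"
    proof (rule AE_I2)
      fix u assume "u \<in> space (time_measure s t)"
      then have "\<bar>X u \<omega>\<bar> \<le> C" using C by (simp add: space_time_measure)
      then have "d * \<bar>X u \<omega>\<bar> \<le> d * C" using d by (rule mult_left_mono)
      then show "norm (\<phi> (X u \<omega>)) \<le> a + d * C" using gr[of "X u \<omega>"] by simp
    qed
  qed (rule path_section_measurable[OF st \<phi> \<omega>])
qed

definition drift :: "real \<Rightarrow> real \<Rightarrow> 'a \<Rightarrow> real" where
  "drift s t \<omega> = (\<integral>u. b (X u \<omega>) \<partial>time_measure s t)"

text \<open>Defined as what the drift leaves of the increment, so the decomposition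
  \<open>X_increment\<close> holds on every path. The identification with a stochastic integral is
  only almost sure and is made in \<open>noise_eq_AE\<close>.\<close>

definition noise :: "real \<Rightarrow> real \<Rightarrow> 'a \<Rightarrow> real" where
  "noise s t \<omega> = X t \<omega> - X s \<omega> - drift s t \<omega>"

definition qvar :: "real \<Rightarrow> real \<Rightarrow> 'a \<Rightarrow> real" where
  "qvar s t \<omega> = (\<integral>u. (sg (X u \<omega>))\<^sup>2 \<partial>time_measure s t)"

text \<open>Integrated over time rather than maximal, so that its second moment can be derived by
  Fubini from second moments at fixed times.\<close>

definition osc :: "real \<Rightarrow> real \<Rightarrow> 'a \<Rightarrow> real" where
  "osc s t \<omega> = (\<integral>u. \<bar>X u \<omega> - X s \<omega>\<bar> \<partial>time_measure s t)"

definition noise_osc :: "real \<Rightarrow> real \<Rightarrow> 'a \<Rightarrow> real" where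
  "noise_osc s t \<omega> = (\<integral>u. \<bar>noise s u \<omega>\<bar> \<partial>time_measure s t)"

lemma X_increment: "X t \<omega> - X s \<omega> = drift s t \<omega> + noise s t \<omega>"
  by (simp add: noise_def)

lemma path_functional_measurable:
  fixes \<phi> :: "real \<Rightarrow> real"
  assumes "0 \<le> s" "0 \<le> t" "\<phi> \<in> borel_measurable borel"
  shows "(\<lambda>\<omega>. \<integral>u. \<phi> (X u \<omega>) \<partial>time_measure s t) \<in> borel_measurable (F t)"
  by (rule time.borel_measurable_lebesgue_integral) (use X_jointly_measurable[OF assms] in \<open>simp add: split_beta'\<close>)

lemma drift_measurable_F: "0 \<le> s \<Longrightarrow> 0 \<le> t \<Longrightarrow> drift s t \<in> borel_measurable (F t)"
  unfolding drift_def[abs_def] by (intro path_functional_measurable b_borel)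

lemma qvar_measurable_F: "0 \<le> s \<Longrightarrow> 0 \<le> t \<Longrightarrow> qvar s t \<in> borel_measurable (F t)"
  unfolding qvar_def[abs_def]
  by (rule path_functional_measurable[where \<phi>="\<lambda>y. (sg y)\<^sup>2"]) (use sg_borel in auto)

lemma noise_measurable_F:
  assumes "0 \<le> s" "s \<le> t" shows "noise s t \<in> borel_measurable (F t)"
  unfolding noise_def[abs_def]
  by (intro borel_measurable_diff X_adapted drift_measurable_F measurable_F_mono[OF X_adapted assms(2)]) (use assms in auto)

lemma noise_measurable: "0 \<le> s \<Longrightarrow> s \<le> t \<Longrightarrow> noise s t \<in> borel_measurable M"
  and drift_measurable: "0 \<le> s \<Longrightarrow> s \<le> t \<Longrightarrow> drift s t \<in> borel_measurable M"
  and qvar_measurable: "0 \<le> s \<Longrightarrow> s \<le> t \<Longrightarrow> qvar s t \<in> borel_measurable M"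
  by (rule measurable_F_M, rule noise_measurable_F drift_measurable_F qvar_measurable_F, simp_all)+

lemma osc_measurable:
  assumes st: "0 \<le> s" "s \<le> t" shows "osc s t \<in> borel_measurable M"
proof -
  have "(\<lambda>z. X (snd z) (fst z)) \<in> borel_measurable (space_time s t)"
    by (rule pair_time_F_M[OF X_jointly_measurable[where \<phi>="\<lambda>y. y"]]) (use st in auto)
  moreover have "(\<lambda>z. X s (fst z)) \<in> borel_measurable (space_time s t)"
    by (rule measurable_compose[OF measurable_fst X_measurable[OF st(1)]])
  ultimately have "(\<lambda>z. \<bar>X (snd z) (fst z) - X s (fst z)\<bar>) \<in> borel_measurable (space_time s t)"
    by measurable
  then show ?thesis unfolding osc_def[abs_def]
    by (intro time.borel_measurable_lebesgue_integral) (simp add: split_beta')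
qed

text \<open>The drift up to u is the delicate part: \<open>time_integral_prefix\<close> turns it
  into an integral against a fixed measure, whose integrand contains the indicator of v <= u,
  jointly measurable in (u, v).\<close>

lemma noise_jointly_measurable:
  assumes st: "0 \<le> s" "s \<le> t"
  shows "(\<lambda>z. noise s (snd z) (fst z)) \<in> borel_measurable (space_time s t)"
proof -
  let ?N = "space_time s t"
  have X: "(\<lambda>z. \<phi> (X (snd z) (fst z))) \<in> borel_measurable ?N" if "\<phi> \<in> borel_measurable borel" for \<phi> :: "real \<Rightarrow> real"
    by (rule pair_time_F_M[OF X_jointly_measurable]) (use st that in auto)
  have Xs: "(\<lambda>z. X s (fst z)) \<in> borel_measurable ?N"
    by (rule measurable_compose[OF measurable_fst X_measurable[OF st(1)]])
  have id: "(\<lambda>u. u) \<in> borel_measurable (time_measure s t)" by (rule measurable_time_measure) simp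
  have m1: "(\<lambda>y. b (X (snd y) (fst (fst y)))) \<in> borel_measurable (?N \<Otimes>\<^sub>M time_measure s t)"
  proof -
    have "(\<lambda>y. (fst (fst y), snd y)) \<in> measurable (?N \<Otimes>\<^sub>M time_measure s t) ?N"
      by measurable
    from measurable_compose[OF this X[OF b_borel]] show ?thesis by simp
  qed
  have u: "(\<lambda>y. snd (fst y)) \<in> borel_measurable (?N \<Otimes>\<^sub>M time_measure s t)"
    "snd \<in> borel_measurable (?N \<Otimes>\<^sub>M time_measure s t)"
    by (intro measurable_compose[OF measurable_fst measurable_compose[OF measurable_snd id]]
        measurable_compose[OF measurable_snd id])+
  have m2: "(\<lambda>y. indicator {..snd (fst y)} (snd y) :: real) \<in> borel_measurable (?N \<Otimes>\<^sub>M time_measure s t)"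
  proof -
    have *: "(\<lambda>y. indicator {..snd (fst y)} (snd y) :: real) = (\<lambda>y. if snd y \<le> snd (fst y) then 1 else 0)"
      by (auto simp: indicator_def)
    show ?thesis unfolding * by (intro measurable_If measurable_const borel_measurable_le u) simp_all
  qed
  have "(\<lambda>z. \<integral>v. indicator {..snd z} v * b (X v (fst z)) \<partial>time_measure s t) \<in> borel_measurable ?N"
    by (rule time.borel_measurable_lebesgue_integral) (use borel_measurable_times[OF m2 m1] in \<open>simp add: split_beta'\<close>)
  then have "(\<lambda>z. drift s (snd z) (fst z)) \<in> borel_measurable ?N"
  proof (rule measurable_cong[THEN iffD1, rotated])
    fix z assume "z \<in> space ?N"
    then have "snd z \<le> t" by (auto simp: space_pair_measure space_time_measure)
    from time_integral_prefix[OF this, where f="\<lambda>v. b (X v (fst z))" and s=s]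
    show "(\<integral>v. indicator {..snd z} v * b (X v (fst z)) \<partial>time_measure s t) = drift s (snd z) (fst z)"
      by (simp only: drift_def)
  qed
  then show ?thesis
    unfolding noise_def using X[of "\<lambda>y. y"] Xs by (intro borel_measurable_diff) auto
qed

lemma noise_osc_measurable:
  assumes st: "0 \<le> s" "s \<le> t" shows "noise_osc s t \<in> borel_measurable M"
  unfolding noise_osc_def[abs_def]
  by (rule time.borel_measurable_lebesgue_integral) (use noise_jointly_measurable[OF st] in \<open>simp add: split_beta'\<close>)

text \<open>The linear growth bound at \<open>X v\<close> is replaced by the one at
  \<open>X s\<close>, and the deviation is collected in \<open>osc\<close>. The bound is the same
  for all u, so that \<open>osc_le\<close> can integrate it.\<close>

lemma abs_drift_le:
  assumes st: "0 \<le> s" "s \<le> u" "u \<le> t" and \<omega>: "\<omega> \<in> space M"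
  shows "\<bar>drift s u \<omega>\<bar> \<le> (t - s) * (c0 + c1 * \<bar>X s \<omega>\<bar>) + c1 * osc s t \<omega>"
proof -
  have ib: "integrable (time_measure s t) (\<lambda>v. b (X v \<omega>))"
    by (rule path_integrable[OF _ _ b_borel \<omega> b_growth]) (use st c1 in auto)
  have io: "integrable (time_measure s t) (\<lambda>v. \<bar>X v \<omega> - X s \<omega>\<bar>)"
    by (rule path_integrable[where \<phi>="\<lambda>y. \<bar>y - X s \<omega>\<bar>" and a="\<bar>X s \<omega>\<bar>" and d=1]) (use st \<omega> in auto)
  have "\<bar>drift s u \<omega>\<bar> = \<bar>\<integral>v. indicator {..u} v * b (X v \<omega>) \<partial>time_measure s t\<bar>"
    by (simp add: drift_def time_integral_prefix[OF st(3)])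
  also have "\<dots> \<le> (\<integral>v. \<bar>indicator {..u} v * b (X v \<omega>)\<bar> \<partial>time_measure s t)"
    by (rule integral_abs_bound)
  also have "\<dots> \<le> (\<integral>v. (c0 + c1 * \<bar>X s \<omega>\<bar>) + c1 * \<bar>X v \<omega> - X s \<omega>\<bar> \<partial>time_measure s t)"
  proof (rule integral_mono')
    show "integrable (time_measure s t) (\<lambda>v. (c0 + c1 * \<bar>X s \<omega>\<bar>) + c1 * \<bar>X v \<omega> - X s \<omega>\<bar>)" using io by auto
    fix v
    have "\<bar>indicator {..u} v * b (X v \<omega>)\<bar> \<le> \<bar>b (X v \<omega>)\<bar>" by (simp add: indicator_def)
    also have "\<dots> \<le> c0 + c1 * \<bar>X v \<omega>\<bar>" by (rule b_growth)
    also have "c1 * \<bar>X v \<omega>\<bar> \<le> c1 * (\<bar>X s \<omega>\<bar> + \<bar>X v \<omega> - X s \<omega>\<bar>)" using c1 by (intro mult_left_mono) auto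
    finally show "\<bar>indicator {..u} v * b (X v \<omega>)\<bar> \<le> (c0 + c1 * \<bar>X s \<omega>\<bar>) + c1 * \<bar>X v \<omega> - X s \<omega>\<bar>"
      by (simp add: algebra_simps)
    show "0 \<le> c0 + c1 * \<bar>X s \<omega>\<bar> + c1 * \<bar>X v \<omega> - X s \<omega>\<bar>" using c0 c1 by simp
  qed
  also have "\<dots> = (t - s) * (c0 + c1 * \<bar>X s \<omega>\<bar>) + c1 * osc s t \<omega>"
    using io st by (simp add: osc_def measure_space_time_measure)
  finally show ?thesis .
qed

lemma osc_nonneg: "0 \<le> osc s t \<omega>" and noise_osc_nonneg: "0 \<le> noise_osc s t \<omega>"
  by (simp_all add: osc_def noise_osc_def)

lemma noise_path_L2:
  assumes st: "0 \<le> s" "s \<le> t" and \<omega>: "\<omega> \<in> space M"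
  shows "L2 (time_measure s t) (\<lambda>u. noise s u \<omega>)"
proof -
  obtain C where C: "\<And>u. s \<le> u \<Longrightarrow> u \<le> t \<Longrightarrow> \<bar>X u \<omega>\<bar> \<le> C" using path_bounded[OF \<omega> st(1)] by blast
  define D where "D = C + C + ((t - s) * (c0 + c1 * \<bar>X s \<omega>\<bar>) + c1 * osc s t \<omega>)"
  show ?thesis
  proof (rule L2_bound[OF time.L2_const[of _ _ D]])
    show "(\<lambda>u. noise s u \<omega>) \<in> borel_measurable (time_measure s t)"
      using measurable_Pair2[OF noise_jointly_measurable[OF st] \<omega>] by simp
    fix u assume "u \<in> space (time_measure s t)"
    then have u: "s \<le> u" "u \<le> t" by (auto simp: space_time_measure)
    have "\<bar>noise s u \<omega>\<bar> \<le> \<bar>X u \<omega>\<bar> + \<bar>X s \<omega>\<bar> + \<bar>drift s u \<omega>\<bar>" unfolding noise_def by linarith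
    also have "\<dots> \<le> D" unfolding D_def
      using C[OF u] C[OF order_refl st(2)] abs_drift_le[OF st(1) u \<omega>] by linarith
    finally show "\<bar>noise s u \<omega>\<bar> \<le> \<bar>D\<bar>" by linarith
  qed
qed

text \<open>Integrating the increment bound over time puts \<open>osc\<close> on both sides, on the
  right with the factor c1 (t - s). As this factor is at most 1/2, the term is absorbed on the left;
  this is one reason for keeping the step size small.\<close>

lemma osc_le:
  assumes st: "0 \<le> s" "s \<le> t" and small: "c1 * (t - s) \<le> 1 / 2" and \<omega>: "\<omega> \<in> space M"
  shows "osc s t \<omega> \<le> 2 * (t - s)\<^sup>2 * (c0 + c1 * \<bar>X s \<omega>\<bar>) + 2 * noise_osc s t \<omega>"
proof -
  define D where "D = (t - s) * (c0 + c1 * \<bar>X s \<omega>\<bar>) + c1 * osc s t \<omega>"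
  have iN: "integrable (time_measure s t) (\<lambda>u. \<bar>noise s u \<omega>\<bar>)"
    by (intro time.L2_integrable L2_abs noise_path_L2[OF st \<omega>])
  have "osc s t \<omega> \<le> (\<integral>u. D + \<bar>noise s u \<omega>\<bar> \<partial>time_measure s t)"
    unfolding osc_def
  proof (rule integral_mono')
    show "integrable (time_measure s t) (\<lambda>u. D + \<bar>noise s u \<omega>\<bar>)" using iN by auto
    fix u assume "u \<in> space (time_measure s t)"
    then have u: "s \<le> u" "u \<le> t" by (auto simp: space_time_measure)
    show "\<bar>X u \<omega> - X s \<omega>\<bar> \<le> D + \<bar>noise s u \<omega>\<bar>"
      using abs_drift_le[OF st(1) u \<omega>] unfolding X_increment D_def by linarith
    show "0 \<le> D + \<bar>noise s u \<omega>\<bar>"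
      using st c0 c1 osc_nonneg[of s t \<omega>] by (simp add: D_def)
  qed
  also have "\<dots> = (t - s) * D + noise_osc s t \<omega>"
    using iN st by (simp add: noise_osc_def measure_space_time_measure)
  finally have "osc s t \<omega> \<le> (t - s)\<^sup>2 * (c0 + c1 * \<bar>X s \<omega>\<bar>) + c1 * (t - s) * osc s t \<omega> + noise_osc s t \<omega>"
    by (simp add: D_def power2_eq_square algebra_simps)
  moreover have "c1 * (t - s) * osc s t \<omega> \<le> 1 / 2 * osc s t \<omega>"
    using small osc_nonneg by (intro mult_right_mono) auto
  ultimately show ?thesis by simp
qed

lemma qvar_bounds:
  assumes st: "0 \<le> s" "s \<le> t"
  shows "0 \<le> qvar s t \<omega>" and "qvar s t \<omega> \<le> K\<^sup>2 * (t - s)"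
proof -
  show "0 \<le> qvar s t \<omega>" by (simp add: qvar_def)
  have "qvar s t \<omega> \<le> (\<integral>u. K\<^sup>2 \<partial>time_measure s t)"
    unfolding qvar_def using sg_bound by (intro integral_mono') (auto simp: abs_le_square_iff[symmetric] intro: order_trans[OF _ abs_ge_self])
  then show "qvar s t \<omega> \<le> K\<^sup>2 * (t - s)"
    using st by (simp add: measure_space_time_measure mult.commute)
qed

end

text \<open>The discontinuous drift \<open>b\<close> is a bounded perturbation of a Lipschitz dissipative \<open>g\<close>.\<close>

locale diffusion = adapted_path +
  fixes g :: "real \<Rightarrow> real" and x0 c \<kappa> :: real
  assumes b_near_g: "\<And>y. \<bar>b y - g y\<bar> \<le> c0"
    and g_lipschitz: "\<And>y z. \<bar>g y - g z\<bar> \<le> c1 * \<bar>y - z\<bar>"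
    and g_dissipative: "\<And>y. y * g y \<le> - c * y\<^sup>2" and c: "0 < c"
    and sg_lower: "\<And>y. \<kappa> \<le> sg y" and \<kappa>: "0 < \<kappa>"
    and X_0: "AE \<omega> in M. X 0 \<omega> = x0"
    and noise_mean: "\<And>s t A. 0 \<le> s \<Longrightarrow> s \<le> t \<Longrightarrow> A \<in> sets (F s) \<Longrightarrow> (\<integral>\<omega>. indicator A \<omega> * noise s t \<omega> \<partial>M) = 0"
    and noise_square: "\<And>s t A. 0 \<le> s \<Longrightarrow> s \<le> t \<Longrightarrow> A \<in> sets (F s) \<Longrightarrow>
      (\<integral>\<omega>. indicator A \<omega> * (noise s t \<omega>)\<^sup>2 \<partial>M) = (\<integral>\<omega>. indicator A \<omega> * qvar s t \<omega> \<partial>M)"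
    and noise_fourth: "\<And>s t. 0 \<le> s \<Longrightarrow> s \<le> t \<Longrightarrow> integrable M (\<lambda>\<omega>. noise s t \<omega> ^ 4)"
      "\<And>s t. 0 \<le> s \<Longrightarrow> s \<le> t \<Longrightarrow> (\<integral>\<omega>. noise s t \<omega> ^ 4 \<partial>M) \<le> 3 * K ^ 4 * (t - s)\<^sup>2"
begin

section \<open>Moments of noise, oscillation and drift over one step\<close>

lemma qvar_lower:
  assumes st: "0 \<le> s" "s \<le> t" and \<omega>: "\<omega> \<in> space M"
  shows "\<kappa>\<^sup>2 * (t - s) \<le> qvar s t \<omega>"
proof -
  have sg2: "(sg y)\<^sup>2 \<le> K\<^sup>2" for y using power_mono[OF sg_bound[of y], of 2] by simp
  have "integrable (time_measure s t) (\<lambda>u. (sg (X u \<omega>))\<^sup>2)"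
    by (rule path_integrable[where \<phi>="\<lambda>y. (sg y)\<^sup>2" and a="K\<^sup>2" and d=0, OF st _ \<omega>]) (use sg2 sg_borel in auto)
  then have "(\<integral>u. \<kappa>\<^sup>2 \<partial>time_measure s t) \<le> qvar s t \<omega>"
    unfolding qvar_def using sg_lower \<kappa> by (intro integral_mono) (auto intro!: power_mono)
  then show ?thesis using st by (simp add: measure_space_time_measure mult.commute)
qed

lemma integrable_qvar:
  assumes st: "0 \<le> s" "s \<le> t" shows "integrable M (qvar s t)"
  by (rule integrable_const_bound[of _ "K\<^sup>2 * (t - s)"])
     (use qvar_bounds[OF st] qvar_measurable[OF st] in auto)

lemma L2_noise_square:
  assumes st: "0 \<le> s" "s \<le> t" shows "L2 M (\<lambda>\<omega>. (noise s t \<omega>)\<^sup>2)"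
  using noise_fourth(1)[OF st] noise_measurable[OF st] by (simp add: L2_def power_mult[symmetric])

lemma L2_noise:
  assumes st: "0 \<le> s" "s \<le> t" shows "L2 M (noise s t)"
  using L2_integrable[OF L2_noise_square[OF st]] noise_measurable[OF st] by (simp add: L2_def)

lemma expectation_noise_square_le:
  assumes st: "0 \<le> s" "s \<le> t" shows "(\<integral>\<omega>. (noise s t \<omega>)\<^sup>2 \<partial>M) \<le> K\<^sup>2 * (t - s)"
proof -
  have "(\<integral>\<omega>. (noise s t \<omega>)\<^sup>2 \<partial>M) = (\<integral>\<omega>. indicator (space M) \<omega> * (noise s t \<omega>)\<^sup>2 \<partial>M)"
    by (intro Bochner_Integration.integral_cong) auto
  also have "\<dots> = (\<integral>\<omega>. indicator (space M) \<omega> * qvar s t \<omega> \<partial>M)"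
    by (rule noise_square[OF st]) (metis sets.top space_F)
  also have "\<dots> = (\<integral>\<omega>. qvar s t \<omega> \<partial>M)"
    by (intro Bochner_Integration.integral_cong) auto
  also have "\<dots> \<le> (\<integral>\<omega>. K\<^sup>2 * (t - s) \<partial>M)"
    using integrable_qvar[OF st] qvar_bounds[OF st] by (intro integral_mono) auto
  finally show ?thesis by (simp add: prob_space)
qed

lemma noise_orthogonal:
  assumes st: "0 \<le> s" "s \<le> t" and \<zeta>: "\<zeta> \<in> borel_measurable (F s)" "integrable M (\<lambda>\<omega>. \<zeta> \<omega> * noise s t \<omega>)"
  shows "(\<integral>\<omega>. \<zeta> \<omega> * noise s t \<omega> \<partial>M) = 0"
  by (rule orthogonal_of_indicator[OF L2_integrable[OF L2_noise[OF st]] noise_mean[OF st] \<zeta>])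

text \<open>Integrability of the squared product is part of the claim, so the computation runs in
  nonnegative integrals: given \<open>F s\<close>, the squared noise may be replaced by
  \<open>qvar\<close>, which is at most K^2 (t - s).\<close>

lemma weighted_noise:
  assumes st: "0 \<le> s" "s \<le> t" and \<zeta>: "\<zeta> \<in> borel_measurable (F s)" "L2 M \<zeta>"
  shows "L2 M (\<lambda>\<omega>. \<zeta> \<omega> * noise s t \<omega>)"
    and "(\<integral>\<omega>. (\<zeta> \<omega> * noise s t \<omega>)\<^sup>2 \<partial>M) \<le> K\<^sup>2 * (t - s) * (\<integral>\<omega>. (\<zeta> \<omega>)\<^sup>2 \<partial>M)"
proof -
  have m: "noise s t \<in> borel_measurable M" "qvar s t \<in> borel_measurable M" "\<zeta> \<in> borel_measurable M"
    using noise_measurable[OF st] qvar_measurable[OF st] measurable_F_M[OF \<zeta>(1)] by auto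
  have A: "(\<integral>\<^sup>+\<omega>. ennreal ((noise s t \<omega>)\<^sup>2) * indicator A \<omega> \<partial>M) = (\<integral>\<^sup>+\<omega>. ennreal (qvar s t \<omega>) * indicator A \<omega> \<partial>M)"
    if A: "A \<in> sets (F s)" for A
  proof -
    have AM: "A \<in> sets M" using A sets_F_subset by blast
    have "(\<integral>\<^sup>+\<omega>. ennreal ((noise s t \<omega>)\<^sup>2) * indicator A \<omega> \<partial>M) = (\<integral>\<^sup>+\<omega>. ennreal (indicator A \<omega> * (noise s t \<omega>)\<^sup>2) \<partial>M)"
      by (intro nn_integral_cong) (auto simp: indicator_def)
    also have "\<dots> = ennreal (\<integral>\<omega>. indicator A \<omega> * (noise s t \<omega>)\<^sup>2 \<partial>M)"
      using integrable_real_mult_indicator[OF AM L2_integrable_square[OF L2_noise[OF st]]]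
      by (intro nn_integral_eq_integral) (auto simp: mult.commute)
    also have "\<dots> = ennreal (\<integral>\<omega>. indicator A \<omega> * qvar s t \<omega> \<partial>M)" by (simp only: noise_square[OF st A])
    also have "\<dots> = (\<integral>\<^sup>+\<omega>. ennreal (indicator A \<omega> * qvar s t \<omega>) \<partial>M)"
      using integrable_real_mult_indicator[OF AM integrable_qvar[OF st]] qvar_bounds[OF st]
      by (intro nn_integral_eq_integral[symmetric]) (auto simp: mult.commute)
    also have "\<dots> = (\<integral>\<^sup>+\<omega>. ennreal (qvar s t \<omega>) * indicator A \<omega> \<partial>M)"
      by (intro nn_integral_cong) (auto simp: indicator_def)
    finally show ?thesis .
  qed
  have "(\<integral>\<^sup>+\<omega>. ennreal ((\<zeta> \<omega> * noise s t \<omega>)\<^sup>2) \<partial>M) = (\<integral>\<^sup>+\<omega>. ennreal ((\<zeta> \<omega>)\<^sup>2) * ennreal ((noise s t \<omega>)\<^sup>2) \<partial>M)"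
    by (simp add: power_mult_distrib ennreal_mult)
  also have "\<dots> = (\<integral>\<^sup>+\<omega>. ennreal ((\<zeta> \<omega>)\<^sup>2) * ennreal (qvar s t \<omega>) \<partial>M)"
    by (rule nn_integral_weight_eq_of_indicator[OF _ _ A]) (use m \<zeta> in auto)
  also have "\<dots> \<le> (\<integral>\<^sup>+\<omega>. ennreal (K\<^sup>2 * (t - s) * (\<zeta> \<omega>)\<^sup>2) \<partial>M)"
    using qvar_bounds[OF st]
    by (intro nn_integral_mono) (auto simp: ennreal_mult[symmetric] mult.commute[of "K\<^sup>2 * (t - s)"] intro!: ennreal_leI mult_left_mono)
  also have "\<dots> = ennreal (K\<^sup>2 * (t - s) * (\<integral>\<omega>. (\<zeta> \<omega>)\<^sup>2 \<partial>M))"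
    using L2_integrable_square[OF \<zeta>(2)] st by (subst nn_integral_eq_integral) auto
  finally have le: "(\<integral>\<^sup>+\<omega>. ennreal ((\<zeta> \<omega> * noise s t \<omega>)\<^sup>2) \<partial>M) \<le> ennreal (K\<^sup>2 * (t - s) * (\<integral>\<omega>. (\<zeta> \<omega>)\<^sup>2 \<partial>M))" .
  have i: "integrable M (\<lambda>\<omega>. (\<zeta> \<omega> * noise s t \<omega>)\<^sup>2)"
    by (rule integrableI_bounded) (use m le in \<open>auto intro: le_less_trans\<close>)
  then show "L2 M (\<lambda>\<omega>. \<zeta> \<omega> * noise s t \<omega>)" using m by (simp add: L2_def)
  have "ennreal (\<integral>\<omega>. (\<zeta> \<omega> * noise s t \<omega>)\<^sup>2 \<partial>M) \<le> ennreal (K\<^sup>2 * (t - s) * (\<integral>\<omega>. (\<zeta> \<omega>)\<^sup>2 \<partial>M))"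
    using le i by (subst (asm) nn_integral_eq_integral) auto
  then show "(\<integral>\<omega>. (\<zeta> \<omega> * noise s t \<omega>)\<^sup>2 \<partial>M) \<le> K\<^sup>2 * (t - s) * (\<integral>\<omega>. (\<zeta> \<omega>)\<^sup>2 \<partial>M)"
    using st by (subst (asm) ennreal_le_iff) auto
qed

text \<open>The constant 8 is 2 * 3 + 2, from (p - q)^2 <= 2 p^2 + 2 q^2 with the fourth moment
  bound 3 K^4 (t - s)^2 of the noise and the pointwise bound K^4 (t - s)^2 for the square of
  \<open>qvar\<close>.\<close>

lemma compensated_square:
  assumes st: "0 \<le> s" "s \<le> t"
  defines "V \<equiv> \<lambda>\<omega>. (noise s t \<omega>)\<^sup>2 - qvar s t \<omega>"
  shows "L2 M V" and "(\<integral>\<omega>. (V \<omega>)\<^sup>2 \<partial>M) \<le> 8 * K ^ 4 * (t - s)\<^sup>2"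
    and "V \<in> borel_measurable (F t)"
    and "A \<in> sets (F s) \<Longrightarrow> (\<integral>\<omega>. indicator A \<omega> * V \<omega> \<partial>M) = 0"
proof -
  have q2: "(qvar s t \<omega>)\<^sup>2 \<le> K ^ 4 * (t - s)\<^sup>2" for \<omega>
    using power_mono[OF qvar_bounds(2)[OF st] qvar_bounds(1)[OF st], of \<omega> 2]
    by (simp add: power_mult_distrib power_mult[symmetric])
  have L2q: "L2 M (qvar s t)"
    by (rule L2_bound[OF L2_const[of "K\<^sup>2 * (t - s)"]])
       (use qvar_measurable[OF st] qvar_bounds(1)[OF st] in \<open>auto intro: order_trans[OF qvar_bounds(2)[OF st] abs_ge_self]\<close>)
  show L2V: "L2 M V" unfolding V_def by (intro L2_diff L2_noise_square st L2q)
  have "(\<integral>\<omega>. (V \<omega>)\<^sup>2 \<partial>M) \<le> (\<integral>\<omega>. 2 * noise s t \<omega> ^ 4 + 2 * (K ^ 4 * (t - s)\<^sup>2) \<partial>M)"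
  proof (rule integral_mono)
    show "integrable M (\<lambda>\<omega>. (V \<omega>)\<^sup>2)" using L2V by (simp add: L2_def)
    show "integrable M (\<lambda>\<omega>. 2 * noise s t \<omega> ^ 4 + 2 * (K ^ 4 * (t - s)\<^sup>2))" using noise_fourth(1)[OF st] by simp
    fix \<omega>
    have "(V \<omega>)\<^sup>2 \<le> 2 * ((noise s t \<omega>)\<^sup>2)\<^sup>2 + 2 * (- qvar s t \<omega>)\<^sup>2"
      using square_add_le[of "(noise s t \<omega>)\<^sup>2" "- qvar s t \<omega>"] by (simp add: V_def)
    then show "(V \<omega>)\<^sup>2 \<le> 2 * noise s t \<omega> ^ 4 + 2 * (K ^ 4 * (t - s)\<^sup>2)"
      using q2[of \<omega>] by (simp add: power_mult[symmetric])
  qed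
  also have "\<dots> \<le> 8 * K ^ 4 * (t - s)\<^sup>2"
    using noise_fourth[OF st] by (simp add: prob_space)
  finally show "(\<integral>\<omega>. (V \<omega>)\<^sup>2 \<partial>M) \<le> 8 * K ^ 4 * (t - s)\<^sup>2" .
  show "V \<in> borel_measurable (F t)"
    unfolding V_def using st by (intro borel_measurable_diff borel_measurable_power noise_measurable_F qvar_measurable_F) auto
  assume A: "A \<in> sets (F s)"
  then have AM: "A \<in> sets M" using sets_F_subset by blast
  have "integrable M (\<lambda>\<omega>. indicator A \<omega> * (noise s t \<omega>)\<^sup>2)" "integrable M (\<lambda>\<omega>. indicator A \<omega> * qvar s t \<omega>)"
    using integrable_real_mult_indicator[OF AM L2_integrable_square[OF L2_noise[OF st]]]
      integrable_real_mult_indicator[OF AM integrable_qvar[OF st]] by (auto simp: mult.commute)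
  then show "(\<integral>\<omega>. indicator A \<omega> * V \<omega> \<partial>M) = 0"
    using noise_square[OF st A] by (simp add: V_def right_diff_distrib)
qed

text \<open>Cauchy-Schwarz in time, then Fubini. The cube means that over a step h the integrated
  oscillation has size h^(3/2), which is small against h.\<close>

lemma noise_osc_moment:
  assumes st: "0 \<le> s" "s < t"
  shows "L2 M (noise_osc s t)" and "(\<integral>\<omega>. (noise_osc s t \<omega>)\<^sup>2 \<partial>M) \<le> K\<^sup>2 * (t - s) ^ 3"
proof -
  interpret P: pair_sigma_finite M "time_measure s t" by (rule pair_sigma_finite_time)
  have st': "0 \<le> s" "s \<le> t" using st by auto
  have jm: "(\<lambda>z. ennreal ((noise s (snd z) (fst z))\<^sup>2)) \<in> borel_measurable (space_time s t)"
    using noise_jointly_measurable[OF st'] by measurable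
  have "(\<integral>\<^sup>+\<omega>. ennreal ((noise_osc s t \<omega>)\<^sup>2) \<partial>M)
    \<le> (\<integral>\<^sup>+\<omega>. ennreal (t - s) * (\<integral>\<^sup>+u. ennreal ((noise s u \<omega>)\<^sup>2) \<partial>time_measure s t) \<partial>M)"
  proof (rule nn_integral_mono)
    fix \<omega> assume \<omega>: "\<omega> \<in> space M"
    have L: "L2 (time_measure s t) (\<lambda>u. noise s u \<omega>)" by (rule noise_path_L2[OF st' \<omega>])
    have "(noise_osc s t \<omega>)\<^sup>2 \<le> (t - s) * (\<integral>u. (noise s u \<omega>)\<^sup>2 \<partial>time_measure s t)"
      using time_integral_square_le[OF st(2) L2_abs[OF L]] by (simp add: noise_osc_def)
    then have "ennreal ((noise_osc s t \<omega>)\<^sup>2) \<le> ennreal ((t - s) * (\<integral>u. (noise s u \<omega>)\<^sup>2 \<partial>time_measure s t))"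
      by (rule ennreal_leI)
    also have "\<dots> = ennreal (t - s) * ennreal (\<integral>u. (noise s u \<omega>)\<^sup>2 \<partial>time_measure s t)"
      using st by (intro ennreal_mult) auto
    also have "ennreal (\<integral>u. (noise s u \<omega>)\<^sup>2 \<partial>time_measure s t) = (\<integral>\<^sup>+u. ennreal ((noise s u \<omega>)\<^sup>2) \<partial>time_measure s t)"
      using L by (intro nn_integral_eq_integral[symmetric]) (auto simp: L2_def)
    finally show "ennreal ((noise_osc s t \<omega>)\<^sup>2) \<le> ennreal (t - s) * (\<integral>\<^sup>+u. ennreal ((noise s u \<omega>)\<^sup>2) \<partial>time_measure s t)" .
  qed
  also have "\<dots> = ennreal (t - s) * (\<integral>\<^sup>+\<omega>. (\<integral>\<^sup>+u. ennreal ((noise s u \<omega>)\<^sup>2) \<partial>time_measure s t) \<partial>M)"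
    by (rule nn_integral_cmult) (use time.borel_measurable_nn_integral_fst[OF jm] in simp)
  also have "\<dots> \<le> ennreal (t - s) * (ennreal (K\<^sup>2 * (t - s)) * ennreal (t - s))"
  proof (rule mult_left_mono)
  have "(\<integral>\<^sup>+\<omega>. (\<integral>\<^sup>+u. ennreal ((noise s u \<omega>)\<^sup>2) \<partial>time_measure s t) \<partial>M)
    = (\<integral>\<^sup>+u. (\<integral>\<^sup>+\<omega>. ennreal ((noise s u \<omega>)\<^sup>2) \<partial>M) \<partial>time_measure s t)"
    using P.Fubini[OF jm] by simp
  also have "\<dots> \<le> (\<integral>\<^sup>+u. ennreal (K\<^sup>2 * (t - s)) \<partial>time_measure s t)"
  proof (rule nn_integral_mono)
    fix u assume "u \<in> space (time_measure s t)"
    then have u: "s \<le> u" "u \<le> t" by (auto simp: space_time_measure)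
    have "(\<integral>\<^sup>+\<omega>. ennreal ((noise s u \<omega>)\<^sup>2) \<partial>M) = ennreal (\<integral>\<omega>. (noise s u \<omega>)\<^sup>2 \<partial>M)"
      using L2_noise[OF st(1) u(1)] by (intro nn_integral_eq_integral) (auto simp: L2_def)
    also have "\<dots> \<le> ennreal (K\<^sup>2 * (t - s))"
    proof (rule ennreal_leI)
      have "K\<^sup>2 * (u - s) \<le> K\<^sup>2 * (t - s)" using u by (intro mult_left_mono) auto
      then show "(\<integral>\<omega>. (noise s u \<omega>)\<^sup>2 \<partial>M) \<le> K\<^sup>2 * (t - s)"
        using expectation_noise_square_le[OF st(1) u(1)] by linarith
    qed
    finally show "(\<integral>\<^sup>+\<omega>. ennreal ((noise s u \<omega>)\<^sup>2) \<partial>M) \<le> ennreal (K\<^sup>2 * (t - s))" .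
  qed
  also have "\<dots> = ennreal (K\<^sup>2 * (t - s)) * ennreal (t - s)"
    using measure_space_time_measure[OF st'(2)] by (simp add: time.emeasure_eq_measure)
  finally show "(\<integral>\<^sup>+\<omega>. (\<integral>\<^sup>+u. ennreal ((noise s u \<omega>)\<^sup>2) \<partial>time_measure s t) \<partial>M)
    \<le> ennreal (K\<^sup>2 * (t - s)) * ennreal (t - s)" .
  qed simp
  finally have le: "(\<integral>\<^sup>+\<omega>. ennreal ((noise_osc s t \<omega>)\<^sup>2) \<partial>M) \<le> ennreal (K\<^sup>2 * (t - s) ^ 3)"
    using st by (simp add: ennreal_mult[symmetric] power3_eq_cube ac_simps)
  have m: "noise_osc s t \<in> borel_measurable M" by (rule noise_osc_measurable[OF st'])
  have i: "integrable M (\<lambda>\<omega>. (noise_osc s t \<omega>)\<^sup>2)"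
    by (rule integrableI_bounded) (use m le in \<open>auto intro: le_less_trans\<close>)
  then show "L2 M (noise_osc s t)" using m by (simp add: L2_def)
  have "ennreal (\<integral>\<omega>. (noise_osc s t \<omega>)\<^sup>2 \<partial>M) \<le> ennreal (K\<^sup>2 * (t - s) ^ 3)"
    using le i by (subst (asm) nn_integral_eq_integral) auto
  then show "(\<integral>\<omega>. (noise_osc s t \<omega>)\<^sup>2 \<partial>M) \<le> K\<^sup>2 * (t - s) ^ 3"
    using st by (subst (asm) ennreal_le_iff) auto
qed

text \<open>The first three summands bound the oscillation; the others bound the drift, whose
  estimate uses the oscillation bound once more. A single constant serves for both.\<close>

definition C0 :: real where
  "C0 = 16 * c0\<^sup>2 + 16 * c1\<^sup>2 + 8 * K\<^sup>2 + 4 * c0\<^sup>2 + 4 * c1\<^sup>2 + 2 * c1\<^sup>2 * (16 * c0\<^sup>2 + 16 * c1\<^sup>2 + 8 * K\<^sup>2)"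

lemma C0_nonneg: "0 \<le> C0"
  by (simp add: C0_def)

text \<open>In mean square the oscillation is of order h^(3/2) and the drift of order h. Surplus
  powers of h are dropped because h <= 1, and constants are multiplied by \<open>w\<close> because
  \<open>w\<close> is at least 1.\<close>

lemma osc_drift_moment:
  assumes s: "0 \<le> s" and h: "0 < h" "h \<le> 1" "c1 * h \<le> 1 / 2" and L: "L2 M (X s)"
  defines "w \<equiv> 1 + (\<integral>\<omega>. (X s \<omega>)\<^sup>2 \<partial>M)"
  shows "L2 M (osc s (s + h))" and "(\<integral>\<omega>. (osc s (s + h) \<omega>)\<^sup>2 \<partial>M) \<le> C0 * h ^ 3 * w"
    and "L2 M (drift s (s + h))" and "(\<integral>\<omega>. (drift s (s + h) \<omega>)\<^sup>2 \<partial>M) \<le> C0 * h\<^sup>2 * w"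
proof -
  have st: "0 \<le> s" "s \<le> s + h" "s < s + h" using s h by auto
  have iX: "integrable M (\<lambda>\<omega>. (X s \<omega>)\<^sup>2)" by (rule L2_integrable_square[OF L])
  have w1: "1 \<le> w" by (simp add: w_def)
  let ?G = "osc s (s + h)" and ?N = "noise_osc s (s + h)" and ?l = "\<lambda>\<omega>. c0 + c1 * \<bar>X s \<omega>\<bar>"
  note N = noise_osc_moment[OF st(1,3), simplified]
  have LG': "L2 M (\<lambda>\<omega>. 2 * h\<^sup>2 * ?l \<omega> + 2 * ?N \<omega>)"
    by (intro L2_add L2_cmult L2_const L2_abs L N(1))
  have Gle: "?G \<omega> \<le> 2 * h\<^sup>2 * ?l \<omega> + 2 * ?N \<omega>" if "\<omega> \<in> space M" for \<omega>
    using osc_le[OF st(1,2) _ that] h by simp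
  show LG: "L2 M ?G"
    by (rule L2_bound[OF LG' osc_measurable[OF st(1,2)]])
       (use Gle osc_nonneg in \<open>auto simp: abs_of_nonneg intro: order_trans[OF _ abs_ge_self]\<close>)
  have l2: "(?l \<omega>)\<^sup>2 \<le> 2 * c0\<^sup>2 + 2 * c1\<^sup>2 * (X s \<omega>)\<^sup>2" for \<omega>
    using square_add_le[of c0 "c1 * \<bar>X s \<omega>\<bar>"] by (simp add: power_mult_distrib)
  have G2: "(?G \<omega>)\<^sup>2 \<le> 16 * c0\<^sup>2 * h ^ 4 + 16 * c1\<^sup>2 * h ^ 4 * (X s \<omega>)\<^sup>2 + 8 * (?N \<omega>)\<^sup>2" if \<omega>: "\<omega> \<in> space M" for \<omega>
  proof -
    have "(?G \<omega>)\<^sup>2 \<le> (2 * h\<^sup>2 * ?l \<omega> + 2 * ?N \<omega>)\<^sup>2" using Gle[OF \<omega>] osc_nonneg by (rule power_mono)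
    also have "\<dots> \<le> 2 * (2 * h\<^sup>2 * ?l \<omega>)\<^sup>2 + 2 * (2 * ?N \<omega>)\<^sup>2" by (rule square_add_le)
    also have "\<dots> = 8 * h ^ 4 * (?l \<omega>)\<^sup>2 + 8 * (?N \<omega>)\<^sup>2" by (simp add: power_mult_distrib power_mult[symmetric])
    also have "\<dots> \<le> 8 * h ^ 4 * (2 * c0\<^sup>2 + 2 * c1\<^sup>2 * (X s \<omega>)\<^sup>2) + 8 * (?N \<omega>)\<^sup>2"
      using l2 by (intro add_mono mult_left_mono) auto
    finally show ?thesis by (simp add: algebra_simps)
  qed
  have iN: "integrable M (\<lambda>\<omega>. (?N \<omega>)\<^sup>2)" by (rule L2_integrable_square[OF N(1)])
  have iG: "integrable M (\<lambda>\<omega>. (?G \<omega>)\<^sup>2)" by (rule L2_integrable_square[OF LG])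
  have "(\<integral>\<omega>. (?G \<omega>)\<^sup>2 \<partial>M) \<le> (\<integral>\<omega>. 16 * c0\<^sup>2 * h ^ 4 + 16 * c1\<^sup>2 * h ^ 4 * (X s \<omega>)\<^sup>2 + 8 * (?N \<omega>)\<^sup>2 \<partial>M)"
    using iG iX iN G2 by (intro integral_mono) auto
  also have "\<dots> = 16 * c0\<^sup>2 * h ^ 4 + 16 * c1\<^sup>2 * h ^ 4 * (w - 1) + 8 * (\<integral>\<omega>. (?N \<omega>)\<^sup>2 \<partial>M)"
    using iX iN by (simp add: prob_space w_def)
  also have "\<dots> \<le> 16 * c0\<^sup>2 * (h ^ 3 * w) + 16 * c1\<^sup>2 * (h ^ 3 * w) + 8 * (K\<^sup>2 * (h ^ 3 * w))"
  proof (intro add_mono)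
    have h4: "h ^ 4 \<le> h ^ 3" using h by (intro power_decreasing) auto
    have h3w: "h ^ 3 \<le> h ^ 3 * w" using h w1 by simp
    show "16 * c0\<^sup>2 * h ^ 4 \<le> 16 * c0\<^sup>2 * (h ^ 3 * w)" using h4 h3w by (intro mult_left_mono) auto
    have "h ^ 4 * (w - 1) \<le> h ^ 3 * w" using h4 h w1 by (intro mult_mono) auto
    then show "16 * c1\<^sup>2 * h ^ 4 * (w - 1) \<le> 16 * c1\<^sup>2 * (h ^ 3 * w)"
      unfolding mult.assoc[of _ "h ^ 4"] by (intro mult_left_mono) auto
    have "K\<^sup>2 * h ^ 3 \<le> K\<^sup>2 * (h ^ 3 * w)" using h3w by (intro mult_left_mono) auto
    then show "8 * (\<integral>\<omega>. (?N \<omega>)\<^sup>2 \<partial>M) \<le> 8 * (K\<^sup>2 * (h ^ 3 * w))" using N(2) by linarith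
  qed
  also have "\<dots> = (16 * c0\<^sup>2 + 16 * c1\<^sup>2 + 8 * K\<^sup>2) * (h ^ 3 * w)" by (simp add: algebra_simps)
  finally have G: "(\<integral>\<omega>. (?G \<omega>)\<^sup>2 \<partial>M) \<le> (16 * c0\<^sup>2 + 16 * c1\<^sup>2 + 8 * K\<^sup>2) * (h ^ 3 * w)" .
  have h3w0: "0 \<le> h ^ 3 * w" using h w1 by simp
  have "(16 * c0\<^sup>2 + 16 * c1\<^sup>2 + 8 * K\<^sup>2) * (h ^ 3 * w) \<le> C0 * (h ^ 3 * w)"
    using h3w0 by (intro mult_right_mono) (auto simp: C0_def)
  with G show "(\<integral>\<omega>. (?G \<omega>)\<^sup>2 \<partial>M) \<le> C0 * h ^ 3 * w" by (simp add: mult.assoc)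
  let ?B = "drift s (s + h)"
  have Ble: "\<bar>?B \<omega>\<bar> \<le> h * ?l \<omega> + c1 * ?G \<omega>" if "\<omega> \<in> space M" for \<omega>
    using abs_drift_le[OF st(1,2) order_refl that] by simp
  have LB': "L2 M (\<lambda>\<omega>. h * ?l \<omega> + c1 * ?G \<omega>)"
    by (intro L2_add L2_cmult L2_const L2_abs L LG)
  show LB: "L2 M ?B"
    by (rule L2_bound[OF LB' drift_measurable[OF st(1,2)]]) (use Ble in \<open>auto intro: order_trans[OF _ abs_ge_self]\<close>)
  have B2: "(?B \<omega>)\<^sup>2 \<le> 4 * c0\<^sup>2 * h\<^sup>2 + 4 * c1\<^sup>2 * h\<^sup>2 * (X s \<omega>)\<^sup>2 + 2 * c1\<^sup>2 * (?G \<omega>)\<^sup>2" if \<omega>: "\<omega> \<in> space M" for \<omega>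
  proof -
    have "\<bar>?B \<omega>\<bar>\<^sup>2 \<le> (h * ?l \<omega> + c1 * ?G \<omega>)\<^sup>2" using Ble[OF \<omega>] by (rule power_mono) simp
    also have "\<dots> \<le> 2 * (h * ?l \<omega>)\<^sup>2 + 2 * (c1 * ?G \<omega>)\<^sup>2" by (rule square_add_le)
    also have "\<dots> = 2 * h\<^sup>2 * (?l \<omega>)\<^sup>2 + 2 * c1\<^sup>2 * (?G \<omega>)\<^sup>2" by (simp add: power_mult_distrib)
    also have "\<dots> \<le> 2 * h\<^sup>2 * (2 * c0\<^sup>2 + 2 * c1\<^sup>2 * (X s \<omega>)\<^sup>2) + 2 * c1\<^sup>2 * (?G \<omega>)\<^sup>2"
      using l2 by (intro add_mono mult_left_mono) auto
    finally show ?thesis by (simp add: algebra_simps)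
  qed
  have iB: "integrable M (\<lambda>\<omega>. (?B \<omega>)\<^sup>2)" by (rule L2_integrable_square[OF LB])
  have "(\<integral>\<omega>. (?B \<omega>)\<^sup>2 \<partial>M) \<le> (\<integral>\<omega>. 4 * c0\<^sup>2 * h\<^sup>2 + 4 * c1\<^sup>2 * h\<^sup>2 * (X s \<omega>)\<^sup>2 + 2 * c1\<^sup>2 * (?G \<omega>)\<^sup>2 \<partial>M)"
    using iG iX iB B2 by (intro integral_mono) auto
  also have "\<dots> = 4 * c0\<^sup>2 * h\<^sup>2 + 4 * c1\<^sup>2 * h\<^sup>2 * (w - 1) + 2 * c1\<^sup>2 * (\<integral>\<omega>. (?G \<omega>)\<^sup>2 \<partial>M)"
    using iX iG by (simp add: prob_space w_def)
  also have "\<dots> \<le> 4 * c0\<^sup>2 * (h\<^sup>2 * w) + 4 * c1\<^sup>2 * (h\<^sup>2 * w) + 2 * c1\<^sup>2 * ((16 * c0\<^sup>2 + 16 * c1\<^sup>2 + 8 * K\<^sup>2) * (h\<^sup>2 * w))"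
  proof (intro add_mono)
    have h3: "h ^ 3 \<le> h\<^sup>2" using h by (intro power_decreasing) auto
    have h2w: "h\<^sup>2 \<le> h\<^sup>2 * w" using h w1 by simp
    show "4 * c0\<^sup>2 * h\<^sup>2 \<le> 4 * c0\<^sup>2 * (h\<^sup>2 * w)" using h2w by (intro mult_left_mono) auto
    have "h\<^sup>2 * (w - 1) \<le> h\<^sup>2 * w" by (intro mult_left_mono) auto
    then show "4 * c1\<^sup>2 * h\<^sup>2 * (w - 1) \<le> 4 * c1\<^sup>2 * (h\<^sup>2 * w)"
      unfolding mult.assoc[of _ "h\<^sup>2"] by (intro mult_left_mono) auto
    have "(16 * c0\<^sup>2 + 16 * c1\<^sup>2 + 8 * K\<^sup>2) * (h ^ 3 * w) \<le> (16 * c0\<^sup>2 + 16 * c1\<^sup>2 + 8 * K\<^sup>2) * (h\<^sup>2 * w)"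
      using h3 w1 by (intro mult_left_mono mult_right_mono) auto
    then show "2 * c1\<^sup>2 * (\<integral>\<omega>. (?G \<omega>)\<^sup>2 \<partial>M) \<le> 2 * c1\<^sup>2 * ((16 * c0\<^sup>2 + 16 * c1\<^sup>2 + 8 * K\<^sup>2) * (h\<^sup>2 * w))"
      using G by (intro mult_left_mono) auto
  qed
  also have "\<dots> = (C0 - (16 * c0\<^sup>2 + 16 * c1\<^sup>2 + 8 * K\<^sup>2)) * (h\<^sup>2 * w)" by (simp add: C0_def algebra_simps)
  also have "\<dots> \<le> C0 * (h\<^sup>2 * w)"
  proof (rule mult_right_mono)
    have "0 \<le> 16 * c0\<^sup>2 + 16 * c1\<^sup>2 + 8 * K\<^sup>2" by simp
    then show "C0 - (16 * c0\<^sup>2 + 16 * c1\<^sup>2 + 8 * K\<^sup>2) \<le> C0" by linarith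
    show "0 \<le> h\<^sup>2 * w" using w1 by simp
  qed
  finally show "(\<integral>\<omega>. (?B \<omega>)\<^sup>2 \<partial>M) \<le> C0 * h\<^sup>2 * w" by (simp add: mult.assoc)
qed

text \<open>z stays free: it is the position itself in the energy estimate and the displacement from
  \<rho> in the Lyapunov argument. Per unit of time, replacing \<open>b\<close> by \<open>g\<close>
  costs c0 |z|; freezing \<open>g\<close> at the left endpoint costs the oscillation term.\<close>

lemma drift_pairing:
  assumes st: "0 \<le> s" "s \<le> t" and \<omega>: "\<omega> \<in> space M"
  shows "z * drift s t \<omega> \<le> (t - s) * (z * g (X s \<omega>) + c0 * \<bar>z\<bar>) + c1 * \<bar>z\<bar> * osc s t \<omega>"
proof -
  have io: "integrable (time_measure s t) (\<lambda>v. \<bar>X v \<omega> - X s \<omega>\<bar>)"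
    by (rule path_integrable[where \<phi>="\<lambda>y. \<bar>y - X s \<omega>\<bar>" and a="\<bar>X s \<omega>\<bar>" and d=1]) (use st \<omega> in auto)
  have ib: "integrable (time_measure s t) (\<lambda>v. b (X v \<omega>))"
    by (rule path_integrable[OF _ _ b_borel \<omega> b_growth]) (use st c1 in auto)
  have "z * drift s t \<omega> = (\<integral>u. z * b (X u \<omega>) \<partial>time_measure s t)" by (simp add: drift_def)
  also have "\<dots> \<le> (\<integral>u. (z * g (X s \<omega>) + c0 * \<bar>z\<bar>) + c1 * \<bar>z\<bar> * \<bar>X u \<omega> - X s \<omega>\<bar> \<partial>time_measure s t)"
  proof (rule integral_mono)
    fix u
    have "z * b (X u \<omega>) = z * g (X s \<omega>) + z * (b (X u \<omega>) - g (X u \<omega>)) + z * (g (X u \<omega>) - g (X s \<omega>))"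
      by (simp add: algebra_simps)
    moreover have "z * (b (X u \<omega>) - g (X u \<omega>)) \<le> \<bar>z\<bar> * c0"
      by (rule order_trans[OF abs_ge_self], subst abs_mult, rule mult_left_mono[OF b_near_g]) simp
    moreover have "z * (g (X u \<omega>) - g (X s \<omega>)) \<le> \<bar>z\<bar> * (c1 * \<bar>X u \<omega> - X s \<omega>\<bar>)"
      by (rule order_trans[OF abs_ge_self], subst abs_mult, rule mult_left_mono[OF g_lipschitz]) simp
    ultimately show "z * b (X u \<omega>) \<le> (z * g (X s \<omega>) + c0 * \<bar>z\<bar>) + c1 * \<bar>z\<bar> * \<bar>X u \<omega> - X s \<omega>\<bar>"
      by (simp add: ac_simps)
  qed (use io ib in auto)
  also have "\<dots> = (t - s) * (z * g (X s \<omega>) + c0 * \<bar>z\<bar>) + c1 * \<bar>z\<bar> * osc s t \<omega>"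
    using io st by (simp add: osc_def measure_space_time_measure)
  finally show ?thesis .
qed

text \<open>Expands the square of position plus drift plus noise. The noise is orthogonal to the
  position, half of the dissipation pays for the term linear in |X_s|, the squared noise contributes
  a constant times h, and the rest is of order h^(3/2).\<close>

lemma energy_step:
  assumes s: "0 \<le> s" and h: "0 < h" "h \<le> 1" "c1 * h \<le> 1 / 2" and L: "L2 M (X s)"
  defines "e \<equiv> (\<integral>\<omega>. (X s \<omega>)\<^sup>2 \<partial>M)"
  shows "L2 M (X (s + h))"
    and "(\<integral>\<omega>. (X (s + h) \<omega>)\<^sup>2 \<partial>M) \<le> e - c * h * e + h * (c0\<^sup>2 / c + 2 * K\<^sup>2)
           + (c1 * (1 + C0) + 2 * C0) * (h * sqrt h) * (1 + e)"
proof -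
  have st: "0 \<le> s" "s \<le> s + h" using s h by auto
  let ?G = "osc s (s + h)" and ?B = "drift s (s + h)" and ?S = "noise s (s + h)"
  note od = osc_drift_moment[OF s h L]
  have LS: "L2 M ?S" by (rule L2_noise[OF st])
  have Xe: "X (s + h) \<omega> = X s \<omega> + (?B \<omega> + ?S \<omega>)" for \<omega> by (simp add: noise_def)
  show LX: "L2 M (X (s + h))"
    unfolding Xe[abs_def] by (intro L2_add L od(3) LS)
  have iX: "integrable M (\<lambda>\<omega>. (X s \<omega>)\<^sup>2)" "integrable M (\<lambda>\<omega>. (?G \<omega>)\<^sup>2)" "integrable M (\<lambda>\<omega>. (?B \<omega>)\<^sup>2)" "integrable M (\<lambda>\<omega>. (?S \<omega>)\<^sup>2)"
    "integrable M (\<lambda>\<omega>. X s \<omega> * ?S \<omega>)"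
    using L od LS by (auto intro: L2_integrable_square L2_mult_integrable)
  have pw: "(X (s + h) \<omega>)\<^sup>2 \<le> (X s \<omega>)\<^sup>2 + h * (- c * (X s \<omega>)\<^sup>2 + c0\<^sup>2 / c)
     + c1 * (h * sqrt h * (X s \<omega>)\<^sup>2 + (?G \<omega>)\<^sup>2 / (h * sqrt h)) + 2 * (?B \<omega>)\<^sup>2 + 2 * (?S \<omega>)\<^sup>2 + 2 * (X s \<omega> * ?S \<omega>)"
    if \<omega>: "\<omega> \<in> space M" for \<omega>
  proof -
    let ?x = "X s \<omega>"
    have "?x * ?B \<omega> \<le> h * (?x * g ?x + c0 * \<bar>?x\<bar>) + c1 * \<bar>?x\<bar> * ?G \<omega>"
      using drift_pairing[OF st \<omega>, of ?x] by simp
    moreover have "h * (?x * g ?x + c0 * \<bar>?x\<bar>) \<le> h * (- c * ?x\<^sup>2 + c0 * \<bar>?x\<bar>)"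
      using h g_dissipative[of ?x] by (intro mult_left_mono) auto
    ultimately have xB: "?x * ?B \<omega> \<le> h * (- c * ?x\<^sup>2 + c0 * \<bar>?x\<bar>) + c1 * \<bar>?x\<bar> * ?G \<omega>"
      by linarith
    have "0 \<le> (sqrt c * \<bar>?x\<bar> - c0 / sqrt c)\<^sup>2" by simp
    also have "\<dots> = c * ?x\<^sup>2 - 2 * (c0 * \<bar>?x\<bar>) + c0\<^sup>2 / c"
      using c by (simp add: power2_diff power_mult_distrib power_divide)
    finally have "2 * (c0 * \<bar>?x\<bar>) \<le> c * ?x\<^sup>2 + c0\<^sup>2 / c" by simp
    then have "h * (2 * (- c * ?x\<^sup>2 + c0 * \<bar>?x\<bar>)) \<le> h * (- c * ?x\<^sup>2 + c0\<^sup>2 / c)"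
      using h by (intro mult_left_mono) auto
    \<comment> \<open>The mean of the squared oscillation is of order h^3, so Young's inequality
      with weight h^(3/2) leaves both parts at order h^(3/2).\<close>
    moreover have "2 * (\<bar>?x\<bar> * ?G \<omega>) \<le> h * sqrt h * ?x\<^sup>2 + (?G \<omega>)\<^sup>2 / (h * sqrt h)"
    proof -
      define r where "r = sqrt (h * sqrt h)"
      have r: "0 < r" "r\<^sup>2 = h * sqrt h" using h by (auto simp: r_def)
      have "0 \<le> (r * \<bar>?x\<bar> - ?G \<omega> / r)\<^sup>2" by simp
      also have "\<dots> = r\<^sup>2 * ?x\<^sup>2 - 2 * (\<bar>?x\<bar> * ?G \<omega>) + (?G \<omega>)\<^sup>2 / r\<^sup>2"
        using r(1) by (simp add: power2_diff power_mult_distrib power_divide)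
      finally show ?thesis by (simp add: r(2))
    qed
    then have "c1 * (2 * (\<bar>?x\<bar> * ?G \<omega>)) \<le> c1 * (h * sqrt h * ?x\<^sup>2 + (?G \<omega>)\<^sup>2 / (h * sqrt h))"
      using c1 by (intro mult_left_mono) auto
    ultimately have "2 * (?x * ?B \<omega>) \<le> h * (- c * ?x\<^sup>2 + c0\<^sup>2 / c) + c1 * (h * sqrt h * ?x\<^sup>2 + (?G \<omega>)\<^sup>2 / (h * sqrt h))"
      using xB by (simp add: algebra_simps)
    moreover have "(X (s + h) \<omega>)\<^sup>2 = ?x\<^sup>2 + 2 * (?x * ?B \<omega>) + 2 * (?x * ?S \<omega>) + (?B \<omega> + ?S \<omega>)\<^sup>2"
      unfolding Xe by (simp add: power2_sum algebra_simps)
    ultimately show ?thesis using square_add_le[of "?B \<omega>" "?S \<omega>"] by linarith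
  qed
  have hs: "0 < h * sqrt h" "h\<^sup>2 \<le> h * sqrt h"
  proof -
    show "0 < h * sqrt h" using h by simp
    have "h \<le> sqrt h" using h real_le_rsqrt[of h h] by (simp add: power2_eq_square mult_left_le)
    then show "h\<^sup>2 \<le> h * sqrt h" using h by (simp add: power2_eq_square)
  qed
  have G: "(\<integral>\<omega>. (?G \<omega>)\<^sup>2 \<partial>M) / (h * sqrt h) \<le> C0 * (h * sqrt h) * (1 + e)"
  proof -
    have h3: "h ^ 3 = (h * sqrt h) * (h * sqrt h)" using h by (simp add: power3_eq_cube)
    have "C0 * h ^ 3 * (1 + e) = (C0 * (h * sqrt h) * (1 + e)) * (h * sqrt h)"
      unfolding h3 by (simp only: ac_simps)
    with od(2) have "(\<integral>\<omega>. (?G \<omega>)\<^sup>2 \<partial>M) \<le> (C0 * (h * sqrt h) * (1 + e)) * (h * sqrt h)"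
      by (simp only: e_def)
    then show ?thesis by (simp only: pos_divide_le_eq[OF hs(1)])
  qed
  have B: "(\<integral>\<omega>. (?B \<omega>)\<^sup>2 \<partial>M) \<le> C0 * (h * sqrt h) * (1 + e)"
  proof -
    have "C0 * h\<^sup>2 * (1 + e) \<le> C0 * (h * sqrt h) * (1 + e)"
      using hs(2) C0_nonneg by (intro mult_right_mono mult_left_mono) (auto simp: e_def add_nonneg_nonneg)
    then show ?thesis using od(4) by (simp add: e_def)
  qed
  have S: "(\<integral>\<omega>. (?S \<omega>)\<^sup>2 \<partial>M) \<le> K\<^sup>2 * h" using expectation_noise_square_le[OF st] by simp
  have XS: "(\<integral>\<omega>. X s \<omega> * ?S \<omega> \<partial>M) = 0" by (rule noise_orthogonal[OF st X_adapted[OF s] iX(5)])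
  have "(\<integral>\<omega>. (X (s + h) \<omega>)\<^sup>2 \<partial>M) \<le> (\<integral>\<omega>. (X s \<omega>)\<^sup>2 + h * (- c * (X s \<omega>)\<^sup>2 + c0\<^sup>2 / c)
     + c1 * (h * sqrt h * (X s \<omega>)\<^sup>2 + (?G \<omega>)\<^sup>2 / (h * sqrt h)) + 2 * (?B \<omega>)\<^sup>2 + 2 * (?S \<omega>)\<^sup>2 + 2 * (X s \<omega> * ?S \<omega>) \<partial>M)"
    using iX pw L2_integrable_square[OF LX] by (intro integral_mono) auto
  also have "\<dots> = e + h * (- c * e + c0\<^sup>2 / c) + c1 * (h * sqrt h * e + (\<integral>\<omega>. (?G \<omega>)\<^sup>2 \<partial>M) / (h * sqrt h))
      + 2 * (\<integral>\<omega>. (?B \<omega>)\<^sup>2 \<partial>M) + 2 * (\<integral>\<omega>. (?S \<omega>)\<^sup>2 \<partial>M) + 2 * (\<integral>\<omega>. X s \<omega> * ?S \<omega> \<partial>M)"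
    using iX by (simp add: prob_space e_def)
  also have "\<dots> \<le> e + h * (- c * e + c0\<^sup>2 / c) + c1 * (h * sqrt h * (1 + e) + C0 * (h * sqrt h) * (1 + e))
      + 2 * (C0 * (h * sqrt h) * (1 + e)) + 2 * (K\<^sup>2 * h) + 2 * 0"
    by (rule add_mono[OF add_mono[OF add_mono[OF add_mono[OF order_refl mult_left_mono[OF add_mono[OF mult_left_mono G]]]
          mult_left_mono[OF B]] mult_left_mono[OF S]]]) (use XS c1 hs in auto)
  also have "\<dots> = e - c * h * e + h * (c0\<^sup>2 / c + 2 * K\<^sup>2) + (c1 * (1 + C0) + 2 * C0) * (h * sqrt h) * (1 + e)"
    by (simp add: algebra_simps)
  finally show "(\<integral>\<omega>. (X (s + h) \<omega>)\<^sup>2 \<partial>M) \<le> e - c * h * e + h * (c0\<^sup>2 / c + 2 * K\<^sup>2)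
           + (c1 * (1 + C0) + 2 * C0) * (h * sqrt h) * (1 + e)" .
qed

text \<open>For small h the one-step bound reads e' <= (1 - c h / 2) e + h C1. This affine map is
  increasing with fixed point 2 C1 / c, so it preserves any bound above that value; adding x0^2 in
  \<open>E\<close> covers the start.\<close>

theorem uniform_second_moment:
  obtains h0 E where "0 < h0" "h0 \<le> 1" "c1 * h0 \<le> 1 / 2"
    "\<And>h k. 0 < h \<Longrightarrow> h \<le> h0 \<Longrightarrow> L2 M (X (real k * h)) \<and> (\<integral>\<omega>. (X (real k * h) \<omega>)\<^sup>2 \<partial>M) \<le> E"
proof -
  define D where "D = c1 * (1 + C0) + 2 * C0 + 1"
  have D: "0 < D" using c1 C0_nonneg by (simp add: D_def add_nonneg_pos)
  \<comment> \<open>The entries provide in turn h <= 1, the absorption in \<open>osc_le\<close>, the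
    bound D sqrt h <= c/2 that leaves half of the dissipation, and the sign of 1 - c h / 2.\<close>
  define h0 where "h0 = Min {1, 1 / (2 * c1), (c / (2 * D))\<^sup>2, 2 / c}"
  have h0: "0 < h0" "h0 \<le> 1" "h0 \<le> 1 / (2 * c1)" "h0 \<le> (c / (2 * D))\<^sup>2" "h0 \<le> 2 / c"
    using c c1 D by (auto simp: h0_def)
  define C1 where "C1 = c0\<^sup>2 / c + 2 * K\<^sup>2 + D"
  have C1: "0 < C1" using c D by (simp add: C1_def add_nonneg_pos)
  define E where "E = x0\<^sup>2 + 2 * C1 / c"
  show ?thesis
  proof (rule that)
    show "0 < h0" "h0 \<le> 1" by fact+
    show "c1 * h0 \<le> 1 / 2" using h0(3) c1 by (simp add: field_simps)
    fix h :: real and k :: nat assume h: "0 < h" "h \<le> h0"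
    have "c1 * h \<le> c1 * h0" "c * h \<le> c * h0" using h c c1 by (auto intro: mult_left_mono)
    moreover have "c1 * h0 \<le> 1 / 2" "c * h0 \<le> 2" using h0 c c1 by (auto simp: field_simps)
    ultimately have h': "h \<le> 1" "c1 * h \<le> 1 / 2" "c * h \<le> 2" using h h0 by linarith+
    have sq: "D * sqrt h \<le> c / 2"
    proof -
      have "sqrt h \<le> sqrt ((c / (2 * D))\<^sup>2)" using h h0 by (intro real_sqrt_le_mono) simp
      also have "\<dots> = c / (2 * D)" using c D by simp
      finally show ?thesis using D by (simp add: field_simps)
    qed
    show "L2 M (X (real k * h)) \<and> (\<integral>\<omega>. (X (real k * h) \<omega>)\<^sup>2 \<partial>M) \<le> E"
    proof (induction k)
      case 0
      have m: "X 0 \<in> borel_measurable M" by (rule X_measurable) simp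
      have ae: "AE \<omega> in M. (X 0 \<omega>)\<^sup>2 = x0\<^sup>2" using X_0 by eventually_elim simp
      have "integrable M (\<lambda>\<omega>. (X 0 \<omega>)\<^sup>2)"
        by (rule integrable_cong_AE_imp[of _ "\<lambda>_. x0\<^sup>2"]) (use m ae in auto)
      moreover have "(\<integral>\<omega>. (X 0 \<omega>)\<^sup>2 \<partial>M) = (\<integral>\<omega>. x0\<^sup>2 \<partial>M)"
        by (rule integral_cong_AE) (use m ae in auto)
      ultimately show ?case using m c C1 by (simp add: L2_def prob_space E_def)
    next
      case (Suc k)
      define e where "e = (\<integral>\<omega>. (X (real k * h) \<omega>)\<^sup>2 \<partial>M)"
      have e: "0 \<le> e" "e \<le> E" and L: "L2 M (X (real k * h))" using Suc by (auto simp: e_def)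
      have kh: "real (Suc k) * h = real k * h + h" by (simp add: algebra_simps)
      have s: "0 \<le> real k * h" using h by simp
      note es = energy_step[OF s h(1) h'(1,2) L, folded e_def]
      have "(\<integral>\<omega>. (X (real k * h + h) \<omega>)\<^sup>2 \<partial>M) \<le> e - c * h * e + h * (c0\<^sup>2 / c + 2 * K\<^sup>2)
           + D * (h * sqrt h) * (1 + e)"
      proof -
        have "(c1 * (1 + C0) + 2 * C0) * (h * sqrt h) * (1 + e) \<le> D * (h * sqrt h) * (1 + e)"
          using h e by (intro mult_right_mono) (auto simp: D_def)
        with es(2) show ?thesis by linarith
      qed
      also have "\<dots> = e - c * h * e + h * (c0\<^sup>2 / c + 2 * K\<^sup>2) + (D * sqrt h) * (h * e) + D * (h * sqrt h)"
        by (simp add: algebra_simps)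
      also have "\<dots> \<le> e - c * h * e + h * (c0\<^sup>2 / c + 2 * K\<^sup>2) + c / 2 * (h * e) + D * h"
      proof -
        have "(D * sqrt h) * (h * e) \<le> c / 2 * (h * e)" using sq h e by (intro mult_right_mono) auto
        moreover have "D * (h * sqrt h) \<le> D * h" using h h' D by (intro mult_left_mono) (auto intro: mult_left_le)
        ultimately show ?thesis by linarith
      qed
      also have "\<dots> = (1 - c * h / 2) * e + h * C1" by (simp add: C1_def algebra_simps)
      also have "\<dots> \<le> (1 - c * h / 2) * E + h * C1" using e h' by (intro add_right_mono mult_left_mono) auto
      also have "\<dots> \<le> E"
      proof -
        have "h * C1 \<le> c * h / 2 * E" using c h by (simp add: E_def algebra_simps)
        then show ?thesis by (simp add: algebra_simps)
      qed
      finally show ?case using es(1) unfolding kh by blast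
    qed
  qed
qed

end

section \<open>A discrete Ito formula\<close>

text \<open>Linear growth of \<open>f1\<close> admits quadratic Lyapunov functions; the bounds on
  \<open>f2\<close> and \<open>f3\<close> make the Taylor remainders uniform in the base
  point.\<close>

locale taylor3 =
  fixes f f1 f2 f3 :: "real \<Rightarrow> real" and L :: real
  assumes d1: "\<And>y. (f has_real_derivative f1 y) (at y)"
    and d2: "\<And>y. (f1 has_real_derivative f2 y) (at y)"
    and d3: "\<And>y. (f2 has_real_derivative f3 y) (at y)"
    and f1_bound: "\<And>y. \<bar>f1 y\<bar> \<le> L * (1 + \<bar>y\<bar>)"
    and f2_bound: "\<And>y. \<bar>f2 y\<bar> \<le> L" and f3_bound: "\<And>y. \<bar>f3 y\<bar> \<le> L"
begin

lemma L_nonneg: "0 \<le> L"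
  using f2_bound[of 0] by linarith

lemma mean_value_bound:
  fixes u u' :: "real \<Rightarrow> real"
  assumes "\<And>r. (u has_real_derivative u' r) (at r)" "u 0 = 0" "\<And>r. \<bar>r\<bar> \<le> \<bar>d\<bar> \<Longrightarrow> \<bar>u' r\<bar> \<le> B"
  shows "\<bar>u d\<bar> \<le> B * \<bar>d\<bar>"
proof -
  have "norm (u d - u 0) \<le> B * norm (d - 0)"
    by (rule field_differentiable_bound[where S="{-\<bar>d\<bar>..\<bar>d\<bar>}" and f'=u'])
       (use assms in \<open>auto intro: has_field_derivative_at_within\<close>)
  then show ?thesis using assms(2) by simp
qed

lemma shift_derivative:
  assumes "\<And>y. (u has_real_derivative u' y) (at y)"
  shows "((\<lambda>r. u (y + r)) has_real_derivative u' (y + r)) (at r)"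
  using DERIV_shift[of u "u' (y + r)" r y] assms[of "y + r"] by (simp add: add.commute)

lemma f1_lipschitz: "\<bar>f1 (y + d) - f1 y\<bar> \<le> L * \<bar>d\<bar>"
  by (rule mean_value_bound[where u="\<lambda>r. f1 (y + r) - f1 y" and u'="\<lambda>r. f2 (y + r)"])
     (use f2_bound in \<open>auto intro!: derivative_eq_intros shift_derivative[OF d2]\<close>)

lemma f2_lipschitz: "\<bar>f2 (y + d) - f2 y\<bar> \<le> L * \<bar>d\<bar>"
  by (rule mean_value_bound[where u="\<lambda>r. f2 (y + r) - f2 y" and u'="\<lambda>r. f3 (y + r)"])
     (use f3_bound in \<open>auto intro!: derivative_eq_intros shift_derivative[OF d3]\<close>)

lemma f_first_order: "\<bar>f (y + d) - f y - f1 y * d\<bar> \<le> L * d\<^sup>2"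
proof -
  have "\<bar>f (y + d) - f y - f1 y * d\<bar> \<le> (L * \<bar>d\<bar>) * \<bar>d\<bar>"
  proof (rule mean_value_bound[where u="\<lambda>r. f (y + r) - f y - f1 y * r" and u'="\<lambda>r. f1 (y + r) - f1 y"])
    fix r
    show "((\<lambda>r. f (y + r) - f y - f1 y * r) has_real_derivative f1 (y + r) - f1 y) (at r)"
      by (auto intro!: derivative_eq_intros shift_derivative[OF d1])
    assume "\<bar>r\<bar> \<le> \<bar>d\<bar>"
    then have "L * \<bar>r\<bar> \<le> L * \<bar>d\<bar>" using L_nonneg by (rule mult_left_mono)
    then show "\<bar>f1 (y + r) - f1 y\<bar> \<le> L * \<bar>d\<bar>" using f1_lipschitz[of y r] by linarith
  qed simp
  then show ?thesis by (simp add: power2_eq_square mult.assoc)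
qed

lemma f_second_order: "\<bar>f (y + d) - f y - f1 y * d - f2 y * d\<^sup>2 / 2\<bar> \<le> L * \<bar>d\<bar> ^ 3"
proof -
  have 1: "\<bar>f1 (y + d) - f1 y - f2 y * d\<bar> \<le> (L * \<bar>d\<bar>) * \<bar>d\<bar>" for d
  proof (rule mean_value_bound[where u="\<lambda>r. f1 (y + r) - f1 y - f2 y * r" and u'="\<lambda>r. f2 (y + r) - f2 y"])
    fix r
    show "((\<lambda>r. f1 (y + r) - f1 y - f2 y * r) has_real_derivative f2 (y + r) - f2 y) (at r)"
      by (auto intro!: derivative_eq_intros shift_derivative[OF d2])
    assume "\<bar>r\<bar> \<le> \<bar>d\<bar>"
    then have "L * \<bar>r\<bar> \<le> L * \<bar>d\<bar>" using L_nonneg by (rule mult_left_mono)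
    then show "\<bar>f2 (y + r) - f2 y\<bar> \<le> L * \<bar>d\<bar>" using f2_lipschitz[of y r] by linarith
  qed simp
  have "\<bar>f (y + d) - f y - f1 y * d - f2 y * d\<^sup>2 / 2\<bar> \<le> (L * \<bar>d\<bar> * \<bar>d\<bar>) * \<bar>d\<bar>"
  proof (rule mean_value_bound[where u="\<lambda>r. f (y + r) - f y - f1 y * r - f2 y * r\<^sup>2 / 2"
        and u'="\<lambda>r. f1 (y + r) - f1 y - f2 y * r"])
    fix r
    show "((\<lambda>r. f (y + r) - f y - f1 y * r - f2 y * r\<^sup>2 / 2) has_real_derivative f1 (y + r) - f1 y - f2 y * r) (at r)"
      by (auto intro!: derivative_eq_intros shift_derivative[OF d1])
    assume "\<bar>r\<bar> \<le> \<bar>d\<bar>"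
    then have "L * \<bar>r\<bar> * \<bar>r\<bar> \<le> L * \<bar>d\<bar> * \<bar>d\<bar>" using L_nonneg by (intro mult_mono) auto
    then show "\<bar>f1 (y + r) - f1 y - f2 y * r\<bar> \<le> L * \<bar>d\<bar> * \<bar>d\<bar>" using 1[of r] by linarith
  qed simp
  then show ?thesis by (simp add: power3_eq_cube mult.assoc)
qed

text \<open>The drift part B is expanded to first order, the noise part S to second order. For B of
  order h and S of order sqrt h, the choice r = sqrt h gives every remainder the order h^(3/2) or
  better.\<close>

lemma step_expansion:
  assumes r: "0 < r"
  shows "\<bar>f (y + (B + S)) - f y - f1 y * B - f1 y * S - f2 y * S\<^sup>2 / 2\<bar>
    \<le> L * (B\<^sup>2 + B\<^sup>2 / r + r * S\<^sup>2 + S ^ 4 / r)"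
proof -
  have am: "\<bar>a\<bar> * \<bar>b\<bar> \<le> r * a\<^sup>2 / 2 + b\<^sup>2 / r / 2" for a b :: real
  proof -
    have "0 \<le> (sqrt r * \<bar>a\<bar> - \<bar>b\<bar> / sqrt r)\<^sup>2" by simp
    also have "\<dots> = r * a\<^sup>2 - 2 * (\<bar>a\<bar> * \<bar>b\<bar>) + b\<^sup>2 / r"
      using r by (simp add: power2_diff power_mult_distrib power_divide)
    finally show ?thesis by simp
  qed
  have "\<bar>f (y + (B + S)) - f y - f1 y * B - f1 y * S - f2 y * S\<^sup>2 / 2\<bar> =
    \<bar>(f ((y + S) + B) - f (y + S) - f1 (y + S) * B) + (f1 (y + S) - f1 y) * B
      + (f (y + S) - f y - f1 y * S - f2 y * S\<^sup>2 / 2)\<bar>"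
    by (simp add: algebra_simps)
  also have "\<dots> \<le> \<bar>f ((y + S) + B) - f (y + S) - f1 (y + S) * B\<bar> + \<bar>(f1 (y + S) - f1 y) * B\<bar>
      + \<bar>f (y + S) - f y - f1 y * S - f2 y * S\<^sup>2 / 2\<bar>" by linarith
  also have "\<dots> \<le> L * B\<^sup>2 + (L * \<bar>S\<bar>) * \<bar>B\<bar> + L * \<bar>S\<bar> ^ 3"
    unfolding abs_mult using f1_lipschitz[of y S]
    by (intro add_mono f_first_order f_second_order mult_right_mono) auto
  also have "\<dots> = L * (B\<^sup>2 + \<bar>S\<bar> * \<bar>B\<bar> + \<bar>S\<bar> * \<bar>S\<^sup>2\<bar>)"
    by (simp add: algebra_simps power3_eq_cube power2_eq_square abs_mult)
  also have "\<dots> \<le> L * (B\<^sup>2 + B\<^sup>2 / r + r * S\<^sup>2 + S ^ 4 / r)"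
  proof (rule mult_left_mono[OF _ L_nonneg])
    have S4: "(S\<^sup>2)\<^sup>2 = S ^ 4" by simp
    have "p + (e / 2 + a / 2) + (e / 2 + c / 2) \<le> p + a + e + c" if "0 \<le> a" "0 \<le> c" for p e a c :: real
      using that by linarith
    from this[of "B\<^sup>2 / r" "S ^ 4 / r" "B\<^sup>2" "r * S\<^sup>2"]
    have "B\<^sup>2 + (r * S\<^sup>2 / 2 + B\<^sup>2 / r / 2) + (r * S\<^sup>2 / 2 + S ^ 4 / r / 2)
      \<le> B\<^sup>2 + B\<^sup>2 / r + r * S\<^sup>2 + S ^ 4 / r" using r by simp
    moreover have "B\<^sup>2 + \<bar>S\<bar> * \<bar>B\<bar> + \<bar>S\<bar> * \<bar>S\<^sup>2\<bar>
      \<le> B\<^sup>2 + (r * S\<^sup>2 / 2 + B\<^sup>2 / r / 2) + (r * S\<^sup>2 / 2 + S ^ 4 / r / 2)"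
      by (intro add_mono order_refl am[of S B] am[of S "S\<^sup>2", unfolded S4])
    ultimately show "B\<^sup>2 + \<bar>S\<bar> * \<bar>B\<bar> + \<bar>S\<bar> * \<bar>S\<^sup>2\<bar> \<le> B\<^sup>2 + B\<^sup>2 / r + r * S\<^sup>2 + S ^ 4 / r"
      by (rule order_trans[rotated])
  qed
  finally show ?thesis .
qed

end

text \<open>Jensen's inequality, read off from the nonnegative variance of |Z|.\<close>

lemma (in prob_space) expectation_abs_le:
  assumes "L2 M Z" "(\<integral>\<omega>. (Z \<omega>)\<^sup>2 \<partial>M) \<le> v"
  shows "(\<integral>\<omega>. \<bar>Z \<omega>\<bar> \<partial>M) \<le> sqrt v"
proof (rule real_le_rsqrt)
  define \<mu> where "\<mu> = (\<integral>\<omega>. \<bar>Z \<omega>\<bar> \<partial>M)"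
  have i: "integrable M (\<lambda>\<omega>. \<bar>Z \<omega>\<bar>)" "integrable M (\<lambda>\<omega>. (Z \<omega>)\<^sup>2)"
    using assms(1) by (auto intro: L2_integrable L2_integrable_square)
  have "0 \<le> (\<integral>\<omega>. (\<bar>Z \<omega>\<bar> - \<mu>)\<^sup>2 \<partial>M)" by simp
  also have "\<dots> = (\<integral>\<omega>. (Z \<omega>)\<^sup>2 - 2 * \<mu> * \<bar>Z \<omega>\<bar> + \<mu>\<^sup>2 \<partial>M)"
    by (simp add: power2_diff algebra_simps)
  also have "\<dots> = (\<integral>\<omega>. (Z \<omega>)\<^sup>2 \<partial>M) - 2 * \<mu> * \<mu> + \<mu>\<^sup>2"
    using i by (simp add: prob_space \<mu>_def)
  finally show "(\<integral>\<omega>. \<bar>Z \<omega>\<bar> \<partial>M)\<^sup>2 \<le> v" using assms(2) by (simp add: \<mu>_def[symmetric] power2_eq_square)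
qed

section \<open>Sums along the observation grid\<close>

locale diffusion_grid = diffusion +
  fixes h0 E :: real
  assumes h0: "0 < h0" "h0 \<le> 1" "c1 * h0 \<le> 1 / 2"
    and grid_moment: "\<And>h k. 0 < h \<Longrightarrow> h \<le> h0 \<Longrightarrow>
      L2 M (X (real k * h)) \<and> (\<integral>\<omega>. (X (real k * h) \<omega>)\<^sup>2 \<partial>M) \<le> E"
begin

definition x where "x h k = X (real k * h)"
definition dB where "dB h k = drift (real k * h) (real k * h + h)"
definition dS where "dS h k = noise (real k * h) (real k * h + h)"
definition dQ where "dQ h k = qvar (real k * h) (real k * h + h)"
definition dG where "dG h k = osc (real k * h) (real k * h + h)"

text \<open>n errors of size h^(3/2), one per step, plus the typical size sqrt(nh) of a martingale
  sum over the horizon nh.\<close>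

definition rate :: "real \<Rightarrow> nat \<Rightarrow> real" where
  "rate h n = real n * (h * sqrt h) + sqrt (real n * h)"

lemma x_Suc: "x h (Suc k) \<omega> = x h k \<omega> + (dB h k \<omega> + dS h k \<omega>)"
proof -
  have "real (Suc k) * h = real k * h + h" by (simp add: algebra_simps)
  then show ?thesis by (simp add: x_def dB_def dS_def noise_def)
qed

lemma grid_mono: "0 < h \<Longrightarrow> mono (\<lambda>k. real k * h)"
  by (auto intro!: monoI)

lemma grid_Suc: "real (Suc k) * h = real k * h + h"
  by (simp add: algebra_simps)

definition CE :: real where "CE = C0 * (1 + E)"

context
  fixes h :: real
  assumes h: "0 < h" "h \<le> h0"
begin

lemma h_props: "h \<le> 1" "c1 * h \<le> 1 / 2" "0 \<le> real k * h" "real k * h \<le> real k * h + h" "0 < sqrt h" "h \<le> sqrt h" "h\<^sup>2 \<le> h * sqrt h"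
proof -
  show *: "h \<le> 1" using h h0 by linarith
  have "c1 * h \<le> c1 * h0" using h c1 by (intro mult_left_mono) auto
  then show "c1 * h \<le> 1 / 2" using h0 by linarith
  show "0 \<le> real k * h" "real k * h \<le> real k * h + h" "0 < sqrt h" using h by auto
  show **: "h \<le> sqrt h" using h * real_le_rsqrt[of h h] by (simp add: power2_eq_square mult_left_le)
  show "h\<^sup>2 \<le> h * sqrt h" using ** h by (simp add: power2_eq_square)
qed

lemma x_L2: "L2 M (x h k)" and x_square: "(\<integral>\<omega>. (x h k \<omega>)\<^sup>2 \<partial>M) \<le> E"
  using grid_moment[OF h, of k] by (auto simp: x_def)

lemma x_adapted: "x h k \<in> borel_measurable (F (real k * h))"
  unfolding x_def by (rule X_adapted) (rule h_props)

lemma E_nonneg: "0 \<le> E"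
  by (rule order_trans[OF _ x_square[of 0]]) simp

lemma CE_nonneg: "0 \<le> CE"
  using C0_nonneg E_nonneg by (simp add: CE_def)

lemma moment_CE:
  assumes "0 \<le> a" shows "C0 * a * (1 + (\<integral>\<omega>. (X (real k * h) \<omega>)\<^sup>2 \<partial>M)) \<le> CE * a"
proof -
  have "C0 * a * (1 + (\<integral>\<omega>. (X (real k * h) \<omega>)\<^sup>2 \<partial>M)) \<le> C0 * a * (1 + E)"
    using x_square[of k] C0_nonneg assms by (intro mult_left_mono) (auto simp: x_def)
  then show ?thesis by (simp add: CE_def ac_simps)
qed

lemma dG_L2: "L2 M (dG h k)" and dG_square: "(\<integral>\<omega>. (dG h k \<omega>)\<^sup>2 \<partial>M) \<le> CE * h ^ 3"
  and dB_L2: "L2 M (dB h k)" and dB_square: "(\<integral>\<omega>. (dB h k \<omega>)\<^sup>2 \<partial>M) \<le> CE * h\<^sup>2"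
proof -
  have LX: "L2 M (X (real k * h))" using x_L2[of k] by (simp add: x_def)
  note od = osc_drift_moment[OF h_props(3) h(1) h_props(1,2) LX]
  show "L2 M (dG h k)" "L2 M (dB h k)" using od by (auto simp: dG_def dB_def)
  show "(\<integral>\<omega>. (dG h k \<omega>)\<^sup>2 \<partial>M) \<le> CE * h ^ 3"
    unfolding dG_def by (rule order_trans[OF od(2) moment_CE]) (use h in simp)
  show "(\<integral>\<omega>. (dB h k \<omega>)\<^sup>2 \<partial>M) \<le> CE * h\<^sup>2"
    unfolding dB_def by (rule order_trans[OF od(4) moment_CE]) simp
qed

lemma dS_L2: "L2 M (dS h k)" and dS_square: "(\<integral>\<omega>. (dS h k \<omega>)\<^sup>2 \<partial>M) \<le> K\<^sup>2 * h"
  and dS_fourth: "integrable M (\<lambda>\<omega>. dS h k \<omega> ^ 4)" "(\<integral>\<omega>. dS h k \<omega> ^ 4 \<partial>M) \<le> 3 * K ^ 4 * h\<^sup>2"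
  unfolding dS_def
  using L2_noise[OF h_props(3,4)] expectation_noise_square_le[OF h_props(3,4)] noise_fourth[OF h_props(3,4)] by auto

lemma dG_nonneg: "0 \<le> dG h k \<omega>"
  by (simp add: dG_def osc_nonneg)

lemma dQ_bounds: "0 \<le> dQ h k \<omega>" "dQ h k \<omega> \<le> K\<^sup>2 * h"
  using qvar_bounds[OF h_props(3,4)] by (auto simp: dQ_def)

lemma dB_abs: "(\<integral>\<omega>. \<bar>dB h k \<omega>\<bar> \<partial>M) \<le> sqrt CE * h"
  using expectation_abs_le[OF dB_L2 dB_square] h by (simp add: real_sqrt_mult)

lemma dG_abs: "(\<integral>\<omega>. dG h k \<omega> \<partial>M) \<le> sqrt CE * (h * sqrt h)"
proof -
  have "sqrt (CE * h ^ 3) = sqrt CE * (h * sqrt h)"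
    using h by (simp add: real_sqrt_mult power3_eq_cube)
  then show ?thesis using expectation_abs_le[OF dG_L2 dG_square] dG_nonneg by simp
qed

text \<open>The weights are controlled in second moment only, because unbounded functions of X_k
  occur as weights, both in the Taylor expansion and in the normal equations.\<close>

lemma weighted_dS_sum:
  assumes \<eta>: "\<And>k. \<eta> k \<in> borel_measurable (F (real k * h))" "\<And>k. L2 M (\<eta> k)" "\<And>k. (\<integral>\<omega>. (\<eta> k \<omega>)\<^sup>2 \<partial>M) \<le> C"
  shows "L2 M (\<lambda>\<omega>. \<Sum>k<n. \<eta> k \<omega> * dS h k \<omega>)"
    and "(\<integral>\<omega>. (\<Sum>k<n. \<eta> k \<omega> * dS h k \<omega>)\<^sup>2 \<partial>M) \<le> K\<^sup>2 * C * (real n * h)"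
proof -
  note w = weighted_noise[OF h_props(3,4) \<eta>(1,2), folded dS_def]
  show "L2 M (\<lambda>\<omega>. \<Sum>k<n. \<eta> k \<omega> * dS h k \<omega>)" by (intro L2_sum w(1))
  have "(\<integral>\<omega>. (\<Sum>k<n. \<eta> k \<omega> * dS h k \<omega>)\<^sup>2 \<partial>M) = (\<Sum>k<n. \<integral>\<omega>. (\<eta> k \<omega> * dS h k \<omega>)\<^sup>2 \<partial>M)"
  proof (rule martingale_difference_sum_square[OF grid_mono[OF h(1)]])
    fix k
    show "L2 M (\<lambda>\<omega>. \<eta> k \<omega> * dS h k \<omega>)" by (rule w(1))
    show "(\<lambda>\<omega>. \<eta> k \<omega> * dS h k \<omega>) \<in> borel_measurable (F (real (Suc k) * h))"
      unfolding grid_Suc dS_def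
      by (intro borel_measurable_times noise_measurable_F h_props measurable_F_mono[OF \<eta>(1)])
    fix A assume A: "A \<in> sets (F (real k * h))"
    then have AM: "A \<in> sets M" using sets_F_subset by blast
    have "(\<lambda>\<omega>. indicator A \<omega> * \<eta> k \<omega>) \<in> borel_measurable (F (real k * h))"
      using A \<eta>(1) by (intro borel_measurable_times) auto
    moreover have "integrable M (\<lambda>\<omega>. indicator A \<omega> * \<eta> k \<omega> * dS h k \<omega>)"
      using integrable_real_mult_indicator[OF AM L2_integrable[OF w(1)]] by (simp add: ac_simps)
    ultimately have "(\<integral>\<omega>. (indicator A \<omega> * \<eta> k \<omega>) * dS h k \<omega> \<partial>M) = 0"
      by (rule noise_orthogonal[OF h_props(3,4), folded dS_def])
    then show "(\<integral>\<omega>. indicator A \<omega> * (\<eta> k \<omega> * dS h k \<omega>) \<partial>M) = 0" by (simp only: mult.assoc)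
  qed
  also have "\<dots> \<le> (\<Sum>k<n. K\<^sup>2 * h * C)"
  proof (rule sum_mono)
    fix k
    have "K\<^sup>2 * h * (\<integral>\<omega>. (\<eta> k \<omega>)\<^sup>2 \<partial>M) \<le> K\<^sup>2 * h * C" using h \<eta>(3) by (intro mult_left_mono) auto
    then show "(\<integral>\<omega>. (\<eta> k \<omega> * dS h k \<omega>)\<^sup>2 \<partial>M) \<le> K\<^sup>2 * h * C" using w(2)[of k] by simp
  qed
  finally show "(\<integral>\<omega>. (\<Sum>k<n. \<eta> k \<omega> * dS h k \<omega>)\<^sup>2 \<partial>M) \<le> K\<^sup>2 * C * (real n * h)" by (simp add: ac_simps)
qed

text \<open>The martingale differences have variance of order h^2; the sum is bounded by the cruder
  order nh, which already fits \<open>rate\<close>.\<close>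

lemma weighted_compensated_sum:
  assumes \<eta>: "\<And>k. \<eta> k \<in> borel_measurable (F (real k * h))" "\<And>k \<omega>. \<bar>\<eta> k \<omega>\<bar> \<le> C"
  shows "L2 M (\<lambda>\<omega>. \<Sum>k<n. \<eta> k \<omega> * ((dS h k \<omega>)\<^sup>2 - dQ h k \<omega>))"
    and "(\<integral>\<omega>. (\<Sum>k<n. \<eta> k \<omega> * ((dS h k \<omega>)\<^sup>2 - dQ h k \<omega>))\<^sup>2 \<partial>M) \<le> 8 * C\<^sup>2 * K ^ 4 * (real n * h)"
proof -
  define V where "V k \<omega> = (dS h k \<omega>)\<^sup>2 - dQ h k \<omega>" for k \<omega>
  have V: "L2 M (V k)" "(\<integral>\<omega>. (V k \<omega>)\<^sup>2 \<partial>M) \<le> 8 * K ^ 4 * h\<^sup>2" "V k \<in> borel_measurable (F (real (Suc k) * h))"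
    "\<And>A. A \<in> sets (F (real k * h)) \<Longrightarrow> (\<integral>\<omega>. indicator A \<omega> * V k \<omega> \<partial>M) = 0" for k
    using compensated_square[OF h_props(3,4)[of k]] unfolding V_def[abs_def] dS_def dQ_def grid_Suc by auto
  have L: "L2 M (\<lambda>\<omega>. \<eta> k \<omega> * V k \<omega>)" for k
    by (rule L2_mult_bounded[OF V(1) measurable_F_M[OF \<eta>(1)] \<eta>(2)])
  show "L2 M (\<lambda>\<omega>. \<Sum>k<n. \<eta> k \<omega> * ((dS h k \<omega>)\<^sup>2 - dQ h k \<omega>))"
    using L2_sum[OF L, where I="{..<n}"] by (simp add: V_def)
  have "(\<integral>\<omega>. (\<Sum>k<n. \<eta> k \<omega> * V k \<omega>)\<^sup>2 \<partial>M) = (\<Sum>k<n. \<integral>\<omega>. (\<eta> k \<omega> * V k \<omega>)\<^sup>2 \<partial>M)"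
  proof (rule martingale_difference_sum_square[OF grid_mono[OF h(1)] L])
    fix k
    show "(\<lambda>\<omega>. \<eta> k \<omega> * V k \<omega>) \<in> borel_measurable (F (real (Suc k) * h))"
      by (intro borel_measurable_times V measurable_F_mono[OF \<eta>(1)]) (simp only: grid_Suc h_props(4))
    fix A assume A: "A \<in> sets (F (real k * h))"
    then have AM: "A \<in> sets M" using sets_F_subset by blast
    have m: "(\<lambda>\<omega>. indicator A \<omega> * \<eta> k \<omega>) \<in> borel_measurable (F (real k * h))"
      using A \<eta>(1) by (intro borel_measurable_times) auto
    have i: "integrable M (\<lambda>\<omega>. indicator A \<omega> * \<eta> k \<omega> * V k \<omega>)"
      using integrable_real_mult_indicator[OF AM L2_integrable[OF L]] by (simp add: ac_simps)
    have z: "\<And>A. A \<in> sets (F (real k * h)) \<Longrightarrow> (\<integral>\<omega>. indicator A \<omega> * V k \<omega> \<partial>M) = 0"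
      by (rule V(4))
    have "(\<integral>\<omega>. (indicator A \<omega> * \<eta> k \<omega>) * V k \<omega> \<partial>M) = 0"
      by (rule orthogonal_of_indicator[OF L2_integrable[OF V(1)] z m i])
    then show "(\<integral>\<omega>. indicator A \<omega> * (\<eta> k \<omega> * V k \<omega>) \<partial>M) = 0" by (simp only: mult.assoc)
  qed
  also have "\<dots> \<le> (\<Sum>k<n. C\<^sup>2 * (8 * K ^ 4 * h\<^sup>2))"
  proof (rule sum_mono)
    fix k
    have "(\<integral>\<omega>. (\<eta> k \<omega> * V k \<omega>)\<^sup>2 \<partial>M) \<le> (\<integral>\<omega>. C\<^sup>2 * (V k \<omega>)\<^sup>2 \<partial>M)"
    proof (rule integral_mono)
      show "integrable M (\<lambda>\<omega>. (\<eta> k \<omega> * V k \<omega>)\<^sup>2)" using L by (simp add: L2_def)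
      show "integrable M (\<lambda>\<omega>. C\<^sup>2 * (V k \<omega>)\<^sup>2)" using V(1)[of k] by (simp add: L2_def)
      fix \<omega>
      have "(\<eta> k \<omega>)\<^sup>2 \<le> C\<^sup>2" using power_mono[OF \<eta>(2)[of k \<omega>], of 2] by simp
      then show "(\<eta> k \<omega> * V k \<omega>)\<^sup>2 \<le> C\<^sup>2 * (V k \<omega>)\<^sup>2" by (simp add: power_mult_distrib mult_right_mono)
    qed
    also have "\<dots> \<le> C\<^sup>2 * (8 * K ^ 4 * h\<^sup>2)" using V(2) by (simp add: mult_left_mono)
    finally show "(\<integral>\<omega>. (\<eta> k \<omega> * V k \<omega>)\<^sup>2 \<partial>M) \<le> C\<^sup>2 * (8 * K ^ 4 * h\<^sup>2)" .
  qed
  also have "\<dots> = 8 * C\<^sup>2 * K ^ 4 * (real n * h\<^sup>2)" by (simp add: ac_simps)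
  also have "\<dots> \<le> 8 * C\<^sup>2 * K ^ 4 * (real n * h)"
    using h h_props(1) by (intro mult_left_mono) (auto simp: power2_eq_square mult_left_le)
  finally show "(\<integral>\<omega>. (\<Sum>k<n. \<eta> k \<omega> * ((dS h k \<omega>)\<^sup>2 - dQ h k \<omega>))\<^sup>2 \<partial>M) \<le> 8 * C\<^sup>2 * K ^ 4 * (real n * h)"
    by (simp add: V_def)
qed

end

text \<open>What remains of an increment of f after the drift and bracket terms: a martingale part,
  compensated squares and Taylor remainders. The bracket enters as the true \<open>dQ\<close>, so a
  path may cross thresholds within a step.\<close>

definition ito_rest :: "(real \<Rightarrow> real) \<Rightarrow> (real \<Rightarrow> real) \<Rightarrow> (real \<Rightarrow> real) \<Rightarrow> real \<Rightarrow> nat \<Rightarrow> 'a \<Rightarrow> real" where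
  "ito_rest f f1 f2 h n \<omega> = f (x h n \<omega>) - f (x h 0 \<omega>)
     - (\<Sum>k<n. f1 (x h k \<omega>) * dB h k \<omega> + f2 (x h k \<omega>) * dQ h k \<omega> / 2)"

text \<open>The parts \<open>rem\<close>, \<open>mar\<close> and \<open>com\<close> have mean
  absolute values of order n h^(3/2), sqrt(nh) and sqrt(nh). The constant depends on f, but not on h
  or n.\<close>

theorem discrete_ito:
  assumes "taylor3 f f1 f2 f3 L"
  obtains D where "0 \<le> D" "\<And>h n. 0 < h \<Longrightarrow> h \<le> h0 \<Longrightarrow> integrable M (ito_rest f f1 f2 h n)"
    "\<And>h n. 0 < h \<Longrightarrow> h \<le> h0 \<Longrightarrow> (\<integral>\<omega>. \<bar>ito_rest f f1 f2 h n \<omega>\<bar> \<partial>M) \<le> D * rate h n"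
proof -
  interpret taylor3 f f1 f2 f3 L by fact
  have f1_borel: "f1 \<in> borel_measurable borel" and f2_borel: "f2 \<in> borel_measurable borel" and f_borel: "f \<in> borel_measurable borel"
    using DERIV_isCont[OF d1] DERIV_isCont[OF d2] DERIV_isCont[OF d3]
    by (auto intro!: borel_measurable_continuous_onI continuous_at_imp_continuous_on)
  define D1 where "D1 = L * (2 * CE + K\<^sup>2 + 3 * K ^ 4)"
  define D2 where "D2 = sqrt (K\<^sup>2 * (L\<^sup>2 * (2 + 2 * E)))"
  define D3 where "D3 = sqrt (8 * (L / 2)\<^sup>2 * K ^ 4)"
  \<comment> \<open>Nonnegativity of \<open>D1\<close> is carried along because that of
    \<open>CE\<close> is established under an admissible step size.\<close>
  have main: "integrable M (ito_rest f f1 f2 h n) \<and> (\<integral>\<omega>. \<bar>ito_rest f f1 f2 h n \<omega>\<bar> \<partial>M) \<le> (D1 + D2 + D3) * rate h n \<and> 0 \<le> D1"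
    if h: "0 < h" "h \<le> h0" for h n
  proof -
    note hp = h_props[OF h]
    define rem where "rem k \<omega> = f (x h (Suc k) \<omega>) - f (x h k \<omega>) - f1 (x h k \<omega>) * dB h k \<omega> - f1 (x h k \<omega>) * dS h k \<omega>
       - f2 (x h k \<omega>) * (dS h k \<omega>)\<^sup>2 / 2" for k \<omega>
    define mar where "mar \<omega> = (\<Sum>k<n. f1 (x h k \<omega>) * dS h k \<omega>)" for \<omega>
    define com where "com \<omega> = (\<Sum>k<n. f2 (x h k \<omega>) / 2 * ((dS h k \<omega>)\<^sup>2 - dQ h k \<omega>))" for \<omega>
    have D10: "0 \<le> D1" using L_nonneg CE_nonneg[OF h] by (simp add: D1_def)
    have xm: "x h k \<in> borel_measurable M" for k by (rule L2_measurable[OF x_L2[OF h]])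
    have split: "ito_rest f f1 f2 h n \<omega> = (\<Sum>k<n. rem k \<omega>) + mar \<omega> + com \<omega>" for \<omega>
    proof -
      have "f (x h n \<omega>) - f (x h 0 \<omega>) = (\<Sum>k<n. f (x h (Suc k) \<omega>) - f (x h k \<omega>))"
        by (rule sum_lessThan_telescope[symmetric])
      then show ?thesis
        unfolding ito_rest_def mar_def com_def rem_def
        by (simp only: sum_subtractf[symmetric] sum.distrib[symmetric]) (intro sum.cong refl, simp add: field_simps)
    qed
    have rem: "integrable M (rem k) \<and> (\<integral>\<omega>. \<bar>rem k \<omega>\<bar> \<partial>M) \<le> D1 * (h * sqrt h)" for k
    proof -
      let ?b = "\<lambda>\<omega>. L * ((dB h k \<omega>)\<^sup>2 + (dB h k \<omega>)\<^sup>2 / sqrt h + sqrt h * (dS h k \<omega>)\<^sup>2 + dS h k \<omega> ^ 4 / sqrt h)"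
      have i: "integrable M (\<lambda>\<omega>. (dB h k \<omega>)\<^sup>2)" "integrable M (\<lambda>\<omega>. (dS h k \<omega>)\<^sup>2)" "integrable M (\<lambda>\<omega>. dS h k \<omega> ^ 4)"
        using dB_L2[OF h] dS_L2[OF h] dS_fourth(1)[OF h] by (auto simp: L2_def)
      have ib: "integrable M ?b" using i by auto
      have le: "\<bar>rem k \<omega>\<bar> \<le> ?b \<omega>" for \<omega>
        unfolding rem_def x_Suc by (rule step_expansion[OF hp(5)])
      have m: "rem k \<in> borel_measurable M"
        unfolding rem_def[abs_def]
        by (intro borel_measurable_diff borel_measurable_times borel_measurable_divide borel_measurable_power borel_measurable_const
            measurable_compose[OF xm f_borel] measurable_compose[OF xm f1_borel] measurable_compose[OF xm f2_borel]
            L2_measurable[OF dB_L2[OF h]] L2_measurable[OF dS_L2[OF h]])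
      have ir: "integrable M (rem k)"
        by (rule Bochner_Integration.integrable_bound[OF ib m]) (use le in \<open>auto intro!: AE_I2 order_trans[OF _ abs_ge_self]\<close>)
      have "(\<integral>\<omega>. \<bar>rem k \<omega>\<bar> \<partial>M) \<le> (\<integral>\<omega>. ?b \<omega> \<partial>M)"
        using ir ib le by (intro integral_mono) auto
      also have "\<dots> = L * ((\<integral>\<omega>. (dB h k \<omega>)\<^sup>2 \<partial>M) + (\<integral>\<omega>. (dB h k \<omega>)\<^sup>2 \<partial>M) / sqrt h + sqrt h * (\<integral>\<omega>. (dS h k \<omega>)\<^sup>2 \<partial>M)
           + (\<integral>\<omega>. dS h k \<omega> ^ 4 \<partial>M) / sqrt h)"
        using i by simp
      also have "\<dots> \<le> L * (CE * (h * sqrt h) + CE * (h * sqrt h) + K\<^sup>2 * (h * sqrt h) + 3 * K ^ 4 * (h * sqrt h))"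
      proof (intro mult_left_mono add_mono L_nonneg)
        have hh: "h\<^sup>2 / sqrt h = h * sqrt h" using h by (simp add: power2_eq_square field_simps)
        show "(\<integral>\<omega>. (dB h k \<omega>)\<^sup>2 \<partial>M) \<le> CE * (h * sqrt h)"
          using dB_square[OF h, of k] mult_left_mono[OF hp(7) CE_nonneg[OF h]] by linarith
        have "(\<integral>\<omega>. (dB h k \<omega>)\<^sup>2 \<partial>M) / sqrt h \<le> CE * h\<^sup>2 / sqrt h"
          using dB_square[OF h, of k] hp(5) by (intro divide_right_mono) auto
        then show "(\<integral>\<omega>. (dB h k \<omega>)\<^sup>2 \<partial>M) / sqrt h \<le> CE * (h * sqrt h)"
          by (simp only: times_divide_eq_right[symmetric] hh)
        have "sqrt h * (\<integral>\<omega>. (dS h k \<omega>)\<^sup>2 \<partial>M) \<le> sqrt h * (K\<^sup>2 * h)"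
          using dS_square[OF h, of k] hp(5) by (intro mult_left_mono) auto
        then show "sqrt h * (\<integral>\<omega>. (dS h k \<omega>)\<^sup>2 \<partial>M) \<le> K\<^sup>2 * (h * sqrt h)" by (simp only: ac_simps)
        have "(\<integral>\<omega>. dS h k \<omega> ^ 4 \<partial>M) / sqrt h \<le> 3 * K ^ 4 * h\<^sup>2 / sqrt h"
          using dS_fourth(2)[OF h, of k] hp(5) by (intro divide_right_mono) auto
        then show "(\<integral>\<omega>. dS h k \<omega> ^ 4 \<partial>M) / sqrt h \<le> 3 * K ^ 4 * (h * sqrt h)"
          by (simp only: times_divide_eq_right[symmetric] hh)
      qed
      also have "\<dots> = D1 * (h * sqrt h)" by (simp add: D1_def algebra_simps)
      finally show ?thesis using ir by blast
    qed
    have f1x: "(\<lambda>\<omega>. f1 (x h k \<omega>)) \<in> borel_measurable (F (real k * h))" "(\<lambda>\<omega>. f2 (x h k \<omega>) / 2) \<in> borel_measurable (F (real k * h))" for k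
      using measurable_compose[OF x_adapted[OF h] f1_borel] measurable_compose[OF x_adapted[OF h] f2_borel] by auto
    have f1sq: "(f1 y)\<^sup>2 \<le> L\<^sup>2 * (2 + 2 * y\<^sup>2)" for y
    proof -
      have "\<bar>f1 y\<bar>\<^sup>2 \<le> (L * (1 + \<bar>y\<bar>))\<^sup>2" using f1_bound by (rule power_mono) simp
      also have "\<dots> \<le> L\<^sup>2 * (2 + 2 * y\<^sup>2)"
        using square_add_le[of 1 "\<bar>y\<bar>"] by (simp add: power_mult_distrib mult_left_mono)
      finally show ?thesis by simp
    qed
    have f1L2: "L2 M (\<lambda>\<omega>. f1 (x h k \<omega>))" for k
    proof (rule L2_bound)
      show "L2 M (\<lambda>\<omega>. L * (1 + \<bar>x h k \<omega>\<bar>))" by (intro L2_cmult L2_add L2_const L2_abs x_L2 h)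
      show "\<bar>f1 (x h k \<omega>)\<bar> \<le> \<bar>L * (1 + \<bar>x h k \<omega>\<bar>)\<bar>" for \<omega>
        using f1_bound[of "x h k \<omega>"] by linarith
    qed (rule measurable_F_M[OF f1x(1)])
    have f1E: "(\<integral>\<omega>. (f1 (x h k \<omega>))\<^sup>2 \<partial>M) \<le> L\<^sup>2 * (2 + 2 * E)" for k
    proof -
      have ix: "integrable M (\<lambda>\<omega>. (x h k \<omega>)\<^sup>2)" by (rule L2_integrable_square[OF x_L2[OF h]])
      have "(\<integral>\<omega>. (f1 (x h k \<omega>))\<^sup>2 \<partial>M) \<le> (\<integral>\<omega>. L\<^sup>2 * (2 + 2 * (x h k \<omega>)\<^sup>2) \<partial>M)"
        using ix f1sq f1L2[of k] by (intro integral_mono) (auto simp: L2_def)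
      also have "\<dots> = L\<^sup>2 * (2 + 2 * (\<integral>\<omega>. (x h k \<omega>)\<^sup>2 \<partial>M))" using ix by (simp add: prob_space)
      also have "\<dots> \<le> L\<^sup>2 * (2 + 2 * E)" using x_square[OF h, of k] by (intro mult_left_mono) auto
      finally show ?thesis .
    qed
    note mar2 = weighted_dS_sum[OF h f1x(1) f1L2 f1E, of n, folded mar_def]
    have "(\<integral>\<omega>. \<bar>mar \<omega>\<bar> \<partial>M) \<le> sqrt (K\<^sup>2 * (L\<^sup>2 * (2 + 2 * E)) * (real n * h))"
      by (rule expectation_abs_le[OF mar2])
    then have mar: "integrable M mar" "(\<integral>\<omega>. \<bar>mar \<omega>\<bar> \<partial>M) \<le> D2 * sqrt (real n * h)"
      using L2_integrable[OF mar2(1)] unfolding D2_def by (auto simp: real_sqrt_mult)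
    have f2h: "\<bar>f2 (x h k \<omega>) / 2\<bar> \<le> L / 2" for k \<omega> using f2_bound[of "x h k \<omega>"] by simp
    note com2 = weighted_compensated_sum[OF h f1x(2) f2h, of n, folded com_def]
    have "(\<integral>\<omega>. \<bar>com \<omega>\<bar> \<partial>M) \<le> sqrt (8 * (L / 2)\<^sup>2 * K ^ 4 * (real n * h))"
      by (rule expectation_abs_le[OF com2])
    then have com: "integrable M com" "(\<integral>\<omega>. \<bar>com \<omega>\<bar> \<partial>M) \<le> D3 * sqrt (real n * h)"
      using L2_integrable[OF com2(1)] unfolding D3_def real_sqrt_mult by (auto simp: real_sqrt_mult)
    have ir: "integrable M (rem k)" "integrable M (\<lambda>\<omega>. \<bar>rem k \<omega>\<bar>)" for k using rem[of k] by auto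
    have int: "integrable M (ito_rest f f1 f2 h n)"
      unfolding split[abs_def] using ir mar com by auto
    have "(\<integral>\<omega>. \<bar>ito_rest f f1 f2 h n \<omega>\<bar> \<partial>M) \<le> (\<integral>\<omega>. (\<Sum>k<n. \<bar>rem k \<omega>\<bar>) + \<bar>mar \<omega>\<bar> + \<bar>com \<omega>\<bar> \<partial>M)"
    proof (rule integral_mono)
      show "integrable M (\<lambda>\<omega>. (\<Sum>k<n. \<bar>rem k \<omega>\<bar>) + \<bar>mar \<omega>\<bar> + \<bar>com \<omega>\<bar>)" using ir mar com by auto
      show "integrable M (\<lambda>\<omega>. \<bar>ito_rest f f1 f2 h n \<omega>\<bar>)" using int by auto
      fix \<omega>
      show "\<bar>ito_rest f f1 f2 h n \<omega>\<bar> \<le> (\<Sum>k<n. \<bar>rem k \<omega>\<bar>) + \<bar>mar \<omega>\<bar> + \<bar>com \<omega>\<bar>"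
        using sum_abs[of "\<lambda>k. rem k \<omega>" "{..<n}"] unfolding split by linarith
    qed
    also have "\<dots> = (\<Sum>k<n. \<integral>\<omega>. \<bar>rem k \<omega>\<bar> \<partial>M) + (\<integral>\<omega>. \<bar>mar \<omega>\<bar> \<partial>M) + (\<integral>\<omega>. \<bar>com \<omega>\<bar> \<partial>M)"
      using ir mar com by simp
    also have "\<dots> \<le> (\<Sum>k<n. D1 * (h * sqrt h)) + D2 * sqrt (real n * h) + D3 * sqrt (real n * h)"
      using rem mar com by (intro add_mono sum_mono) auto
    also have "\<dots> \<le> (D1 + D2 + D3) * rate h n"
    proof -
      have p: "0 \<le> D2" "0 \<le> D3" "0 \<le> real n * (h * sqrt h)" "0 \<le> sqrt (real n * h)"
        using h E_nonneg[OF h] by (auto simp: D2_def D3_def)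
      have "(D1 + D2 + D3) * rate h n = D1 * (real n * (h * sqrt h)) + D2 * sqrt (real n * h) + D3 * sqrt (real n * h)
        + (D1 * sqrt (real n * h) + (D2 + D3) * (real n * (h * sqrt h)))"
        by (simp add: rate_def algebra_simps)
      moreover have "0 \<le> D1 * sqrt (real n * h) + (D2 + D3) * (real n * (h * sqrt h))" using p D10 by auto
      ultimately show ?thesis by (simp add: ac_simps)
    qed
    finally show ?thesis using int D10 by blast
  qed
  show ?thesis
  proof (rule that[of "D1 + D2 + D3"])
    show "0 \<le> D1 + D2 + D3" using main[OF h0(1) order_refl] E_nonneg[OF h0(1) order_refl] by (simp add: D2_def D3_def)
  qed (use main in blast)+
qed

end

section \<open>Occupation of intervals\<close>

text \<open>The terms are those of the generator of the Lyapunov function. At moderate distance the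
  Gaussian part is to win, far away the quadratic drift. The factor \<kappa>^2/4 is \<kappa>^2/2
  from ellipticity times the half that is kept in 1 - l z^2 <= - l z^2 / 2.\<close>

lemma drift_condition:
  fixes B c K \<kappa> \<delta> :: real
  assumes B: "0 \<le> B" and c: "0 < c" and \<kappa>: "0 < \<kappa>" and \<delta>: "0 < \<delta>"
  obtains l A where "0 < l" "0 < A" "2 \<le> l * \<delta>\<^sup>2"
    "\<And>z. \<delta> \<le> \<bar>z\<bar> \<Longrightarrow> (1 + A * l * exp (- (l * z\<^sup>2 / 2))) * (B * \<bar>z\<bar> - c * z\<^sup>2) + K\<^sup>2 / 2
       - \<kappa>\<^sup>2 / 4 * (A * l\<^sup>2 * z\<^sup>2 * exp (- (l * z\<^sup>2 / 2))) \<le> - 1"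
proof -
  \<comment> \<open>The first entry gives 2 <= l \<delta>^2, hence 1 - l z^2 <= - l z^2 / 2 for |z|
    >= \<delta>. The second makes the bracket multiplied by the Gaussian weight at most
    -\<delta>.\<close>
  define l where "l = max (2 / \<delta>\<^sup>2) (4 * (B + 1) / (\<kappa>\<^sup>2 * \<delta>))"
  have "0 < 2 / \<delta>\<^sup>2" using \<delta> by simp
  then have l: "0 < l" by (simp add: l_def less_max_iff_disj)
  have l1: "2 \<le> l * \<delta>\<^sup>2"
  proof -
    have "2 / \<delta>\<^sup>2 \<le> l" by (simp add: l_def)
    then show ?thesis using \<delta> by (simp add: pos_divide_le_eq)
  qed
  have l2: "B + 1 \<le> \<kappa>\<^sup>2 / 4 * l * \<delta>"
  proof -
    have "4 * (B + 1) / (\<kappa>\<^sup>2 * \<delta>) \<le> l" by (simp add: l_def)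
    then have "4 * (B + 1) \<le> l * (\<kappa>\<^sup>2 * \<delta>)" using \<kappa> \<delta> by (simp add: pos_divide_le_eq)
    then show ?thesis by (simp add: ac_simps)
  qed
  \<comment> \<open>For |z| >= Z the dissipation alone outweighs the linear term and K^2/2 by at
    least 1.\<close>
  define Z where "Z = (B + K\<^sup>2 / 2 + 1) / c + 1"
  have Z: "1 \<le> Z" using B c by (simp add: Z_def)
  have cZ: "c * Z = B + K\<^sup>2 / 2 + 1 + c" using c by (simp add: Z_def field_simps)
  define e where "e z = exp (- (l * z\<^sup>2 / 2))" for z
  \<comment> \<open>Calibrated at |z| = Z, where the Gaussian weight is smallest on the inner range,
    so that A l \<delta> e(z) pays there for B Z + K^2/2 + 1.\<close>
  define A where "A = (B * Z + K\<^sup>2 / 2 + 1) / (l * \<delta> * e Z)"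
  have BZ: "0 \<le> B * Z" using B Z by simp
  have eZ: "0 < e Z" by (simp add: e_def)
  have A: "0 < A" using BZ l \<delta> eZ by (simp add: A_def add_nonneg_pos)
  have main: "(1 + A * l * e z) * (B * \<bar>z\<bar> - c * z\<^sup>2) + K\<^sup>2 / 2 - \<kappa>\<^sup>2 / 4 * (A * l\<^sup>2 * z\<^sup>2 * e z) \<le> - 1"
    if z: "\<delta> \<le> \<bar>z\<bar>" for z
  proof -
    have zz: "z\<^sup>2 = \<bar>z\<bar> * \<bar>z\<bar>" by (simp add: power2_eq_square)
    have e0: "0 < e z" by (simp add: e_def)
    have "\<delta> * \<bar>z\<bar> \<le> z\<^sup>2" unfolding zz using z by (intro mult_right_mono) auto
    then have "\<kappa>\<^sup>2 / 4 * l * (\<delta> * \<bar>z\<bar>) \<le> \<kappa>\<^sup>2 / 4 * l * z\<^sup>2" using l by (intro mult_left_mono) auto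
    moreover have "(B + 1) * \<bar>z\<bar> \<le> \<kappa>\<^sup>2 / 4 * l * \<delta> * \<bar>z\<bar>" using l2 by (intro mult_right_mono) auto
    moreover have "0 \<le> c * z\<^sup>2" using c by simp
    ultimately have br: "B * \<bar>z\<bar> - c * z\<^sup>2 - \<kappa>\<^sup>2 / 4 * l * z\<^sup>2 \<le> - \<delta>"
      using z by (simp add: algebra_simps)
    have Al: "0 \<le> A * l * e z" using A l e0 by simp
    have "(1 + A * l * e z) * (B * \<bar>z\<bar> - c * z\<^sup>2) + K\<^sup>2 / 2 - \<kappa>\<^sup>2 / 4 * (A * l\<^sup>2 * z\<^sup>2 * e z)
      = (B * \<bar>z\<bar> - c * z\<^sup>2 + K\<^sup>2 / 2) + A * l * e z * (B * \<bar>z\<bar> - c * z\<^sup>2 - \<kappa>\<^sup>2 / 4 * l * z\<^sup>2)"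
      by (simp add: algebra_simps power2_eq_square)
    also have "\<dots> \<le> (B * \<bar>z\<bar> - c * z\<^sup>2 + K\<^sup>2 / 2) + A * l * e z * (- \<delta>)"
      using br Al by (intro add_left_mono mult_left_mono)
    also have "\<dots> \<le> - 1"
    proof (cases "Z \<le> \<bar>z\<bar>")
      case True
      then have "c * Z * \<bar>z\<bar> \<le> c * z\<^sup>2"
        unfolding zz mult.assoc using c Z by (intro mult_left_mono mult_right_mono) auto
      then have "B * \<bar>z\<bar> + (K\<^sup>2 / 2 + 1 + c) * \<bar>z\<bar> \<le> c * z\<^sup>2" unfolding cZ by (simp add: algebra_simps)
      moreover have "(K\<^sup>2 / 2 + 1 + c) * 1 \<le> (K\<^sup>2 / 2 + 1 + c) * \<bar>z\<bar>" using True Z c by (intro mult_left_mono) auto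
      moreover have "0 \<le> A * l * e z * \<delta>" using Al \<delta> by simp
      ultimately show ?thesis using c by simp
    next
      case False
      then have "z\<^sup>2 \<le> Z\<^sup>2" by (simp add: abs_le_square_iff[symmetric])
      then have "l * z\<^sup>2 / 2 \<le> l * Z\<^sup>2 / 2" using l by (intro divide_right_mono mult_left_mono) auto
      then have "e Z \<le> e z" by (simp add: e_def)
      then have "A * l * \<delta> * e Z \<le> A * l * \<delta> * e z" using A l \<delta> by (intro mult_left_mono) auto
      moreover have "A * l * \<delta> * e Z = B * Z + K\<^sup>2 / 2 + 1" using l \<delta> eZ by (simp add: A_def)
      moreover have "B * \<bar>z\<bar> \<le> B * Z" using False B by (intro mult_left_mono) auto
      moreover have "0 \<le> c * z\<^sup>2" using c by simp
      ultimately show ?thesis by (simp add: algebra_simps)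
    qed
    finally show ?thesis .
  qed
  show ?thesis by (rule that[of l A]) (use l A l1 main in \<open>auto simp: e_def\<close>)
qed

text \<open>With q = l (y - \<rho>)^2 / 2, the derivatives of the Gaussian part are controlled by q
  exp(-q) <= 1 and q^2 exp(-q) <= 2.\<close>

lemma gaussian_test_function:
  fixes l A \<rho> :: real
  assumes l: "0 < l" and A: "0 < A"
  defines "e \<equiv> \<lambda>y. exp (- (l * (y - \<rho>)\<^sup>2 / 2))"
  obtains L where "taylor3 (\<lambda>y. (y - \<rho>)\<^sup>2 / 2 - A * e y) (\<lambda>y. (y - \<rho>) * (1 + A * l * e y))
     (\<lambda>y. 1 + A * l * (1 - l * (y - \<rho>)\<^sup>2) * e y) (\<lambda>y. - (A * l\<^sup>2 * (y - \<rho>) * (3 - l * (y - \<rho>)\<^sup>2) * e y)) L"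
proof -
  define L1 where "L1 = (1 + A * l) * (1 + \<bar>\<rho>\<bar>)"
  define L2 where "L2 = 1 + 3 * (A * l)"
  define L3 where "L3 = A * l\<^sup>2 * (5 + 14 / l)"
  have L: "0 \<le> L1" "0 \<le> L2" "0 \<le> L3" using l A by (auto simp: L1_def L2_def L3_def add_nonneg_nonneg)
  have e: "0 < e y" "e y \<le> 1" for y using l by (auto simp: e_def)
  have q1: "l * (y - \<rho>)\<^sup>2 * e y \<le> 2" for y
  proof -
    define q where "q = l * (y - \<rho>)\<^sup>2 / 2"
    have "q \<le> exp q" using exp_ge_add_one_self[of q] by linarith
    then have "q * exp (- q) \<le> 1" by (simp add: exp_minus field_simps)
    then show ?thesis by (simp add: e_def q_def)
  qed
  have q2: "(l * (y - \<rho>)\<^sup>2)\<^sup>2 * e y \<le> 8" for y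
  proof -
    define q where "q = l * (y - \<rho>)\<^sup>2 / 2"
    have q0: "0 \<le> q" using l by (simp add: q_def)
    have "q\<^sup>2 / 2 \<le> exp q" using exp_lower_Taylor_quadratic[OF q0] q0 by linarith
    then have "q\<^sup>2 * exp (- q) \<le> 2" by (simp add: exp_minus field_simps)
    then show ?thesis by (simp add: e_def q_def power_divide power_mult_distrib)
  qed
  have ed: "(e has_real_derivative - (l * (y - \<rho>) * e y)) (at y)" for y
    unfolding e_def by (auto intro!: derivative_eq_intros)
  show ?thesis
  proof (rule that[of "L1 + L2 + L3"], unfold_locales)
    fix y
    show "((\<lambda>y. (y - \<rho>)\<^sup>2 / 2 - A * e y) has_real_derivative (y - \<rho>) * (1 + A * l * e y)) (at y)"
      by (auto intro!: derivative_eq_intros ed simp: field_simps)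
    show "((\<lambda>y. (y - \<rho>) * (1 + A * l * e y)) has_real_derivative 1 + A * l * (1 - l * (y - \<rho>)\<^sup>2) * e y) (at y)"
      by (auto intro!: derivative_eq_intros ed simp: algebra_simps power2_eq_square)
    show "((\<lambda>y. 1 + A * l * (1 - l * (y - \<rho>)\<^sup>2) * e y) has_real_derivative
        - (A * l\<^sup>2 * (y - \<rho>) * (3 - l * (y - \<rho>)\<^sup>2) * e y)) (at y)"
      by (auto intro!: derivative_eq_intros ed simp: algebra_simps power2_eq_square)
    show "\<bar>(y - \<rho>) * (1 + A * l * e y)\<bar> \<le> (L1 + L2 + L3) * (1 + \<bar>y\<bar>)"
    proof -
      have "\<bar>(y - \<rho>) * (1 + A * l * e y)\<bar> = \<bar>y - \<rho>\<bar> * (1 + A * l * e y)"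
        using l A e[of y] by (simp add: abs_mult abs_of_nonneg add_nonneg_nonneg)
      also have "\<dots> \<le> ((1 + \<bar>\<rho>\<bar>) * (1 + \<bar>y\<bar>)) * (1 + A * l)"
      proof (rule mult_mono)
        have "\<bar>y - \<rho>\<bar> \<le> \<bar>y\<bar> + \<bar>\<rho>\<bar>" by linarith
        also have "\<dots> \<le> (1 + \<bar>\<rho>\<bar>) * (1 + \<bar>y\<bar>)" by (simp add: algebra_simps)
        finally show "\<bar>y - \<rho>\<bar> \<le> (1 + \<bar>\<rho>\<bar>) * (1 + \<bar>y\<bar>)" .
        show "1 + A * l * e y \<le> 1 + A * l" using l A e[of y] by (simp add: mult_left_le)
      qed (use l A e[of y] in \<open>auto simp: add_nonneg_nonneg\<close>)
      also have "\<dots> = L1 * (1 + \<bar>y\<bar>)" by (simp add: L1_def ac_simps)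
      also have "\<dots> \<le> (L1 + L2 + L3) * (1 + \<bar>y\<bar>)" using L by (intro mult_right_mono) auto
      finally show ?thesis .
    qed
    show "\<bar>1 + A * l * (1 - l * (y - \<rho>)\<^sup>2) * e y\<bar> \<le> L1 + L2 + L3"
    proof -
      have "\<bar>(1 - l * (y - \<rho>)\<^sup>2) * e y\<bar> \<le> e y + l * (y - \<rho>)\<^sup>2 * e y"
        using e[of y] l by (simp add: abs_mult abs_le_iff algebra_simps)
      also have "\<dots> \<le> 3" using e[of y] q1[of y] by linarith
      finally have "A * l * \<bar>(1 - l * (y - \<rho>)\<^sup>2) * e y\<bar> \<le> A * l * 3" using l A by (intro mult_left_mono) auto
      then have "\<bar>A * l * (1 - l * (y - \<rho>)\<^sup>2) * e y\<bar> \<le> 3 * (A * l)" using l A by (simp add: abs_mult ac_simps)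
      then show ?thesis using L unfolding L2_def by linarith
    qed
    show "\<bar>- (A * l\<^sup>2 * (y - \<rho>) * (3 - l * (y - \<rho>)\<^sup>2) * e y)\<bar> \<le> L1 + L2 + L3"
    proof -
      define z where "z = y - \<rho>"
      define p where "p = l * z\<^sup>2"
      have p: "0 \<le> p" "z\<^sup>2 = p / l" "p * e y \<le> 2" "p\<^sup>2 * e y \<le> 8" using l q1[of y] q2[of y] by (auto simp: p_def z_def)
      have "\<bar>z\<bar> \<le> 1 + z\<^sup>2" using abs_mult_le_squares[of 1 z] by simp
      then have "\<bar>z\<bar> * \<bar>3 - p\<bar> * e y \<le> (1 + z\<^sup>2) * (3 + p) * e y"
        using p e[of y] by (intro mult_mono) (auto simp: abs_le_iff)
      also have "\<dots> = 3 * e y + p * e y + (3 * (p * e y) + p\<^sup>2 * e y) / l"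
        unfolding p(2) using l by (simp add: field_simps power2_eq_square)
      also have "\<dots> \<le> 3 * 1 + 2 + (3 * 2 + 8) / l"
        using p e[of y] l by (intro add_mono divide_right_mono mult_left_mono) auto
      finally have "A * l\<^sup>2 * (\<bar>z\<bar> * \<bar>3 - p\<bar> * e y) \<le> A * l\<^sup>2 * (5 + 14 / l)"
        using A by (intro mult_left_mono) auto
      moreover have "\<bar>- (A * l\<^sup>2 * z * (3 - p) * e y)\<bar> = A * l\<^sup>2 * (\<bar>z\<bar> * \<bar>3 - p\<bar> * e y)"
        using A e[of y] by (simp add: abs_mult)
      ultimately show ?thesis using L unfolding L3_def p_def z_def by linarith
    qed
  qed
qed

text \<open>A smoothing of |y - \<theta>|. Its slope is bounded by 1 whatever \<delta> is, while its
  second derivative is a bump of height 1/\<delta> and width about \<delta>, so that 3 \<delta>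
  times the bump dominates the indicator of the \<delta>-neighbourhood.\<close>

lemma sqrt_test_function:
  fixes \<delta> \<theta> :: real
  assumes \<delta>: "0 < \<delta>"
  defines "r \<equiv> \<lambda>y. sqrt (\<delta>\<^sup>2 + (y - \<theta>)\<^sup>2)"
  shows "taylor3 r (\<lambda>y. (y - \<theta>) / r y) (\<lambda>y. \<delta>\<^sup>2 / r y ^ 3) (\<lambda>y. - (3 * \<delta>\<^sup>2 * (y - \<theta>) / r y ^ 5)) (1 + 1 / \<delta> + 3 / \<delta>\<^sup>2)"
    and "\<bar>(y - \<theta>) / r y\<bar> \<le> 1" and "0 \<le> \<delta>\<^sup>2 / r y ^ 3" and "r y \<le> \<delta> + \<bar>y - \<theta>\<bar>"
    and "\<bar>y - \<theta>\<bar> \<le> \<delta> \<Longrightarrow> 1 \<le> 3 * \<delta> * (\<delta>\<^sup>2 / r y ^ 3)"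
proof -
  have pos: "0 < \<delta>\<^sup>2 + (y - \<theta>)\<^sup>2" for y using \<delta> by (simp add: add_pos_nonneg)
  have r: "0 < r y" "(r y)\<^sup>2 = \<delta>\<^sup>2 + (y - \<theta>)\<^sup>2" "\<delta> \<le> r y" "\<bar>y - \<theta>\<bar> \<le> r y" for y
  proof -
    show "0 < r y" "(r y)\<^sup>2 = \<delta>\<^sup>2 + (y - \<theta>)\<^sup>2" using pos[of y] by (auto simp: r_def)
    show "\<delta> \<le> r y" unfolding r_def by (rule real_le_rsqrt) simp
    show "\<bar>y - \<theta>\<bar> \<le> r y" unfolding r_def by (rule real_le_rsqrt) simp
  qed
  have d1: "(r has_real_derivative (y - \<theta>) / r y) (at y)" for y
  proof -
    have "((\<lambda>y. \<delta>\<^sup>2 + (y - \<theta>)\<^sup>2) has_real_derivative 2 * (y - \<theta>)) (at y)"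
      by (auto intro!: derivative_eq_intros)
    from DERIV_chain2[OF DERIV_real_sqrt[OF pos] this]
    have "(r has_real_derivative inverse (r y) / 2 * (2 * (y - \<theta>))) (at y)"
      unfolding r_def .
    moreover have "inverse (r y) / 2 * (2 * (y - \<theta>)) = (y - \<theta>) / r y"
      using r(1)[of y] by (simp add: field_simps)
    ultimately show ?thesis by (simp only:)
  qed
  have d2: "((\<lambda>y. (y - \<theta>) / r y) has_real_derivative \<delta>\<^sup>2 / r y ^ 3) (at y)" for y
  proof -
    have "((\<lambda>y. (y - \<theta>) / r y) has_real_derivative (1 * r y - (y - \<theta>) * ((y - \<theta>) / r y)) / (r y * r y)) (at y)"
      using r(1)[of y] by (auto intro!: derivative_eq_intros d1)
    moreover have "(1 * r y - (y - \<theta>) * ((y - \<theta>) / r y)) / (r y * r y) = ((r y)\<^sup>2 - (y - \<theta>)\<^sup>2) / r y ^ 3"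
      using r(1)[of y] by (simp add: field_simps power2_eq_square power3_eq_cube)
    ultimately show ?thesis by (simp add: r(2))
  qed
  have d3: "((\<lambda>y. \<delta>\<^sup>2 / r y ^ 3) has_real_derivative - (3 * \<delta>\<^sup>2 * (y - \<theta>) / r y ^ 5)) (at y)" for y
  proof -
    have "((\<lambda>y. \<delta>\<^sup>2 / r y ^ 3) has_real_derivative (0 * r y ^ 3 - \<delta>\<^sup>2 * (3 * (r y)\<^sup>2 * ((y - \<theta>) / r y))) / (r y ^ 3 * r y ^ 3)) (at y)"
      using r(1)[of y] by (auto intro!: derivative_eq_intros d1)
    moreover have "(0 * r y ^ 3 - \<delta>\<^sup>2 * (3 * (r y)\<^sup>2 * ((y - \<theta>) / r y))) / (r y ^ 3 * r y ^ 3) = - (3 * \<delta>\<^sup>2 * (y - \<theta>) / r y ^ 5)"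
      using r(1)[of y] by (simp add: field_simps eval_nat_numeral)
    ultimately show ?thesis by simp
  qed
  have f1: "\<bar>(y - \<theta>) / r y\<bar> \<le> 1" for y using r(1,4)[of y] by (simp add: abs_divide)
  have f2: "0 \<le> \<delta>\<^sup>2 / r y ^ 3" "\<delta>\<^sup>2 / r y ^ 3 \<le> 1 / \<delta>" for y
  proof -
    show "0 \<le> \<delta>\<^sup>2 / r y ^ 3" using r(1)[of y] by simp
    have "\<delta> ^ 3 \<le> r y ^ 3" using r(3)[of y] \<delta> by (intro power_mono) auto
    then have "\<delta>\<^sup>2 / r y ^ 3 \<le> \<delta>\<^sup>2 / \<delta> ^ 3" using r(1)[of y] \<delta> by (intro divide_left_mono) auto
    also have "\<dots> = 1 / \<delta>" using \<delta> by (simp add: power2_eq_square power3_eq_cube)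
    finally show "\<delta>\<^sup>2 / r y ^ 3 \<le> 1 / \<delta>" .
  qed
  have f3: "\<bar>- (3 * \<delta>\<^sup>2 * (y - \<theta>) / r y ^ 5)\<bar> \<le> 3 / \<delta>\<^sup>2" for y
  proof -
    have "\<bar>- (3 * \<delta>\<^sup>2 * (y - \<theta>) / r y ^ 5)\<bar> = 3 * \<delta>\<^sup>2 / r y ^ 4 * \<bar>(y - \<theta>) / r y\<bar>"
      using r(1)[of y] by (simp add: abs_mult abs_divide eval_nat_numeral)
    also have "\<dots> \<le> 3 * \<delta>\<^sup>2 / r y ^ 4 * 1" using f1[of y] by (intro mult_left_mono) auto
    also have "\<dots> \<le> 3 * \<delta>\<^sup>2 / \<delta> ^ 4"
      using r(1,3)[of y] \<delta> power_mono[OF r(3)[of y], of 4] by (simp add: divide_left_mono)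
    also have "\<dots> = 3 / \<delta>\<^sup>2" using \<delta> by (simp add: power2_eq_square power4_eq_xxxx)
    finally show ?thesis .
  qed
  show "taylor3 r (\<lambda>y. (y - \<theta>) / r y) (\<lambda>y. \<delta>\<^sup>2 / r y ^ 3) (\<lambda>y. - (3 * \<delta>\<^sup>2 * (y - \<theta>) / r y ^ 5)) (1 + 1 / \<delta> + 3 / \<delta>\<^sup>2)"
  proof
    fix y
    have nn: "0 \<le> 1 / \<delta>" "0 \<le> 3 / \<delta>\<^sup>2" using \<delta> by auto
    have "1 * 1 \<le> (1 + 1 / \<delta> + 3 / \<delta>\<^sup>2) * (1 + \<bar>y\<bar>)" using nn by (intro mult_mono) auto
    then show "\<bar>(y - \<theta>) / r y\<bar> \<le> (1 + 1 / \<delta> + 3 / \<delta>\<^sup>2) * (1 + \<bar>y\<bar>)" using f1[of y] by linarith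
    show "\<bar>\<delta>\<^sup>2 / r y ^ 3\<bar> \<le> 1 + 1 / \<delta> + 3 / \<delta>\<^sup>2" using f2[of y] nn by linarith
    show "\<bar>- (3 * \<delta>\<^sup>2 * (y - \<theta>) / r y ^ 5)\<bar> \<le> 1 + 1 / \<delta> + 3 / \<delta>\<^sup>2" using f3[of y] nn by linarith
  qed (rule d1 d2 d3)+
  show "\<bar>(y - \<theta>) / r y\<bar> \<le> 1" "0 \<le> \<delta>\<^sup>2 / r y ^ 3" by (rule f1 f2)+
  show "r y \<le> \<delta> + \<bar>y - \<theta>\<bar>"
    unfolding r_def using \<delta> by (intro real_le_lsqrt) (auto simp: power2_sum)
  assume z: "\<bar>y - \<theta>\<bar> \<le> \<delta>"
  have "(y - \<theta>)\<^sup>2 \<le> \<delta>\<^sup>2" using power_mono[OF z, of 2] by simp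
  then have r2: "(r y)\<^sup>2 \<le> 2 * \<delta>\<^sup>2" by (simp add: r(2))
  \<comment> \<open>3/2 is a rational bound for sqrt 2; together with r^2 <= 2 \<delta>^2 it gives
    r^3 <= 3 \<delta>^3.\<close>
  have "r y \<le> 3 / 2 * \<delta>"
  proof (rule power2_le_imp_le)
    have "(3 / 2 * \<delta>)\<^sup>2 = 9 / 4 * \<delta>\<^sup>2" by (simp add: power_mult_distrib power_divide)
    then show "(r y)\<^sup>2 \<le> (3 / 2 * \<delta>)\<^sup>2" using r2 zero_le_power2[of \<delta>] by linarith
  qed (use \<delta> in simp)
  then have "r y * (r y)\<^sup>2 \<le> (3 / 2 * \<delta>) * (2 * \<delta>\<^sup>2)" using r2 \<delta> by (intro mult_mono) auto
  then have "r y ^ 3 \<le> 3 * \<delta> * \<delta>\<^sup>2" by (simp add: power3_eq_cube power2_eq_square)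
  then show "1 \<le> 3 * \<delta> * (\<delta>\<^sup>2 / r y ^ 3)" using r(1)[of y] by (simp add: le_divide_eq)
qed

section \<open>Occupation bounds for the sampled path\<close>

context diffusion_grid
begin

definition visits :: "real set \<Rightarrow> real \<Rightarrow> nat \<Rightarrow> 'a \<Rightarrow> real" where
  "visits A h n \<omega> = (\<Sum>k<n. indicator A (x h k \<omega>))"

lemma integrable_visits:
  assumes h: "0 < h" "h \<le> h0" and A: "A \<in> sets borel"
  shows "integrable M (visits A h n)"
  unfolding visits_def[abs_def]
proof (rule Bochner_Integration.integrable_sum)
  fix k
  have "(\<lambda>\<omega>. indicator A (x h k \<omega>) :: real) \<in> borel_measurable M"
    by (rule measurable_compose[OF L2_measurable[OF x_L2[OF h]]]) (use A in auto)
  then show "integrable M (\<lambda>\<omega>. indicator A (x h k \<omega>) :: real)"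
    by (intro integrable_const_bound[of _ 1]) (auto simp: indicator_def)
qed

lemma rate_nonneg: "0 < h \<Longrightarrow> 0 \<le> rate h n"
  by (simp add: rate_def)

lemma rate_ge: "0 < h \<Longrightarrow> real n * (h * sqrt h) \<le> rate h n"
  by (simp add: rate_def)

text \<open>A discrete Tanaka estimate. In the expansion of the smoothed distance every visit adds
  at least a multiple of h/\<delta> to the bracket term, while the drift sum is O(nh) because the
  slope is at most 1. Multiplication by \<delta> leaves an occupation time O(\<delta> nh).
  \<open>C\<close> does not depend on \<delta>; only the lower order constant \<open>A\<close>
  does.\<close>

theorem few_visits_near_point:
  obtains C where "0 \<le> C" "\<And>\<delta>. 0 < \<delta> \<Longrightarrow> \<exists>A\<ge>0. \<forall>h n. 0 < h \<longrightarrow> h \<le> h0 \<longrightarrow>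
     h * (\<integral>\<omega>. visits {\<theta> - \<delta>..\<theta> + \<delta>} h n \<omega> \<partial>M) \<le> C * \<delta> * (real n * h) + A * (1 + rate h n)"
proof -
  have CE0: "0 \<le> CE" by (rule CE_nonneg[OF h0(1) order_refl])
  have E0: "0 \<le> E" by (rule E_nonneg[OF h0(1) order_refl])
  show ?thesis
  proof (rule that[of "6 / \<kappa>\<^sup>2 * sqrt CE"])
    show "0 \<le> 6 / \<kappa>\<^sup>2 * sqrt CE" using CE0 by simp
    fix \<delta> :: real assume \<delta>: "0 < \<delta>"
    define r where "r y = sqrt (\<delta>\<^sup>2 + (y - \<theta>)\<^sup>2)" for y
    define f1 where "f1 y = (y - \<theta>) / r y" for y
    define f2 where "f2 y = \<delta>\<^sup>2 / r y ^ 3" for y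
    have t1: "taylor3 r f1 f2 (\<lambda>y. - (3 * \<delta>\<^sup>2 * (y - \<theta>) / r y ^ 5)) (1 + 1 / \<delta> + 3 / \<delta>\<^sup>2)"
      unfolding f1_def[abs_def] f2_def[abs_def] r_def[abs_def] by (rule sqrt_test_function(1)[OF \<delta>])
    have t: "\<bar>f1 y\<bar> \<le> 1" "0 \<le> f2 y" "r y \<le> \<delta> + \<bar>y - \<theta>\<bar>" "\<bar>y - \<theta>\<bar> \<le> \<delta> \<Longrightarrow> 1 \<le> 3 * \<delta> * f2 y" for y
      unfolding f1_def f2_def r_def using sqrt_test_function(2-5)[OF \<delta>, of y \<theta>] by blast+
    obtain D where D: "0 \<le> D" "\<And>h n. 0 < h \<Longrightarrow> h \<le> h0 \<Longrightarrow> integrable M (ito_rest r f1 f2 h n)"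
      "\<And>h n. 0 < h \<Longrightarrow> h \<le> h0 \<Longrightarrow> (\<integral>\<omega>. \<bar>ito_rest r f1 f2 h n \<omega>\<bar> \<partial>M) \<le> D * rate h n"
      using discrete_ito[OF t1] by blast
    define A where "A = 6 * \<delta> / \<kappa>\<^sup>2 * (\<delta> + \<bar>\<theta>\<bar> + sqrt E + D)"
    have A: "0 \<le> A" using \<delta> D(1) E0 by (simp add: A_def)
    have main: "h * (\<integral>\<omega>. visits {\<theta> - \<delta>..\<theta> + \<delta>} h n \<omega> \<partial>M) \<le> 6 / \<kappa>\<^sup>2 * sqrt CE * \<delta> * (real n * h) + A * (1 + rate h n)"
      if h: "0 < h" "h \<le> h0" for h n
    proof -
      let ?I = "visits {\<theta> - \<delta>..\<theta> + \<delta>} h n"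
      let ?b = "\<lambda>\<omega>. 6 * \<delta> / \<kappa>\<^sup>2 * (\<delta> + \<bar>\<theta>\<bar> + \<bar>x h n \<omega>\<bar> + \<bar>ito_rest r f1 f2 h n \<omega>\<bar> + (\<Sum>k<n. \<bar>dB h k \<omega>\<bar>))"
      have pw: "h * ?I \<omega> \<le> ?b \<omega>" if \<omega>: "\<omega> \<in> space M" for \<omega>
      proof -
        have "h * indicator {\<theta> - \<delta>..\<theta> + \<delta>} (x h k \<omega>) \<le> 6 * \<delta> / \<kappa>\<^sup>2 * (f2 (x h k \<omega>) * dQ h k \<omega> / 2)" for k
        proof -
          let ?y = "x h k \<omega>"
          have q: "\<kappa>\<^sup>2 * h \<le> dQ h k \<omega>"
            unfolding dQ_def using qvar_lower[OF h_props(3,4)[OF h] \<omega>, of k] by simp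
          have "indicator {\<theta> - \<delta>..\<theta> + \<delta>} ?y \<le> 3 * \<delta> * f2 ?y"
            using t(4)[of ?y] t(2)[of ?y] \<delta> by (auto simp: indicator_def abs_le_iff)
          then have "h * indicator {\<theta> - \<delta>..\<theta> + \<delta>} ?y \<le> h * (3 * \<delta> * f2 ?y)" using h by (intro mult_left_mono) auto
          also have "\<dots> = 3 * \<delta> * f2 ?y / \<kappa>\<^sup>2 * (\<kappa>\<^sup>2 * h)" using \<kappa> by simp
          also have "\<dots> \<le> 3 * \<delta> * f2 ?y / \<kappa>\<^sup>2 * dQ h k \<omega>" using q t(2)[of ?y] \<delta> by (intro mult_left_mono) auto
          finally show ?thesis by (simp add: ac_simps)
        qed
        then have "h * ?I \<omega> \<le> (\<Sum>k<n. 6 * \<delta> / \<kappa>\<^sup>2 * (f2 (x h k \<omega>) * dQ h k \<omega> / 2))"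
          unfolding visits_def sum_distrib_left by (rule sum_mono)
        also have "\<dots> = 6 * \<delta> / \<kappa>\<^sup>2 * (\<Sum>k<n. f2 (x h k \<omega>) * dQ h k \<omega> / 2)" by (rule sum_distrib_left[symmetric])
        also have "\<dots> \<le> ?b \<omega>"
        proof (rule mult_left_mono)
          have "(\<Sum>k<n. f2 (x h k \<omega>) * dQ h k \<omega> / 2) =
            r (x h n \<omega>) - r (x h 0 \<omega>) - ito_rest r f1 f2 h n \<omega> - (\<Sum>k<n. f1 (x h k \<omega>) * dB h k \<omega>)"
            by (simp add: ito_rest_def sum.distrib)
          moreover have "r (x h n \<omega>) \<le> \<delta> + (\<bar>\<theta>\<bar> + \<bar>x h n \<omega>\<bar>)" using t(3)[of "x h n \<omega>"] by linarith
          moreover have "0 \<le> r (x h 0 \<omega>)" by (simp add: r_def)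
          moreover have "- (\<Sum>k<n. f1 (x h k \<omega>) * dB h k \<omega>) \<le> (\<Sum>k<n. \<bar>dB h k \<omega>\<bar>)"
            unfolding sum_negf[symmetric]
          proof (rule sum_mono)
            fix k
            have "\<bar>f1 (x h k \<omega>)\<bar> * \<bar>dB h k \<omega>\<bar> \<le> 1 * \<bar>dB h k \<omega>\<bar>" using t(1)[of "x h k \<omega>"] by (intro mult_right_mono) auto
            then show "- (f1 (x h k \<omega>) * dB h k \<omega>) \<le> \<bar>dB h k \<omega>\<bar>" using abs_ge_minus_self[of "f1 (x h k \<omega>) * dB h k \<omega>"] by (simp add: abs_mult)
          qed
          ultimately show "(\<Sum>k<n. f2 (x h k \<omega>) * dQ h k \<omega> / 2) \<le>
            \<delta> + \<bar>\<theta>\<bar> + \<bar>x h n \<omega>\<bar> + \<bar>ito_rest r f1 f2 h n \<omega>\<bar> + (\<Sum>k<n. \<bar>dB h k \<omega>\<bar>)" by linarith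
        qed (use \<delta> in simp)
        finally show ?thesis .
      qed
      have i: "integrable M (\<lambda>\<omega>. \<bar>x h n \<omega>\<bar>)" "integrable M (\<lambda>\<omega>. \<bar>ito_rest r f1 f2 h n \<omega>\<bar>)" "integrable M (\<lambda>\<omega>. \<bar>dB h k \<omega>\<bar>)" for k
        using L2_integrable[OF x_L2[OF h]] D(2)[OF h] L2_integrable[OF dB_L2[OF h]] by auto
      have "h * (\<integral>\<omega>. ?I \<omega> \<partial>M) = (\<integral>\<omega>. h * ?I \<omega> \<partial>M)" by simp
      also have "\<dots> \<le> (\<integral>\<omega>. ?b \<omega> \<partial>M)"
      proof (rule integral_mono[OF _ _ pw])
        show "integrable M (\<lambda>\<omega>. h * ?I \<omega>)" using integrable_visits[OF h] by simp
        show "integrable M ?b" using i by auto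
      qed
      also have "\<dots> = 6 * \<delta> / \<kappa>\<^sup>2 * (\<delta> + \<bar>\<theta>\<bar> + (\<integral>\<omega>. \<bar>x h n \<omega>\<bar> \<partial>M) + (\<integral>\<omega>. \<bar>ito_rest r f1 f2 h n \<omega>\<bar> \<partial>M) + (\<Sum>k<n. \<integral>\<omega>. \<bar>dB h k \<omega>\<bar> \<partial>M))"
        using i by (simp add: prob_space)
      also have "\<dots> \<le> 6 * \<delta> / \<kappa>\<^sup>2 * (\<delta> + \<bar>\<theta>\<bar> + sqrt E + D * rate h n + (\<Sum>k<n. sqrt CE * h))"
        using \<delta> by (intro mult_left_mono add_mono order_refl sum_mono expectation_abs_le x_L2 x_square D dB_abs h) auto
      also have "\<dots> = 6 / \<kappa>\<^sup>2 * sqrt CE * \<delta> * (real n * h) + 6 * \<delta> / \<kappa>\<^sup>2 * (\<delta> + \<bar>\<theta>\<bar> + sqrt E + D * rate h n)"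
        by (simp add: algebra_simps add_divide_distrib)
      also have "\<dots> \<le> 6 / \<kappa>\<^sup>2 * sqrt CE * \<delta> * (real n * h) + A * (1 + rate h n)"
      proof -
        have R: "0 \<le> rate h n" by (rule rate_nonneg[OF h(1)])
        have "\<delta> + \<bar>\<theta>\<bar> + sqrt E + D * rate h n \<le> (\<delta> + \<bar>\<theta>\<bar> + sqrt E + D) * (1 + rate h n)"
        proof -
          have "0 \<le> (\<delta> + \<bar>\<theta>\<bar> + sqrt E) * rate h n + D" using R \<delta> E0 D(1) by simp
          then show ?thesis by (simp add: algebra_simps)
        qed
        then have "6 * \<delta> / \<kappa>\<^sup>2 * (\<delta> + \<bar>\<theta>\<bar> + sqrt E + D * rate h n) \<le> 6 * \<delta> / \<kappa>\<^sup>2 * ((\<delta> + \<bar>\<theta>\<bar> + sqrt E + D) * (1 + rate h n))"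
          using \<delta> by (intro mult_left_mono) auto
        then show ?thesis by (simp add: A_def mult.assoc)
      qed
      finally show ?thesis .
    qed
    then show "\<exists>A\<ge>0. \<forall>h n. 0 < h \<longrightarrow> h \<le> h0 \<longrightarrow>
     h * (\<integral>\<omega>. visits {\<theta> - \<delta>..\<theta> + \<delta>} h n \<omega> \<partial>M) \<le> 6 / \<kappa>\<^sup>2 * sqrt CE * \<delta> * (real n * h) + A * (1 + rate h n)"
      using A by blast
  qed
qed

text \<open>Since \<open>rate h n = o(nh)\<close> when \<open>h \<longlonglongrightarrow> 0\<close> and \<open>nh \<longlonglongrightarrow> \<infinity>\<close>, this is a uniform form of \<open>E Z = o(nh)\<close>.\<close>

definition negligible :: "(real \<Rightarrow> nat \<Rightarrow> 'a \<Rightarrow> real) \<Rightarrow> bool" where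
  "negligible Z \<longleftrightarrow> (\<forall>h n. 0 < h \<longrightarrow> h \<le> h0 \<longrightarrow> integrable M (Z h n) \<and> (\<forall>\<omega>\<in>space M. 0 \<le> Z h n \<omega>)) \<and>
     (\<forall>\<epsilon>>0. \<exists>A\<ge>0. \<forall>h n. 0 < h \<longrightarrow> h \<le> h0 \<longrightarrow>
        (\<integral>\<omega>. Z h n \<omega> \<partial>M) \<le> \<epsilon> * (real n * h) + A * (1 + rate h n))"

text \<open>The stronger form with no linear term, for errors of order \<open>rate\<close>
  alone.\<close>

lemma negligibleI:
  assumes "\<And>h n. 0 < h \<Longrightarrow> h \<le> h0 \<Longrightarrow> integrable M (Z h n)"
    and "\<And>h n \<omega>. 0 < h \<Longrightarrow> h \<le> h0 \<Longrightarrow> \<omega> \<in> space M \<Longrightarrow> 0 \<le> Z h n \<omega>"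
    and "0 \<le> A" "\<And>h n. 0 < h \<Longrightarrow> h \<le> h0 \<Longrightarrow> (\<integral>\<omega>. Z h n \<omega> \<partial>M) \<le> A * (1 + rate h n)"
  shows "negligible Z"
  unfolding negligible_def
proof (intro conjI allI impI)
  fix \<epsilon> :: real assume e: "0 < \<epsilon>"
  show "\<exists>A\<ge>0. \<forall>h n. 0 < h \<longrightarrow> h \<le> h0 \<longrightarrow> (\<integral>\<omega>. Z h n \<omega> \<partial>M) \<le> \<epsilon> * (real n * h) + A * (1 + rate h n)"
  proof (intro exI[of _ A] conjI allI impI)
    fix h :: real and n :: nat assume "0 < h" "h \<le> h0"
    then show "(\<integral>\<omega>. Z h n \<omega> \<partial>M) \<le> \<epsilon> * (real n * h) + A * (1 + rate h n)"
      using assms(4)[of h n] e by (simp add: add_increasing)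
  qed fact
qed (use assms in auto)

text \<open>Up to the errors in \<open>Z\<close>, the Lyapunov function falls by h in each step from
  outside the interval and rises by at most (C - 1) h in each step from inside. Being bounded below,
  it cannot keep falling, which bounds nh by C times the time inside. The inequality is pathwise;
  only \<open>Z\<close> is estimated in mean.\<close>

theorem many_visits:
  assumes \<delta>: "0 < \<delta>"
  obtains C Z where "0 < C" "negligible Z"
    "\<And>h n \<omega>. 0 < h \<Longrightarrow> h \<le> h0 \<Longrightarrow> \<omega> \<in> space M \<Longrightarrow>
       real n * h \<le> C * (h * visits {\<rho> - \<delta>..\<rho> + \<delta>} h n \<omega>) + Z h n \<omega>"
proof -
  have CE0: "0 \<le> CE" by (rule CE_nonneg[OF h0(1) order_refl])
  have E0: "0 \<le> E" by (rule E_nonneg[OF h0(1) order_refl])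
  \<comment> \<open>Dissipativity of \<open>g\<close> is centred at 0; recentring it at \<rho>
    through the Lipschitz constant costs c1 |\<rho>|.\<close>
  define B where "B = c0 + c1 * \<bar>\<rho>\<bar>"
  have B: "0 \<le> B" using c0 c1 by (simp add: B_def)
  obtain l a where l: "0 < l" "0 < a" "2 \<le> l * \<delta>\<^sup>2"
    and neg: "\<And>z. \<delta> \<le> \<bar>z\<bar> \<Longrightarrow> (1 + a * l * exp (- (l * z\<^sup>2 / 2))) * (B * \<bar>z\<bar> - c * z\<^sup>2) + K\<^sup>2 / 2
       - \<kappa>\<^sup>2 / 4 * (a * l\<^sup>2 * z\<^sup>2 * exp (- (l * z\<^sup>2 / 2))) \<le> - 1"
    using drift_condition[OF B c \<kappa> \<delta>] by metis
  define e where "e y = exp (- (l * (y - \<rho>)\<^sup>2 / 2))" for y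
  define f where "f y = (y - \<rho>)\<^sup>2 / 2 - a * e y" for y
  define w where "w y = 1 + a * l * e y" for y
  define f1 where "f1 y = (y - \<rho>) * w y" for y
  define f2 where "f2 y = 1 + a * l * (1 - l * (y - \<rho>)\<^sup>2) * e y" for y
  have e: "0 < e y" "e y \<le> 1" for y using l by (auto simp: e_def)
  obtain L where t: "taylor3 f f1 f2 (\<lambda>y. - (a * l\<^sup>2 * (y - \<rho>) * (3 - l * (y - \<rho>)\<^sup>2) * e y)) L"
    using gaussian_test_function[OF l(1,2), of \<rho>] unfolding f_def[abs_def] f1_def[abs_def] f2_def[abs_def] w_def e_def by blast
  obtain D where D: "0 \<le> D" "\<And>h n. 0 < h \<Longrightarrow> h \<le> h0 \<Longrightarrow> integrable M (ito_rest f f1 f2 h n)"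
    "\<And>h n. 0 < h \<Longrightarrow> h \<le> h0 \<Longrightarrow> (\<integral>\<omega>. \<bar>ito_rest f f1 f2 h n \<omega>\<bar> \<partial>M) \<le> D * rate h n"
    using discrete_ito[OF t] by blast
  define W where "W = 1 + a * l"
  have W: "0 \<le> w y" "w y \<le> W" "1 \<le> W" for y using l e[of y] by (auto simp: w_def W_def add_nonneg_nonneg mult_left_le)
  \<comment> \<open>The first two summands bound drift and bracket inside the interval; the last
    offsets the -1 that is charged at every step.\<close>
  define C where "C = W * (B * \<delta>) + K\<^sup>2 / 2 * W + 1"
  have C: "1 \<le> C" using W B \<delta> by (simp add: C_def)
  \<comment> \<open>In order: minus the lower bound of f, a bound for its initial value, the rest in
    the discrete Ito formula, and the error of freezing the drift at the left endpoint.\<close>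
  define Z where "Z h n \<omega> = a + (x h 0 \<omega> - \<rho>)\<^sup>2 / 2 + \<bar>ito_rest f f1 f2 h n \<omega>\<bar> + W * c1 * (\<Sum>k<n. \<bar>x h k \<omega> - \<rho>\<bar> * dG h k \<omega>)"
    for h n \<omega>
  define A where "A = a + (E + \<rho>\<^sup>2) + D + W * c1 * (2 * E + 2 * \<rho>\<^sup>2 + CE)"
  have A: "0 \<le> A" using l E0 CE0 D(1) W c1 by (simp add: A_def add_nonneg_nonneg)
  have props: "integrable M (Z h n) \<and> (\<forall>\<omega>. 0 \<le> Z h n \<omega>) \<and> (\<integral>\<omega>. Z h n \<omega> \<partial>M) \<le> A * (1 + rate h n)"
    if h: "0 < h" "h \<le> h0" for h n
  proof -
    have Lx: "L2 M (\<lambda>\<omega>. x h k \<omega> - \<rho>)" for k by (intro L2_diff x_L2 h L2_const)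
    have i: "integrable M (\<lambda>\<omega>. (x h k \<omega> - \<rho>)\<^sup>2)" "integrable M (\<lambda>\<omega>. \<bar>x h k \<omega> - \<rho>\<bar> * dG h k \<omega>)"
      "integrable M (\<lambda>\<omega>. (dG h k \<omega>)\<^sup>2)" "integrable M (\<lambda>\<omega>. (x h k \<omega>)\<^sup>2)" for k
      using Lx dG_L2[OF h] x_L2[OF h] by (auto intro!: L2_integrable_square L2_mult_integrable L2_abs)
    have int: "integrable M (Z h n)"
      unfolding Z_def[abs_def] using i D(2)[OF h, of n] by auto
    have nn: "0 \<le> Z h n \<omega>" for \<omega>
      unfolding Z_def using l W c1 dG_nonneg[OF h] by (intro add_nonneg_nonneg mult_nonneg_nonneg sum_nonneg) auto
    have zE: "(\<integral>\<omega>. (x h k \<omega> - \<rho>)\<^sup>2 \<partial>M) \<le> 2 * E + 2 * \<rho>\<^sup>2" for k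
    proof -
      have "(\<integral>\<omega>. (x h k \<omega> - \<rho>)\<^sup>2 \<partial>M) \<le> (\<integral>\<omega>. 2 * (x h k \<omega>)\<^sup>2 + 2 * \<rho>\<^sup>2 \<partial>M)"
        using i square_add_le[of "x h k _" "- \<rho>"] by (intro integral_mono) auto
      also have "\<dots> = 2 * (\<integral>\<omega>. (x h k \<omega>)\<^sup>2 \<partial>M) + 2 * \<rho>\<^sup>2" using i by (simp add: prob_space)
      finally show ?thesis using x_square[OF h, of k] by linarith
    qed
    have zG: "(\<integral>\<omega>. \<bar>x h k \<omega> - \<rho>\<bar> * dG h k \<omega> \<partial>M) \<le> (2 * E + 2 * \<rho>\<^sup>2 + CE) * (h * sqrt h)" for k
    proof -
      define s where "s = h * sqrt h"
      have s: "0 < s" "h ^ 3 / s = s" using h by (auto simp: s_def power3_eq_cube field_simps)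
      have "(\<integral>\<omega>. \<bar>x h k \<omega> - \<rho>\<bar> * dG h k \<omega> \<partial>M) \<le> (\<integral>\<omega>. s * (x h k \<omega> - \<rho>)\<^sup>2 + (dG h k \<omega>)\<^sup>2 / s \<partial>M)"
      proof (rule integral_mono)
        fix \<omega>
        define u v where "u = sqrt s * (x h k \<omega> - \<rho>)" and "v = dG h k \<omega> / sqrt s"
        have "\<bar>u * v\<bar> \<le> u\<^sup>2 + v\<^sup>2" by (rule abs_mult_le_squares)
        moreover have "\<bar>u * v\<bar> = \<bar>x h k \<omega> - \<rho>\<bar> * dG h k \<omega>"
          using s dG_nonneg[OF h, of k \<omega>] by (simp add: u_def v_def abs_mult)
        moreover have "u\<^sup>2 + v\<^sup>2 = s * (x h k \<omega> - \<rho>)\<^sup>2 + (dG h k \<omega>)\<^sup>2 / s"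
          using s by (simp add: u_def v_def power_mult_distrib power_divide)
        ultimately show "\<bar>x h k \<omega> - \<rho>\<bar> * dG h k \<omega> \<le> s * (x h k \<omega> - \<rho>)\<^sup>2 + (dG h k \<omega>)\<^sup>2 / s" by simp
      qed (use i in auto)
      also have "\<dots> = s * (\<integral>\<omega>. (x h k \<omega> - \<rho>)\<^sup>2 \<partial>M) + (\<integral>\<omega>. (dG h k \<omega>)\<^sup>2 \<partial>M) / s" using i by simp
      also have "\<dots> \<le> s * (2 * E + 2 * \<rho>\<^sup>2) + CE * h ^ 3 / s"
        using zE dG_square[OF h, of k] s by (intro add_mono mult_left_mono divide_right_mono) auto
      also have "\<dots> = (2 * E + 2 * \<rho>\<^sup>2 + CE) * s"
        by (simp only: times_divide_eq_right[symmetric] s(2)) (simp add: algebra_simps)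
      finally show ?thesis by (simp add: s_def)
    qed
    have "(\<integral>\<omega>. Z h n \<omega> \<partial>M) = a + (\<integral>\<omega>. (x h 0 \<omega> - \<rho>)\<^sup>2 \<partial>M) / 2 + (\<integral>\<omega>. \<bar>ito_rest f f1 f2 h n \<omega>\<bar> \<partial>M)
       + W * c1 * (\<Sum>k<n. \<integral>\<omega>. \<bar>x h k \<omega> - \<rho>\<bar> * dG h k \<omega> \<partial>M)"
      unfolding Z_def using i D(2)[OF h, of n] by (simp add: prob_space)
    also have "\<dots> \<le> a + (2 * E + 2 * \<rho>\<^sup>2) / 2 + D * rate h n + W * c1 * (\<Sum>k<n. (2 * E + 2 * \<rho>\<^sup>2 + CE) * (h * sqrt h))"
      using W c1 by (intro add_mono order_refl mult_left_mono sum_mono zG zE divide_right_mono D(3) h) auto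
    also have "\<dots> = a + (E + \<rho>\<^sup>2) + D * rate h n + W * c1 * (2 * E + 2 * \<rho>\<^sup>2 + CE) * (real n * (h * sqrt h))"
      by (simp add: algebra_simps)
    also have "\<dots> \<le> a + (E + \<rho>\<^sup>2) + D * rate h n + W * c1 * (2 * E + 2 * \<rho>\<^sup>2 + CE) * rate h n"
      using W c1 E0 CE0 by (intro add_left_mono mult_left_mono rate_ge h) auto
    also have "\<dots> \<le> A * (1 + rate h n)"
    proof -
      have R: "0 \<le> rate h n" by (rule rate_nonneg[OF h(1)])
      have "0 \<le> (a + (E + \<rho>\<^sup>2)) * rate h n + D + W * c1 * (2 * E + 2 * \<rho>\<^sup>2 + CE)"
        using R l E0 CE0 D(1) W c1 by (intro add_nonneg_nonneg mult_nonneg_nonneg) auto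
      then show ?thesis unfolding A_def by (simp add: algebra_simps)
    qed
    finally show ?thesis using int nn by blast
  qed
  have bound: "real n * h \<le> C * (h * visits {\<rho> - \<delta>..\<rho> + \<delta>} h n \<omega>) + Z h n \<omega>"
    if h: "0 < h" "h \<le> h0" and \<omega>: "\<omega> \<in> space M" for h n \<omega>
  proof -
    have step: "f1 (x h k \<omega>) * dB h k \<omega> + f2 (x h k \<omega>) * dQ h k \<omega> / 2
        \<le> h * (C * indicator {\<rho> - \<delta>..\<rho> + \<delta>} (x h k \<omega>) - 1) + W * c1 * (\<bar>x h k \<omega> - \<rho>\<bar> * dG h k \<omega>)" for k
    proof -
      define y where "y = x h k \<omega>"
      define z where "z = y - \<rho>"
      define G where "G = dG h k \<omega>"
      define Q where "Q = dQ h k \<omega>"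
      have G0: "0 \<le> G" unfolding G_def by (rule dG_nonneg[OF h])
      have Q: "\<kappa>\<^sup>2 * h \<le> Q" "Q \<le> K\<^sup>2 * h" "0 \<le> Q"
      proof -
        show "\<kappa>\<^sup>2 * h \<le> Q"
          unfolding Q_def dQ_def using qvar_lower[OF h_props(3,4)[OF h] \<omega>, of k] by simp
        show "Q \<le> K\<^sup>2 * h" "0 \<le> Q" unfolding Q_def using dQ_bounds[OF h] by auto
      qed
      have zg: "z * g y \<le> - c * z\<^sup>2 + c1 * \<bar>\<rho>\<bar> * \<bar>z\<bar>"
      proof -
        have "z * (g y - g z) \<le> \<bar>z\<bar> * (c1 * \<bar>y - z\<bar>)"
          by (rule order_trans[OF abs_ge_self], subst abs_mult, rule mult_left_mono[OF g_lipschitz]) simp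
        moreover have "y - z = \<rho>" by (simp add: z_def)
        ultimately show ?thesis using g_dissipative[of z] by (simp add: algebra_simps)
      qed
      have "z * dB h k \<omega> \<le> h * (z * g y + c0 * \<bar>z\<bar>) + c1 * \<bar>z\<bar> * G"
        using drift_pairing[OF h_props(3,4)[OF h] \<omega>, of z k] by (simp add: dB_def dG_def y_def x_def G_def)
      also have "\<dots> \<le> h * (B * \<bar>z\<bar> - c * z\<^sup>2) + c1 * \<bar>z\<bar> * G"
        using zg h by (intro add_right_mono mult_left_mono) (auto simp: B_def algebra_simps)
      finally have "w y * (z * dB h k \<omega>) \<le> w y * (h * (B * \<bar>z\<bar> - c * z\<^sup>2) + c1 * \<bar>z\<bar> * G)"
        using W(1) by (rule mult_left_mono)
      moreover have "w y * (c1 * \<bar>z\<bar> * G) \<le> W * (c1 * \<bar>z\<bar> * G)"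
        using W c1 G0 by (intro mult_right_mono) auto
      ultimately have drift: "f1 y * dB h k \<omega> \<le> h * (w y * (B * \<bar>z\<bar> - c * z\<^sup>2)) + W * c1 * (\<bar>z\<bar> * G)"
        by (simp add: f1_def z_def algebra_simps)
      show ?thesis
      proof (cases "\<bar>z\<bar> \<le> \<delta>")
        case True
        have "w y * (B * \<bar>z\<bar> - c * z\<^sup>2) \<le> W * (B * \<delta>)"
        proof -
          have "w y * (B * \<bar>z\<bar> - c * z\<^sup>2) \<le> w y * (B * \<delta>)"
            using True B c W(1) by (intro mult_left_mono) (auto intro: order_trans[OF _ mult_left_mono[OF True B]])
          also have "\<dots> \<le> W * (B * \<delta>)" using W B \<delta> by (intro mult_right_mono) auto
          finally show ?thesis .
        qed
        then have "h * (w y * (B * \<bar>z\<bar> - c * z\<^sup>2)) \<le> h * (W * (B * \<delta>))" using h by (intro mult_left_mono) auto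
        moreover have "f2 y * Q / 2 \<le> h * (K\<^sup>2 / 2 * W)"
        proof -
          have "(1 - l * z\<^sup>2) * e y \<le> 1 * e y" using l e[of y] by (intro mult_right_mono) auto
          also have "\<dots> \<le> 1" using e[of y] by simp
          finally have "a * l * ((1 - l * z\<^sup>2) * e y) \<le> a * l * 1" using l by (intro mult_left_mono) auto
          then have "f2 y \<le> W" by (simp add: f2_def W_def z_def mult.assoc)
          then have "f2 y * Q \<le> W * Q" using Q by (intro mult_right_mono) auto
          also have "\<dots> \<le> W * (K\<^sup>2 * h)" using Q W by (intro mult_left_mono) auto
          finally show ?thesis by (simp add: ac_simps)
        qed
        moreover have "indicator {\<rho> - \<delta>..\<rho> + \<delta>} y = (1::real)" using True by (auto simp: z_def abs_le_iff indicator_def)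
        ultimately show ?thesis using drift h unfolding y_def[symmetric] Q_def[symmetric] G_def[symmetric] z_def[symmetric]
          by (simp add: C_def algebra_simps)
      next
        case False
        have "f2 y * Q / 2 \<le> h * (K\<^sup>2 / 2 - \<kappa>\<^sup>2 / 4 * (a * l\<^sup>2 * z\<^sup>2 * e y))"
        proof -
          have "\<delta>\<^sup>2 \<le> z\<^sup>2" using False \<delta> by (simp add: abs_le_square_iff[symmetric])
          then have "l * \<delta>\<^sup>2 \<le> l * z\<^sup>2" using l by (intro mult_left_mono) auto
          then have "1 - l * z\<^sup>2 \<le> - (l * z\<^sup>2 / 2)" using l(3) by linarith
          then have "a * l * e y * (1 - l * z\<^sup>2) \<le> a * l * e y * (- (l * z\<^sup>2 / 2))"
            using l e[of y] by (intro mult_left_mono) auto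
          then have "f2 y \<le> 1 - a * l\<^sup>2 * z\<^sup>2 * e y / 2" by (simp add: f2_def z_def power2_eq_square algebra_simps)
          then have "f2 y * Q \<le> (1 - a * l\<^sup>2 * z\<^sup>2 * e y / 2) * Q" using Q by (intro mult_right_mono) auto
          moreover have "a * l\<^sup>2 * z\<^sup>2 * e y / 2 * (\<kappa>\<^sup>2 * h) \<le> a * l\<^sup>2 * z\<^sup>2 * e y / 2 * Q"
            using Q l e[of y] by (intro mult_left_mono) auto
          ultimately have "f2 y * Q \<le> K\<^sup>2 * h - a * l\<^sup>2 * z\<^sup>2 * e y / 2 * (\<kappa>\<^sup>2 * h)" using Q by (simp add: left_diff_distrib)
          then show ?thesis by (simp add: algebra_simps)
        qed
        moreover have "h * (w y * (B * \<bar>z\<bar> - c * z\<^sup>2) + K\<^sup>2 / 2 - \<kappa>\<^sup>2 / 4 * (a * l\<^sup>2 * z\<^sup>2 * e y)) \<le> h * (- 1)"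
          using neg[of z] False h unfolding w_def e_def z_def[symmetric] by (intro mult_left_mono) auto
        moreover have "indicator {\<rho> - \<delta>..\<rho> + \<delta>} y = (0::real)" using False by (auto simp: z_def abs_le_iff indicator_def)
        ultimately show ?thesis using drift unfolding y_def[symmetric] Q_def[symmetric] G_def[symmetric] z_def[symmetric]
          by (simp add: algebra_simps)
      qed
    qed
    have "f (x h n \<omega>) - f (x h 0 \<omega>) - ito_rest f f1 f2 h n \<omega> = (\<Sum>k<n. f1 (x h k \<omega>) * dB h k \<omega> + f2 (x h k \<omega>) * dQ h k \<omega> / 2)"
      by (simp add: ito_rest_def)
    also have "\<dots> \<le> (\<Sum>k<n. h * (C * indicator {\<rho> - \<delta>..\<rho> + \<delta>} (x h k \<omega>) - 1) + W * c1 * (\<bar>x h k \<omega> - \<rho>\<bar> * dG h k \<omega>))"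
      by (rule sum_mono) (rule step)
    also have "\<dots> = C * (h * visits {\<rho> - \<delta>..\<rho> + \<delta>} h n \<omega>) - real n * h + W * c1 * (\<Sum>k<n. \<bar>x h k \<omega> - \<rho>\<bar> * dG h k \<omega>)"
    proof -
      have "(\<Sum>k<n. h * (C * indicator {\<rho> - \<delta>..\<rho> + \<delta>} (x h k \<omega>))) = C * (h * visits {\<rho> - \<delta>..\<rho> + \<delta>} h n \<omega>)"
        by (simp only: visits_def sum_distrib_left mult.left_commute)
      then show ?thesis
        by (simp only: sum.distrib sum_subtractf right_diff_distrib mult_1_right sum_distrib_left[symmetric] sum_constant card_lessThan)
    qed
    finally have "real n * h \<le> C * (h * visits {\<rho> - \<delta>..\<rho> + \<delta>} h n \<omega>) + W * c1 * (\<Sum>k<n. \<bar>x h k \<omega> - \<rho>\<bar> * dG h k \<omega>)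
       + ito_rest f f1 f2 h n \<omega> + f (x h 0 \<omega>) - f (x h n \<omega>)" by linarith
    moreover have "f (x h 0 \<omega>) \<le> (x h 0 \<omega> - \<rho>)\<^sup>2 / 2" using l e[of "x h 0 \<omega>"] by (simp add: f_def)
    moreover have "- a \<le> f (x h n \<omega>)"
    proof -
      have "a * e (x h n \<omega>) \<le> a" using l e[of "x h n \<omega>"] by (simp add: mult_left_le)
      moreover have "0 \<le> (x h n \<omega> - \<rho>)\<^sup>2 / 2" by simp
      ultimately show ?thesis unfolding f_def by linarith
    qed
    moreover have "ito_rest f f1 f2 h n \<omega> \<le> \<bar>ito_rest f f1 f2 h n \<omega>\<bar>" by simp
    ultimately show "real n * h \<le> C * (h * visits {\<rho> - \<delta>..\<rho> + \<delta>} h n \<omega>) + Z h n \<omega>"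
      unfolding Z_def by linarith
  qed
  have "negligible Z" by (rule negligibleI[OF _ _ A]) (use props in auto)
  then show ?thesis using that[of C Z] C bound by simp
qed

end

section \<open>Least squares residuals\<close>

text \<open>The difference of the two values controls v, because the points are at least 2 d apart;
  the value at y1 then controls u.\<close>

lemma two_point_norm_equivalence:
  fixes u v y1 y2 d Y :: real
  assumes d: "0 < d" and gap: "2 * d \<le> \<bar>y2 - y1\<bar>" and Y: "\<bar>y1\<bar> \<le> Y"
  shows "u\<^sup>2 + v\<^sup>2 \<le> (2 + (2 * Y\<^sup>2 + 1) / d\<^sup>2) * ((u + v * y1)\<^sup>2 + (u + v * y2)\<^sup>2)"
proof -
  define T where "T = (u + v * y1)\<^sup>2 + (u + v * y2)\<^sup>2"
  have v: "v\<^sup>2 \<le> T / d\<^sup>2"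
  proof -
    have "(2 * d)\<^sup>2 \<le> (y2 - y1)\<^sup>2" using power_mono[OF gap, of 2] d by simp
    then have "v\<^sup>2 * (2 * d)\<^sup>2 \<le> v\<^sup>2 * (y2 - y1)\<^sup>2" by (intro mult_left_mono) auto
    also have "\<dots> = ((u + v * y2) + - (u + v * y1))\<^sup>2"
      by (simp add: power_mult_distrib[symmetric] algebra_simps)
    also have "\<dots> \<le> 2 * T"
      using square_add_le[of "u + v * y2" "- (u + v * y1)"] by (simp only: T_def power2_minus distrib_left add.commute)
    finally have "2 * (v\<^sup>2 * d\<^sup>2) \<le> T" by (simp add: power_mult_distrib mult.commute)
    moreover have "0 \<le> v\<^sup>2 * d\<^sup>2" by simp
    ultimately have "v\<^sup>2 * d\<^sup>2 \<le> T" by linarith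
    then show ?thesis using d by (simp add: pos_le_divide_eq)
  qed
  have "u\<^sup>2 = ((u + v * y1) + - (v * y1))\<^sup>2" by simp
  also have "\<dots> \<le> 2 * (u + v * y1)\<^sup>2 + 2 * (- (v * y1))\<^sup>2" by (rule square_add_le)
  also have "\<dots> \<le> 2 * T + 2 * (Y\<^sup>2 * v\<^sup>2)"
  proof -
    have "y1\<^sup>2 \<le> Y\<^sup>2" using power_mono[OF Y, of 2] by simp
    then have "y1\<^sup>2 * v\<^sup>2 \<le> Y\<^sup>2 * v\<^sup>2" by (intro mult_right_mono) auto
    then have "2 * (- (v * y1))\<^sup>2 \<le> 2 * (Y\<^sup>2 * v\<^sup>2)" by (simp add: power_mult_distrib mult.commute)
    then show ?thesis by (intro add_mono) (simp add: T_def)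
  qed
  also have "\<dots> \<le> 2 * T + 2 * (Y\<^sup>2 * (T / d\<^sup>2))"
    using v by (intro add_left_mono mult_left_mono) auto
  finally have "u\<^sup>2 + v\<^sup>2 \<le> 2 * T + 2 * (Y\<^sup>2 * (T / d\<^sup>2)) + T / d\<^sup>2" using v by linarith
  also have "\<dots> = (2 + (2 * Y\<^sup>2 + 1) / d\<^sup>2) * T" by (simp add: algebra_simps add_divide_distrib)
  finally show ?thesis by (simp add: T_def)
qed

text \<open>Two separated groups of observations make the regression on \<open>1, y\<close> uniformly nondegenerate:
  an affine function is large on at least one of the groups.\<close>

lemma affine_sum_lower_bound:
  fixes y w :: "nat \<Rightarrow> real" and A1 A2 :: "real set"
  assumes w: "\<And>k. k < n \<Longrightarrow> 0 \<le> w k" "\<And>k. k < n \<Longrightarrow> y k \<in> A1 \<union> A2 \<Longrightarrow> w k = 1"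
    and N: "N \<le> (\<Sum>k<n. indicator A1 (y k))" "N \<le> (\<Sum>k<n. indicator A2 (y k))" and N0: "0 \<le> N" and a: "0 < a"
    and two: "\<And>y1 y2 u v. y1 \<in> A1 \<Longrightarrow> y2 \<in> A2 \<Longrightarrow> a * (u\<^sup>2 + v\<^sup>2) \<le> (u + v * y1)\<^sup>2 + (u + v * y2)\<^sup>2"
  shows "a / 2 * N * (u\<^sup>2 + v\<^sup>2) \<le> (\<Sum>k<n. (u + v * y k)\<^sup>2 * w k)"
proof -
  define t where "t = a / 2 * (u\<^sup>2 + v\<^sup>2)"
  have t: "0 \<le> t" using a by (simp add: t_def)
  have one: "t * N \<le> (\<Sum>k<n. (u + v * y k)\<^sup>2 * w k)"
    if A: "A = A1 \<or> A = A2" and big: "\<And>z. z \<in> A \<Longrightarrow> t \<le> (u + v * z)\<^sup>2" for A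
  proof -
    have "t * N \<le> t * (\<Sum>k<n. indicator A (y k))" using A N t by (intro mult_left_mono) auto
    also have "\<dots> = (\<Sum>k<n. t * indicator A (y k))" by (rule sum_distrib_left)
    also have "\<dots> \<le> (\<Sum>k<n. (u + v * y k)\<^sup>2 * w k)"
    proof (rule sum_mono)
      fix k assume "k \<in> {..<n}"
      then have k: "k < n" by simp
      show "t * indicator A (y k) \<le> (u + v * y k)\<^sup>2 * w k"
      proof (cases "y k \<in> A")
        case True
        then show ?thesis using big[OF True] w(2)[OF k] A by auto
      qed (use w(1)[OF k] in simp)
    qed
    finally show ?thesis .
  qed
  have "t * N \<le> (\<Sum>k<n. (u + v * y k)\<^sup>2 * w k)"
  proof (cases "\<forall>z\<in>A1. t \<le> (u + v * z)\<^sup>2")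
    case True
    then show ?thesis by (intro one[of A1]) auto
  next
    case False
    then obtain y1 where y1: "y1 \<in> A1" "(u + v * y1)\<^sup>2 < t" by auto
    have "t \<le> (u + v * z)\<^sup>2" if "z \<in> A2" for z
      using two[OF y1(1) that, of u v] y1(2) by (simp add: t_def algebra_simps)
    then show ?thesis by (intro one[of A2]) auto
  qed
  then show ?thesis by (simp add: t_def ac_simps)
qed

text \<open>By the normal equation, P equals the pairing of the fitted function with the increments.
  Young's inequality returns P/4 from the drift part, and nondegeneracy returns another P/4 from
  \<open>u * N0 + v * N1\<close>; moving P/2 to the left produces the factors 2.\<close>

lemma projection_bound:
  fixes y w B S :: "nat \<Rightarrow> real"
  assumes w: "\<And>k. k < n \<Longrightarrow> 0 \<le> w k \<and> w k \<le> 1" and r: "0 < r"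
    and nondeg: "r * (u\<^sup>2 + v\<^sup>2) \<le> (\<Sum>k<n. (u + v * y k)\<^sup>2 * w k)"
    and normal: "(\<Sum>k<n. (u + v * y k)\<^sup>2 * w k) = (\<Sum>k<n. (u + v * y k) * w k * (B k + S k))"
  shows "(\<Sum>k<n. (u + v * y k)\<^sup>2 * w k) \<le>
    2 * ((\<Sum>k<n. w k * S k)\<^sup>2 + (\<Sum>k<n. w k * y k * S k)\<^sup>2) / r + 2 * (\<Sum>k<n. (B k)\<^sup>2)"
proof -
  define P where "P = (\<Sum>k<n. (u + v * y k)\<^sup>2 * w k)"
  define N0 where "N0 = (\<Sum>k<n. w k * S k)"
  define N1 where "N1 = (\<Sum>k<n. w k * y k * S k)"
  have am: "a * b \<le> r / 4 * a\<^sup>2 + b\<^sup>2 / r" for a b :: real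
  proof -
    have "0 \<le> (sqrt r / 2 * a - b / sqrt r)\<^sup>2" by simp
    also have "\<dots> = r / 4 * a\<^sup>2 - a * b + b\<^sup>2 / r"
      using r by (simp add: power2_diff power_mult_distrib power_divide)
    finally show ?thesis by simp
  qed
  have am4: "a * b \<le> a\<^sup>2 / 4 + b\<^sup>2" for a b :: real
  proof -
    have "0 \<le> (a / 2 - b)\<^sup>2" by simp
    then show ?thesis by (simp add: power2_diff power_divide)
  qed
  have "P = (\<Sum>k<n. (u + v * y k) * w k * B k) + (u * N0 + v * N1)"
    unfolding P_def normal N0_def N1_def sum_distrib_left sum.distrib[symmetric]
    by (intro sum.cong refl) (simp add: algebra_simps)
  also have "(\<Sum>k<n. (u + v * y k) * w k * B k) \<le> (\<Sum>k<n. (u + v * y k)\<^sup>2 * w k / 4 + (B k)\<^sup>2)"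
  proof (rule sum_mono)
    fix k assume "k \<in> {..<n}"
    then have k: "0 \<le> w k" "w k \<le> 1" using w by auto
    have "(u + v * y k) * w k * B k = w k * ((u + v * y k) * B k)" by simp
    also have "\<dots> \<le> w k * ((u + v * y k)\<^sup>2 / 4 + (B k)\<^sup>2)" using k am4 by (intro mult_left_mono)
    also have "\<dots> \<le> (u + v * y k)\<^sup>2 * w k / 4 + (B k)\<^sup>2"
      using k by (simp add: distrib_left mult_left_le_one_le mult.commute)
    finally show "(u + v * y k) * w k * B k \<le> (u + v * y k)\<^sup>2 * w k / 4 + (B k)\<^sup>2" .
  qed
  also have "\<dots> = P / 4 + (\<Sum>k<n. (B k)\<^sup>2)" by (simp add: P_def sum.distrib sum_divide_distrib)
  also have "u * N0 + v * N1 \<le> (r / 4 * u\<^sup>2 + N0\<^sup>2 / r) + (r / 4 * v\<^sup>2 + N1\<^sup>2 / r)"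
    using am by (intro add_mono)
  also have "\<dots> = r * (u\<^sup>2 + v\<^sup>2) / 4 + (N0\<^sup>2 + N1\<^sup>2) / r" by (simp add: algebra_simps add_divide_distrib)
  also have "\<dots> \<le> P / 4 + (N0\<^sup>2 + N1\<^sup>2) / r" using nondeg by (simp add: P_def)
  finally have "P \<le> P / 4 + (\<Sum>k<n. (B k)\<^sup>2) + (P / 4 + (N0\<^sup>2 + N1\<^sup>2) / r)" by simp
  then have "P \<le> 2 * ((N0\<^sup>2 + N1\<^sup>2) / r) + 2 * (\<Sum>k<n. (B k)\<^sup>2)" by linarith
  then show ?thesis by (simp only: P_def N0_def N1_def times_divide_eq_right)
qed

section \<open>Consistency of the residual variance\<close>

context diffusion_grid
begin

text \<open>For n > 0 the quotient equals 1/(nh) + sqrt h + 1/sqrt(nh).\<close>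

lemma rate_tendsto:
  assumes hs: "\<And>n. 0 < hs n" "hs \<longlonglongrightarrow> 0" "filterlim (\<lambda>n. real n * hs n) at_top sequentially"
  shows "(\<lambda>n. (1 + rate (hs n) n) / (real n * hs n)) \<longlonglongrightarrow> 0"
proof -
  have inv: "(\<lambda>n. inverse (real n * hs n)) \<longlonglongrightarrow> 0"
    using hs(3) by (rule tendsto_inverse_0_at_top)
  have "(\<lambda>n. inverse (real n * hs n) + (sqrt (hs n) + sqrt (inverse (real n * hs n)))) \<longlonglongrightarrow> 0 + (sqrt 0 + sqrt 0)"
    by (intro tendsto_add tendsto_real_sqrt inv hs)
  then have lim: "(\<lambda>n. inverse (real n * hs n) + (sqrt (hs n) + sqrt (inverse (real n * hs n)))) \<longlonglongrightarrow> 0" by simp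
  have "\<forall>\<^sub>F n in sequentially. inverse (real n * hs n) + (sqrt (hs n) + sqrt (inverse (real n * hs n)))
     = (1 + rate (hs n) n) / (real n * hs n)"
    using eventually_gt_at_top[of 0]
  proof eventually_elim
    case (elim n)
    define a where "a = real n * hs n"
    have a: "0 < a" using elim hs(1)[of n] by (simp add: a_def)
    have "sqrt (inverse a) = sqrt a / a"
      using a by (simp add: real_sqrt_inverse) (simp add: field_simps)
    moreover have "real n * (hs n * sqrt (hs n)) / a = sqrt (hs n)" using elim hs(1)[of n] by (simp add: a_def)
    ultimately show ?case
      unfolding rate_def a_def[symmetric] by (simp add: add_divide_distrib inverse_eq_divide)
  qed
  with lim show ?thesis by (rule Lim_transform_eventually)
qed

text \<open>Markov's inequality at level \<eta> nh. The tolerance in \<open>negligible\<close> is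
  taken as \<eta> e / 2, so the linear part contributes e/2; the remainder vanishes by
  \<open>rate_tendsto\<close>.\<close>

lemma negligible_prob_tendsto:
  assumes Z: "negligible Z" and hs: "\<And>n. 0 < hs n" "hs \<longlonglongrightarrow> 0" "filterlim (\<lambda>n. real n * hs n) at_top sequentially"
    and \<eta>: "0 < \<eta>"
  shows "(\<lambda>n. measure M {\<omega> \<in> space M. Z (hs n) n \<omega> > \<eta> * (real n * hs n)}) \<longlonglongrightarrow> 0"
proof (rule LIMSEQ_I)
  fix e :: real assume e: "0 < e"
  obtain A where A: "0 \<le> A" "\<And>h n. 0 < h \<Longrightarrow> h \<le> h0 \<Longrightarrow>
      (\<integral>\<omega>. Z h n \<omega> \<partial>M) \<le> \<eta> * e / 2 * (real n * h) + A * (1 + rate h n)"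
    using Z[unfolded negligible_def, THEN conjunct2, rule_format, of "\<eta> * e / 2"] e \<eta> by auto
  have "(\<lambda>n. A / \<eta> * ((1 + rate (hs n) n) / (real n * hs n))) \<longlonglongrightarrow> A / \<eta> * 0"
    by (intro tendsto_mult_left rate_tendsto hs)
  then have "\<forall>\<^sub>F n in sequentially. A / \<eta> * ((1 + rate (hs n) n) / (real n * hs n)) < e / 2"
    using e by (intro order_tendstoD(2)[of _ 0]) auto
  moreover have "\<forall>\<^sub>F n in sequentially. hs n < h0" using hs(2) h0(1) by (rule order_tendstoD(2))
  ultimately have "\<forall>\<^sub>F n in sequentially. norm (measure M {\<omega> \<in> space M. Z (hs n) n \<omega> > \<eta> * (real n * hs n)} - 0) < e"
    using eventually_gt_at_top[of 0]
  proof eventually_elim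
    case (elim n)
    define a where "a = real n * hs n"
    have a: "0 < a" using elim hs(1)[of n] by (simp add: a_def)
    have h: "0 < hs n" "hs n \<le> h0" using elim hs(1)[of n] by auto
    have i: "integrable M (Z (hs n) n)" and nn: "\<And>\<omega>. \<omega> \<in> space M \<Longrightarrow> 0 \<le> Z (hs n) n \<omega>"
      using Z h by (auto simp: negligible_def)
    have "measure M {\<omega> \<in> space M. Z (hs n) n \<omega> > \<eta> * a} \<le> measure M {\<omega> \<in> space M. Z (hs n) n \<omega> \<ge> \<eta> * a}"
      using i by (intro finite_measure_mono) auto
    also have "\<dots> \<le> (1 / (\<eta> * a)) * (\<integral>\<omega>. Z (hs n) n \<omega> \<partial>M)"
      using integral_Markov_inequality_measure[OF i sets.top _ mult_pos_pos[OF \<eta> a]] nn by simp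
    also have "\<dots> \<le> (1 / (\<eta> * a)) * (\<eta> * e / 2 * a + A * (1 + rate (hs n) n))"
      using A(2)[OF h, of n] \<eta> a by (intro mult_left_mono) (auto simp: a_def)
    also have "\<dots> = e / 2 + A / \<eta> * ((1 + rate (hs n) n) / a)"
      using \<eta> a by (simp add: field_simps)
    also have "\<dots> < e" using elim(1) unfolding a_def by linarith
    finally show ?case by (simp add: a_def)
  qed
  then show "\<exists>no. \<forall>n\<ge>no. norm (measure M {\<omega> \<in> space M. Z (hs n) n \<omega> > \<eta> * (real n * hs n)} - 0) < e"
    by (simp add: eventually_sequentially)
qed

lemma negligible_drift_squares: "negligible (\<lambda>h n \<omega>. \<Sum>k<n. (dB h k \<omega>)\<^sup>2)"
proof (rule negligibleI[of _ CE])
  show "0 \<le> CE" by (rule CE_nonneg[OF h0(1) order_refl])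
  fix h :: real and n :: nat assume h: "0 < h" "h \<le> h0"
  have i: "integrable M (\<lambda>\<omega>. (dB h k \<omega>)\<^sup>2)" for k by (rule L2_integrable_square[OF dB_L2[OF h]])
  show "integrable M (\<lambda>\<omega>. \<Sum>k<n. (dB h k \<omega>)\<^sup>2)" using i by auto
  have "(\<integral>\<omega>. (\<Sum>k<n. (dB h k \<omega>)\<^sup>2) \<partial>M) = (\<Sum>k<n. \<integral>\<omega>. (dB h k \<omega>)\<^sup>2 \<partial>M)" using i by simp
  also have "\<dots> \<le> (\<Sum>k<n. CE * (h * sqrt h))"
    using order_trans[OF dB_square[OF h] mult_left_mono[OF h_props(7)[OF h] CE_nonneg[OF h]]] by (rule sum_mono)
  also have "\<dots> = CE * (real n * (h * sqrt h))" by simp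
  also have "\<dots> \<le> CE * (1 + rate h n)"
    using rate_ge[OF h(1), of n] CE_nonneg[OF h] by (intro mult_left_mono) auto
  finally show "(\<integral>\<omega>. (\<Sum>k<n. (dB h k \<omega>)\<^sup>2) \<partial>M) \<le> CE * (1 + rate h n)" .
qed (simp add: sum_nonneg)

section \<open>Squared increments and residuals in one regime\<close>

context
  fixes I :: "real set" and \<Theta> :: "real set" and \<sigma> :: real
  assumes I: "I \<in> sets borel" and sg_I: "\<And>y. y \<in> I \<Longrightarrow> sg y = \<sigma>" and \<Theta>: "finite \<Theta>"
    and boundary: "\<And>\<delta> y y'. y \<in> I \<Longrightarrow> (\<forall>\<theta>\<in>\<Theta>. \<delta> < \<bar>y - \<theta>\<bar>) \<Longrightarrow> \<bar>y' - y\<bar> \<le> \<delta> \<Longrightarrow> y' \<in> I"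
begin

lemma weight_adapted:
  assumes h: "0 < h" "h \<le> h0"
  shows "(\<lambda>\<omega>. indicator I (x h k \<omega>) :: real) \<in> borel_measurable (F (real k * h))"
    and "(\<lambda>\<omega>. indicator I (x h k \<omega>) * x h k \<omega>) \<in> borel_measurable (F (real k * h))"
proof -
  show *: "(\<lambda>\<omega>. indicator I (x h k \<omega>) :: real) \<in> borel_measurable (F (real k * h))"
    by (rule measurable_compose[OF x_adapted[OF h]]) (use I in auto)
  show "(\<lambda>\<omega>. indicator I (x h k \<omega>) * x h k \<omega>) \<in> borel_measurable (F (real k * h))"
    using * x_adapted[OF h] by (rule borel_measurable_times)
qed

text \<open>Each squared sum has mean of order nh. The division by n reflects the nondegeneracy
  constant in \<open>projection_bound\<close>, which will be proportional to n, and leaves the order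
  h.\<close>

lemma negligible_noise_sums:
  "negligible (\<lambda>h n \<omega>. ((\<Sum>k<n. indicator I (x h k \<omega>) * dS h k \<omega>)\<^sup>2
     + (\<Sum>k<n. indicator I (x h k \<omega>) * x h k \<omega> * dS h k \<omega>)\<^sup>2) / real n)"
proof (rule negligibleI[of _ "K\<^sup>2 * (1 + E)"])
  show "0 \<le> K\<^sup>2 * (1 + E)" using E_nonneg[OF h0(1) order_refl] by simp
  fix h :: real and n :: nat assume h: "0 < h" "h \<le> h0"
  let ?N0 = "\<lambda>\<omega>. \<Sum>k<n. indicator I (x h k \<omega>) * dS h k \<omega>"
  let ?N1 = "\<lambda>\<omega>. \<Sum>k<n. indicator I (x h k \<omega>) * x h k \<omega> * dS h k \<omega>"
  have L0: "L2 M (\<lambda>\<omega>. indicator I (x h k \<omega>) :: real)" for k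
    by (rule L2_bound[OF L2_const[of 1] measurable_F_M[OF weight_adapted(1)[OF h]]]) (auto simp: indicator_def)
  have m0: "(\<integral>\<omega>. (indicator I (x h k \<omega>) :: real)\<^sup>2 \<partial>M) \<le> 1" for k
  proof -
    have "(\<integral>\<omega>. (indicator I (x h k \<omega>) :: real)\<^sup>2 \<partial>M) \<le> (\<integral>\<omega>. 1 \<partial>M)"
      using L2_integrable_square[OF L0] by (intro integral_mono) (auto simp: indicator_def)
    then show ?thesis by (simp add: prob_space)
  qed
  have L1: "L2 M (\<lambda>\<omega>. indicator I (x h k \<omega>) * x h k \<omega>)" for k
    by (rule L2_bound[OF x_L2[OF h] measurable_F_M[OF weight_adapted(2)[OF h]]]) (auto simp: indicator_def)
  have m1: "(\<integral>\<omega>. (indicator I (x h k \<omega>) * x h k \<omega>)\<^sup>2 \<partial>M) \<le> E" for k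
  proof -
    have "(\<integral>\<omega>. (indicator I (x h k \<omega>) * x h k \<omega>)\<^sup>2 \<partial>M) \<le> (\<integral>\<omega>. (x h k \<omega>)\<^sup>2 \<partial>M)"
      using L2_integrable_square[OF L1] L2_integrable_square[OF x_L2[OF h]]
      by (intro integral_mono) (auto simp: indicator_def)
    then show ?thesis using x_square[OF h, of k] by linarith
  qed
  note s0 = weighted_dS_sum[OF h weight_adapted(1)[OF h] L0 m0, of n]
  note s1 = weighted_dS_sum[OF h weight_adapted(2)[OF h] L1 m1, of n]
  have i: "integrable M (\<lambda>\<omega>. (?N0 \<omega>)\<^sup>2)" "integrable M (\<lambda>\<omega>. (?N1 \<omega>)\<^sup>2)"
    using s0(1) s1(1) by (auto intro: L2_integrable_square)
  show "integrable M (\<lambda>\<omega>. ((?N0 \<omega>)\<^sup>2 + (?N1 \<omega>)\<^sup>2) / real n)"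
    by (intro integrable_divide_zero Bochner_Integration.integrable_add i)
  have "(\<integral>\<omega>. ((?N0 \<omega>)\<^sup>2 + (?N1 \<omega>)\<^sup>2) / real n \<partial>M) = ((\<integral>\<omega>. (?N0 \<omega>)\<^sup>2 \<partial>M) + (\<integral>\<omega>. (?N1 \<omega>)\<^sup>2 \<partial>M)) / real n"
    by (simp only: integral_divide_zero Bochner_Integration.integral_add[OF i])
  also have "\<dots> \<le> (K\<^sup>2 * 1 * (real n * h) + K\<^sup>2 * E * (real n * h)) / real n"
    using s0(2) s1(2) by (intro divide_right_mono add_mono) auto
  \<comment> \<open>For n = 0 the quotient is 0 by convention.\<close>
  also have "\<dots> \<le> K\<^sup>2 * (1 + E) * h"
    using h E_nonneg[OF h] by (cases "n = 0") (auto simp: field_simps)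
  also have "\<dots> \<le> K\<^sup>2 * (1 + E) * (1 + rate h n)"
    using h_props(1)[OF h] rate_nonneg[OF h(1), of n] E_nonneg[OF h] by (intro mult_left_mono) auto
  finally show "(\<integral>\<omega>. ((?N0 \<omega>)\<^sup>2 + (?N1 \<omega>)\<^sup>2) / real n \<partial>M) \<le> K\<^sup>2 * (1 + E) * (1 + rate h n)" .
qed simp

text \<open>The coefficient differs from \<sigma> only when the path has left I. Then it started
  within \<delta> of a threshold or has moved by at least \<delta>; the first case is counted by the
  neighbourhood indicators, the second by displacement divided by \<delta>.\<close>

lemma qvar_in_regime:
  assumes h: "0 < h" "h \<le> h0" and \<omega>: "\<omega> \<in> space M" and \<delta>: "0 < \<delta>"
  shows "\<bar>indicator I (x h k \<omega>) * (dQ h k \<omega> - \<sigma>\<^sup>2 * h)\<bar>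
    \<le> K\<^sup>2 * (h * (\<Sum>\<theta>\<in>\<Theta>. indicator {\<theta> - \<delta>..\<theta> + \<delta>} (x h k \<omega>)) + dG h k \<omega> / \<delta>)"
proof (cases "x h k \<omega> \<in> I")
  case True
  define s where "s = real k * h"
  have st: "0 \<le> s" "s \<le> s + h" using h by (auto simp: s_def)
  define near where "near = (\<Sum>\<theta>\<in>\<Theta>. indicator {\<theta> - \<delta>..\<theta> + \<delta>} (x h k \<omega>) :: real)"
  have near: "0 \<le> near" by (simp add: near_def sum_nonneg)
  have xs: "x h k \<omega> = X s \<omega>" by (simp add: x_def s_def)
  have sg2: "(sg y)\<^sup>2 \<le> K\<^sup>2" "0 \<le> (sg y)\<^sup>2" for y using power_mono[OF sg_bound[of y], of 2] by auto
  have \<sigma>2: "\<sigma>\<^sup>2 \<le> K\<^sup>2" "0 \<le> \<sigma>\<^sup>2" using sg2[of "x h k \<omega>"] sg_I[OF True] by auto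
  have i1: "integrable (time_measure s (s + h)) (\<lambda>u. (sg (X u \<omega>))\<^sup>2)"
    by (rule path_integrable[where \<phi>="\<lambda>y. (sg y)\<^sup>2" and a="K\<^sup>2" and d=0, OF st _ \<omega>]) (use sg2 sg_borel in auto)
  have i2: "integrable (time_measure s (s + h)) (\<lambda>u. \<bar>X u \<omega> - X s \<omega>\<bar>)"
    by (rule path_integrable[where \<phi>="\<lambda>y. \<bar>y - X s \<omega>\<bar>" and a="\<bar>X s \<omega>\<bar>" and d=1]) (use st \<omega> in auto)
  have dQs: "dQ h k \<omega> = qvar s (s + h) \<omega>" and dGs: "dG h k \<omega> = osc s (s + h) \<omega>"
    by (simp_all add: dQ_def dG_def s_def)
  have "\<bar>dQ h k \<omega> - \<sigma>\<^sup>2 * h\<bar> = \<bar>\<integral>u. (sg (X u \<omega>))\<^sup>2 - \<sigma>\<^sup>2 \<partial>time_measure s (s + h)\<bar>"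
    using i1 st by (simp add: dQs qvar_def measure_space_time_measure mult.commute[of h])
  also have "\<dots> \<le> (\<integral>u. \<bar>(sg (X u \<omega>))\<^sup>2 - \<sigma>\<^sup>2\<bar> \<partial>time_measure s (s + h))" by (rule integral_abs_bound)
  also have "\<dots> \<le> (\<integral>u. K\<^sup>2 * (near + \<bar>X u \<omega> - X s \<omega>\<bar> / \<delta>) \<partial>time_measure s (s + h))"
  proof (rule integral_mono)
    fix u
    show "\<bar>(sg (X u \<omega>))\<^sup>2 - \<sigma>\<^sup>2\<bar> \<le> K\<^sup>2 * (near + \<bar>X u \<omega> - X s \<omega>\<bar> / \<delta>)"
    proof (cases "X u \<omega> \<in> I")
      case True
      then show ?thesis using near \<delta> sg_I by simp
    next
      case False
      have "1 \<le> near + \<bar>X u \<omega> - X s \<omega>\<bar> / \<delta>"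
      proof (cases "\<forall>\<theta>\<in>\<Theta>. \<delta> < \<bar>X s \<omega> - \<theta>\<bar>")
        case True
        then have "\<delta> \<le> \<bar>X u \<omega> - X s \<omega>\<bar>"
          using boundary[of "X s \<omega>" \<delta> "X u \<omega>"] False \<open>x h k \<omega> \<in> I\<close> by (force simp: xs)
        then have "1 \<le> \<bar>X u \<omega> - X s \<omega>\<bar> / \<delta>" using \<delta> by (simp add: pos_le_divide_eq)
        then show ?thesis using near by simp
      next
        case False
        then obtain \<theta> where \<theta>: "\<theta> \<in> \<Theta>" "\<bar>X s \<omega> - \<theta>\<bar> \<le> \<delta>" by force
        then have "indicator {\<theta> - \<delta>..\<theta> + \<delta>} (x h k \<omega>) = (1::real)" by (auto simp: xs abs_le_iff)
        moreover have "indicator {\<theta> - \<delta>..\<theta> + \<delta>} (x h k \<omega>) \<le> near"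
          unfolding near_def by (rule member_le_sum[OF \<theta>(1)]) (use \<Theta> in auto)
        moreover have "0 \<le> \<bar>X u \<omega> - X s \<omega>\<bar> / \<delta>" using \<delta> by simp
        ultimately show ?thesis by linarith
      qed
      then have "K\<^sup>2 * 1 \<le> K\<^sup>2 * (near + \<bar>X u \<omega> - X s \<omega>\<bar> / \<delta>)" by (intro mult_left_mono) auto
      moreover have "\<bar>(sg (X u \<omega>))\<^sup>2 - \<sigma>\<^sup>2\<bar> \<le> K\<^sup>2" using sg2[of "X u \<omega>"] \<sigma>2 by linarith
      ultimately show ?thesis by simp
    qed
  qed (use i1 i2 in auto)
  also have "\<dots> = K\<^sup>2 * (h * near + dG h k \<omega> / \<delta>)"
    using i2 st by (simp add: dGs osc_def measure_space_time_measure mult.commute[of h])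
  finally show ?thesis using True by (simp add: near_def)
next
  case False
  then show ?thesis using h \<delta> dG_nonneg[OF h, of k \<omega>] by (simp add: sum_nonneg)
qed

text \<open>The squared increment splits into a compensated square, the bracket \<open>dQ\<close>
  and terms containing the drift. Replacing \<open>dQ\<close> by \<sigma>^2 h costs S \<delta> nh
  near the thresholds, which is where the tolerance of \<open>negligible\<close> is spent; all other
  errors are of order 1 + \<open>rate\<close>, with a constant that may depend on \<delta>.\<close>

lemma negligible_quadratic_variation:
  "negligible (\<lambda>h n \<omega>. \<bar>(\<Sum>k<n. (x h (Suc k) \<omega> - x h k \<omega>)\<^sup>2 * indicator I (x h k \<omega>)) - \<sigma>\<^sup>2 * (h * visits I h n \<omega>)\<bar>)"
  (is "negligible (\<lambda>h n \<omega>. \<bar>?U h n \<omega>\<bar>)")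
proof -
  let ?w = "\<lambda>h k \<omega>. indicator I (x h k \<omega>) :: real"
  have CE0: "0 \<le> CE" by (rule CE_nonneg[OF h0(1) order_refl])
  have "\<forall>\<theta>. \<exists>C\<ge>0. \<forall>\<delta>>0. \<exists>A\<ge>0. \<forall>h n. 0 < h \<longrightarrow> h \<le> h0 \<longrightarrow>
     h * (\<integral>\<omega>. visits {\<theta> - \<delta>..\<theta> + \<delta>} h n \<omega> \<partial>M) \<le> C * \<delta> * (real n * h) + A * (1 + rate h n)"
    by (metis few_visits_near_point)
  then obtain Cn where Cn: "\<And>\<theta>. 0 \<le> Cn \<theta>" "\<And>\<theta> \<delta>. 0 < \<delta> \<Longrightarrow> \<exists>A\<ge>0. \<forall>h n. 0 < h \<longrightarrow> h \<le> h0 \<longrightarrow>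
     h * (\<integral>\<omega>. visits {\<theta> - \<delta>..\<theta> + \<delta>} h n \<omega> \<partial>M) \<le> Cn \<theta> * \<delta> * (real n * h) + A * (1 + rate h n)"
    by metis
  define com where "com h n \<omega> = (\<Sum>k<n. ?w h k \<omega> * ((dS h k \<omega>)\<^sup>2 - dQ h k \<omega>))" for h n \<omega>
  \<comment> \<open>Majorant of 2 |dS dB| + dB^2. As dS^2 is of order h and dB^2 of order h^2, the
    weight sqrt h balances the cross term at h^(3/2).\<close>
  define crs where "crs h k \<omega> = sqrt h * (dS h k \<omega>)\<^sup>2 + (dB h k \<omega>)\<^sup>2 / sqrt h + (dB h k \<omega>)\<^sup>2" for h k \<omega>
  define D3 where "D3 = sqrt (8 * 1\<^sup>2 * K ^ 4)"
  have basic: "integrable M (?U h n)" "integrable M (com h n)" "integrable M (crs h k)" "integrable M (dG h k)"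
      "(\<integral>\<omega>. \<bar>com h n \<omega>\<bar> \<partial>M) \<le> D3 * sqrt (real n * h)"
      "(\<integral>\<omega>. crs h k \<omega> \<partial>M) \<le> (K\<^sup>2 + 2 * CE) * (h * sqrt h)"
    if h: "0 < h" "h \<le> h0" for h n k
  proof -
    have wm: "(\<lambda>\<omega>. ?w h k \<omega>) \<in> borel_measurable M" for k by (rule measurable_F_M[OF weight_adapted(1)[OF h]])
    have L: "L2 M (\<lambda>\<omega>. x h (Suc k) \<omega> - x h k \<omega>)" for k by (intro L2_diff x_L2 h)
    have "integrable M (\<lambda>\<omega>. (x h (Suc k) \<omega> - x h k \<omega>)\<^sup>2 * ?w h k \<omega>)" for k
    proof (rule Bochner_Integration.integrable_bound[OF L2_integrable_square[OF L[of k]]])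
      show "(\<lambda>\<omega>. (x h (Suc k) \<omega> - x h k \<omega>)\<^sup>2 * ?w h k \<omega>) \<in> borel_measurable M"
        using L2_measurable[OF L] wm by (intro borel_measurable_times borel_measurable_power)
    qed (auto simp: indicator_def)
    then show "integrable M (?U h n)"
      by (intro Bochner_Integration.integrable_diff Bochner_Integration.integrable_sum integrable_mult_right integrable_visits h I)
    have w1: "\<bar>?w h k \<omega>\<bar> \<le> 1" for k \<omega> by (simp add: indicator_def)
    note c2 = weighted_compensated_sum[OF h weight_adapted(1)[OF h] w1, of n, folded com_def]
    show "integrable M (com h n)" by (rule L2_integrable[OF c2(1)])
    have "(\<integral>\<omega>. \<bar>com h n \<omega>\<bar> \<partial>M) \<le> sqrt (8 * 1\<^sup>2 * K ^ 4 * (real n * h))"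
      by (rule expectation_abs_le[OF c2])
    then show "(\<integral>\<omega>. \<bar>com h n \<omega>\<bar> \<partial>M) \<le> D3 * sqrt (real n * h)" unfolding D3_def real_sqrt_mult by (simp add: real_sqrt_mult)
    have i: "integrable M (\<lambda>\<omega>. (dB h k \<omega>)\<^sup>2)" "integrable M (\<lambda>\<omega>. (dS h k \<omega>)\<^sup>2)"
      using dB_L2[OF h] dS_L2[OF h] by (auto simp: L2_def)
    show "integrable M (crs h k)" unfolding crs_def using i by auto
    show "integrable M (dG h k)" by (rule L2_integrable[OF dG_L2[OF h]])
    have hp: "0 < sqrt h" using h by simp
    have "(\<integral>\<omega>. crs h k \<omega> \<partial>M) = sqrt h * (\<integral>\<omega>. (dS h k \<omega>)\<^sup>2 \<partial>M) + (\<integral>\<omega>. (dB h k \<omega>)\<^sup>2 \<partial>M) / sqrt h + (\<integral>\<omega>. (dB h k \<omega>)\<^sup>2 \<partial>M)"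
      unfolding crs_def using i by simp
    also have "\<dots> \<le> sqrt h * (K\<^sup>2 * h) + CE * h\<^sup>2 / sqrt h + CE * (h * sqrt h)"
      using hp by (intro add_mono mult_left_mono divide_right_mono dS_square dB_square h
          order_trans[OF dB_square[OF h] mult_left_mono[OF h_props(7)[OF h] CE0]]) auto
    also have "CE * h\<^sup>2 / sqrt h = CE * (h * sqrt h)" using h by (simp add: power2_eq_square field_simps)
    finally show "(\<integral>\<omega>. crs h k \<omega> \<partial>M) \<le> (K\<^sup>2 + 2 * CE) * (h * sqrt h)" by (simp add: algebra_simps)
  qed
  have pw: "\<bar>?U h n \<omega>\<bar> \<le> \<bar>com h n \<omega>\<bar> + (\<Sum>k<n. crs h k \<omega>)
      + (K\<^sup>2 * (\<Sum>\<theta>\<in>\<Theta>. h * visits {\<theta> - \<delta>..\<theta> + \<delta>} h n \<omega>) + K\<^sup>2 / \<delta> * (\<Sum>k<n. dG h k \<omega>))"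
    if h: "0 < h" "h \<le> h0" and \<omega>: "\<omega> \<in> space M" and \<delta>: "0 < \<delta>" for h n \<omega> \<delta>
  proof -
    have "?U h n \<omega> = (\<Sum>k<n. ?w h k \<omega> * ((dS h k \<omega>)\<^sup>2 - dQ h k \<omega>) + (?w h k \<omega> * (dQ h k \<omega> - \<sigma>\<^sup>2 * h)
        + ?w h k \<omega> * (2 * (dS h k \<omega> * dB h k \<omega>) + (dB h k \<omega>)\<^sup>2)))"
      unfolding visits_def sum_distrib_left sum_subtractf[symmetric] x_Suc
      by (intro sum.cong refl) (simp add: power2_sum algebra_simps)
    also have "\<dots> = com h n \<omega> + ((\<Sum>k<n. ?w h k \<omega> * (dQ h k \<omega> - \<sigma>\<^sup>2 * h))
        + (\<Sum>k<n. ?w h k \<omega> * (2 * (dS h k \<omega> * dB h k \<omega>) + (dB h k \<omega>)\<^sup>2)))"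
      by (simp only: sum.distrib com_def)
    finally have "\<bar>?U h n \<omega>\<bar> \<le> \<bar>com h n \<omega>\<bar> + (\<bar>\<Sum>k<n. ?w h k \<omega> * (dQ h k \<omega> - \<sigma>\<^sup>2 * h)\<bar>
        + \<bar>\<Sum>k<n. ?w h k \<omega> * (2 * (dS h k \<omega> * dB h k \<omega>) + (dB h k \<omega>)\<^sup>2)\<bar>)" by linarith
    also have "\<dots> \<le> \<bar>com h n \<omega>\<bar> + ((\<Sum>k<n. K\<^sup>2 * (h * (\<Sum>\<theta>\<in>\<Theta>. indicator {\<theta> - \<delta>..\<theta> + \<delta>} (x h k \<omega>)) + dG h k \<omega> / \<delta>))
        + (\<Sum>k<n. crs h k \<omega>))"
    proof (intro add_mono order_refl)
      show "\<bar>\<Sum>k<n. ?w h k \<omega> * (dQ h k \<omega> - \<sigma>\<^sup>2 * h)\<bar>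
        \<le> (\<Sum>k<n. K\<^sup>2 * (h * (\<Sum>\<theta>\<in>\<Theta>. indicator {\<theta> - \<delta>..\<theta> + \<delta>} (x h k \<omega>)) + dG h k \<omega> / \<delta>))"
        by (rule order_trans[OF sum_abs sum_mono]) (rule qvar_in_regime[OF h \<omega> \<delta>])
      show "\<bar>\<Sum>k<n. ?w h k \<omega> * (2 * (dS h k \<omega> * dB h k \<omega>) + (dB h k \<omega>)\<^sup>2)\<bar> \<le> (\<Sum>k<n. crs h k \<omega>)"
      proof (rule order_trans[OF sum_abs sum_mono])
        fix k
        define u v where "u = sqrt (sqrt h) * dS h k \<omega>" and "v = dB h k \<omega> / sqrt (sqrt h)"
        have uv: "u * v = dS h k \<omega> * dB h k \<omega>" "u\<^sup>2 = sqrt h * (dS h k \<omega>)\<^sup>2" "v\<^sup>2 = (dB h k \<omega>)\<^sup>2 / sqrt h"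
          using h by (auto simp: u_def v_def power_mult_distrib power_divide)
        have "\<bar>?w h k \<omega> * (2 * (dS h k \<omega> * dB h k \<omega>) + (dB h k \<omega>)\<^sup>2)\<bar> \<le> \<bar>2 * (dS h k \<omega> * dB h k \<omega>) + (dB h k \<omega>)\<^sup>2\<bar>"
          by (simp add: indicator_def)
        also have "\<dots> \<le> 2 * \<bar>u * v\<bar> + (dB h k \<omega>)\<^sup>2" unfolding uv(1)
          by (rule order_trans[OF abs_triangle_ineq]) simp
        also have "\<dots> \<le> u\<^sup>2 + v\<^sup>2 + (dB h k \<omega>)\<^sup>2" using two_abs_mult_le[of u v] by simp
        finally show "\<bar>?w h k \<omega> * (2 * (dS h k \<omega> * dB h k \<omega>) + (dB h k \<omega>)\<^sup>2)\<bar> \<le> crs h k \<omega>"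
          by (simp add: crs_def uv)
      qed
    qed
    also have "(\<Sum>k<n. K\<^sup>2 * (h * (\<Sum>\<theta>\<in>\<Theta>. indicator {\<theta> - \<delta>..\<theta> + \<delta>} (x h k \<omega>)) + dG h k \<omega> / \<delta>))
      = K\<^sup>2 * (\<Sum>\<theta>\<in>\<Theta>. h * visits {\<theta> - \<delta>..\<theta> + \<delta>} h n \<omega>) + K\<^sup>2 / \<delta> * (\<Sum>k<n. dG h k \<omega>)"
    proof -
      have "(\<Sum>k<n. \<Sum>\<theta>\<in>\<Theta>. indicator {\<theta> - \<delta>..\<theta> + \<delta>} (x h k \<omega>) :: real) = (\<Sum>\<theta>\<in>\<Theta>. visits {\<theta> - \<delta>..\<theta> + \<delta>} h n \<omega>)"
        unfolding visits_def by (rule sum.swap)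
      then show ?thesis
        by (simp only: distrib_left sum.distrib sum_distrib_left[symmetric] sum_divide_distrib[symmetric]) simp
    qed
    finally show ?thesis by simp
  qed
  show ?thesis
    unfolding negligible_def
  proof (intro conjI allI impI)
    fix h :: real and n :: nat assume h: "0 < h" "h \<le> h0"
    show "integrable M (\<lambda>\<omega>. \<bar>?U h n \<omega>\<bar>)" using basic(1)[OF h] by (rule integrable_abs)
    show "\<forall>\<omega>\<in>space M. 0 \<le> \<bar>?U h n \<omega>\<bar>" by simp
  next
    fix \<epsilon> :: real assume \<epsilon>: "0 < \<epsilon>"
    define S where "S = K\<^sup>2 * (\<Sum>\<theta>\<in>\<Theta>. Cn \<theta>)"
    have S: "0 \<le> S" using Cn(1) by (simp add: S_def sum_nonneg)
    \<comment> \<open>Chosen after \<epsilon>, to make the summed constant S times \<delta> at most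
      \<epsilon>; the added 1 covers S = 0.\<close>
    define \<delta> where "\<delta> = \<epsilon> / (S + 1)"
    have \<delta>: "0 < \<delta>" "S * \<delta> \<le> \<epsilon>" using \<epsilon> S by (auto simp: \<delta>_def field_simps)
    obtain An where An: "\<And>\<theta>. 0 \<le> An \<theta>" "\<And>\<theta> h n. 0 < h \<Longrightarrow> h \<le> h0 \<Longrightarrow>
     h * (\<integral>\<omega>. visits {\<theta> - \<delta>..\<theta> + \<delta>} h n \<omega> \<partial>M) \<le> Cn \<theta> * \<delta> * (real n * h) + An \<theta> * (1 + rate h n)"
      using Cn(2)[OF \<delta>(1)] by metis
    define A where "A = D3 + (K\<^sup>2 + 2 * CE) + K\<^sup>2 * (\<Sum>\<theta>\<in>\<Theta>. An \<theta>) + K\<^sup>2 / \<delta> * sqrt CE"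
    have D3: "0 \<le> D3" by (simp add: D3_def)
    show "\<exists>A\<ge>0. \<forall>h n. 0 < h \<longrightarrow> h \<le> h0 \<longrightarrow> (\<integral>\<omega>. \<bar>?U h n \<omega>\<bar> \<partial>M) \<le> \<epsilon> * (real n * h) + A * (1 + rate h n)"
    proof (intro exI[of _ A] conjI allI impI)
      show "0 \<le> A" unfolding A_def using D3 CE0 An(1) \<delta> by (intro add_nonneg_nonneg mult_nonneg_nonneg sum_nonneg) auto
      fix h :: real and n :: nat assume h: "0 < h" "h \<le> h0"
      have iV: "integrable M (visits {\<theta> - \<delta>..\<theta> + \<delta>} h n)" for \<theta> by (rule integrable_visits[OF h]) simp
      note i = basic(2-4)[OF h]
      have "(\<integral>\<omega>. \<bar>?U h n \<omega>\<bar> \<partial>M) \<le> (\<integral>\<omega>. \<bar>com h n \<omega>\<bar> + (\<Sum>k<n. crs h k \<omega>)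
        + (K\<^sup>2 * (\<Sum>\<theta>\<in>\<Theta>. h * visits {\<theta> - \<delta>..\<theta> + \<delta>} h n \<omega>) + K\<^sup>2 / \<delta> * (\<Sum>k<n. dG h k \<omega>)) \<partial>M)"
      proof (rule integral_mono[OF _ _ pw[OF h _ \<delta>(1)]])
        show "integrable M (\<lambda>\<omega>. \<bar>?U h n \<omega>\<bar>)" using basic(1)[OF h] by (rule integrable_abs)
        show "integrable M (\<lambda>\<omega>. \<bar>com h n \<omega>\<bar> + (\<Sum>k<n. crs h k \<omega>)
          + (K\<^sup>2 * (\<Sum>\<theta>\<in>\<Theta>. h * visits {\<theta> - \<delta>..\<theta> + \<delta>} h n \<omega>) + K\<^sup>2 / \<delta> * (\<Sum>k<n. dG h k \<omega>)))"
          using i iV by auto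
      qed
      also have "\<dots> = (\<integral>\<omega>. \<bar>com h n \<omega>\<bar> \<partial>M) + (\<Sum>k<n. \<integral>\<omega>. crs h k \<omega> \<partial>M)
        + (K\<^sup>2 * (\<Sum>\<theta>\<in>\<Theta>. h * (\<integral>\<omega>. visits {\<theta> - \<delta>..\<theta> + \<delta>} h n \<omega> \<partial>M)) + K\<^sup>2 / \<delta> * (\<Sum>k<n. \<integral>\<omega>. dG h k \<omega> \<partial>M))"
        using i iV by simp
      also have "\<dots> \<le> D3 * sqrt (real n * h) + (\<Sum>k<n. (K\<^sup>2 + 2 * CE) * (h * sqrt h))
        + (K\<^sup>2 * (\<Sum>\<theta>\<in>\<Theta>. Cn \<theta> * \<delta> * (real n * h) + An \<theta> * (1 + rate h n)) + K\<^sup>2 / \<delta> * (\<Sum>k<n. sqrt CE * (h * sqrt h)))"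
        using \<delta>(1) by (intro add_mono sum_mono mult_left_mono basic An dG_abs h) auto
      also have "\<dots> = D3 * sqrt (real n * h) + ((K\<^sup>2 + 2 * CE) * (real n * (h * sqrt h))
        + (K\<^sup>2 / \<delta> * sqrt CE) * (real n * (h * sqrt h)))
        + (S * \<delta> * (real n * h) + K\<^sup>2 * (\<Sum>\<theta>\<in>\<Theta>. An \<theta>) * (1 + rate h n))"
      proof -
        have "(\<Sum>\<theta>\<in>\<Theta>. Cn \<theta> * \<delta> * (real n * h) + An \<theta> * (1 + rate h n))
          = (\<Sum>\<theta>\<in>\<Theta>. Cn \<theta>) * \<delta> * (real n * h) + (\<Sum>\<theta>\<in>\<Theta>. An \<theta>) * (1 + rate h n)"
          by (simp only: sum.distrib sum_distrib_right)
        then show ?thesis by (simp add: S_def algebra_simps)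
      qed
      also have "\<dots> \<le> D3 * (1 + rate h n) + ((K\<^sup>2 + 2 * CE) * (1 + rate h n) + (K\<^sup>2 / \<delta> * sqrt CE) * (1 + rate h n))
        + (\<epsilon> * (real n * h) + K\<^sup>2 * (\<Sum>\<theta>\<in>\<Theta>. An \<theta>) * (1 + rate h n))"
      proof -
        have "real n * (h * sqrt h) \<le> 1 + rate h n" using rate_ge[OF h(1), of n] by simp
        moreover have "sqrt (real n * h) \<le> 1 + rate h n" using h by (simp add: rate_def)
        ultimately show ?thesis
          using D3 CE0 \<delta> h by (intro add_mono mult_left_mono mult_right_mono order_refl) auto
      qed
      also have "\<dots> = \<epsilon> * (real n * h) + A * (1 + rate h n)" by (simp add: A_def algebra_simps)
      finally show "(\<integral>\<omega>. \<bar>?U h n \<omega>\<bar> \<partial>M) \<le> \<epsilon> * (real n * h) + A * (1 + rate h n)" .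
    qed
  qed
qed

text \<open>Off five events of vanishing probability, regime I is visited at least n/(2C) times, the
  squared increments are close to \<sigma>^2 times the occupation time, and the projection P is
  small. The estimator enters only through its residual form and the normal equation, with u and v
  depending on n and on the path.\<close>

theorem residual_variance_consistent:
  fixes hs :: "nat \<Rightarrow> real" and \<rho> \<delta> \<epsilon> :: real and R :: "nat \<Rightarrow> 'a \<Rightarrow> real"
  assumes hs: "\<And>n. 0 < hs n" "hs \<longlonglongrightarrow> 0" "filterlim (\<lambda>n. real n * hs n) at_top sequentially"
    and \<delta>: "0 < \<delta>" and sub: "{\<rho> - \<delta>..\<rho> + 5 * \<delta>} \<subseteq> I" and \<epsilon>: "0 < \<epsilon>"
    and R: "\<And>n \<omega>. \<omega> \<in> space M \<Longrightarrow> \<exists>u v.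
        R n \<omega> = ((\<Sum>k<n. (x (hs n) (Suc k) \<omega> - x (hs n) k \<omega>)\<^sup>2 * indicator I (x (hs n) k \<omega>))
            - (\<Sum>k<n. (u + v * x (hs n) k \<omega>)\<^sup>2 * indicator I (x (hs n) k \<omega>))) / (hs n * visits I (hs n) n \<omega>) \<and>
        (\<Sum>k<n. (u + v * x (hs n) k \<omega>)\<^sup>2 * indicator I (x (hs n) k \<omega>)) =
          (\<Sum>k<n. (u + v * x (hs n) k \<omega>) * indicator I (x (hs n) k \<omega>) * (x (hs n) (Suc k) \<omega> - x (hs n) k \<omega>))"
  shows "(\<lambda>n. measure M {\<omega> \<in> space M. \<bar>R n \<omega> - \<sigma>\<^sup>2\<bar> > \<epsilon>}) \<longlonglongrightarrow> 0"
proof -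
  \<comment> \<open>The centres of \<open>A1\<close> and \<open>A2\<close> are 4 \<delta> apart, so
    points of the two intervals differ by at least 2 \<delta>, the gap in
    \<open>two_point_norm_equivalence\<close>.\<close>
  define A1 where "A1 = {\<rho> - \<delta>..\<rho> + \<delta>}"
  define A2 where "A2 = {\<rho> + 4 * \<delta> - \<delta>..\<rho> + 4 * \<delta> + \<delta>}"
  have AI: "A1 \<subseteq> I" "A2 \<subseteq> I" using sub \<delta> by (auto simp: A1_def A2_def)
  obtain C1 Z1 where Z1: "0 < C1" "negligible Z1"
    "\<And>h n \<omega>. 0 < h \<Longrightarrow> h \<le> h0 \<Longrightarrow> \<omega> \<in> space M \<Longrightarrow> real n * h \<le> C1 * (h * visits A1 h n \<omega>) + Z1 h n \<omega>"
    using many_visits[OF \<delta>, of \<rho>] unfolding A1_def by blast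
  obtain C2 Z2 where Z2: "0 < C2" "negligible Z2"
    "\<And>h n \<omega>. 0 < h \<Longrightarrow> h \<le> h0 \<Longrightarrow> \<omega> \<in> space M \<Longrightarrow> real n * h \<le> C2 * (h * visits A2 h n \<omega>) + Z2 h n \<omega>"
    using many_visits[OF \<delta>, of "\<rho> + 4 * \<delta>"] unfolding A2_def by blast
  note negZ = Z1(2) Z2(2)
  define Z3 where "Z3 h n \<omega> = \<bar>(\<Sum>k<n. (x h (Suc k) \<omega> - x h k \<omega>)\<^sup>2 * indicator I (x h k \<omega>)) - \<sigma>\<^sup>2 * (h * visits I h n \<omega>)\<bar>" for h n \<omega>
  define Z4 where "Z4 h n \<omega> = ((\<Sum>k<n. indicator I (x h k \<omega>) * dS h k \<omega>)\<^sup>2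
     + (\<Sum>k<n. indicator I (x h k \<omega>) * x h k \<omega> * dS h k \<omega>)\<^sup>2) / real n" for h n \<omega>
  define Z5 where "Z5 h n \<omega> = (\<Sum>k<n. (dB h k \<omega>)\<^sup>2)" for h n \<omega>
  have neg: "negligible Z3" "negligible Z4" "negligible Z5"
    using negligible_quadratic_variation negligible_noise_sums negligible_drift_squares
    unfolding Z3_def[abs_def] Z4_def[abs_def] Z5_def[abs_def] by auto
  define C where "C = max C1 C2"
  have C: "0 < C" "C1 \<le> C" "C2 \<le> C" using Z1(1) Z2(1) by (auto simp: C_def)
  define Y where "Y = \<bar>\<rho>\<bar> + \<delta>"
  define q where "q = 2 + (2 * Y\<^sup>2 + 1) / \<delta>\<^sup>2"
  have q: "0 < q" using \<delta> by (simp add: q_def add_pos_nonneg)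
  define a where "a = 1 / q"
  have a: "0 < a" using q by (simp add: a_def)
  have two: "a * (u\<^sup>2 + v\<^sup>2) \<le> (u + v * y1)\<^sup>2 + (u + v * y2)\<^sup>2" if "y1 \<in> A1" "y2 \<in> A2" for y1 y2 u v
  proof -
    have "u\<^sup>2 + v\<^sup>2 \<le> q * ((u + v * y1)\<^sup>2 + (u + v * y2)\<^sup>2)"
      unfolding q_def by (rule two_point_norm_equivalence[OF \<delta>]) (use that \<delta> in \<open>auto simp: A1_def A2_def Y_def abs_le_iff\<close>)
    then show ?thesis using q by (simp add: a_def field_simps)
  qed
  \<comment> \<open>With N = n / (2 C) visits guaranteed to each interval, the nondegeneracy
    constant a/2 * N equals c' n.\<close>
  define c' where "c' = a / (4 * C)"
  have c': "0 < c'" using a C by (simp add: c'_def)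
  \<comment> \<open>The squared increments contribute an error \<eta> nh and P contributes (2 +
    2/c') \<eta> nh; dividing by an occupation time of at least nh/(2C) turns their sum into
    \<epsilon>.\<close>
  define \<eta> where "\<eta> = \<epsilon> / (2 * C * (3 + 2 / c'))"
  have \<eta>: "0 < \<eta>" using \<epsilon> C c' by (simp add: \<eta>_def add_pos_pos)
  let ?bad = "\<lambda>Z \<gamma> n. {\<omega> \<in> space M. Z (hs n) n \<omega> > \<gamma> * (real n * hs n)}"
  let ?P = "\<lambda>n. measure M (?bad Z1 (1/2) n) + measure M (?bad Z2 (1/2) n) + measure M (?bad Z3 \<eta> n)
     + measure M (?bad Z4 \<eta> n) + measure M (?bad Z5 \<eta> n)"
  have lim: "?P \<longlonglongrightarrow> 0"
  proof -
    have "?P \<longlonglongrightarrow> 0 + 0 + 0 + 0 + 0"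
      by (intro tendsto_add negligible_prob_tendsto negZ neg hs \<eta>) auto
    then show ?thesis by simp
  qed
  show ?thesis
  proof (rule tendsto_sandwich[OF _ _ tendsto_const lim])
    show "\<forall>\<^sub>F n in sequentially. 0 \<le> measure M {\<omega> \<in> space M. \<bar>R n \<omega> - \<sigma>\<^sup>2\<bar> > \<epsilon>}" by simp
    have "\<forall>\<^sub>F n in sequentially. hs n < h0" using hs(2) h0(1) by (rule order_tendstoD(2))
    then show "\<forall>\<^sub>F n in sequentially. measure M {\<omega> \<in> space M. \<bar>R n \<omega> - \<sigma>\<^sup>2\<bar> > \<epsilon>} \<le> ?P n"
      using eventually_gt_at_top[of 0]
    proof eventually_elim
      case (elim n)
      define h where "h = hs n"
      have h: "0 < h" "h \<le> h0" using elim hs(1)[of n] by (auto simp: h_def)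
      have n: "0 < real n" using elim by simp
      have ev: "?bad Z \<gamma> n \<in> sets M" if "negligible Z" for Z \<gamma>
      proof -
        have "Z h n \<in> borel_measurable M" using that h by (auto simp: negligible_def)
        then show ?thesis unfolding h_def[symmetric] by (rule borel_measurable_less[OF borel_measurable_const])
      qed
      have sub: "{\<omega> \<in> space M. \<bar>R n \<omega> - \<sigma>\<^sup>2\<bar> > \<epsilon>} \<subseteq> ?bad Z1 (1/2) n \<union> ?bad Z2 (1/2) n \<union> ?bad Z3 \<eta> n \<union> ?bad Z4 \<eta> n \<union> ?bad Z5 \<eta> n"
      proof (rule subsetI, rule ccontr)
        fix \<omega> assume "\<omega> \<in> {\<omega> \<in> space M. \<bar>R n \<omega> - \<sigma>\<^sup>2\<bar> > \<epsilon>}"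
          and "\<omega> \<notin> ?bad Z1 (1/2) n \<union> ?bad Z2 (1/2) n \<union> ?bad Z3 \<eta> n \<union> ?bad Z4 \<eta> n \<union> ?bad Z5 \<eta> n"
        then have \<omega>: "\<omega> \<in> space M" and big: "\<bar>R n \<omega> - \<sigma>\<^sup>2\<bar> > \<epsilon>"
          and g: "Z1 h n \<omega> \<le> 1 / 2 * (real n * h)" "Z2 h n \<omega> \<le> 1 / 2 * (real n * h)" "Z3 h n \<omega> \<le> \<eta> * (real n * h)"
            "Z4 h n \<omega> \<le> \<eta> * (real n * h)" "Z5 h n \<omega> \<le> \<eta> * (real n * h)"
          by (auto simp: h_def not_less)
        define N where "N = real n / (2 * C)"
        have N: "0 < N" using n C by (simp add: N_def)
        have V: "N \<le> visits A h n \<omega>"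
          if "real n * h \<le> C' * (h * visits A h n \<omega>) + z" "z \<le> 1 / 2 * (real n * h)" "C' \<le> C" for A C' z
        proof -
          have "0 \<le> visits A h n \<omega>" by (simp add: visits_def sum_nonneg)
          then have "C' * (h * visits A h n \<omega>) \<le> C * (h * visits A h n \<omega>)"
            using that(3) h by (intro mult_right_mono) auto
          then have "h * (real n / 2) \<le> h * (C * visits A h n \<omega>)" using that(1,2) by (simp add: ac_simps)
          then have "real n / 2 \<le> C * visits A h n \<omega>" using h by simp
          then show ?thesis using C by (simp add: N_def field_simps)
        qed
        have V1: "N \<le> visits A1 h n \<omega>" by (rule V[OF Z1(3)[OF h \<omega>] g(1) C(2)])
        have V2: "N \<le> visits A2 h n \<omega>" by (rule V[OF Z2(3)[OF h \<omega>] g(2) C(3)])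
        have VI: "N \<le> visits I h n \<omega>"
          unfolding visits_def
          by (rule order_trans[OF V1[unfolded visits_def] sum_mono]) (use AI(1) in \<open>auto simp: indicator_def\<close>)
        obtain u v where uv: "R n \<omega> = ((\<Sum>k<n. (x h (Suc k) \<omega> - x h k \<omega>)\<^sup>2 * indicator I (x h k \<omega>))
            - (\<Sum>k<n. (u + v * x h k \<omega>)\<^sup>2 * indicator I (x h k \<omega>))) / (h * visits I h n \<omega>)"
          and normal: "(\<Sum>k<n. (u + v * x h k \<omega>)\<^sup>2 * indicator I (x h k \<omega>)) =
          (\<Sum>k<n. (u + v * x h k \<omega>) * indicator I (x h k \<omega>) * (x h (Suc k) \<omega> - x h k \<omega>))"
          using R[OF \<omega>, of n] unfolding h_def by blast
        define P where "P = (\<Sum>k<n. (u + v * x h k \<omega>)\<^sup>2 * indicator I (x h k \<omega>))"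
        have "a / 2 * N * (u\<^sup>2 + v\<^sup>2) \<le> P"
          unfolding P_def
          by (rule affine_sum_lower_bound[OF _ _ V1[unfolded visits_def] V2[unfolded visits_def] _ a two])
             (use AI N in \<open>auto simp: indicator_def\<close>)
        moreover have "a / 2 * N = c' * real n" using C by (simp add: c'_def N_def)
        ultimately have nondeg: "(c' * real n) * (u\<^sup>2 + v\<^sup>2) \<le> P" by simp
        have "P \<le> 2 * ((\<Sum>k<n. indicator I (x h k \<omega>) * dS h k \<omega>)\<^sup>2
            + (\<Sum>k<n. indicator I (x h k \<omega>) * x h k \<omega> * dS h k \<omega>)\<^sup>2) / (c' * real n) + 2 * (\<Sum>k<n. (dB h k \<omega>)\<^sup>2)"
          unfolding P_def
          by (rule projection_bound[OF _ _ nondeg[unfolded P_def]])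
             (use c' n normal in \<open>auto simp: indicator_def x_Suc\<close>)
        also have "\<dots> = 2 / c' * Z4 h n \<omega> + 2 * Z5 h n \<omega>" by (simp add: Z4_def Z5_def)
        also have "\<dots> \<le> 2 / c' * (\<eta> * (real n * h)) + 2 * (\<eta> * (real n * h))"
          using g c' by (intro add_mono mult_left_mono) auto
        finally have P: "P \<le> (2 / c' + 2) * (\<eta> * (real n * h))" by (simp add: algebra_simps)
        have P0: "0 \<le> P" by (simp add: P_def sum_nonneg)
        have hV: "0 < h * visits I h n \<omega>" using h VI N by simp
        define T where "T = (\<Sum>k<n. (x h (Suc k) \<omega> - x h k \<omega>)\<^sup>2 * indicator I (x h k \<omega>))"
        have RT: "R n \<omega> = (T - P) / (h * visits I h n \<omega>)" unfolding uv T_def P_def ..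
        have "(R n \<omega> - \<sigma>\<^sup>2) * (h * visits I h n \<omega>) = T - \<sigma>\<^sup>2 * (h * visits I h n \<omega>) - P"
        proof -
          have "R n \<omega> * (h * visits I h n \<omega>) = T - P"
            unfolding RT by (rule nonzero_eq_divide_eq[THEN iffD1, OF _ refl]) (use hV in linarith)
          then show ?thesis by (simp add: left_diff_distrib)
        qed
        then have "\<bar>R n \<omega> - \<sigma>\<^sup>2\<bar> * (h * visits I h n \<omega>) = \<bar>T - \<sigma>\<^sup>2 * (h * visits I h n \<omega>) - P\<bar>"
          using hV by (metis abs_mult abs_of_pos)
        also have "\<dots> \<le> \<bar>T - \<sigma>\<^sup>2 * (h * visits I h n \<omega>)\<bar> + P" using P0 by linarith
        also have "\<dots> \<le> \<eta> * (real n * h) + (2 / c' + 2) * (\<eta> * (real n * h))"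
          using g(3) P unfolding Z3_def T_def by (rule add_mono)
        also have "\<dots> = (3 + 2 / c') * \<eta> * (real n * h)" by (simp add: algebra_simps)
        finally have up: "\<bar>R n \<omega> - \<sigma>\<^sup>2\<bar> * (h * visits I h n \<omega>) \<le> (3 + 2 / c') * \<eta> * (real n * h)" .
        have "\<epsilon> * (h * N) \<le> \<epsilon> * (h * visits I h n \<omega>)" using \<epsilon> h VI by (intro mult_left_mono) auto
        also have "\<dots> < \<bar>R n \<omega> - \<sigma>\<^sup>2\<bar> * (h * visits I h n \<omega>)" using big hV by (intro mult_strict_right_mono)
        also note up
        also have "(3 + 2 / c') * \<eta> * (real n * h) = \<epsilon> * (h * N)"
        proof -
          have "0 < 3 + 2 / c'" using c' by (simp add: add_pos_pos)
          then show ?thesis using C by (simp add: \<eta>_def N_def)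
        qed
        finally show False by simp
      qed
      have "measure M {\<omega> \<in> space M. \<bar>R n \<omega> - \<sigma>\<^sup>2\<bar> > \<epsilon>} \<le>
        measure M (?bad Z1 (1/2) n \<union> ?bad Z2 (1/2) n \<union> ?bad Z3 \<eta> n \<union> ?bad Z4 \<eta> n \<union> ?bad Z5 \<eta> n)"
        by (rule finite_measure_mono[OF sub]) (intro sets.Un ev negZ neg)
      also have "\<dots> \<le> ?P n"
        by (intro order_trans[OF measure_Un_le] add_mono order_refl sets.Un ev negZ neg)
      finally show ?case .
    qed
  qed
qed

end

end

section \<open>Ito processes\<close>

locale ito_solution = adapted_path +
  fixes W Y :: "real \<Rightarrow> 'a \<Rightarrow> real" and x0 :: real
  assumes bm: "brownian_motion M F W"
    and ito: "\<And>t. 0 \<le> t \<Longrightarrow> ito_integral_at M F W (\<lambda>u \<omega>. sg (X u \<omega>)) t (Y t)"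
    and solves: "\<And>t. 0 \<le> t \<Longrightarrow> AE \<omega> in M. X t \<omega> = x0 + drift 0 t \<omega> + Y t \<omega>"
begin

sublocale martingale_part: ito_integrable M F W "\<lambda>u \<omega>. sg (X u \<omega>)" Y K
proof unfold_locales
  fix s t :: real assume s: "0 \<le> s"
  show "(\<lambda>z. sg (X (snd z) (fst z))) \<in> borel_measurable (space_time s t)"
  proof (cases "s \<le> t")
    case True
    then show ?thesis using s by (intro pair_time_F_M[OF X_jointly_measurable] sg_borel) auto
  next
    case False
    then have "space (space_time s t) = {}" by (simp add: space_pair_measure space_time_measure)
    then show ?thesis by (simp add: measurable_def)
  qed
qed (use bm ito sg_bound in auto)

lemma drift_additive:
  assumes st: "0 \<le> s" "s \<le> t" and \<omega>: "\<omega> \<in> space M"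
  shows "drift 0 t \<omega> = drift 0 s \<omega> + drift s t \<omega>"
proof -
  have i: "integrable lborel (\<lambda>u. indicator {r<..t} u *\<^sub>R b (X u \<omega>))" if "0 \<le> r" "r \<le> t" for r t
    using path_integrable[OF that b_borel \<omega> b_growth less_imp_le[OF c1]]
    by (simp add: time_measure_def integrable_restrict_space)
  have d: "drift r t \<omega> = (\<integral>u. indicator {r<..t} u *\<^sub>R b (X u \<omega>) \<partial>lborel)" for r t
    unfolding drift_def time_measure_def by (rule integral_restrict_space) simp
  have "drift 0 s \<omega> + drift s t \<omega> =
    (\<integral>u. indicator {0<..s} u *\<^sub>R b (X u \<omega>) + indicator {s<..t} u *\<^sub>R b (X u \<omega>) \<partial>lborel)"
    unfolding d using i[of 0 s] i[of s t] st by (intro Bochner_Integration.integral_add[symmetric]) auto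
  also have "\<dots> = drift 0 t \<omega>"
    unfolding d using st by (intro Bochner_Integration.integral_cong) (auto simp: indicator_def)
  finally show ?thesis by simp
qed

text \<open>The exceptional set depends on s and t. That is enough, since the moment properties
  transferred from \<open>Y\<close> to the noise concern fixed times.\<close>

lemma noise_eq_AE:
  assumes st: "0 \<le> s" "s \<le> t"
  shows "AE \<omega> in M. noise s t \<omega> = Y t \<omega> - Y s \<omega>"
proof -
  have "0 \<le> t" using st by simp
  from solves[OF st(1)] solves[OF this] AE_space show ?thesis
    by eventually_elim (simp add: noise_def drift_additive[OF st])
qed

text \<open>Grid points are nonnegative, so at time 0 every increment in a simple integral
  degenerates and \<open>Y 0\<close> is an L2 limit of 0. This recovers the initial value of the
  path from the integral equation.\<close>

lemma ito_integral_0: "AE \<omega> in M. Y 0 \<omega> = 0"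
proof -
  obtain ss xis where sa: "\<And>n. simple_adapted F (ss n) (xis n)"
    and lim: "(\<lambda>n. \<integral>\<^sup>+\<omega>. ennreal ((Y 0 \<omega> - simple_integral W (ss n) (xis n) 0 \<omega>)\<^sup>2) \<partial>M) \<longlonglongrightarrow> 0"
    using ito[of 0] unfolding ito_integral_at_def by blast
  have Y0: "Y 0 \<in> borel_measurable M" using ito[of 0] by (simp add: ito_integral_at_def)
  have "0 \<le> ss n ! k" if "k \<le> length (xis n)" for n k
    by (rule martingale_part.simple_adapted_nth(4)[OF sa that])
  then have "simple_integral W (ss n) (xis n) 0 \<omega> = 0" for n \<omega>
    by (simp add: simple_integral_def min_absorb1)
  with lim have "(\<lambda>n. \<integral>\<^sup>+\<omega>. ennreal ((Y 0 \<omega>)\<^sup>2) \<partial>M) \<longlonglongrightarrow> 0" by simp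
  then have "(\<integral>\<^sup>+\<omega>. ennreal ((Y 0 \<omega>)\<^sup>2) \<partial>M) = 0" by (simp add: LIMSEQ_const_iff)
  then show ?thesis using Y0 by (simp add: nn_integral_0_iff_AE)
qed

lemma initial_value: "AE \<omega> in M. X 0 \<omega> = x0"
proof -
  have "drift 0 0 \<omega> = 0" for \<omega>
    unfolding drift_def time_measure_def by (subst integral_restrict_space) auto
  with solves[of 0] ito_integral_0 show ?thesis by auto
qed

lemma indicator_noise_measurable:
  assumes "0 \<le> s" "s \<le> t" "A \<in> sets (F s)"
  shows "(\<lambda>\<omega>. indicator A \<omega> * noise s t \<omega> ^ p) \<in> borel_measurable M"
    and "(\<lambda>\<omega>. indicator A \<omega> * (Y t \<omega> - Y s \<omega>) ^ p) \<in> borel_measurable M"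
proof -
  have [measurable]: "A \<in> sets M" using assms(3) sets_F_subset by blast
  have [measurable]: "noise s t \<in> borel_measurable M" "Y t \<in> borel_measurable M" "Y s \<in> borel_measurable M"
    using assms by (auto intro: noise_measurable martingale_part.Y_measurable)
  show "(\<lambda>\<omega>. indicator A \<omega> * noise s t \<omega> ^ p) \<in> borel_measurable M"
    "(\<lambda>\<omega>. indicator A \<omega> * (Y t \<omega> - Y s \<omega>) ^ p) \<in> borel_measurable M"
    by measurable
qed

lemma noise_power_integral:
  assumes "0 \<le> s" "s \<le> t" "A \<in> sets (F s)"
  shows "(\<integral>\<omega>. indicator A \<omega> * noise s t \<omega> ^ p \<partial>M) = (\<integral>\<omega>. indicator A \<omega> * (Y t \<omega> - Y s \<omega>) ^ p \<partial>M)"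
  using noise_eq_AE[OF assms(1,2)] indicator_noise_measurable[OF assms]
  by (intro integral_cong_AE) auto

lemma noise_mean:
  assumes "0 \<le> s" "s \<le> t" "A \<in> sets (F s)"
  shows "(\<integral>\<omega>. indicator A \<omega> * noise s t \<omega> \<partial>M) = 0"
  using noise_power_integral[OF assms, of 1] martingale_part.ito_increment(1)[OF assms] by simp

lemma noise_square:
  assumes st: "0 \<le> s" "s \<le> t" and A: "A \<in> sets (F s)"
  shows "(\<integral>\<omega>. indicator A \<omega> * (noise s t \<omega>)\<^sup>2 \<partial>M) = (\<integral>\<omega>. indicator A \<omega> * qvar s t \<omega> \<partial>M)"
proof -
  interpret T: finite_measure "time_measure s t" by (rule finite_measure_time)
  interpret P: pair_sigma_finite M "time_measure s t" ..
  interpret S: finite_measure "space_time s t" by (rule finite_measure_space_time)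
  have [measurable]: "A \<in> sets M" using A sets_F_subset by blast
  have [measurable]: "(\<lambda>z. sg (X (snd z) (fst z))) \<in> borel_measurable (space_time s t)"
    by (rule martingale_part.H_measurable[OF st(1)])
  have "integrable (space_time s t) (\<lambda>z. indicator A (fst z) * (sg (X (snd z) (fst z)))\<^sup>2)"
  proof (rule S.integrable_const_bound[of _ "K\<^sup>2"])
    have "(sg y)\<^sup>2 \<le> K\<^sup>2" for y
      using sg_bound[of y] by (simp add: abs_le_square_iff[symmetric])
    then show "AE z in space_time s t. norm (indicator A (fst z) * (sg (X (snd z) (fst z)))\<^sup>2) \<le> K\<^sup>2"
      by (auto simp: indicator_def)
  qed measurable
  then have "(\<integral>z. indicator A (fst z) * (sg (X (snd z) (fst z)))\<^sup>2 \<partial>space_time s t) =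
    (\<integral>\<omega>. (\<integral>u. indicator A \<omega> * (sg (X u \<omega>))\<^sup>2 \<partial>time_measure s t) \<partial>M)"
    using P.integral_fst'[of "\<lambda>z. indicator A (fst z) * (sg (X (snd z) (fst z)))\<^sup>2"] by simp
  also have "\<dots> = (\<integral>\<omega>. indicator A \<omega> * qvar s t \<omega> \<partial>M)" by (simp add: qvar_def)
  finally show ?thesis
    using noise_power_integral[OF st A, of 2] martingale_part.ito_increment(2)[OF st A] by simp
qed

lemma noise_fourth:
  assumes st: "0 \<le> s" "s \<le> t"
  shows "integrable M (\<lambda>\<omega>. noise s t \<omega> ^ 4)" and "(\<integral>\<omega>. noise s t \<omega> ^ 4 \<partial>M) \<le> 3 * K ^ 4 * (t - s)\<^sup>2"
proof -
  have m: "(\<lambda>\<omega>. noise s t \<omega> ^ 4) \<in> borel_measurable M" "(\<lambda>\<omega>. (Y t \<omega> - Y s \<omega>) ^ 4) \<in> borel_measurable M"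
    using noise_measurable[OF st] martingale_part.ito_increment(3)[OF st] by auto
  have ae: "AE \<omega> in M. noise s t \<omega> ^ 4 = (Y t \<omega> - Y s \<omega>) ^ 4" using noise_eq_AE[OF st] by auto
  show "integrable M (\<lambda>\<omega>. noise s t \<omega> ^ 4)"
    using integrable_cong_AE[OF m ae] martingale_part.ito_increment(3)[OF st] by blast
  show "(\<integral>\<omega>. noise s t \<omega> ^ 4 \<partial>M) \<le> 3 * K ^ 4 * (t - s)\<^sup>2"
    using integral_cong_AE[OF m ae] martingale_part.ito_increment(4)[OF st] by simp
qed

end

section \<open>Regimes\<close>

text \<open>The linear restoring forces of the two outer regimes, joined at 0: slope -a on the left
  and -d on the right. Unlike the threshold drift it is globally Lipschitz.\<close>

definition two_slope :: "real \<Rightarrow> real \<Rightarrow> real \<Rightarrow> real" where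
  "two_slope a d y = - a * min y 0 - d * max y 0"

lemma two_slope_0 [simp]: "two_slope a d 0 = 0"
  by (simp add: two_slope_def)

lemma two_slope_lipschitz:
  assumes "0 \<le> a" "0 \<le> d"
  shows "\<bar>two_slope a d y - two_slope a d z\<bar> \<le> (a + d) * \<bar>y - z\<bar>"
proof -
  have "two_slope a d y - two_slope a d z = a * (min z 0 - min y 0) + d * (max z 0 - max y 0)"
    by (simp add: two_slope_def algebra_simps)
  also have "\<bar>\<dots>\<bar> \<le> a * \<bar>min z 0 - min y 0\<bar> + d * \<bar>max z 0 - max y 0\<bar>"
    using assms by (intro order_trans[OF abs_triangle_ineq]) (simp add: abs_mult)
  also have "\<dots> \<le> a * \<bar>y - z\<bar> + d * \<bar>y - z\<bar>"
    using assms by (intro add_mono mult_left_mono) (auto simp: min_def max_def)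
  finally show ?thesis by (simp add: distrib_right)
qed

lemma two_slope_dissipative: "y * two_slope a d y \<le> - min a d * y\<^sup>2"
proof (cases "0 \<le> y")
  case True
  have "min a d * y\<^sup>2 \<le> d * y\<^sup>2" by (intro mult_right_mono) auto
  then show ?thesis using True by (simp add: two_slope_def power2_eq_square mult.left_commute)
next
  case False
  have "min a d * y\<^sup>2 \<le> a * y\<^sup>2" by (intro mult_right_mono) auto
  then show ?thesis using False by (simp add: two_slope_def power2_eq_square mult.left_commute)
qed

section \<open>Geometry of the thresholds and of the coefficients\<close>

locale thresholds =
  fixes m :: nat and \<theta> :: "nat \<Rightarrow> ereal"
  assumes m: "1 \<le> m" and theta_0: "\<theta> 0 = -\<infinity>" and theta_m: "\<theta> m = \<infinity>"
    and theta_step: "\<And>j. j < m \<Longrightarrow> \<theta> j < \<theta> (Suc j)"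
begin

lemma theta_mono: "j \<le> k \<Longrightarrow> k \<le> m \<Longrightarrow> \<theta> j \<le> \<theta> k"
proof (induction k)
  case (Suc k)
  then show ?case using theta_step[of k] by (cases "j = Suc k") (auto intro: order_trans less_imp_le)
qed auto

text \<open>Meaningful for 1 <= j < m, where \<theta> j is finite by \<open>theta_finite\<close>;
  infinite values are converted to 0.\<close>

definition threshold :: "nat \<Rightarrow> real" where
  "threshold j = real_of_ereal (\<theta> j)"

lemma theta_finite: "1 \<le> j \<Longrightarrow> j < m \<Longrightarrow> \<theta> j = ereal (threshold j)"
  using theta_step[of j] theta_step[of "j - 1"] less_imp_diff_less[of j m 1]
  unfolding threshold_def by (cases "\<theta> j") auto

text \<open>The value of \<theta> m makes such an index exist and that of \<theta> 0 keeps it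
  positive; by monotonicity of \<theta> it is the only regime containing y.\<close>

definition regime :: "real \<Rightarrow> nat" where
  "regime y = (LEAST j. ereal y < \<theta> j)"

lemma regime_bounds: "1 \<le> regime y" "regime y \<le> m"
  and regime_lower: "\<theta> (regime y - 1) \<le> ereal y" and regime_upper: "ereal y < \<theta> (regime y)"
proof -
  have ex: "ereal y < \<theta> m" by (simp add: theta_m)
  show up: "ereal y < \<theta> (regime y)" unfolding regime_def by (rule LeastI[of _ m]) (rule ex)
  show "regime y \<le> m" unfolding regime_def by (rule Least_le) (rule ex)
  show one: "1 \<le> regime y" using up theta_0 by (cases "regime y") auto
  have "\<not> ereal y < \<theta> (regime y - 1)"
    using not_less_Least[of "regime y - 1" "\<lambda>j. ereal y < \<theta> j"] one by (simp add: regime_def)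
  then show "\<theta> (regime y - 1) \<le> ereal y" by simp
qed

lemma regime_eqI:
  assumes j: "1 \<le> j" "j \<le> m" and y: "\<theta> (j - 1) \<le> ereal y" "ereal y < \<theta> j"
  shows "regime y = j"
proof (rule antisym)
  show "regime y \<le> j" unfolding regime_def by (rule Least_le) (rule y)
  show "j \<le> regime y"
  proof (rule ccontr)
    assume "\<not> j \<le> regime y"
    then have "\<theta> (regime y) \<le> \<theta> (j - 1)" using j by (intro theta_mono) auto
    with y(1) regime_upper[of y] show False by simp
  qed
qed

lemma ind_eq: "1 \<le> j \<Longrightarrow> j \<le> m \<Longrightarrow> ind \<theta> j y = (if j = regime y then 1 else 0)"
  using regime_eqI[of j y] regime_lower[of y] regime_upper[of y] unfolding ind_def by metis

lemma sum_ind: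
  fixes f :: "nat \<Rightarrow> real"
  shows "(\<Sum>j=1..m. f j * ind \<theta> j y) = f (regime y)"
proof -
  have "(\<Sum>j=1..m. f j * ind \<theta> j y) = (\<Sum>j=1..m. if j = regime y then f j else 0)"
    by (intro sum.cong) (auto simp: ind_eq)
  then show ?thesis using regime_bounds[of y] by simp
qed

lemma drift_coef_eq: "drift_coef m \<theta> \<alpha> \<beta> y = \<beta> (regime y) - \<alpha> (regime y) * y"
  and diff_coef_eq: "diff_coef m \<theta> \<sigma> y = \<sigma> (regime y)"
  unfolding drift_coef_def diff_coef_def by (rule sum_ind)+

lemma ind_borel [measurable]: "ind \<theta> j \<in> borel_measurable borel"
  unfolding ind_def[abs_def] by measurable

lemma drift_coef_borel: "drift_coef m \<theta> \<alpha> \<beta> \<in> borel_measurable borel"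
  and diff_coef_borel: "diff_coef m \<theta> \<sigma> \<in> borel_measurable borel"
  unfolding drift_coef_def[abs_def] diff_coef_def[abs_def] by measurable

definition regime_set :: "nat \<Rightarrow> real set" where
  "regime_set j = {y. \<theta> (j - 1) \<le> ereal y \<and> ereal y < \<theta> j}"

lemma ind_indicator: "ind \<theta> j y = indicator (regime_set j) y"
  by (simp add: ind_def regime_set_def)

lemma regime_set_borel: "regime_set j \<in> sets borel"
  unfolding regime_set_def by measurable

text \<open>A regime can be left only across a finite threshold, and a point farther than \<delta>
  from all of these has room for a displacement of \<delta>.\<close>

lemma regime_set_boundary:
  assumes j: "1 \<le> j" "j \<le> m" and y: "y \<in> regime_set j" and far: "\<forall>r\<in>threshold ` {1..<m}. \<delta> < \<bar>y - r\<bar>"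
    and near: "\<bar>y' - y\<bar> \<le> \<delta>"
  shows "y' \<in> regime_set j"
proof -
  have "\<theta> (j - 1) \<le> ereal y'"
  proof (cases "j = 1")
    case False
    then have "1 \<le> j - 1" "j - 1 < m" using j by auto
    note fin = theta_finite[OF this]
    have "\<delta> < \<bar>y - threshold (j - 1)\<bar>" using far \<open>1 \<le> j - 1\<close> \<open>j - 1 < m\<close> by auto
    moreover have "threshold (j - 1) \<le> y" using y by (subst (asm) regime_set_def, subst (asm) fin) auto
    ultimately show ?thesis using near by (subst fin) auto
  qed (simp add: theta_0)
  moreover have "ereal y' < \<theta> j"
  proof (cases "j = m")
    case False
    then have "1 \<le> j" "j < m" using j by auto
    note fin = theta_finite[OF this]
    have "\<delta> < \<bar>y - threshold j\<bar>" using far False j by auto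
    moreover have "y < threshold j" using y by (subst (asm) regime_set_def, subst (asm) fin) auto
    ultimately show ?thesis using near by (subst fin) auto
  qed (simp add: theta_m)
  ultimately show ?thesis by (simp add: regime_set_def)
qed

lemma regime_set_interval:
  assumes j: "1 \<le> j" "j \<le> m"
  obtains \<rho> \<delta> where "0 < \<delta>" "{\<rho> - \<delta>..\<rho> + 5 * \<delta>} \<subseteq> regime_set j"
proof -
  have "\<theta> (j - 1) < \<theta> j" using theta_step[of "j - 1"] j by simp
  then obtain a where a: "\<theta> (j - 1) < ereal a" "ereal a < \<theta> j" using ereal_dense2 by blast
  then obtain c where c: "ereal a < ereal c" "ereal c < \<theta> j" using ereal_dense2 by blast
  show ?thesis
  \<comment> \<open>With a sixth of the length as \<delta>, the required interval is exactly
    [a, c].\<close>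
  proof (rule that[of "(c - a) / 6" "a + (c - a) / 6"])
    show "0 < (c - a) / 6" using c by simp
    show "{a + (c - a) / 6 - (c - a) / 6..a + (c - a) / 6 + 5 * ((c - a) / 6)} \<subseteq> regime_set j"
    proof
      fix y assume "y \<in> {a + (c - a) / 6 - (c - a) / 6..a + (c - a) / 6 + 5 * ((c - a) / 6)}"
      then have "a \<le> y" "y \<le> c" by (auto simp: field_simps)
      then show "y \<in> regime_set j"
        using a c order.trans[OF less_imp_le[OF a(1)], of "ereal y"] le_less_trans[OF _ c(2), of "ereal y"]
        by (simp add: regime_set_def)
    qed
  qed
qed

text \<open>A radius containing all finite thresholds. The sum makes sense also for m = 1, when
  there are none.\<close>

definition span :: real where
  "span = (\<Sum>j\<in>{1..<m}. \<bar>threshold j\<bar>)"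

lemma span_nonneg: "0 \<le> span" by (simp add: span_def sum_nonneg)

lemma abs_theta_le_span: "1 \<le> j \<Longrightarrow> j < m \<Longrightarrow> \<bar>threshold j\<bar> \<le> span"
  unfolding span_def by (rule member_le_sum) auto

lemma regime_outside:
  shows "span < y \<Longrightarrow> regime y = m" and "y < - span \<Longrightarrow> regime y = 1"
proof -
  show "regime y = m" if "span < y"
  proof (rule ccontr)
    assume "regime y \<noteq> m"
    then have "1 \<le> regime y" "regime y < m" using regime_bounds[of y] by auto
    note fin = theta_finite[OF this] and le = abs_theta_le_span[OF this]
    have "y < threshold (regime y)" using regime_upper[of y] by (subst (asm) fin) simp
    with le that show False by simp
  qed
  show "regime y = 1" if "y < - span"
  proof (rule ccontr)
    assume "regime y \<noteq> 1"
    then have "1 \<le> regime y - 1" "regime y - 1 < m" using regime_bounds[of y] by auto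
    note fin = theta_finite[OF this] and le = abs_theta_le_span[OF this]
    have "threshold (regime y - 1) \<le> y" using regime_lower[of y] by (subst (asm) fin) simp
    with le that show False by simp
  qed
qed

text \<open>Beyond \<open>span\<close> the regime is 1 or m, the slopes agree and the difference is
  an intercept \<beta>. Within it, the last two summands of \<open>c0\<close> bound the linear parts
  of the two drifts.\<close>

lemma drift_near_linear:
  fixes \<alpha> \<beta> :: "nat \<Rightarrow> real"
  assumes \<alpha>: "0 < \<alpha> 1" "0 < \<alpha> m"
  defines "c0 \<equiv> (\<Sum>j=1..m. \<bar>\<beta> j\<bar>) + (\<Sum>j=1..m. \<bar>\<alpha> j\<bar>) * span + (\<alpha> 1 + \<alpha> m) * span"
  shows "\<bar>drift_coef m \<theta> \<alpha> \<beta> y - two_slope (\<alpha> 1) (\<alpha> m) y\<bar> \<le> c0" and "0 \<le> c0"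
proof -
  have b: "\<bar>\<beta> (regime y)\<bar> \<le> (\<Sum>j=1..m. \<bar>\<beta> j\<bar>)" and a: "\<bar>\<alpha> (regime y)\<bar> \<le> (\<Sum>j=1..m. \<bar>\<alpha> j\<bar>)"
    using regime_bounds[of y] by (auto intro!: member_le_sum[where f="\<lambda>j. \<bar>\<beta> j\<bar>"] member_le_sum[where f="\<lambda>j. \<bar>\<alpha> j\<bar>"])
  have nn: "0 \<le> (\<Sum>j=1..m. \<bar>\<alpha> j\<bar>) * span" "0 \<le> (\<alpha> 1 + \<alpha> m) * span"
    using span_nonneg \<alpha> by (auto intro!: mult_nonneg_nonneg sum_nonneg)
  then show "0 \<le> c0" by (simp add: c0_def sum_nonneg)
  let ?g = "two_slope (\<alpha> 1) (\<alpha> m) y"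
  consider "span < y" | "y < - span" | "\<bar>y\<bar> \<le> span" by linarith
  then show "\<bar>drift_coef m \<theta> \<alpha> \<beta> y - ?g\<bar> \<le> c0"
  proof cases
    case 1
    then have "drift_coef m \<theta> \<alpha> \<beta> y - ?g = \<beta> (regime y)"
      using regime_outside(1)[of y] span_nonneg by (simp add: drift_coef_eq two_slope_def)
    with b nn show ?thesis by (simp add: c0_def)
  next
    case 2
    then have "drift_coef m \<theta> \<alpha> \<beta> y - ?g = \<beta> (regime y)"
      using regime_outside(2)[of y] span_nonneg by (simp add: drift_coef_eq two_slope_def)
    with b nn show ?thesis by (simp add: c0_def)
  next
    case 3
    have "\<bar>?g\<bar> \<le> (\<alpha> 1 + \<alpha> m) * \<bar>y\<bar>"
      using two_slope_lipschitz[of "\<alpha> 1" "\<alpha> m" y 0] \<alpha> by simp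
    also have "\<dots> \<le> (\<alpha> 1 + \<alpha> m) * span" using 3 \<alpha> by (intro mult_left_mono) auto
    finally have g: "\<bar>?g\<bar> \<le> (\<alpha> 1 + \<alpha> m) * span" .
    have "\<bar>\<alpha> (regime y) * y\<bar> \<le> (\<Sum>j=1..m. \<bar>\<alpha> j\<bar>) * span"
      unfolding abs_mult by (rule mult_mono[OF a 3]) (auto intro: sum_nonneg)
    with g b show ?thesis unfolding drift_coef_eq c0_def by linarith
  qed
qed

text \<open>With u = h times the estimated \<beta> and v = -h times the estimated \<alpha>, the
  residual in regime j is the increment minus u + v X_k. The normal equations make the fit
  orthogonal to the residual, so the residual sum of squares is a difference, as in Pythagoras'
  theorem.\<close>

lemma sigma_hat_square:
  assumes j: "1 \<le> j" "j \<le> m" and h: "0 < h"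
  shows "\<exists>u v.
    (sigma_hat m \<theta> j n h obs)\<^sup>2 = ((\<Sum>k<n. (obs (Suc k) - obs k)\<^sup>2 * ind \<theta> j (obs k))
        - (\<Sum>k<n. (u + v * obs k)\<^sup>2 * ind \<theta> j (obs k))) / (h * (\<Sum>k<n. ind \<theta> j (obs k))) \<and>
    (\<Sum>k<n. (u + v * obs k)\<^sup>2 * ind \<theta> j (obs k)) =
      (\<Sum>k<n. (u + v * obs k) * ind \<theta> j (obs k) * (obs (Suc k) - obs k))"
proof -
  define w where "w k = ind \<theta> j (obs k)" for k
  define d where "d k = obs (Suc k) - obs k" for k
  define L D J Q H where "L = L0n \<theta> j n obs" and "D = Dn \<theta> j n obs" and "J = Jn \<theta> j n obs"
    and "Q = Qn \<theta> j n obs" and "H = Hn \<theta> j n obs"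
  note stat = L_def D_def J_def Q_def H_def L0n_def Dn_def Jn_def Qn_def Hn_def w_def[symmetric] d_def[symmetric]
  define u v where "u = beta_hat \<theta> j n h obs * h" and "v = - (alpha_hat \<theta> j n h obs * h)"
  have quadratic: "(\<Sum>k<n. (u + v * obs k)\<^sup>2 * w k) = u * (u * L + v * J) + v * (u * J + v * D)"
    unfolding stat sum_distrib_left sum.distrib[symmetric]
    by (intro sum.cong refl) (simp add: power2_eq_square algebra_simps)
  have linear: "(\<Sum>k<n. (u + v * obs k) * w k * d k) = u * Q + v * H"
    unfolding stat sum_distrib_left sum.distrib[symmetric]
    by (intro sum.cong refl) (simp add: algebra_simps)
  have normal: "(\<Sum>k<n. (u + v * obs k)\<^sup>2 * w k) = (\<Sum>k<n. (u + v * obs k) * w k * d k)"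
  proof (cases "L * D - J\<^sup>2 = 0")
    \<comment> \<open>A vanishing determinant gives u = v = 0 by the convention on division by zero,
      and both sides of the normal equation are 0.\<close>
    case True
    then have "L * D * h - J\<^sup>2 * h = 0" by (simp add: left_diff_distrib[symmetric])
    then have "u = 0" "v = 0" by (simp_all add: u_def v_def beta_hat_def alpha_hat_def L_def D_def J_def)
    then show ?thesis by simp
  next
    case False
    have \<Delta>: "L * D * h - J\<^sup>2 * h = (L * D - J\<^sup>2) * h" by (simp add: left_diff_distrib)
    have u: "u = (Q * D - H * J) / (L * D - J\<^sup>2)"
      unfolding u_def beta_hat_def L_def[symmetric] D_def[symmetric] J_def[symmetric] Q_def[symmetric] H_def[symmetric] \<Delta>
      using h by simp
    have v: "v = (L * H - Q * J) / (L * D - J\<^sup>2)"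
      unfolding v_def alpha_hat_def L_def[symmetric] D_def[symmetric] J_def[symmetric] Q_def[symmetric] H_def[symmetric] \<Delta>
      using h by (simp add: minus_divide_left)
    have "u * L + v * J = Q" "u * J + v * D = H"
      unfolding u v using False by (simp_all add: divide_simps) (simp_all add: algebra_simps power2_eq_square)
    then show ?thesis unfolding quadratic linear by simp
  qed
  define S where "S = (\<Sum>k<n. (d k - (u + v * obs k))\<^sup>2 * w k)"
  have w: "0 \<le> w k" for k by (simp add: w_def ind_def)
  have "S = (\<Sum>k<n. (d k)\<^sup>2 * w k) - 2 * (\<Sum>k<n. (u + v * obs k) * w k * d k) + (\<Sum>k<n. (u + v * obs k)\<^sup>2 * w k)"
    unfolding S_def sum_distrib_left sum.distrib[symmetric] sum_subtractf[symmetric]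
    by (intro sum.cong refl) (simp add: power2_eq_square algebra_simps)
  then have S: "S = (\<Sum>k<n. (d k)\<^sup>2 * w k) - (\<Sum>k<n. (u + v * obs k)\<^sup>2 * w k)" using normal by simp
  have residual: "(obs (Suc k) - obs k - (\<Sum>l=1..m. (beta_hat \<theta> l n h obs - alpha_hat \<theta> l n h obs * obs k) * ind \<theta> l (obs k) * h))\<^sup>2
      * ind \<theta> j (obs k) = (d k - (u + v * obs k))\<^sup>2 * w k" for k
  proof (cases "j = regime (obs k)")
    case True
    have "(\<Sum>l=1..m. (beta_hat \<theta> l n h obs - alpha_hat \<theta> l n h obs * obs k) * ind \<theta> l (obs k) * h) = u + v * obs k"
      unfolding sum_distrib_right[symmetric] sum_ind u_def v_def True[symmetric] by (simp add: algebra_simps)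
    then show ?thesis by (simp add: d_def w_def)
  qed (use j in \<open>simp add: w_def ind_eq\<close>)
  have "sigma_hat m \<theta> j n h obs = sqrt (S / (\<Sum>k<n. w k * h))"
    unfolding sigma_hat_def residual S_def Ln_def w_def ..
  then have "sigma_hat m \<theta> j n h obs = sqrt (S / (h * (\<Sum>k<n. w k)))"
    by (simp add: sum_distrib_left mult.commute)
  \<comment> \<open>Squaring undoes the root only for a nonnegative radicand; in a regime without
    visits the quotient is 0.\<close>
  moreover have "0 \<le> S / (h * (\<Sum>k<n. w k))"
    using h w by (simp add: S_def sum_nonneg)
  ultimately have "(sigma_hat m \<theta> j n h obs)\<^sup>2 = S / (h * (\<Sum>k<n. w k))" by simp
  with S normal show ?thesis unfolding w_def d_def by blast
qed

end

theorem theorem8: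
  fixes M :: "'a measure" and F :: "real \<Rightarrow> 'a measure" and W X :: "real \<Rightarrow> 'a \<Rightarrow> real"
    and m :: nat and \<theta> :: "nat \<Rightarrow> ereal" and \<alpha> \<beta> \<sigma> :: "nat \<Rightarrow> real" and x :: real
    and h :: "nat \<Rightarrow> real" and i :: nat
  assumes BM: "brownian_motion M F W"
    and m: "m \<ge> 1"
    and theta0: "\<theta> 0 = -\<infinity>" and thetam: "\<theta> m = \<infinity>"
    and theta_mono: "\<And>j. j < m \<Longrightarrow> \<theta> j < \<theta> (Suc j)"
    and alpha1: "\<alpha> 1 > 0" and alpham: "\<alpha> m > 0"
    and sigma_pos: "\<And>j. 1 \<le> j \<Longrightarrow> j \<le> m \<Longrightarrow> \<sigma> j > 0"
    and sol: "threshold_sde_solution M F W m \<theta> \<alpha> \<beta> \<sigma> x X"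
    and h_pos: "\<And>n. h n > 0"
    and h_lim: "h \<longlonglongrightarrow> 0"
    and nh_lim: "filterlim (\<lambda>n. real n * h n) at_top sequentially"
    and i: "1 \<le> i" "i \<le> m"
  shows "\<forall>\<epsilon>>0. (\<lambda>n. measure M {\<omega> \<in> space M.
            \<bar>(sigma_hat m \<theta> i n (h n) (\<lambda>k. X (real k * h n) \<omega>))\<^sup>2 - (\<sigma> i)\<^sup>2\<bar> > \<epsilon>})
          \<longlonglongrightarrow> 0"
proof -
  interpret th: thresholds m \<theta> by (rule thresholds.intro[OF m theta0 thetam theta_mono])
  interpret prob_space M using BM by (simp add: brownian_motion_def)
  interpret filtered_prob_space M F
    by (rule filtered_prob_space.intro[OF prob_space_axioms filtered_prob_space_axioms.intro])
      (use BM in \<open>auto simp: brownian_motion_def\<close>)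
  define b where "b = drift_coef m \<theta> \<alpha> \<beta>"
  define sg where "sg = diff_coef m \<theta> \<sigma>"
  define g where "g = two_slope (\<alpha> 1) (\<alpha> m)"
  define c0 where "c0 = (\<Sum>j=1..m. \<bar>\<beta> j\<bar>) + (\<Sum>j=1..m. \<bar>\<alpha> j\<bar>) * th.span + (\<alpha> 1 + \<alpha> m) * th.span"
  define c1 where "c1 = \<alpha> 1 + \<alpha> m"
  \<comment> \<open>The diffusion coefficient takes finitely many values, all positive, so their
    minimum and maximum serve as ellipticity constant and bound.\<close>
  define \<kappa> where "\<kappa> = Min (\<sigma> ` {1..m})"
  define K where "K = Max (\<sigma> ` {1..m})"
  have c1: "0 < c1" using alpha1 alpham by (simp add: c1_def)
  have near: "\<bar>b y - g y\<bar> \<le> c0" and c0: "0 \<le> c0" for y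
    using th.drift_near_linear(1)[OF alpha1 alpham, of \<beta> y] th.drift_near_linear(2)[OF alpha1 alpham, of \<beta>] by (simp_all add: b_def g_def c0_def)
  have lip: "\<bar>g y - g z\<bar> \<le> c1 * \<bar>y - z\<bar>" for y z
    unfolding g_def c1_def by (rule two_slope_lipschitz) (use alpha1 alpham in auto)
  have sg_eq: "sg y = \<sigma> (th.regime y)" for y by (simp add: sg_def th.diff_coef_eq)
  have mem: "sg y \<in> \<sigma> ` {1..m}" for y using th.regime_bounds[of y] by (simp add: sg_eq)
  have \<kappa>: "0 < \<kappa>" using m sigma_pos by (auto simp: \<kappa>_def)
  have low: "\<kappa> \<le> sg y" and up: "sg y \<le> K" for y
    using mem[of y] by (auto simp: \<kappa>_def K_def)
  \<comment> \<open>Prepares the choice of one process \<open>Y\<close> from the integrals that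
    exist separately at each time.\<close>
  have "\<forall>t. \<exists>Y. 0 \<le> t \<longrightarrow> ito_integral_at M F W (\<lambda>s \<omega>. sg (X s \<omega>)) t Y \<and>
      (AE \<omega> in M. X t \<omega> = x + (LBINT s=0..t. b (X s \<omega>)) + Y \<omega>)"
    using sol unfolding threshold_sde_solution_def sg_def b_def by blast
  then obtain Y where "\<forall>t. 0 \<le> t \<longrightarrow> ito_integral_at M F W (\<lambda>s \<omega>. sg (X s \<omega>)) t (Y t) \<and>
      (AE \<omega> in M. X t \<omega> = x + (LBINT s=0..t. b (X s \<omega>)) + Y t \<omega>)"
    by (rule choice[THEN exE])
  then have Y: "\<And>t. 0 \<le> t \<Longrightarrow> ito_integral_at M F W (\<lambda>s \<omega>. sg (X s \<omega>)) t (Y t)"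
      "\<And>t. 0 \<le> t \<Longrightarrow> AE \<omega> in M. X t \<omega> = x + (LBINT s=0..t. b (X s \<omega>)) + Y t \<omega>"
    by blast+
  interpret adapted_path M F X b sg c0 c1 K
  proof (rule adapted_path.intro[OF filtered_prob_space_axioms adapted_path_axioms.intro])
    show "X t \<in> borel_measurable (F t)" if "0 \<le> t" for t
      using sol that by (simp add: threshold_sde_solution_def)
    show "continuous_on {0..} (\<lambda>t. X t \<omega>)" if "\<omega> \<in> space M" for \<omega>
      using sol that by (simp add: threshold_sde_solution_def)
    show "0 \<le> c0" "0 < c1" by (rule c0 c1)+
    show "b \<in> borel_measurable borel" "sg \<in> borel_measurable borel"
      unfolding b_def sg_def by (rule th.drift_coef_borel th.diff_coef_borel)+
    show "\<bar>b y\<bar> \<le> c0 + c1 * \<bar>y\<bar>" for y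
      using near[of y] lip[of y 0] by (simp add: g_def)
    show "\<bar>sg y\<bar> \<le> K" for y using low[of y] up[of y] \<kappa> by simp
  qed
  have LB: "(LBINT s=0..t. b (X s \<omega>)) = drift 0 t \<omega>" if "0 \<le> t" for t \<omega>
  proof -
    have "(LBINT s=0..t. b (X s \<omega>)) = (\<integral>s. indicator {0<..t} s *\<^sub>R b (X s \<omega>) \<partial>lborel)"
      using interval_integral_Ioc[OF that, of "\<lambda>s. b (X s \<omega>)"] by (simp add: set_lebesgue_integral_def zero_ereal_def)
    also have "\<dots> = drift 0 t \<omega>"
      unfolding drift_def time_measure_def by (rule integral_restrict_space[symmetric]) simp
    finally show ?thesis .
  qed
  have "AE \<omega> in M. X t \<omega> = x + drift 0 t \<omega> + Y t \<omega>" if "0 \<le> t" for t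
    using Y(2)[OF that] by (simp only: LB[OF that])
  then interpret ito_solution M F X b sg c0 c1 K W Y x
    by (intro ito_solution.intro[OF adapted_path_axioms ito_solution_axioms.intro] BM Y(1))
  interpret diffusion M F X b sg c0 c1 K g x "min (\<alpha> 1) (\<alpha> m)" \<kappa>
  proof (rule diffusion.intro[OF adapted_path_axioms diffusion_axioms.intro])
    show "y * g y \<le> - min (\<alpha> 1) (\<alpha> m) * y\<^sup>2" for y unfolding g_def by (rule two_slope_dissipative)
    show "0 < min (\<alpha> 1) (\<alpha> m)" by (simp only: min_less_iff_conj alpha1 alpham)
  qed (fact near lip low \<kappa> initial_value noise_mean noise_square noise_fourth)+
  obtain h0 E where hE: "0 < h0" "h0 \<le> 1" "c1 * h0 \<le> 1 / 2"
    "\<And>h k. 0 < h \<Longrightarrow> h \<le> h0 \<Longrightarrow> L2 M (X (real k * h)) \<and> (\<integral>\<omega>. (X (real k * h) \<omega>)\<^sup>2 \<partial>M) \<le> E"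
    using uniform_second_moment by blast
  interpret grid: diffusion_grid M F X b sg c0 c1 K g x "min (\<alpha> 1) (\<alpha> m)" \<kappa> h0 E
    by (rule diffusion_grid.intro[OF diffusion_axioms diffusion_grid_axioms.intro]) (fact hE)+
  obtain \<rho> \<delta> where \<delta>: "0 < \<delta>" "{\<rho> - \<delta>..\<rho> + 5 * \<delta>} \<subseteq> th.regime_set i"
    using th.regime_set_interval[OF i] by blast
  show ?thesis
  proof (intro allI impI)
    fix \<epsilon> :: real assume \<epsilon>: "0 < \<epsilon>"
    show "(\<lambda>n. measure M {\<omega> \<in> space M.
            \<bar>(sigma_hat m \<theta> i n (h n) (\<lambda>k. X (real k * h n) \<omega>))\<^sup>2 - (\<sigma> i)\<^sup>2\<bar> > \<epsilon>}) \<longlonglongrightarrow> 0"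
    proof (rule grid.residual_variance_consistent[where I="th.regime_set i" and \<Theta>="th.threshold ` {1..<m}" and \<delta>=\<delta> and \<rho>=\<rho>])
      show "sg y = \<sigma> i" if "y \<in> th.regime_set i" for y
        using th.regime_eqI[OF i, of y] that by (simp add: sg_eq th.regime_set_def)
      show "y' \<in> th.regime_set i" if "y \<in> th.regime_set i"
        "\<forall>r\<in>th.threshold ` {1..<m}. \<delta> < \<bar>y - r\<bar>" "\<bar>y' - y\<bar> \<le> \<delta>" for \<delta> y y'
        by (rule th.regime_set_boundary[OF i that])
      fix n \<omega> assume "\<omega> \<in> space M"
      show "\<exists>u v. (sigma_hat m \<theta> i n (h n) (\<lambda>k. X (real k * h n) \<omega>))\<^sup>2 =
          ((\<Sum>k<n. (grid.x (h n) (Suc k) \<omega> - grid.x (h n) k \<omega>)\<^sup>2 * indicator (th.regime_set i) (grid.x (h n) k \<omega>))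
            - (\<Sum>k<n. (u + v * grid.x (h n) k \<omega>)\<^sup>2 * indicator (th.regime_set i) (grid.x (h n) k \<omega>)))
            / (h n * grid.visits (th.regime_set i) (h n) n \<omega>) \<and>
        (\<Sum>k<n. (u + v * grid.x (h n) k \<omega>)\<^sup>2 * indicator (th.regime_set i) (grid.x (h n) k \<omega>)) =
          (\<Sum>k<n. (u + v * grid.x (h n) k \<omega>) * indicator (th.regime_set i) (grid.x (h n) k \<omega>) *
            (grid.x (h n) (Suc k) \<omega> - grid.x (h n) k \<omega>))"
        using th.sigma_hat_square[OF i h_pos[of n], of n "\<lambda>k. X (real k * h n) \<omega>"]
        unfolding th.ind_indicator grid.x_def grid.visits_def .
    qed (use th.regime_set_borel h_pos h_lim nh_lim \<delta> \<epsilon> in auto)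
  qed
qed

end
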